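(* Let $n=2$, let $F:\mathcal S\to\mathbb R$ be convex and satisfy hypotheses (i) and (ii) of the context, and let $u$ be a viscosity solution of $F(D^2u)=-\chi_{\{u>0\}}$ in a bounded domain $\Omega\subset\mathbb R^2$ with $0\in\Omega$. Suppose that $0\in\partial\{u>0\}$, $|\nabla u(0)|=0$, and that $0$ is a rank-2 flat point at which, for some $M>0$, the zero set of the polynomial $p(x)=M^2x_1^2-x_2^2$ approximates $\partial\{u>0\}$ near $0$. Assume further that $u$ is non-degenerate at $0$. Then in some neighbourhood of $0$ the free boundary $\partial\{u>0\}$ consists of four $C^1$ curves tangential to the zero set of the polynomial $M^2x_1^2-x_2^2$ (that is, to the pair of crossing lines $x_2=\pm Mx_1$) at $0$.
   Context: $\mathcal S$ is the space of real symmetric $n\times n$ matrices (here $n=2$). Hypotheses on $F:\mathcal S\to\mathbb R$: (i) (uniform ellipticity) there are constants $\lambda,\Lambda>0$ such that $\lambda\|N\|\le F(M+N)-F(M)\le\Lambda\|N\|$ for all $M\in\mathcal S$ and all nonnegative $N\in\mathcal S$, where $\|\cdot\|$ is the matrix norm; (ii) $F$ is smooth except at the origin, homogeneous of degree one, $F(tM)=tF(M)$ for $t\in\mathbb R$, and $F(0)=0$. $\chi_{\{u>0\}}$ is the characteristic function of $\{u>0\}$. A continuous function $u$ is a viscosity solution of $F(D^2u)=-\chi_{\{u>0\}}$ in $\Omega$ if, for every $x_0\in\Omega$ and every paraboloid (quadratic polynomial) $v$: if $v$ touches the graph of $u$ from above at $(x_0,u(x_0))$, then $F(D^2v(x_0))\ge-\chi_{\{u>0\}}(x_0)$;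 and if $v$ touches the graph of $u$ from below at $(x_0,u(x_0))$, then $F(D^2v(x_0))\le-\chi_{\{u>0\}}(x_0)$. $B_r$ is the open disc of radius $r$ centered at $0$. The Hausdorff distance is $\mathrm{HD}(A,B)=\max\{\sup_{a\in A}\mathrm{dist}(a,B),\ \sup_{b\in B}\mathrm{dist}(b,A)\}$. That $0$ is a rank-2 flat point at which the zero set of $p$ approximates $\partial\{u>0\}$ near $0$ means $$\lim_{r\to0^+}\frac1r\,\mathrm{HD}\big(\partial\{u>0\}\cap B_r,\ \{p=0\}\cap B_r\big)=0.$$ That $u$ is non-degenerate at $0$ means that there are $c>0$ and $\rho>0$ such that $\inf_{B_r}u\le-c\,r^2$ for all $0<r<\rho$. *)

theory Defs
  imports "HOL-Analysis.Analysis"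
begin

definition sym_mats :: "(real ^ 'n ^ 'n) set"
  where "sym_mats = {A. transpose A = A}"

definition psd_mats :: "(real ^ 'n ^ 'n) set"
  where "psd_mats = {A \<in> sym_mats. \<forall>x. 0 \<le> x \<bullet> (A *v x)}"

text \<open>The matrix norm is the operator norm; the library's \<^const>\<open>norm\<close> on matrices
  is the Frobenius norm.\<close>

definition uniformly_elliptic :: "(real ^ 'n ^ 'n \<Rightarrow> real) \<Rightarrow> bool"
  where "uniformly_elliptic F \<longleftrightarrow>
    (\<exists>l > 0. \<exists>L > 0. \<forall>A \<in> sym_mats. \<forall>N \<in> psd_mats.
       l * onorm ((*v) N) \<le> F (A + N) - F A \<and> F (A + N) - F A \<le> L * onorm ((*v) N))"

text \<open>On open sets this is the usual notion of a function of class \<open>C\<^sup>k\<close>.\<close>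

fun higher_differentiable_on ::
  "'a::euclidean_space set \<Rightarrow> ('a \<Rightarrow> 'b::real_normed_vector) \<Rightarrow> nat \<Rightarrow> bool"
  where
    "higher_differentiable_on S f 0 \<longleftrightarrow> continuous_on S f"
  | "higher_differentiable_on S f (Suc k) \<longleftrightarrow>
       (\<forall>x \<in> S. f differentiable (at x)) \<and>
       (\<forall>v. higher_differentiable_on S (\<lambda>x. frechet_derivative f (at x) v) k)"

definition smooth_on ::
  "'a::euclidean_space set \<Rightarrow> ('a \<Rightarrow> 'b::real_normed_vector) \<Rightarrow> bool"
  where "smooth_on S f \<longleftrightarrow> (\<forall>k. higher_differentiable_on S f k)"

definition sym_part :: "real ^ 'n ^ 'n \<Rightarrow> real ^ 'n ^ 'n"
  where "sym_part A = (1/2) *\<^sub>R (A + transpose A)"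

text \<open>Only the values of \<open>F\<close> on symmetric matrices matter. As \<^const>\<open>sym_part\<close> is a linear
  projection onto the space of symmetric matrices, \<open>F\<close> is smooth on that space away from \<open>0\<close>
  iff \<open>F \<circ> sym_part\<close> is smooth on the open set of all matrices with nonzero symmetric part.\<close>

definition smooth_except_origin :: "(real ^ 'n ^ 'n \<Rightarrow> real) \<Rightarrow> bool"
  where "smooth_except_origin F \<longleftrightarrow> smooth_on {A. sym_part A \<noteq> 0} (F \<circ> sym_part)"

text \<open>The factor \<open>t\<close> ranges over all reals, including negative ones.\<close>

definition homogeneous_deg1 :: "(real ^ 'n ^ 'n \<Rightarrow> real) \<Rightarrow> bool"
  where "homogeneous_deg1 F \<longleftrightarrow> (\<forall>A \<in> sym_mats. \<forall>t. F (t *\<^sub>R A) = t * F A)"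

text \<open>The paraboloid with value \<open>a\<close> and gradient \<open>b\<close> at the origin and with Hessian \<open>A\<close>
  (for symmetric \<open>A\<close>).\<close>

definition paraboloid :: "real \<Rightarrow> real ^ 'n \<Rightarrow> real ^ 'n ^ 'n \<Rightarrow> real ^ 'n \<Rightarrow> real"
  where "paraboloid a b A x = a + b \<bullet> x + (1/2) * (x \<bullet> (A *v x))"

lemma GDERIV_paraboloid:
  assumes "A \<in> sym_mats"
  shows "GDERIV (paraboloid a b A) x :> b + A *v x"
proof -
  have "transpose A = A"
    using assms by (simp add: sym_mats_def)
  then have "A *v u = u v* A" for u
    using transpose_matrix_vector[of A u] by (simp only:)
  then have sym: "u \<bullet> (A *v v) = v \<bullet> (A *v u)" for u v
    using dot_lmul_matrix[of u A v] by (simp only: inner_commute[of v])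
  have lin: "((\<lambda>x. A *v x) has_derivative (\<lambda>h. A *v h)) (at x)"
    by (rule bounded_linear_imp_has_derivative) (rule matrix_vector_mul_bounded_linear)
  have "((\<lambda>x. b \<bullet> x) has_derivative (\<lambda>h. b \<bullet> h)) (at x)"
    by (rule bounded_linear_imp_has_derivative) (rule bounded_linear_inner_right)
  from has_derivative_add[OF has_derivative_add[OF has_derivative_const[of a] this]
      has_derivative_mult_right[OF has_derivative_inner[OF has_derivative_ident lin], of "1/2"]]
  have "(paraboloid a b A has_derivative
      (\<lambda>h. 0 + b \<bullet> h + (1/2) * (x \<bullet> (A *v h) + h \<bullet> (A *v x)))) (at x)"
    by (simp only: paraboloid_def[abs_def])
  moreover have "0 + b \<bullet> h + (1/2) * (x \<bullet> (A *v h) + h \<bullet> (A *v x)) = h \<bullet> (b + A *v x)" for h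
    using sym[of x h] by (simp add: inner_add_right inner_commute)
  ultimately show ?thesis
    by (simp only: gderiv_def)
qed

lemma Hessian_paraboloid:
  fixes A :: "real ^ 'n ^ 'n"
  shows "((\<lambda>x. b + A *v x) has_derivative (\<lambda>h. A *v h)) (at x)"
proof -
  have "((\<lambda>x. A *v x) has_derivative (\<lambda>h. A *v h)) (at x)"
    by (rule bounded_linear_imp_has_derivative) (rule matrix_vector_mul_bounded_linear)
  from has_derivative_add[OF has_derivative_const[of b] this] show ?thesis
    by simp
qed

text \<open>Touching is local: the inequality is required in a neighbourhood of \<open>x\<^sub>0\<close>.\<close>

definition touches_above ::
  "('a::topological_space \<Rightarrow> real) \<Rightarrow> ('a \<Rightarrow> real) \<Rightarrow> 'a \<Rightarrow> bool"
  where "touches_above v u x0 \<longleftrightarrow> v x0 = u x0 \<and> (\<forall>\<^sub>F x in nhds x0. u x \<le> v x)"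

definition touches_below ::
  "('a::topological_space \<Rightarrow> real) \<Rightarrow> ('a \<Rightarrow> real) \<Rightarrow> 'a \<Rightarrow> bool"
  where "touches_below v u x0 \<longleftrightarrow> v x0 = u x0 \<and> (\<forall>\<^sub>F x in nhds x0. v x \<le> u x)"

definition pos_set :: "'a set \<Rightarrow> ('a \<Rightarrow> real) \<Rightarrow> 'a set"
  where "pos_set \<Omega> u = {x \<in> \<Omega>. u x > 0}"

definition viscosity_solution ::
  "(real ^ 'n ^ 'n \<Rightarrow> real) \<Rightarrow> (real ^ 'n) set \<Rightarrow> (real ^ 'n \<Rightarrow> real) \<Rightarrow> bool"
  where "viscosity_solution F \<Omega> u \<longleftrightarrow>
    continuous_on \<Omega> u \<and>
    (\<forall>x0 \<in> \<Omega>. \<forall>a b. \<forall>A \<in> sym_mats.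
      (touches_above (paraboloid a b A) u x0 \<longrightarrow> F A \<ge> - indicator (pos_set \<Omega> u) x0) \<and>
      (touches_below (paraboloid a b A) u x0 \<longrightarrow> F A \<le> - indicator (pos_set \<Omega> u) x0))"

text \<open>The part of \<open>\<partial>{u > 0}\<close> inside \<open>\<Omega>\<close>.\<close>

definition free_boundary :: "'a::topological_space set \<Rightarrow> ('a \<Rightarrow> real) \<Rightarrow> 'a set"
  where "free_boundary \<Omega> u = frontier (pos_set \<Omega> u) \<inter> \<Omega>"

text \<open>Meaningful for nonempty bounded sets only.\<close>

definition Hausdorff_dist :: "'a::metric_space set \<Rightarrow> 'a set \<Rightarrow> real"
  where "Hausdorff_dist A B = max (SUP a\<in>A. infdist a B) (SUP b\<in>B. infdist b A)"

definition cross_poly :: "real \<Rightarrow> real ^ 2 \<Rightarrow> real"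
  where "cross_poly M x = M\<^sup>2 * (x $ 1)\<^sup>2 - (x $ 2)\<^sup>2"

definition rank2_flat_at_0 ::
  "(real ^ 2) set \<Rightarrow> (real ^ 2 \<Rightarrow> real) \<Rightarrow> (real ^ 2 \<Rightarrow> real) \<Rightarrow> bool"
  where "rank2_flat_at_0 \<Omega> u p \<longleftrightarrow>
    ((\<lambda>r. (1 / r) * Hausdorff_dist (free_boundary \<Omega> u \<inter> ball 0 r) ({x. p x = 0} \<inter> ball 0 r))
      \<longlongrightarrow> 0) (at_right 0)"

text \<open>The requirement \<open>ball 0 \<rho> \<subseteq> \<Omega>\<close> can always be met by shrinking \<open>\<rho>\<close>; for continuous \<open>u\<close> it
  makes \<open>u\<close> bounded on the discs in question, so that the infimum is a genuine one.\<close>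

definition nondegenerate_at_0 ::
  "'a::real_normed_vector set \<Rightarrow> ('a \<Rightarrow> real) \<Rightarrow> bool"
  where "nondegenerate_at_0 \<Omega> u \<longleftrightarrow>
    (\<exists>c > 0. \<exists>\<rho> > 0. ball 0 \<rho> \<subseteq> \<Omega> \<and>
      (\<forall>r. 0 < r \<and> r < \<rho> \<longrightarrow> (INF x\<in>ball 0 r. u x) \<le> - c * r\<^sup>2))"

text \<open>\<open>C\<^sup>1\<close> up to the endpoints, with nowhere vanishing velocity, so that the image is a \<open>C\<^sup>1\<close> curve
  in the geometric sense.\<close>

definition C1_arc :: "(real \<Rightarrow> 'a::real_normed_vector) \<Rightarrow> bool"
  where "C1_arc \<gamma> \<longleftrightarrow> arc \<gamma> \<and> \<gamma> C1_differentiable_on {0..1} \<and>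
    (\<forall>t \<in> {0..1}. vector_derivative \<gamma> (at t) \<noteq> 0)"

text \<open>The zero set of \<open>cross_poly M\<close> is the union of the four rays spanned by
  \<open>(\<sigma>, \<tau> M)\<close>, \<open>\<sigma>, \<tau> \<in> {-1, 1}\<close>. The set \<open>\<Gamma>\<close> consists, near \<open>0\<close>, of four \<open>C\<^sup>1\<close> curves issuing from \<open>0\<close>,
  otherwise disjoint, one tangential to each ray. The endpoints \<open>\<gamma> \<sigma> \<tau> 1\<close> are left out, since
  the neighbourhood \<open>N\<close> is open.\<close>

definition four_C1_curves_tangential_to_cross :: "(real ^ 2) set \<Rightarrow> real \<Rightarrow> bool"
  where "four_C1_curves_tangential_to_cross \<Gamma> M \<longleftrightarrow>
    (\<exists>N (\<gamma> :: real \<Rightarrow> real \<Rightarrow> real \<Rightarrow> real ^ 2).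
      open N \<and> 0 \<in> N \<and>
      \<Gamma> \<inter> N = (\<Union>\<sigma>\<in>{-1, 1}. \<Union>\<tau>\<in>{-1, 1}. \<gamma> \<sigma> \<tau> ` {0..<1}) \<and>
      (\<forall>\<sigma>\<in>{-1, 1}. \<forall>\<tau>\<in>{-1, 1}.
        C1_arc (\<gamma> \<sigma> \<tau>) \<and> pathstart (\<gamma> \<sigma> \<tau>) = 0 \<and>
        (\<exists>k > 0. vector_derivative (\<gamma> \<sigma> \<tau>) (at 0) = k *\<^sub>R vector [\<sigma>, \<tau> * M])) \<and>
      (\<forall>\<sigma>\<in>{-1, 1}. \<forall>\<tau>\<in>{-1, 1}. \<forall>\<sigma>'\<in>{-1, 1}. \<forall>\<tau>'\<in>{-1, 1}. (\<sigma>, \<tau>) \<noteq> (\<sigma>', \<tau>') \<longrightarrow>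
        path_image (\<gamma> \<sigma> \<tau>) \<inter> path_image (\<gamma> \<sigma>' \<tau>') = {0}))"

end

theory Submission
  imports Defs "HOL-Complex_Analysis.Complex_Analysis"
begin

text \<open>
  A convex \<open>F\<close> that is homogeneous of degree one also under negative factors is linear, so by ellipticity a
  linear change of variables turns the equation into \<open>\<Delta>v = - \<chi>\<close>, with \<open>\<chi>\<close> the characteristic function of
  \<open>{v > 0}\<close>, and the cross into the lines through \<open>cis \<theta>\<close> and \<open>cis (- \<theta>)\<close>.
  By flatness, \<open>v\<close> has a constant sign in each of the four sectors off thin cones. Let \<open>w\<close> be the explicit function
  with \<open>\<Delta>w = - 1\<close> in the sectors where \<open>v\<close> is positive and \<open>\<Delta>w = 0\<close> in the others. The difference \<open>v - w\<close> is
  harmonic up to errors on thin strips, so comparison with harmonic polynomials and a Campanato iteration give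
  \<open>v - w = Re (e z\<^sup>2) + o(r\<^sup>2)\<close> on the disc of radius \<open>r\<close>, where \<open>e\<close> depends on \<open>r\<close> but varies slowly.
  The function \<open>w\<close> is a multiple of \<open>Re (z\<^sup>2) ln |z|\<close> up to \<open>O(|z|\<^sup>2)\<close>; the multiple is nonzero, as otherwise
  non-degeneracy or the prescribed signs are contradicted. Hence \<open>v\<close> is, together with its gradient, close to
  \<open>b Re (z\<^sup>2)\<close> with real \<open>b\<close>, \<open>|b| \<rightarrow> \<infinity>\<close>, which forces \<open>\<theta> = pi / 4\<close>, and the implicit function argument
  yields a \<open>C\<^sup>1\<close> graph along each of the four rays.
\<close>

text \<open>The outcome rests on two rates along the radii \<open>\<rho> / 16 ^ k\<close>. The
  corrections \<open>e k\<close> need not converge, but their increments tend to zero, so they are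
  o(k). The logarithm of the model contributes a real term that is linear in \<open>k\<close>. If
  its coefficient is nonzero, this term dominates, and the quadratic coefficient divided by its
  modulus tends to 1 or - 1. That coefficient is proportional to the difference between the numbers
  of positive sectors in the two pairs of opposite sectors. It vanishes only if \<open>v\<close> is
  positive in all sectors, in none, or in exactly two adjacent ones, which fill a half plane. Each
  case is refuted at a point off the cross where the sign of \<open>Re (e z\<^sup>2)\<close> is
  prescribed. The ratio 16 is what makes each Campanato step halve the error: the cubic remainder
  shrinks by the third power of 16, the normalisation only by the second, and the surplus factor
  beats the constant of the coefficient estimate. Finally, \<open>Re (z\<^sup>2)\<close> is small
  only near the diagonals, while by flatness every point of the cross has a zero of \<open>v\<close>
  nearby; this determines the angle.\<close>

section \<open>Pointwise Laplacians and the comparison principle\<close>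

text \<open>Every real quadratic form on \<open>\<complex>\<close> is \<open>Re (c h\<^sup>2) + L / 4 * |h|\<^sup>2\<close>, so this is a second-order Taylor expansion with
  Laplacian \<open>L\<close>; no regularity away from \<open>z\<close> is required.\<close>

definition has_laplacian :: "(complex \<Rightarrow> real) \<Rightarrow> real \<Rightarrow> complex \<Rightarrow> bool" where
  "has_laplacian \<psi> L z \<longleftrightarrow> (\<exists>b c. \<forall>\<epsilon>>0. \<forall>\<^sub>F h in nhds 0.
     \<bar>\<psi> (z + h) - (\<psi> z + Re (b * h) + Re (c * h\<^sup>2) + L / 4 * (cmod h)\<^sup>2)\<bar> \<le> \<epsilon> * (cmod h)\<^sup>2)"

lemma has_laplacianI:
  assumes "\<And>\<epsilon>. \<epsilon> > 0 \<Longrightarrow> \<forall>\<^sub>F h in nhds 0.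
     \<bar>\<psi> (z + h) - (\<psi> z + Re (b * h) + Re (c * h\<^sup>2) + L / 4 * (cmod h)\<^sup>2)\<bar> \<le> \<epsilon> * (cmod h)\<^sup>2"
  shows "has_laplacian \<psi> L z"
  using assms unfolding has_laplacian_def by blast

lemma has_laplacian_add:
  assumes "has_laplacian f K z" and "has_laplacian g L z"
  shows "has_laplacian (\<lambda>w. f w + g w) (K + L) z"
proof -
  obtain b c where f: "\<And>\<epsilon>. \<epsilon> > 0 \<Longrightarrow> \<forall>\<^sub>F h in nhds 0.
     \<bar>f (z + h) - (f z + Re (b * h) + Re (c * h\<^sup>2) + K / 4 * (cmod h)\<^sup>2)\<bar> \<le> \<epsilon> * (cmod h)\<^sup>2"
    using assms(1) unfolding has_laplacian_def by blast
  obtain b' c' where g: "\<And>\<epsilon>. \<epsilon> > 0 \<Longrightarrow> \<forall>\<^sub>F h in nhds 0.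
     \<bar>g (z + h) - (g z + Re (b' * h) + Re (c' * h\<^sup>2) + L / 4 * (cmod h)\<^sup>2)\<bar> \<le> \<epsilon> * (cmod h)\<^sup>2"
    using assms(2) unfolding has_laplacian_def by blast
  show ?thesis
  proof (rule has_laplacianI[where b = "b + b'" and c = "c + c'"])
    fix \<epsilon> :: real
    assume "\<epsilon> > 0"
    then have "\<epsilon> / 2 > 0" by simp
    show "\<forall>\<^sub>F h in nhds 0. \<bar>f (z + h) + g (z + h) - (f z + g z + Re ((b + b') * h)
        + Re ((c + c') * h\<^sup>2) + (K + L) / 4 * (cmod h)\<^sup>2)\<bar> \<le> \<epsilon> * (cmod h)\<^sup>2"
      using f[OF \<open>\<epsilon> / 2 > 0\<close>] g[OF \<open>\<epsilon> / 2 > 0\<close>]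
    proof eventually_elim
      case (elim h)
      have *: "Re ((b + b') * h) = Re (b * h) + Re (b' * h)"
        "Re ((c + c') * h\<^sup>2) = Re (c * h\<^sup>2) + Re (c' * h\<^sup>2)"
        "(K + L) / 4 * (cmod h)\<^sup>2 = K / 4 * (cmod h)\<^sup>2 + L / 4 * (cmod h)\<^sup>2"
        "\<epsilon> * (cmod h)\<^sup>2 = \<epsilon> / 2 * (cmod h)\<^sup>2 + \<epsilon> / 2 * (cmod h)\<^sup>2"
        by (simp_all add: algebra_simps add_divide_distrib)
      show ?case unfolding * using elim by linarith
    qed
  qed
qed

lemma has_laplacian_cmult:
  assumes "has_laplacian f K z"
  shows "has_laplacian (\<lambda>w. r * f w) (r * K) z"
proof -
  obtain b c where f: "\<And>\<epsilon>. \<epsilon> > 0 \<Longrightarrow> \<forall>\<^sub>F h in nhds 0.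
     \<bar>f (z + h) - (f z + Re (b * h) + Re (c * h\<^sup>2) + K / 4 * (cmod h)\<^sup>2)\<bar> \<le> \<epsilon> * (cmod h)\<^sup>2"
    using assms unfolding has_laplacian_def by blast
  show ?thesis
  proof (rule has_laplacianI[where b = "r * b" and c = "r * c"])
    fix \<epsilon> :: real
    assume "\<epsilon> > 0"
    then have "\<epsilon> / (\<bar>r\<bar> + 1) > 0" by simp
    show "\<forall>\<^sub>F h in nhds 0. \<bar>r * f (z + h) - (r * f z + Re (r * b * h)
        + Re (r * c * h\<^sup>2) + r * K / 4 * (cmod h)\<^sup>2)\<bar> \<le> \<epsilon> * (cmod h)\<^sup>2"
      using f[OF \<open>\<epsilon> / (\<bar>r\<bar> + 1) > 0\<close>]
    proof eventually_elim
      case (elim h)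
      have "r * f (z + h) - (r * f z + Re (r * b * h) + Re (r * c * h\<^sup>2) + r * K / 4 * (cmod h)\<^sup>2)
        = r * (f (z + h) - (f z + Re (b * h) + Re (c * h\<^sup>2) + K / 4 * (cmod h)\<^sup>2))"
        by (simp add: algebra_simps)
      then have "\<bar>r * f (z + h) - (r * f z + Re (r * b * h) + Re (r * c * h\<^sup>2) + r * K / 4 * (cmod h)\<^sup>2)\<bar>
        \<le> \<bar>r\<bar> * (\<epsilon> / (\<bar>r\<bar> + 1) * (cmod h)\<^sup>2)"
        using mult_left_mono[OF elim abs_ge_zero[of r]] by (simp only: abs_mult)
      also have "\<dots> = (\<bar>r\<bar> / (\<bar>r\<bar> + 1)) * (\<epsilon> * (cmod h)\<^sup>2)"
        by simp
      also have "\<dots> \<le> 1 * (\<epsilon> * (cmod h)\<^sup>2)"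
        using \<open>\<epsilon> > 0\<close> by (intro mult_right_mono) auto
      finally show ?case by simp
    qed
  qed
qed

lemma has_laplacian_uminus: "has_laplacian f K z \<Longrightarrow> has_laplacian (\<lambda>w. - f w) (- K) z"
  using has_laplacian_cmult[of f K z "-1"] by simp

lemma has_laplacian_diff:
  "has_laplacian f K z \<Longrightarrow> has_laplacian g L z \<Longrightarrow> has_laplacian (\<lambda>w. f w - g w) (K - L) z"
  using has_laplacian_add[OF _ has_laplacian_uminus, of f K z g L] by simp

lemma has_laplacian_const: "has_laplacian (\<lambda>_. k) 0 z"
  by (rule has_laplacianI[where b = 0 and c = 0]) auto

lemma has_laplacian_cmod_power2: "has_laplacian (\<lambda>w. (cmod (w - p))\<^sup>2) 4 z"
proof (rule has_laplacianI[where b = "2 * cnj (z - p)" and c = 0])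
  fix \<epsilon> :: real
  assume "\<epsilon> > 0"
  have "(cmod (z + h - p))\<^sup>2 = (cmod (z - p))\<^sup>2 + Re (2 * cnj (z - p) * h) + (cmod h)\<^sup>2" for h
    unfolding cmod_power2 by (simp add: power2_eq_square algebra_simps)
  then show "\<forall>\<^sub>F h in nhds 0. \<bar>(cmod (z + h - p))\<^sup>2 - ((cmod (z - p))\<^sup>2 + Re (2 * cnj (z - p) * h)
      + Re (0 * h\<^sup>2) + 4 / 4 * (cmod h)\<^sup>2)\<bar> \<le> \<epsilon> * (cmod h)\<^sup>2"
    using \<open>\<epsilon> > 0\<close> by simp
qed

text \<open>The Taylor polynomial of a holomorphic function contains only powers of
  \<open>h\<close>, and the real part of its quadratic term is exactly the trace-free part of the
  Hessian.\<close>

lemma has_laplacian_Re_holomorphic: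
  assumes hol: "f holomorphic_on S" and "open S" and "z \<in> S"
  shows "has_laplacian (\<lambda>w. Re (f w)) 0 z"
proof -
  obtain r where r: "r > 0" "cball z r \<subseteq> S"
    using assms(2,3) open_contains_cball by blast
  have hd: "(deriv ^^ i) f holomorphic_on S" for i
    by (intro holomorphic_higher_deriv hol \<open>open S\<close>)
  have "continuous_on (cball z r) ((deriv ^^ 3) f)"
    using hd r(2) holomorphic_on_imp_continuous_on holomorphic_on_subset by blast
  then have "compact ((deriv ^^ 3) f ` cball z r)"
    using compact_continuous_image compact_cball by blast
  then obtain B where B: "\<And>w. w \<in> cball z r \<Longrightarrow> cmod ((deriv ^^ 3) f w) \<le> B"
    by (metis bounded_iff compact_imp_bounded imageI)
  define R where "R h = f (z + h) - (f z + deriv f z * h + (deriv ^^ 2) f z / 2 * h\<^sup>2)" for h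
  have R: "cmod (R h) \<le> B / 2 * cmod h ^ 3" if "cmod h \<le> r" for h
  proof -
    have "cmod (f (z + h) - (\<Sum>i\<le>2. (deriv ^^ i) f z * (z + h - z) ^ i / fact i))
       \<le> B * cmod (z + h - z) ^ Suc 2 / fact 2"
    proof (rule complex_Taylor[where S = "cball z r" and f = "\<lambda>i. (deriv ^^ i) f" and n = 2, simplified funpow_0])
      show "((deriv ^^ i) f has_field_derivative (deriv ^^ Suc i) f x) (at x within cball z r)"
        if "x \<in> cball z r" "i \<le> 2" for i x
        using holomorphic_derivI[OF hd \<open>open S\<close>, of x i] that r(2)
        by (auto intro: has_field_derivative_at_within)
    qed (use B that r in \<open>auto simp: dist_norm numeral_3_eq_3 numeral_2_eq_2\<close>)
    also have "(\<Sum>i\<le>2. (deriv ^^ i) f z * (z + h - z) ^ i / fact i)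
       = f z + deriv f z * h + (deriv ^^ 2) f z / 2 * h\<^sup>2"
      by (simp add: numeral_2_eq_2)
    finally show ?thesis by (simp add: R_def numeral_3_eq_3 numeral_2_eq_2)
  qed
  show ?thesis
  proof (rule has_laplacianI[where b = "deriv f z" and c = "(deriv ^^ 2) f z / 2"])
    fix \<epsilon> :: real
    assume "\<epsilon> > 0"
    have "((\<lambda>h. B / 2 * cmod h) \<longlongrightarrow> B / 2 * cmod 0) (nhds (0::complex))"
      by (intro tendsto_intros filterlim_ident)
    then have "\<forall>\<^sub>F h in nhds (0::complex). B / 2 * cmod h < \<epsilon>"
      using \<open>\<epsilon> > 0\<close> by (intro order_tendstoD(2)) auto
    moreover have "\<forall>\<^sub>F h in nhds (0::complex). cmod h \<le> r"
      unfolding eventually_nhds_metric using r by (auto intro!: exI[of _ r])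
    ultimately show "\<forall>\<^sub>F h in nhds 0. \<bar>Re (f (z + h)) - (Re (f z) + Re (deriv f z * h)
        + Re ((deriv ^^ 2) f z / 2 * h\<^sup>2) + 0 / 4 * (cmod h)\<^sup>2)\<bar> \<le> \<epsilon> * (cmod h)\<^sup>2"
    proof eventually_elim
      case (elim h)
      have "Re (f (z + h)) - (Re (f z) + Re (deriv f z * h)
        + Re ((deriv ^^ 2) f z / 2 * h\<^sup>2) + 0 / 4 * (cmod h)\<^sup>2) = Re (R h)"
        by (simp add: R_def)
      then have "\<bar>Re (f (z + h)) - (Re (f z) + Re (deriv f z * h)
        + Re ((deriv ^^ 2) f z / 2 * h\<^sup>2) + 0 / 4 * (cmod h)\<^sup>2)\<bar> \<le> cmod (R h)"
        using abs_Re_le_cmod by metis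
      also have "\<dots> \<le> B / 2 * cmod h * (cmod h)\<^sup>2"
        using R[OF elim(2)] by (simp add: power2_eq_square power3_eq_cube)
      also have "\<dots> \<le> \<epsilon> * (cmod h)\<^sup>2"
        using elim(1) by (intro mult_right_mono) auto
      finally show ?case .
    qed
  qed
qed

lemma has_laplacian_cong:
  assumes "has_laplacian f L z" and "\<forall>\<^sub>F w in nhds z. f w = g w"
  shows "has_laplacian g L z"
proof -
  obtain b c where f: "\<And>\<epsilon>. \<epsilon> > 0 \<Longrightarrow> \<forall>\<^sub>F h in nhds 0.
     \<bar>f (z + h) - (f z + Re (b * h) + Re (c * h\<^sup>2) + L / 4 * (cmod h)\<^sup>2)\<bar> \<le> \<epsilon> * (cmod h)\<^sup>2"
    using assms unfolding has_laplacian_def by blast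
  have "f z = g z" using assms(2) eventually_nhds_x_imp_x by blast
  have "filterlim (\<lambda>h. z + h) (nhds (z + 0)) (nhds 0)"
    by (intro tendsto_intros filterlim_ident)
  then have ev: "\<forall>\<^sub>F h in nhds 0. f (z + h) = g (z + h)"
    using eventually_compose_filterlim[OF assms(2)] by simp
  show ?thesis
  proof (rule has_laplacianI[where b = b and c = c])
    fix \<epsilon> :: real
    assume "\<epsilon> > 0"
    show "\<forall>\<^sub>F h in nhds 0. \<bar>g (z + h) - (g z + Re (b * h) + Re (c * h\<^sup>2)
       + L / 4 * (cmod h)\<^sup>2)\<bar> \<le> \<epsilon> * (cmod h)\<^sup>2"
      using f[OF \<open>\<epsilon> > 0\<close>] ev by eventually_elim (simp add: \<open>f z = g z\<close>)
  qed
qed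

lemma has_laplacian_ln_cmod:
  assumes "z \<noteq> p"
  shows "has_laplacian (\<lambda>w. ln (cmod (w - p))) 0 z"
proof -
  \<comment> \<open>Multiplication by \<open>u\<close> carries \<open>z - p\<close> to the positive
    real axis, which keeps the argument of \<open>Ln\<close> off the branch cut near
    \<open>z\<close>; it changes the logarithm of the modulus only by a constant.\<close>
  define u where "u = cnj (z - p)"
  have "u \<noteq> 0" using assms by (simp add: u_def)
  define S where "S = {w. Re (u * (w - p)) > 0}"
  have "open S" unfolding S_def by (intro open_Collect_less continuous_intros)
  have "Re (u * (z - p)) = (cmod (z - p))\<^sup>2"
    unfolding cmod_power2 u_def by (simp add: power2_eq_square algebra_simps)
  moreover have "(cmod (z - p))\<^sup>2 > 0" using assms by simp
  ultimately have "z \<in> S" by (simp only: S_def mem_Collect_eq)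
  have hol: "(\<lambda>w. Ln (u * (w - p))) holomorphic_on S"
    by (intro holomorphic_intros) (auto simp: S_def complex_nonpos_Reals_iff)
  have "has_laplacian (\<lambda>w. Re (Ln (u * (w - p)))) 0 z"
    by (rule has_laplacian_Re_holomorphic[OF hol \<open>open S\<close> \<open>z \<in> S\<close>])
  then have "has_laplacian (\<lambda>w. Re (Ln (u * (w - p))) + (- ln (cmod u))) (0 + 0) z"
    by (intro has_laplacian_add has_laplacian_const)
  moreover have "\<forall>\<^sub>F w in nhds z. Re (Ln (u * (w - p))) + (- ln (cmod u)) = ln (cmod (w - p))"
  proof -
    have "\<forall>\<^sub>F w in nhds z. w \<in> S" using \<open>open S\<close> \<open>z \<in> S\<close> eventually_nhds_in_open by blast
    then show ?thesis
    proof eventually_elim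
      case (elim w)
      then have "w \<noteq> p" by (auto simp: S_def)
      then show ?case using \<open>u \<noteq> 0\<close> by (simp add: norm_mult ln_mult)
    qed
  qed
  ultimately show ?thesis using has_laplacian_cong by fastforce
qed

text \<open>With \<open>s = Im (e * h)\<close> one has
  \<open>s\<^sup>2 = ((cmod h)\<^sup>2 - Re ((e * h)\<^sup>2)) / 2\<close>, so the second-order term
  is shared between the radial part and the trace-free part. The global bound on the third
  derivative controls the remainder.\<close>

lemma has_laplacian_Im_compose:
  fixes \<phi> :: "real \<Rightarrow> real"
  assumes e: "cmod e = 1"
    and d1: "\<And>t. (\<phi> has_real_derivative \<phi>' t) (at t)"
    and d2: "\<And>t. (\<phi>' has_real_derivative \<phi>'' t) (at t)"
    and d3: "\<And>t. (\<phi>'' has_real_derivative \<phi>''' t) (at t)"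
    and B: "\<And>t. \<bar>\<phi>''' t\<bar> \<le> B"
  shows "has_laplacian (\<lambda>w. \<phi> (Im (e * w))) (\<phi>'' (Im (e * z))) z"
proof -
  define t where "t = Im (e * z)"
  define diff where "diff n = (if n = 0 then \<phi> else if n = 1 then \<phi>' else if n = 2 then \<phi>'' else \<phi>''')" for n :: nat
  have T: "\<bar>\<phi> (t + s) - (\<phi> t + \<phi>' t * s + \<phi>'' t / 2 * s\<^sup>2)\<bar> \<le> B * \<bar>s\<bar> ^ 3" for s
  proof (cases "s = 0")
    case False
    have "\<exists>c. (if t + s < t then t + s < c \<and> c < t else t < c \<and> c < t + s) \<and>
       \<phi> (t + s) = (\<Sum>m<3. diff m t / fact m * (t + s - t) ^ m) + diff 3 c / fact 3 * (t + s - t) ^ 3"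
    proof (rule Taylor[where a = "t - \<bar>s\<bar>" and b = "t + \<bar>s\<bar>"])
      show "\<forall>m ta. m < 3 \<and> t - \<bar>s\<bar> \<le> ta \<and> ta \<le> t + \<bar>s\<bar> \<longrightarrow> DERIV (diff m) ta :> diff (Suc m) ta"
      proof (intro allI impI)
        fix m :: nat and ta
        assume "m < 3 \<and> t - \<bar>s\<bar> \<le> ta \<and> ta \<le> t + \<bar>s\<bar>"
        then have "m = 0 \<or> m = 1 \<or> m = 2" by auto
        then show "DERIV (diff m) ta :> diff (Suc m) ta"
          using d1 d2 d3 by (auto simp: diff_def)
      qed
    qed (use False in \<open>auto simp: diff_def\<close>)
    then obtain c where "\<phi> (t + s) = (\<Sum>m<3. diff m t / fact m * s ^ m) + diff 3 c / fact 3 * s ^ 3"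
      by auto
    then have "\<phi> (t + s) - (\<phi> t + \<phi>' t * s + \<phi>'' t / 2 * s\<^sup>2) = \<phi>''' c / 6 * s ^ 3"
      by (simp add: numeral_3_eq_3 diff_def numeral_2_eq_2 fact_numeral)
    then have "\<bar>\<phi> (t + s) - (\<phi> t + \<phi>' t * s + \<phi>'' t / 2 * s\<^sup>2)\<bar> = \<bar>\<phi>''' c / 6 * s ^ 3\<bar>"
      by (simp only:)
    also have "\<dots> = \<bar>\<phi>''' c\<bar> / 6 * \<bar>s\<bar> ^ 3"
      by (simp add: abs_mult power_abs)
    finally have "\<bar>\<phi> (t + s) - (\<phi> t + \<phi>' t * s + \<phi>'' t / 2 * s\<^sup>2)\<bar> = \<bar>\<phi>''' c\<bar> / 6 * \<bar>s\<bar> ^ 3" .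
    also have "\<dots> \<le> B * \<bar>s\<bar> ^ 3"
      using B[of c] by (intro mult_right_mono) auto
    finally show ?thesis .
  qed simp
  have "B \<ge> 0" using B[of 0] by linarith
  show ?thesis
  proof (rule has_laplacianI[where b = "- \<i> * \<phi>' t * e" and c = "- \<phi>'' t / 4 * e\<^sup>2"])
    fix \<epsilon> :: real
    assume "\<epsilon> > 0"
    have "((\<lambda>h. B * cmod h) \<longlongrightarrow> B * cmod 0) (nhds (0::complex))"
      by (intro tendsto_intros filterlim_ident)
    then have "\<forall>\<^sub>F h in nhds (0::complex). B * cmod h < \<epsilon>"
      using \<open>\<epsilon> > 0\<close> by (intro order_tendstoD(2)) auto
    then show "\<forall>\<^sub>F h in nhds 0. \<bar>\<phi> (Im (e * (z + h))) - (\<phi> (Im (e * z)) + Re (- \<i> * \<phi>' t * e * h)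
        + Re (- \<phi>'' t / 4 * e\<^sup>2 * h\<^sup>2) + \<phi>'' (Im (e * z)) / 4 * (cmod h)\<^sup>2)\<bar> \<le> \<epsilon> * (cmod h)\<^sup>2"
    proof eventually_elim
      case (elim h)
      define s where "s = Im (e * h)"
      have "\<bar>s\<bar> \<le> cmod (e * h)" unfolding s_def by (rule abs_Im_le_cmod)
      then have s: "\<bar>s\<bar> \<le> cmod h" by (simp add: norm_mult e)
      have h2: "(cmod h)\<^sup>2 = (cmod (e * h))\<^sup>2" by (simp add: norm_mult e)
      have "(Im k)\<^sup>2 = ((cmod k)\<^sup>2 - Re (k\<^sup>2)) / 2" for k
        unfolding cmod_power2 by (simp add: power2_eq_square)
      then have s2: "s\<^sup>2 = ((cmod h)\<^sup>2 - Re ((e * h)\<^sup>2)) / 2"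
        unfolding h2 s_def by blast
      have r1: "Re (- \<i> * \<phi>' t * e * h) = \<phi>' t * s"
        unfolding s_def by (simp add: algebra_simps)
      have r2: "- \<phi>'' t / 4 * e\<^sup>2 * h\<^sup>2 = of_real (- \<phi>'' t / 4) * (e * h)\<^sup>2"
        by (simp add: power_mult_distrib)
      have r3: "Re (- \<phi>'' t / 4 * e\<^sup>2 * h\<^sup>2) = - \<phi>'' t / 4 * Re ((e * h)\<^sup>2)"
        unfolding r2 by (simp only: Re_complex_of_real Im_complex_of_real times_complex.sel mult_zero_left diff_zero)
      have "\<phi> (Im (e * (z + h))) - (\<phi> (Im (e * z)) + Re (- \<i> * \<phi>' t * e * h)
        + Re (- \<phi>'' t / 4 * e\<^sup>2 * h\<^sup>2) + \<phi>'' (Im (e * z)) / 4 * (cmod h)\<^sup>2)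
        = \<phi> (t + s) - (\<phi> t + \<phi>' t * s + \<phi>'' t / 2 * s\<^sup>2)"
        unfolding r1 r3 s2 by (simp add: t_def s_def algebra_simps diff_divide_distrib)
      then have "\<bar>\<phi> (Im (e * (z + h))) - (\<phi> (Im (e * z)) + Re (- \<i> * \<phi>' t * e * h)
        + Re (- \<phi>'' t / 4 * e\<^sup>2 * h\<^sup>2) + \<phi>'' (Im (e * z)) / 4 * (cmod h)\<^sup>2)\<bar> \<le> B * \<bar>s\<bar> ^ 3"
        using T[of s] by simp
      also have "\<dots> \<le> B * cmod h ^ 3"
        using s \<open>B \<ge> 0\<close> by (intro mult_left_mono power_mono) auto
      also have "\<dots> = B * cmod h * (cmod h)\<^sup>2"
        by (simp add: power2_eq_square power3_eq_cube)
      also have "\<dots> \<le> \<epsilon> * (cmod h)\<^sup>2"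
        using elim by (intro mult_right_mono) auto
      finally show ?case .
    qed
  qed
qed

text \<open>A strip of half-width \<open>d\<close> carries a bump of Laplacian at least \<open>1/3\<close> whose size is only
  of order \<open>d\<close>.\<close>

definition strip_barrier :: "real \<Rightarrow> real \<Rightarrow> real" where
  "strip_barrier d t = d * sqrt (d\<^sup>2 + t\<^sup>2)"

text \<open>The Laplacian is positive everywhere and not only on the strip, so that the barriers of
  two crossing strips can be added without loss.\<close>

lemma has_laplacian_strip_barrier:
  assumes "cmod e = 1" and "d > 0"
  shows "has_laplacian (\<lambda>w. strip_barrier d (Im (e * w))) (d ^ 3 / sqrt (d\<^sup>2 + (Im (e * z))\<^sup>2) ^ 3) z"
proof -
  define q where "q t = sqrt (d\<^sup>2 + t\<^sup>2)" for t
  have q0: "q t > 0" for t using assms(2) by (simp add: q_def sum_power2_gt_zero_iff)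
  have q2: "(q t)\<^sup>2 = d\<^sup>2 + t\<^sup>2" for t by (simp add: q_def)
  have qd: "q t \<ge> d" for t unfolding q_def using assms(2) by (intro real_le_rsqrt) auto
  have qt: "q t \<ge> \<bar>t\<bar>" for t unfolding q_def by (intro real_le_rsqrt) auto
  have dq: "(q has_real_derivative t / q t) (at t)" for t
    unfolding q_def using assms(2)
    by (auto intro!: derivative_eq_intros simp: sum_power2_gt_zero_iff not_sum_power2_lt_zero field_simps)
  note [derivative_intros] = DERIV_chain2[OF dq]
  have "has_laplacian (\<lambda>w. (\<lambda>t. d * q t) (Im (e * w))) ((\<lambda>t. d ^ 3 / q t ^ 3) (Im (e * z))) z"
  proof (rule has_laplacian_Im_compose[where \<phi>' = "\<lambda>t. d * t / q t" and \<phi>''' = "\<lambda>t. - 3 * d ^ 3 * t / q t ^ 5"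
        and B = "3 / d"])
    fix t
    have qn: "q t \<noteq> 0" using q0[of t] by simp
    show "((\<lambda>t. d * q t) has_real_derivative d * t / q t) (at t)"
      by (auto intro!: derivative_eq_intros)
    have "(d * q t - d * t * (t / q t)) / (q t * q t) = d ^ 3 / q t ^ 3"
    proof -
      have "d * q t - d * t * (t / q t) = d * ((q t)\<^sup>2 - t\<^sup>2) / q t"
        using qn by (simp add: field_simps power2_eq_square)
      also have "\<dots> = d ^ 3 / q t" by (simp add: q2, simp add: power2_eq_square power3_eq_cube)
      finally show ?thesis using qn by (simp add: field_simps power3_eq_cube)
    qed
    then show "((\<lambda>t. d * t / q t) has_real_derivative d ^ 3 / q t ^ 3) (at t)"
      using qn by (auto intro!: derivative_eq_intros)
    show "((\<lambda>t. d ^ 3 / q t ^ 3) has_real_derivative - 3 * d ^ 3 * t / q t ^ 5) (at t)"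
      using qn by (auto intro!: derivative_eq_intros simp: field_simps eval_nat_numeral)
    have "\<bar>- 3 * d ^ 3 * t / q t ^ 5\<bar> = 3 * d ^ 3 * \<bar>t\<bar> / q t ^ 5"
      using assms(2) q0[of t] by (simp add: abs_mult)
    also have "\<dots> \<le> 3 * q t ^ 3 * q t / q t ^ 5"
      using assms(2) q0[of t] qd[of t] qt[of t]
      by (intro divide_right_mono mult_mono power_mono) auto
    also have "\<dots> = 3 / q t" using qn by (simp add: field_simps eval_nat_numeral)
    also have "\<dots> \<le> 3 / d" using qd[of t] assms(2) by (intro divide_left_mono) (auto intro!: mult_pos_pos q0)
    finally show "\<bar>- 3 * d ^ 3 * t / q t ^ 5\<bar> \<le> 3 / d" .
  qed (rule assms(1))
  then show ?thesis by (simp add: strip_barrier_def q_def)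
qed

text \<open>On the strip the root is at most \<open>sqrt 2 * d\<close>, and the cube of
  \<open>sqrt 2\<close> is less than 3.\<close>

lemma strip_barrier_laplacian_ge:
  assumes "d > 0" and "\<bar>t\<bar> \<le> d"
  shows "d ^ 3 / sqrt (d\<^sup>2 + t\<^sup>2) ^ 3 \<ge> 1 / 3"
proof -
  have "t\<^sup>2 \<le> d\<^sup>2" using assms abs_le_square_iff[of t d] by simp
  then have "sqrt (d\<^sup>2 + t\<^sup>2) \<le> sqrt (2 * d\<^sup>2)" by simp
  also have "\<dots> = sqrt 2 * d" using assms by (simp add: real_sqrt_mult)
  finally have "sqrt (d\<^sup>2 + t\<^sup>2) ^ 3 \<le> (sqrt 2 * d) ^ 3"
    by (intro power_mono) auto
  also have "\<dots> = 2 * sqrt 2 * d ^ 3" by (simp add: power3_eq_cube)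
  also have "\<dots> \<le> 3 * d ^ 3"
  proof -
    have "sqrt 2 \<le> 3 / 2" by (rule real_le_lsqrt) (auto simp: power2_eq_square)
    then show ?thesis using assms by (intro mult_right_mono) auto
  qed
  finally have "sqrt (d\<^sup>2 + t\<^sup>2) ^ 3 \<le> 3 * d ^ 3" .
  moreover have "sqrt (d\<^sup>2 + t\<^sup>2) > 0" using assms by (simp add: sum_power2_gt_zero_iff)
  ultimately show ?thesis by (simp add: field_simps)
qed

lemma strip_barrier_bounds:
  assumes "d > 0" and "\<bar>t\<bar> \<le> r"
  shows "0 \<le> strip_barrier d t" and "strip_barrier d t \<le> d * (d + r)"
proof -
  show "0 \<le> strip_barrier d t" using assms by (simp add: strip_barrier_def)
  have "t\<^sup>2 \<le> r\<^sup>2" using assms by (metis abs_le_square_iff abs_of_nonneg abs_ge_zero order_trans)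
  moreover have "0 \<le> 2 * d * r" using assms by simp
  ultimately have "d\<^sup>2 + t\<^sup>2 \<le> (d + r)\<^sup>2" unfolding power2_sum by linarith
  then have "sqrt (d\<^sup>2 + t\<^sup>2) \<le> d + r"
    using assms by (intro real_le_lsqrt) auto
  then show "strip_barrier d t \<le> d * (d + r)"
    unfolding strip_barrier_def using assms by (intro mult_left_mono) auto
qed

text \<open>\<open>visc_ge v \<mu> z\<close> says that \<open>v\<close> satisfies \<open>\<Delta>v \<ge> \<mu>\<close> at \<open>z\<close> in the viscosity sense.\<close>

definition visc_ge :: "(complex \<Rightarrow> real) \<Rightarrow> real \<Rightarrow> complex \<Rightarrow> bool" where
  "visc_ge v \<mu> z \<longleftrightarrow> (\<forall>\<psi> L. has_laplacian \<psi> L z \<longrightarrow> \<psi> z = v z \<longrightarrow>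
      (\<forall>\<^sub>F w in nhds z. v w \<le> \<psi> w) \<longrightarrow> \<mu> \<le> L)"

text \<open>Touching is weakened to a local maximum of \<open>v - \<psi>\<close>, which is what the
  maximum principle provides; the missing constant is added to \<open>\<psi>\<close>.\<close>

lemma visc_geD:
  assumes "visc_ge v \<mu> z" "has_laplacian \<psi> L z" "\<forall>\<^sub>F w in nhds z. v w - \<psi> w \<le> v z - \<psi> z"
  shows "\<mu> \<le> L"
proof -
  have 1: "has_laplacian (\<lambda>w. \<psi> w + (v z - \<psi> z)) (L + 0) z"
    by (intro has_laplacian_add has_laplacian_const assms(2))
  have 2: "\<forall>\<^sub>F w in nhds z. v w \<le> \<psi> w + (v z - \<psi> z)"
    using assms(3) by eventually_elim simp
  show ?thesis
    using assms(1)[unfolded visc_ge_def, rule_format, OF 1 _ 2] by simp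
qed

lemma visc_ge_mono: "visc_ge v \<mu> z \<Longrightarrow> \<nu> \<le> \<mu> \<Longrightarrow> visc_ge v \<nu> z"
  unfolding visc_ge_def by (meson order_trans)

lemma visc_ge_add:
  assumes "visc_ge v \<mu> z" and "has_laplacian g K z"
  shows "visc_ge (\<lambda>w. v w + g w) (\<mu> + K) z"
  unfolding visc_ge_def
proof (intro allI impI)
  fix \<psi> L
  assume *: "has_laplacian \<psi> L z" "\<psi> z = v z + g z" "\<forall>\<^sub>F w in nhds z. v w + g w \<le> \<psi> w"
  have "has_laplacian (\<lambda>w. \<psi> w - g w) (L - K) z"
    by (intro has_laplacian_diff * assms)
  moreover have "\<forall>\<^sub>F w in nhds z. v w - (\<psi> w - g w) \<le> v z - (\<psi> z - g z)"
    using *(3) by eventually_elim (simp add: *(2))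
  ultimately have "\<mu> \<le> L - K" by (rule visc_geD[OF assms(1)])
  then show "\<mu> + K \<le> L" by simp
qed

text \<open>The centre may be excluded because adding \<open>\<eta> ln (r / |z - p|)\<close> to the majorant \<open>G\<close> does not
  change its Laplacian and keeps the maximum away from the centre.\<close>

lemma comparison:
  fixes v G :: "complex \<Rightarrow> real"
  assumes "r > 0"
    and cv: "continuous_on (cball p r) v" and cG: "continuous_on (cball p r) G"
    and bd: "\<And>z. cmod (z - p) = r \<Longrightarrow> v z \<le> G z"
    and int: "\<And>z. cmod (z - p) < r \<Longrightarrow> z \<noteq> p \<Longrightarrow>
      \<exists>\<psi> L \<mu>. has_laplacian \<psi> L z \<and> \<psi> z = G z \<and> (\<forall>\<^sub>F w in nhds z. G w \<le> \<psi> w) \<and> visc_ge v \<mu> z \<and> L < \<mu>"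
    and z: "z \<in> cball p r"
  shows "v z \<le> G z"
proof -
  have main: "v z - G z \<le> \<eta> * ln (r / cmod (z - p))" if \<eta>: "\<eta> > 0" and z: "z \<in> cball p r" "z \<noteq> p" for \<eta> z
  proof (rule ccontr)
    assume neg: "\<not> ?thesis"
    define E where "E w = v w - G w - \<eta> * (ln r - ln (cmod (w - p)))" for w
    have "bounded ((\<lambda>w. v w - G w) ` cball p r)"
      by (rule compact_imp_bounded[OF compact_continuous_image[OF continuous_on_diff[OF cv cG] compact_cball]])
    then obtain B where B: "\<And>w. w \<in> cball p r \<Longrightarrow> \<bar>v w - G w\<bar> \<le> B"
      unfolding bounded_iff by (auto simp del: mem_cball)
    have Ez: "E z > 0" using neg z \<open>r > 0\<close> by (simp add: E_def ln_div)
    \<comment> \<open>Within distance \<open>s\<close> of the centre the penalty is at least the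
      bound \<open>B\<close>, so \<open>E\<close> is nonpositive there. The positive maximum of
      \<open>E\<close> over the annulus \<open>K\<close> is therefore attained in its
      interior.\<close>
    define s where "s = min (cmod (z - p)) (r * exp (- B / \<eta>))"
    have s: "s > 0" "s \<le> cmod (z - p)" "s \<le> r"
      using z \<open>r > 0\<close> by (auto simp: s_def dist_norm norm_minus_commute)
    define K where "K = cball p r - ball p s"
    have "compact K" unfolding K_def by (intro compact_diff compact_cball open_ball)
    moreover have "z \<in> K" using s z by (auto simp: K_def dist_norm norm_minus_commute)
    moreover have "continuous_on K E"
      unfolding E_def
    proof (intro continuous_intros continuous_on_subset[OF cv] continuous_on_subset[OF cG])
      show "\<forall>x\<in>K. cmod (x - p) \<noteq> 0" using s(1) by (auto simp: K_def)
    qed (auto simp: K_def)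
    ultimately obtain x where x: "x \<in> K" and max: "\<And>y. y \<in> K \<Longrightarrow> E y \<le> E x"
      using continuous_attains_sup[of K E] by blast
    have Ex: "E x > 0" using max[OF \<open>z \<in> K\<close>] Ez by linarith
    have xs: "cmod (x - p) \<ge> s" and xr: "cmod (x - p) \<le> r"
      using x by (auto simp: K_def dist_norm norm_minus_commute)
    have neg_small: "E y \<le> 0" if y: "y \<noteq> p" "cmod (y - p) \<le> s" for y
    proof -
      have "cmod (y - p) \<le> r * exp (- B / \<eta>)" using y by (simp add: s_def)
      then have "ln (cmod (y - p)) \<le> ln (r * exp (- B / \<eta>))"
        using y \<open>r > 0\<close> by (subst ln_le_cancel_iff) auto
      also have "\<dots> = ln r - B / \<eta>" using \<open>r > 0\<close> by (simp add: ln_mult)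
      finally have "B \<le> \<eta> * (ln r - ln (cmod (y - p)))" using \<eta> by (simp add: field_simps)
      moreover have "v y - G y \<le> B" using B[of y] y s by (auto simp: dist_norm norm_minus_commute)
      ultimately show ?thesis by (simp add: E_def)
    qed
    have "x \<noteq> p" using xs s(1) by auto
    have "cmod (x - p) \<noteq> s" using neg_small[OF \<open>x \<noteq> p\<close>] Ex by auto
    moreover have "cmod (x - p) \<noteq> r" using bd[of x] Ex by (auto simp: E_def)
    ultimately have x2: "s < cmod (x - p)" "cmod (x - p) < r" using xs xr by auto
    obtain \<psi> L \<mu> where \<psi>: "has_laplacian \<psi> L x" "\<psi> x = G x" "\<forall>\<^sub>F w in nhds x. G w \<le> \<psi> w"
      "visc_ge v \<mu> x" "L < \<mu>"
      using int[OF x2(2) \<open>x \<noteq> p\<close>] by blast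
    have "has_laplacian (\<lambda>w. \<psi> w + \<eta> * (ln r - ln (cmod (w - p)))) (L + \<eta> * (0 - 0)) x"
      by (intro has_laplacian_add has_laplacian_cmult has_laplacian_diff has_laplacian_const
          has_laplacian_ln_cmod \<psi> \<open>x \<noteq> p\<close>)
    moreover have "\<forall>\<^sub>F w in nhds x. v w - (\<psi> w + \<eta> * (ln r - ln (cmod (w - p))))
        \<le> v x - (\<psi> x + \<eta> * (ln r - ln (cmod (x - p))))"
    proof -
      have "open (ball p r - cball p s)" by (intro open_Diff open_ball closed_cball)
      moreover have "x \<in> ball p r - cball p s" using x2 by (auto simp: dist_norm norm_minus_commute)
      ultimately have "\<forall>\<^sub>F w in nhds x. w \<in> ball p r - cball p s"
        using eventually_nhds_in_open by blast
      then show ?thesis using \<psi>(3)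
      proof eventually_elim
        case (elim w)
        have "w \<in> K" using elim by (auto simp: K_def)
        then have "E w \<le> E x" by (rule max)
        then show ?case using elim(2) \<psi>(2) by (simp add: E_def)
      qed
    qed
    ultimately have "\<mu> \<le> L + \<eta> * (0 - 0)" by (rule visc_geD[OF \<psi>(4)])
    then show False using \<psi>(5) by simp
  qed
  \<comment> \<open>At each fixed point other than the centre the penalty vanishes as
    \<open>\<eta>\<close> tends to zero.\<close>
  have off: "v z \<le> G z" if z: "z \<in> cball p r" "z \<noteq> p" for z
  proof (rule field_le_epsilon)
    fix e :: real
    assume "e > 0"
    define l where "l = ln (r / cmod (z - p))"
    have "l \<ge> 0" using z \<open>r > 0\<close> by (auto simp: l_def dist_norm norm_minus_commute)
    have "v z - G z \<le> (e / (l + 1)) * l"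
      unfolding l_def by (rule main) (use z \<open>e > 0\<close> \<open>l \<ge> 0\<close> in \<open>auto simp: l_def[symmetric]\<close>)
    also have "\<dots> \<le> e" using \<open>l \<ge> 0\<close> \<open>e > 0\<close> by (simp add: field_simps)
    finally show "v z \<le> G z + e" by simp
  qed
  show ?thesis
  proof (cases "z = p")
    case True
    have "p \<in> ball p r" using \<open>r > 0\<close> by simp
    have "isCont (\<lambda>w. v w - G w) p"
      by (rule continuous_on_interior[OF continuous_on_diff[OF cv cG]])
        (use \<open>r > 0\<close> in \<open>simp add: interior_cball\<close>)
    then have "((\<lambda>w. v w - G w) \<longlongrightarrow> v p - G p) (at p)" unfolding isCont_def .
    moreover have "\<forall>\<^sub>F w in at p. v w - G w \<le> 0"
    proof -
      have "\<forall>\<^sub>F w in at p. w \<in> ball p r" by (rule eventually_at_in_open') (use \<open>r > 0\<close> in simp_all)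
      moreover have "\<forall>\<^sub>F w in at p. w \<noteq> p" by (simp add: eventually_neq_at_within)
      ultimately show ?thesis
        by eventually_elim (use off ball_subset_cball[of p r] in \<open>simp add: subset_iff\<close>)
    qed
    ultimately have "v p - G p \<le> 0" by (rule tendsto_upperbound) simp
    then show ?thesis using True by simp
  next
    case False
    then show ?thesis using off z by blast
  qed
qed

section \<open>Approximation by harmonic polynomials\<close>

text \<open>This replaces the solution of a Dirichlet problem. By Stone-Weierstrass it suffices that
  the real parts of polynomials form an algebra on the circle: a product of two real parts is half
  of \<open>Re (x * y) + Re (x * cnj y)\<close>, and on the unit circle
  \<open>z ^ m * cnj z ^ n\<close> reduces to a power of \<open>z\<close> or of
  \<open>cnj z\<close>.\<close>

lemma circle_approx_unit:
  fixes g :: "complex \<Rightarrow> real"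
  assumes "continuous_on (sphere 0 1) g" and "\<epsilon> > 0"
  shows "\<exists>P. \<forall>z\<in>sphere 0 1. \<bar>g z - Re (poly P z)\<bar> < \<epsilon>"
proof -
  define A :: "(complex \<Rightarrow> real) set"
    where "A = {h. \<exists>P. \<forall>z\<in>sphere 0 1. h z = Re (poly P z)}"
  have add: "(\<lambda>z. h z + k z) \<in> A" if "h \<in> A" "k \<in> A" for h k
  proof -
    obtain P Q where "\<forall>z\<in>sphere 0 1. h z = Re (poly P z)" "\<forall>z\<in>sphere 0 1. k z = Re (poly Q z)"
      using \<open>h \<in> A\<close> \<open>k \<in> A\<close> unfolding A_def by blast
    then have "\<forall>z\<in>sphere 0 1. h z + k z = Re (poly (P + Q) z)" by simp
    then show ?thesis unfolding A_def by blast
  qed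
  have poly: "(\<lambda>z. Re (poly P z)) \<in> A" for P unfolding A_def by blast
  have sum: "(\<lambda>z. \<Sum>i\<in>I. h i z) \<in> A" if "\<And>i. i \<in> I \<Longrightarrow> h i \<in> A" for h and I :: "nat set"
    using that
  proof (induction I rule: infinite_finite_induct)
    case (insert i I)
    then show ?case using add[of "h i" "\<lambda>z. \<Sum>i\<in>I. h i z"] by simp
  qed (use poly[of 0] in simp_all)
  have mono: "(\<lambda>z. Re (c * z ^ m * cnj z ^ n)) \<in> A" for c m n
  proof -
    have zz: "z ^ k * cnj z ^ k = 1" if "z \<in> sphere 0 1" for z :: complex and k
      using that complex_norm_square[of z] by (simp flip: power_mult_distrib)
    show ?thesis
    proof (cases "n \<le> m")
      case True
      have "Re (c * z ^ m * cnj z ^ n) = Re (poly (monom c (m - n)) z)" if "z \<in> sphere 0 1" for z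
      proof -
        have "z ^ m = z ^ (m - n) * z ^ n" using True by (simp flip: power_add)
        then have "c * z ^ m * cnj z ^ n = c * z ^ (m - n) * (z ^ n * cnj z ^ n)" by simp
        then show ?thesis unfolding zz[OF that] by (simp only: poly_monom mult_1_right)
      qed
      then show ?thesis unfolding A_def by blast
    next
      case False
      have "Re (c * z ^ m * cnj z ^ n) = Re (poly (monom (cnj c) (n - m)) z)" if "z \<in> sphere 0 1" for z
      proof -
        have "cnj z ^ n = cnj z ^ (n - m) * cnj z ^ m" using False by (simp flip: power_add)
        then have "c * z ^ m * cnj z ^ n = c * cnj z ^ (n - m) * (z ^ m * cnj z ^ m)" by simp
        then have "c * z ^ m * cnj z ^ n = cnj (cnj c * z ^ (n - m))"
          unfolding zz[OF that] by simp
        then show ?thesis by (simp only: poly_monom cnj.sel)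
      qed
      then show ?thesis unfolding A_def by blast
    qed
  qed
  have half: "(\<lambda>z. h z / 2) \<in> A" if h: "h \<in> A" for h
  proof -
    obtain P where "\<forall>z\<in>sphere 0 1. h z = Re (poly P z)" using h unfolding A_def by blast
    then have "\<forall>z\<in>sphere 0 1. h z / 2 = Re (poly (smult (1 / 2) P) z)" by simp
    then show ?thesis unfolding A_def by blast
  qed
  have mult: "(\<lambda>z. h z * k z) \<in> A" if hk: "h \<in> A" "k \<in> A" for h k
  proof -
    obtain P Q where P: "\<forall>z\<in>sphere 0 1. h z = Re (poly P z)" and Q: "\<forall>z\<in>sphere 0 1. k z = Re (poly Q z)"
      using hk unfolding A_def by blast
    have *: "Re (poly P z * cnj (poly Q z)) = (\<Sum>i\<le>degree P. \<Sum>j\<le>degree Q.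
        Re (coeff P i * cnj (coeff Q j) * z ^ i * cnj z ^ j))" for z
      by (simp add: poly_altdef sum_product Re_sum mult_ac del: times_complex.sel)
    have "(\<lambda>z. Re (poly P z * cnj (poly Q z))) \<in> A"
      unfolding * by (intro sum mono)
    then have A1: "(\<lambda>z. (Re (poly (P * Q) z) + Re (poly P z * cnj (poly Q z))) / 2) \<in> A"
      by (intro half add poly)
    have "Re x * Re y = (Re (x * y) + Re (x * cnj y)) / 2" for x y by simp
    then have "\<forall>z\<in>sphere 0 1. h z * k z = (Re (poly (P * Q) z) + Re (poly P z * cnj (poly Q z))) / 2"
      using P Q by (simp only: poly_mult) simp
    then show ?thesis using A1 unfolding A_def by fastforce
  qed
  interpret function_ring_on A "sphere 0 1"
  proof
    show "continuous_on (sphere 0 1) f" if f: "f \<in> A" for f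
    proof -
      obtain P where "\<forall>z\<in>sphere 0 1. f z = Re (poly P z)" using f unfolding A_def by blast
      moreover have "continuous_on (sphere 0 1) (\<lambda>z. Re (poly P z))" by (intro continuous_intros)
      ultimately show ?thesis
        by (subst continuous_on_cong[OF refl, where g = "\<lambda>z. Re (poly P z)"]) auto
    qed
    show "(\<lambda>_. c) \<in> A" for c using poly[of "[:of_real c:]"] by simp
    show "\<exists>f\<in>A. f x \<noteq> f y" if "x \<noteq> y" for x y
    proof (cases "Re x = Re y")
      case True
      then have "Im x \<noteq> Im y" using that complex_eqI by blast
      then show ?thesis using poly[of "[:0, - \<i>:]"] by (intro bexI) auto
    next
      case False
      then show ?thesis using poly[of "[:0, 1:]"] by (intro bexI) auto
    qed
  qed (auto intro: add mult)
  obtain h where "h \<in> A" "\<forall>z\<in>sphere 0 1. \<bar>g z - h z\<bar> < \<epsilon>"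
    using Stone_Weierstrass_basic[OF assms] by blast
  moreover obtain P where "\<forall>z\<in>sphere 0 1. h z = Re (poly P z)"
    using \<open>h \<in> A\<close> unfolding A_def by blast
  ultimately show ?thesis by (metis (no_types, lifting))
qed

lemma circle_approx:
  fixes g :: "complex \<Rightarrow> real"
  assumes "continuous_on (sphere p r) g" and "r > 0" and "\<epsilon> > 0"
  shows "\<exists>P. \<forall>h. cmod h = r \<longrightarrow> \<bar>g (p + h) - Re (poly P h)\<bar> < \<epsilon>"
proof -
  have "continuous_on (sphere 0 1) (\<lambda>w. g (p + of_real r * w))"
    by (rule continuous_on_compose2[OF assms(1)])
      (use assms(2) in \<open>auto intro!: continuous_intros simp: dist_norm norm_mult\<close>)
  from circle_approx_unit[OF this assms(3)] obtain P
    where P: "\<And>w. cmod w = 1 \<Longrightarrow> \<bar>g (p + of_real r * w) - Re (poly P w)\<bar> < \<epsilon>"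
    unfolding Ball_def mem_sphere_0 by blast
  have "\<bar>g (p + h) - Re (poly (pcompose P [:0, of_real (1 / r):]) h)\<bar> < \<epsilon>" if "cmod h = r" for h
    using P[of "h / of_real r"] that assms(2) by (simp add: poly_pcompose norm_divide)
  then show ?thesis by blast
qed

text \<open>Averaging over the \<open>N\<close>-th roots of unity extracts \<open>coeff P n\<close> from the values of \<open>Re P\<close> alone:
  the contribution of the complex conjugate of \<open>P\<close> averages to zero.\<close>

lemma coeff_le_of_Re_le:
  fixes P :: "complex poly"
  assumes "r > 0" and "n \<ge> 1" and le: "\<And>z. cmod z = r \<Longrightarrow> Re (poly P z) \<le> m"
  shows "cmod (coeff P n) * r ^ n \<le> 2 * (m - Re (coeff P 0))"
proof -
  \<comment> \<open>Large enough to prevent aliasing: for degrees \<open>i\<close> of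
    \<open>P\<close>, \<open>N\<close> divides \<open>i\<close> only for \<open>i = 0\<close> and
    \<open>i + (N - n)\<close> only for \<open>i = n\<close>, and it never divides
    \<open>(N - i) + (N - n)\<close>, which lies strictly between \<open>N\<close> and
    \<open>2 * N\<close>.\<close>
  define N where "N = degree P + n + 1"
  define e where "e j k = exp (2 * of_real pi * \<i> * of_nat (j * k) / of_nat N)" for j k
  have "N > 0" by (simp add: N_def)
  have e_pow: "e j k = e j 1 ^ k" for j k
    unfolding e_def by (simp add: field_simps flip: exp_of_nat_mult)
  have e_mult: "e i k * e j k = e (i + j) k" for i j k
    unfolding e_def by (simp add: field_simps add_divide_distrib flip: exp_add)
  have e_norm: "cmod (e j k) = 1" for j k
    unfolding e_def by (simp add: norm_exp_eq_Re)
  have e_cnj: "cnj (e j k) * e N k = e (N - j) k" if "j \<le> N" for j k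
  proof -
    have "cnj (e j k) * e j k = 1"
      using e_norm[of j k] by (metis complex_norm_square mult.commute of_real_1 power_one)
    moreover have "e N k = e j k * e (N - j) k" using that by (simp add: e_mult)
    ultimately show ?thesis by (simp flip: mult.assoc)
  qed
  have e_sum: "(\<Sum>k<N. e j k) = (if N dvd j then of_nat N else 0)" for j
  proof (cases "N dvd j")
    case True
    then have "e j 1 = 1"
      using complex_root_unity_eq_1[of N j] \<open>N > 0\<close> by (simp add: e_def mult_ac)
    then have "e j k = 1" for k using e_pow[of j k] by simp
    then show ?thesis using True by simp
  next
    case False
    then have ne: "e j 1 \<noteq> 1"
      using complex_root_unity_eq_1[of N j] \<open>N > 0\<close> by (simp add: e_def mult_ac)
    have "e j 1 ^ N = 1"
      using complex_root_unity_eq_1[of N "j * N"] \<open>N > 0\<close> unfolding e_pow[symmetric] by (simp add: e_def mult_ac)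
    then have "(\<Sum>k<N. e j 1 ^ k) = 0" using ne by (simp add: sum_gp_strict)
    moreover have "(\<Sum>k<N. e j k) = (\<Sum>k<N. e j 1 ^ k)" by (intro sum.cong refl e_pow)
    ultimately show ?thesis using False by simp
  qed
  define z where "z k = of_real r * e 1 k" for k
  have z_pow: "z k ^ i = of_real (r ^ i) * e i k" for i k
  proof -
    have "e 1 k ^ i = e i k" unfolding e_pow[of 1 k] e_pow[of i k] e_pow[of 1 i, simplified]
      by (simp add: e_def field_simps flip: exp_of_nat_mult power_mult)
    then show ?thesis by (simp add: z_def power_mult_distrib)
  qed
  have poly_z: "poly P (z k) = (\<Sum>i\<le>degree P. coeff P i * of_real (r ^ i) * e i k)" for k
    by (simp add: poly_altdef z_pow mult.assoc)
  have avg0: "(\<Sum>k<N. poly P (z k)) = of_nat N * coeff P 0"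
  proof -
    have "(\<Sum>k<N. poly P (z k)) = (\<Sum>i\<le>degree P. coeff P i * of_real (r ^ i) * (\<Sum>k<N. e i k))"
      unfolding poly_z by (subst sum.swap) (simp add: sum_distrib_left)
    also have "\<dots> = (\<Sum>i\<le>degree P. if i = 0 then of_nat N * coeff P 0 else 0)"
    proof (intro sum.cong refl)
      fix i assume "i \<in> {..degree P}"
      then have "N dvd i \<longleftrightarrow> i = 0" by (auto simp: N_def dest: dvd_imp_le)
      then show "coeff P i * of_real (r ^ i) * (\<Sum>k<N. e i k) = (if i = 0 then of_nat N * coeff P 0 else 0)"
        unfolding e_sum by simp
    qed
    finally show ?thesis by simp
  qed
  have avg1: "(\<Sum>k<N. poly P (z k) * e (N - n) k) = of_nat N * (coeff P n * of_real (r ^ n))"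
  proof -
    have "(\<Sum>k<N. poly P (z k) * e (N - n) k)
       = (\<Sum>i\<le>degree P. coeff P i * of_real (r ^ i) * (\<Sum>k<N. e (i + (N - n)) k))"
      unfolding poly_z sum_distrib_right
      by (subst sum.swap) (simp add: sum_distrib_left mult.assoc e_mult del: of_real_power)
    also have "\<dots> = (\<Sum>i\<le>degree P. if i = n then of_nat N * (coeff P n * of_real (r ^ n)) else 0)"
    proof (intro sum.cong refl)
      fix i assume i: "i \<in> {..degree P}"
      have "N dvd i + (N - n) \<longleftrightarrow> i = n"
      proof
        assume "N dvd i + (N - n)"
        then obtain q where q: "i + (N - n) = N * q" by (elim dvdE)
        have "0 < i + (N - n)" "i + (N - n) < N * 2" using i by (auto simp: N_def)
        then have "0 < q" "q < 2" unfolding q by simp_all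
        then have "q = 1" by simp
        then show "i = n" using q by (simp add: N_def)
      next
        assume "i = n"
        then have "i + (N - n) = N" by (simp add: N_def)
        then show "N dvd i + (N - n)" by simp
      qed
      then show "coeff P i * of_real (r ^ i) * (\<Sum>k<N. e (i + (N - n)) k)
         = (if i = n then of_nat N * (coeff P n * of_real (r ^ n)) else 0)"
        unfolding e_sum by simp
    qed
    also have "\<dots> = of_nat N * (coeff P n * of_real (r ^ n))"
      by (cases "n \<le> degree P") (auto simp: coeff_eq_0)
    finally show ?thesis .
  qed
  have avg2: "(\<Sum>k<N. cnj (poly P (z k)) * e (N - n) k) = 0"
  proof -
    have "e N k = 1" for k
      using complex_root_unity_eq_1[of N "N * k"] \<open>N > 0\<close> by (simp add: e_def mult_ac)
    then have ec: "cnj (e i k) = e (N - i) k" if "i \<le> N" for i k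
      using e_cnj[OF that, of k] by simp
    have "(\<Sum>k<N. cnj (poly P (z k)) * e (N - n) k)
       = (\<Sum>k<N. \<Sum>i\<le>degree P. cnj (coeff P i) * of_real (r ^ i) * e ((N - i) + (N - n)) k)"
      unfolding poly_z
      by (intro sum.cong refl) (simp add: sum_distrib_right mult.assoc ec N_def e_mult del: of_real_power)
    also have "\<dots> = (\<Sum>i\<le>degree P. cnj (coeff P i) * of_real (r ^ i) * (\<Sum>k<N. e ((N - i) + (N - n)) k))"
      by (subst sum.swap) (simp add: sum_distrib_left)
    also have "\<dots> = (\<Sum>i\<le>degree P. 0)"
    proof (intro sum.cong refl)
      fix i assume i: "i \<in> {..degree P}"
      have "\<not> N dvd (N - i) + (N - n)"
      proof
        assume "N dvd (N - i) + (N - n)"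
        then obtain q where q: "(N - i) + (N - n) = N * q" by (elim dvdE)
        have "N * 1 < (N - i) + (N - n)" "(N - i) + (N - n) < N * 2"
          using i assms(2) by (auto simp: N_def)
        then have "1 < q" "q < 2" unfolding q mult_less_cancel1 by simp_all
        then show False by simp
      qed
      then show "cnj (coeff P i) * of_real (r ^ i) * (\<Sum>k<N. e ((N - i) + (N - n)) k) = 0"
        unfolding e_sum by simp
    qed
    finally show ?thesis by simp
  qed
  have avg3: "(\<Sum>k<N. e (N - n) k) = 0"
  proof -
    have "\<not> N dvd N - n" using assms(2) by (auto simp: N_def dest: dvd_imp_le)
    then show ?thesis unfolding e_sum by simp
  qed
  have zr: "cmod (z k) = r" for k using assms(1) by (simp add: z_def norm_mult e_norm)
  \<comment> \<open>Adding the conjugate and subtracting the constant leaves the average unchanged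
    but turns the summand into a multiple of the nonnegative quantity \<open>m - Re P\<close>. Its
    absolute average is its average, which the constant coefficient gives.\<close>
  have "of_nat N * (coeff P n * of_real (r ^ n))
      = (\<Sum>k<N. poly P (z k) * e (N - n) k + cnj (poly P (z k)) * e (N - n) k - of_real (2 * m) * e (N - n) k)"
    by (simp only: sum_subtractf sum.distrib avg1 avg2 avg3 flip: sum_distrib_left) simp
  also have "\<dots> = (\<Sum>k<N. - of_real (2 * (m - Re (poly P (z k)))) * e (N - n) k)"
    by (intro sum.cong refl, simp only: complex_add_cnj flip: distrib_right left_diff_distrib)
      (simp add: algebra_simps)
  finally have "cmod (of_nat N * (coeff P n * of_real (r ^ n)))
      = cmod (\<Sum>k<N. - of_real (2 * (m - Re (poly P (z k)))) * e (N - n) k)"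
    by (simp only:)
  also have "\<dots> \<le> (\<Sum>k<N. 2 * (m - Re (poly P (z k))))"
  proof (rule order_trans[OF norm_sum sum_mono])
    fix k
    have "0 \<le> 2 * (m - Re (poly P (z k)))" using le[OF zr] by simp
    then show "cmod (- of_real (2 * (m - Re (poly P (z k)))) * e (N - n) k) \<le> 2 * (m - Re (poly P (z k)))"
      by (simp only: norm_mult norm_minus_cancel norm_of_real e_norm abs_of_nonneg mult_1_right)
  qed
  also have "\<dots> = 2 * (of_nat N * m - Re (\<Sum>k<N. poly P (z k)))"
    by (simp add: sum_subtractf flip: sum_distrib_left)
  also have "\<dots> = of_nat N * (2 * (m - Re (coeff P 0)))"
    unfolding avg0 by (simp add: algebra_simps)
  also have "cmod (of_nat N * (coeff P n * of_real (r ^ n))) = of_nat N * (cmod (coeff P n) * r ^ n)"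
    using assms(1) by (simp add: norm_mult norm_power)
  finally show ?thesis using \<open>N > 0\<close> by simp
qed

lemma poly_third_order_tail:
  fixes P :: "complex poly"
  assumes "r > 0" and K: "\<And>n. n \<ge> 1 \<Longrightarrow> cmod (coeff P n) * r ^ n \<le> K" and z: "cmod z \<le> r / 16"
  shows "cmod (poly P z - (coeff P 0 + coeff P 1 * z + coeff P 2 * z\<^sup>2)) \<le> K / 2048"
proof -
  have "K \<ge> 0" using K[of 1] \<open>r > 0\<close> by (meson mult_nonneg_nonneg norm_ge_zero order_refl order_trans zero_le_power less_imp_le)
  define D where "D = degree P"
  have "poly P z = (\<Sum>i\<le>D + 2. coeff P i * z ^ i)"
    unfolding poly_altdef D_def by (rule sum.mono_neutral_left) (auto simp: coeff_eq_0)
  also have "{..D + 2} = {0, 1, 2} \<union> {3..D + 2}" by auto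
  also have "(\<Sum>i\<in>{0, 1, 2} \<union> {3..D + 2}. coeff P i * z ^ i)
     = coeff P 0 + coeff P 1 * z + coeff P 2 * z\<^sup>2 + (\<Sum>i=3..D + 2. coeff P i * z ^ i)"
    by (subst sum.union_disjoint) auto
  finally have "poly P z - (coeff P 0 + coeff P 1 * z + coeff P 2 * z\<^sup>2) = (\<Sum>i=3..D + 2. coeff P i * z ^ i)"
    by simp
  also have "cmod \<dots> \<le> (\<Sum>i=3..D + 2. K * (1 / 16) ^ i)"
  proof (rule order_trans[OF norm_sum sum_mono])
    fix i assume "i \<in> {3..D + 2}"
    have "cmod (coeff P i * z ^ i) = cmod (coeff P i) * cmod z ^ i" by (simp add: norm_mult norm_power)
    also have "\<dots> \<le> cmod (coeff P i) * (r / 16) ^ i"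
      using z by (intro mult_left_mono power_mono) auto
    also have "\<dots> = cmod (coeff P i) * r ^ i * (1 / 16) ^ i" by (simp add: power_divide)
    also have "\<dots> \<le> K * (1 / 16) ^ i"
      using K[of i] \<open>i \<in> {3..D + 2}\<close> by (intro mult_right_mono) auto
    finally show "cmod (coeff P i * z ^ i) \<le> K * (1 / 16) ^ i" .
  qed
  also have "\<dots> = K * (\<Sum>i=3..D + 2. (1 / 16) ^ i)" by (simp only: sum_distrib_left)
  also have "\<dots> \<le> K * (1 / 2048)"
  proof (intro mult_left_mono \<open>K \<ge> 0\<close>)
    \<comment> \<open>The subtracted term is the exact remainder of the geometric series, whose sum
      is 1/3840; it makes the induction close.\<close>
    have "(\<Sum>i=3..D + 2. (1 / 16 :: real) ^ i) \<le> 1 / 2048 - (1 / 16) ^ (D + 2) / 15" if "D \<ge> 1" for D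
      using that by (induction D rule: nat_induct_at_least) (simp_all add: numeral_3_eq_3 field_simps)
    then show "(\<Sum>i=3..D + 2. (1 / 16 :: real) ^ i) \<le> 1 / 2048"
      by (cases "D \<ge> 1") (smt (verit) divide_nonneg_nonneg zero_le_power, auto simp: not_le)
  qed
  finally show ?thesis by simp
qed

section \<open>Campanato iteration with harmonic quadratic polynomials\<close>

definition harmonic_quadratic :: "real \<Rightarrow> complex \<Rightarrow> complex \<Rightarrow> complex \<Rightarrow> real" where
  "harmonic_quadratic c0 c1 c2 h = c0 + Re (c1 * h + c2 * h\<^sup>2)"

text \<open>The difference of the two approximations is a harmonic polynomial of size
  \<open>(M + \<delta>) * r\<^sup>2\<close>, and its terms up to degree two are absorbed into the
  new quadratic. The rest is at most \<open>4 * (M + \<delta>) * r\<^sup>2 / 2048\<close>, which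
  measured by the square of \<open>r / 16\<close> is \<open>(M + \<delta>) / 2\<close>. The error
  \<open>\<delta> * r\<^sup>2\<close> itself is multiplied by 256.\<close>

lemma campanato_step:
  fixes g :: "complex \<Rightarrow> real"
  assumes "r > 0"
    and P: "\<And>h. cmod h \<le> r \<Longrightarrow> \<bar>g h - Re (poly P h)\<bar> \<le> \<delta> * r\<^sup>2"
    and q: "\<And>h. cmod h \<le> r \<Longrightarrow> \<bar>g h - harmonic_quadratic c0 c1 c2 h\<bar> \<le> M * r\<^sup>2"
  shows "\<exists>c0' c1' c2'. \<bar>c0' - c0\<bar> \<le> (M + \<delta>) * r\<^sup>2 \<and> cmod (c1' - c1) \<le> 4 * (M + \<delta>) * r
     \<and> cmod (c2' - c2) \<le> 4 * (M + \<delta>)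
     \<and> (\<forall>h. cmod h \<le> r / 16 \<longrightarrow> \<bar>g h - harmonic_quadratic c0' c1' c2' h\<bar> \<le> (M / 2 + 257 * \<delta>) * (r / 16)\<^sup>2)"
proof -
  define Q where "Q = P - [:of_real c0, c1, c2:]"
  have Qh: "Re (poly Q h) = Re (poly P h) - harmonic_quadratic c0 c1 c2 h" for h
    by (simp add: Q_def harmonic_quadratic_def power2_eq_square algebra_simps)
  have "\<delta> * r\<^sup>2 \<ge> 0" using P[of 0] \<open>r > 0\<close> by (smt (verit) norm_zero)
  then have "\<delta> \<ge> 0" using \<open>r > 0\<close> by (simp add: zero_le_mult_iff)
  have Qb: "\<bar>Re (poly Q h)\<bar> \<le> (M + \<delta>) * r\<^sup>2" if "cmod h \<le> r" for h
    using P[OF that] q[OF that] unfolding Qh by (simp add: algebra_simps)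
  have Q0: "\<bar>Re (coeff Q 0)\<bar> \<le> (M + \<delta>) * r\<^sup>2"
    using Qb[of 0] \<open>r > 0\<close> by (simp add: poly_0_coeff_0)
  have Qn: "cmod (coeff Q n) * r ^ n \<le> 4 * (M + \<delta>) * r\<^sup>2" if "n \<ge> 1" for n
  proof -
    have "cmod (coeff Q n) * r ^ n \<le> 2 * ((M + \<delta>) * r\<^sup>2 - Re (coeff Q 0))"
      using Qb by (intro coeff_le_of_Re_le assms that) (metis abs_le_D1 order_refl)
    also have "\<dots> \<le> 4 * (M + \<delta>) * r\<^sup>2" using abs_le_D2[OF Q0] by (simp add: algebra_simps)
    finally show ?thesis .
  qed
  have c1: "cmod (coeff Q 1) \<le> 4 * (M + \<delta>) * r"
    using Qn[of 1] \<open>r > 0\<close> by (simp add: power2_eq_square)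
  have c2: "cmod (coeff Q 2) \<le> 4 * (M + \<delta>)"
    using Qn[of 2] \<open>r > 0\<close> by simp
  have fin: "\<bar>g h - harmonic_quadratic (c0 + Re (coeff Q 0)) (c1 + coeff Q 1) (c2 + coeff Q 2) h\<bar>
      \<le> (M / 2 + 257 * \<delta>) * (r / 16)\<^sup>2" if h: "cmod h \<le> r / 16" for h
  proof -
    have "cmod h \<le> r" using h \<open>r > 0\<close> by simp
    have "\<bar>Re (poly Q h - (coeff Q 0 + coeff Q 1 * h + coeff Q 2 * h\<^sup>2))\<bar> \<le> 4 * (M + \<delta>) * r\<^sup>2 / 2048"
      using abs_Re_le_cmod poly_third_order_tail[OF \<open>r > 0\<close> Qn h] by (rule order_trans)
    moreover have "Re (poly Q h - (coeff Q 0 + coeff Q 1 * h + coeff Q 2 * h\<^sup>2))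
      = Re (poly P h) - harmonic_quadratic (c0 + Re (coeff Q 0)) (c1 + coeff Q 1) (c2 + coeff Q 2) h"
      using Qh[of h] by (simp add: harmonic_quadratic_def algebra_simps)
    moreover have "\<bar>g h - Re (poly P h)\<bar> \<le> \<delta> * r\<^sup>2" by (rule P) fact
    ultimately have "\<bar>g h - harmonic_quadratic (c0 + Re (coeff Q 0)) (c1 + coeff Q 1) (c2 + coeff Q 2) h\<bar>
      \<le> \<delta> * r\<^sup>2 + 4 * (M + \<delta>) * r\<^sup>2 / 2048" by linarith
    also have "\<dots> = (M / 2 + 256.5 * \<delta>) * (r / 16)\<^sup>2" by (simp add: power2_eq_square field_simps)
    also have "\<dots> \<le> (M / 2 + 257 * \<delta>) * (r / 16)\<^sup>2" using \<open>\<delta> \<ge> 0\<close> by (intro mult_right_mono) auto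
    finally show ?thesis .
  qed
  show ?thesis
    by (rule exI[of _ "c0 + Re (coeff Q 0)"], rule exI[of _ "c1 + coeff Q 1"], rule exI[of _ "c2 + coeff Q 2"])
      (use Q0 c1 c2 fin in auto)
qed

text \<open>The increments carry different powers of the radius: those of \<open>c1\<close> are
  summable whenever \<open>M\<close> and \<open>\<delta>\<close> are bounded, whereas
  \<open>c2\<close> may drift without limit. This drift is where the logarithmic growth can
  enter.\<close>

lemma campanato_iteration:
  fixes g :: "complex \<Rightarrow> real" and M \<delta> :: "nat \<Rightarrow> real"
  assumes "\<rho> > 0"
    and P: "\<And>k. \<exists>P. \<forall>h. cmod h \<le> \<rho> / 16 ^ k \<longrightarrow> \<bar>g h - Re (poly P h)\<bar> \<le> \<delta> k * (\<rho> / 16 ^ k)\<^sup>2"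
    and M0: "\<forall>h. cmod h \<le> \<rho> \<longrightarrow> \<bar>g h\<bar> \<le> M 0 * \<rho>\<^sup>2"
    and M: "\<And>k. M (Suc k) = M k / 2 + 257 * \<delta> k"
  shows "\<exists>c0 c1 c2. c1 0 = 0 \<and> c2 0 = 0
    \<and> (\<forall>k h. cmod h \<le> \<rho> / 16 ^ k \<longrightarrow>
         \<bar>g h - harmonic_quadratic (c0 k) (c1 k) (c2 k) h\<bar> \<le> M k * (\<rho> / 16 ^ k)\<^sup>2)
    \<and> (\<forall>k. cmod (c1 (Suc k) - c1 k) \<le> 4 * (M k + \<delta> k) * (\<rho> / 16 ^ k))
    \<and> (\<forall>k. cmod (c2 (Suc k) - c2 k) \<le> 4 * (M k + \<delta> k))"
proof -
  define I where "I k q = ((k = 0 \<longrightarrow> q = (0, 0, 0)) \<and> (\<forall>h. cmod h \<le> \<rho> / 16 ^ k \<longrightarrow>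
     \<bar>g h - harmonic_quadratic (fst q) (fst (snd q)) (snd (snd q)) h\<bar> \<le> M k * (\<rho> / 16 ^ k)\<^sup>2))"
    for k :: nat and q :: "real \<times> complex \<times> complex"
  define J where "J k q q' = (cmod (fst (snd q') - fst (snd q)) \<le> 4 * (M k + \<delta> k) * (\<rho> / 16 ^ k)
     \<and> cmod (snd (snd q') - snd (snd q)) \<le> 4 * (M k + \<delta> k))"
    for k :: nat and q q' :: "real \<times> complex \<times> complex"
  have "\<exists>f. \<forall>k. I k (f k) \<and> J k (f k) (f (Suc k))"
  proof (rule dependent_nat_choice)
    show "\<exists>q. I 0 q"
      using M0 by (intro exI[of _ "(0, 0, 0)"]) (simp add: I_def harmonic_quadratic_def)
    fix q k
    assume I: "I k q"
    obtain P where "\<forall>h. cmod h \<le> \<rho> / 16 ^ k \<longrightarrow> \<bar>g h - Re (poly P h)\<bar> \<le> \<delta> k * (\<rho> / 16 ^ k)\<^sup>2"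
      using P by blast
    then obtain c0' c1' c2' where "cmod (c1' - fst (snd q)) \<le> 4 * (M k + \<delta> k) * (\<rho> / 16 ^ k)"
      "cmod (c2' - snd (snd q)) \<le> 4 * (M k + \<delta> k)"
      "\<And>h. cmod h \<le> \<rho> / 16 ^ k / 16 \<Longrightarrow> \<bar>g h - harmonic_quadratic c0' c1' c2' h\<bar>
          \<le> (M k / 2 + 257 * \<delta> k) * (\<rho> / 16 ^ k / 16)\<^sup>2"
      using campanato_step[of "\<rho> / 16 ^ k" g P "\<delta> k" "fst q" "fst (snd q)" "snd (snd q)" "M k"] I \<open>\<rho> > 0\<close>
      unfolding I_def by auto
    then have "I (Suc k) (c0', c1', c2') \<and> J k q (c0', c1', c2')"
      unfolding I_def J_def M by (simp add: mult.commute)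
    then show "\<exists>q'. I (Suc k) q' \<and> J k q q'" by blast
  qed
  then obtain f where f: "\<And>k. I k (f k)" "\<And>k. J k (f k) (f (Suc k))" by blast
  show ?thesis
    using f f(1)[of 0]
    by (intro exI[of _ "\<lambda>k. fst (f k)"] exI[of _ "\<lambda>k. fst (snd (f k))"] exI[of _ "\<lambda>k. snd (snd (f k))"])
      (auto simp: I_def J_def)
qed

lemma geometric_increments_limit:
  fixes x :: "nat \<Rightarrow> complex"
  assumes "C \<ge> 0" and inc: "\<And>k. k \<ge> K \<Longrightarrow> cmod (x (Suc k) - x k) \<le> C / 16 ^ k"
  shows "\<exists>l. x \<longlonglongrightarrow> l \<and> (\<forall>k\<ge>K. cmod (x k - l) \<le> 2 * C / 16 ^ k)"
proof -
  \<comment> \<open>The constant 16/15 is the sum of the powers of 1/16; with it the bound for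
    \<open>x n - x k\<close> telescopes without loss.\<close>
  define D where "D = 16 / 15 * C"
  have diff: "cmod (x n - x k) \<le> D / 16 ^ k - D / 16 ^ n" if "k \<ge> K" "n \<ge> k" for k n
    using \<open>n \<ge> k\<close>
  proof (induction n rule: dec_induct)
    case base
    then show ?case by simp
  next
    case (step n)
    have "cmod (x (Suc n) - x k) \<le> cmod (x (Suc n) - x n) + cmod (x n - x k)"
      using norm_triangle_ineq[of "x (Suc n) - x n" "x n - x k"] by simp
    also have "\<dots> \<le> C / 16 ^ n + (D / 16 ^ k - D / 16 ^ n)"
      using inc[of n] step that by (intro add_mono) auto
    also have "\<dots> = D / 16 ^ k - D / 16 ^ Suc n"
      by (simp add: D_def field_simps)
    finally show ?case .
  qed
  have diff2: "cmod (x n - x k) \<le> 2 * C / 16 ^ k" if "k \<ge> K" "n \<ge> k" for k n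
  proof -
    have "D / 16 ^ k - D / 16 ^ n \<le> D / 16 ^ k" using \<open>C \<ge> 0\<close> by (simp add: D_def)
    also have "\<dots> \<le> 2 * C / 16 ^ k"
      using \<open>C \<ge> 0\<close> by (intro divide_right_mono) (auto simp: D_def)
    finally show ?thesis using diff[OF that] by simp
  qed
  have lim0: "(\<lambda>k. 2 * C / 16 ^ k) \<longlonglongrightarrow> 0"
    using tendsto_mult[OF tendsto_const[of "2 * C"] LIMSEQ_realpow_zero[of "1 / 16"]]
    by (simp add: power_divide)
  have "Cauchy x"
  proof (rule metric_CauchyI)
    fix e :: real
    assume "e > 0"
    then have "\<forall>\<^sub>F k in sequentially. 2 * C / 16 ^ k < e / 2"
      using lim0 by (intro order_tendstoD(2)) auto
    then obtain N where N: "\<And>k. k \<ge> N \<Longrightarrow> 2 * C / 16 ^ k < e / 2"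
      unfolding eventually_sequentially by blast
    define k where "k = max N K"
    have "dist (x n) (x k) < e / 2" if "n \<ge> k" for n
      using diff2[of k n] N[of k] that by (simp add: k_def dist_norm)
    then show "\<exists>M. \<forall>m\<ge>M. \<forall>n\<ge>M. dist (x m) (x n) < e"
      by (meson dist_triangle_half_l)
  qed
  then obtain l where l: "x \<longlonglongrightarrow> l" using Cauchy_convergent convergent_def by blast
  have "cmod (x k - l) \<le> 2 * C / 16 ^ k" if k: "k \<ge> K" for k
  proof (rule tendsto_upperbound)
    show "(\<lambda>n. cmod (x k - x n)) \<longlonglongrightarrow> cmod (x k - l)" by (intro tendsto_intros l)
    show "\<forall>\<^sub>F n in sequentially. cmod (x k - x n) \<le> 2 * C / 16 ^ k"
      by (rule eventually_sequentiallyI[of k]) (use diff2[OF k] in \<open>simp add: norm_minus_commute\<close>)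
  qed simp
  with l show ?thesis by blast
qed

section \<open>Continuous differentiability\<close>

lemma has_laplacian_Re_poly: "has_laplacian (\<lambda>w. Re (poly P (w - p))) 0 z"
proof (rule has_laplacian_Re_holomorphic)
  show "(\<lambda>w. poly P (w - p)) holomorphic_on UNIV"
    by (intro holomorphic_intros)
qed auto

text \<open>The majorant adds \<open>(r\<^sup>2 - (cmod (z - p))\<^sup>2) / 2\<close> to the
  harmonic polynomial. Its Laplacian is - 2, strictly below the lower bound - 1 for
  \<open>v\<close>.\<close>

lemma le_Re_poly_of_visc:
  assumes "r > 0" and cv: "continuous_on (cball p r) v"
    and v: "\<And>z. z \<in> ball p r \<Longrightarrow> visc_ge v (- 1) z"
    and bd: "\<And>h. cmod h = r \<Longrightarrow> v (p + h) \<le> Re (poly P h) + m"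
    and h: "cmod h \<le> r"
  shows "v (p + h) \<le> Re (poly P h) + m + r\<^sup>2 / 2"
proof -
  define G where "G z = Re (poly P (z - p)) + (m + (1 / 2) * (r\<^sup>2 - (cmod (z - p))\<^sup>2))" for z
  have "v (p + h) \<le> G (p + h)"
  proof (rule comparison[OF \<open>r > 0\<close> cv])
    show "continuous_on (cball p r) G" unfolding G_def by (intro continuous_intros)
    show "v z \<le> G z" if "cmod (z - p) = r" for z
      using bd[OF that] that by (simp add: G_def)
    fix z
    assume "cmod (z - p) < r"
    then have "visc_ge v (- 1) z" by (intro v) (simp add: dist_norm norm_minus_commute)
    moreover have "has_laplacian G (0 + (0 + (1 / 2) * (0 - 4))) z"
      unfolding G_def
      by (intro has_laplacian_add has_laplacian_cmult has_laplacian_diff has_laplacian_const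
          has_laplacian_cmod_power2 has_laplacian_Re_poly)
    ultimately show "\<exists>\<psi> L \<mu>. has_laplacian \<psi> L z \<and> \<psi> z = G z
        \<and> (\<forall>\<^sub>F w in nhds z. G w \<le> \<psi> w) \<and> visc_ge v \<mu> z \<and> L < \<mu>"
      by (intro exI[of _ G] exI[of _ "0 + (0 + (1 / 2) * (0 - 4))"] exI[of _ "- 1"]) auto
  next
    show "p + h \<in> cball p r" using h by (simp add: dist_norm)
  qed
  also have "G (p + h) \<le> Re (poly P h) + m + r\<^sup>2 / 2"
    by (simp add: G_def)
  finally show ?thesis .
qed

lemma visc_approx_Re_poly:
  assumes "r > 0" and cv: "continuous_on (cball p r) v"
    and v: "\<And>z. z \<in> ball p r \<Longrightarrow> visc_ge v (- 1) z"
    and v': "\<And>z. z \<in> ball p r \<Longrightarrow> visc_ge (\<lambda>w. - v w) 0 z"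
  shows "\<exists>P. \<forall>h. cmod h \<le> r \<longrightarrow> \<bar>v (p + h) - Re (poly P h)\<bar> \<le> 2 * r\<^sup>2"
proof -
  have "continuous_on (sphere p r) v" by (rule continuous_on_subset[OF cv]) auto
  moreover have "r\<^sup>2 > 0" using \<open>r > 0\<close> by simp
  ultimately obtain P where P: "\<And>h. cmod h = r \<Longrightarrow> \<bar>v (p + h) - Re (poly P h)\<bar> < r\<^sup>2"
    using circle_approx[OF _ \<open>r > 0\<close>] by blast
  have "\<bar>v (p + h) - Re (poly P h)\<bar> \<le> 2 * r\<^sup>2" if h: "cmod h \<le> r" for h
  proof -
    have "v (p + h) \<le> Re (poly P h) + r\<^sup>2 + r\<^sup>2 / 2"
    proof (rule le_Re_poly_of_visc[OF \<open>r > 0\<close> cv v _ h])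
      show "v (p + h) \<le> Re (poly P h) + r\<^sup>2" if "cmod h = r" for h
        using P[OF that] by simp
    qed
    moreover have "- v (p + h) \<le> Re (poly (- P) h) + r\<^sup>2 + r\<^sup>2 / 2"
    proof (rule le_Re_poly_of_visc[OF \<open>r > 0\<close> _ _ _ h])
      show "continuous_on (cball p r) (\<lambda>w. - v w)" by (intro continuous_intros cv)
      show "visc_ge (\<lambda>w. - v w) (- 1) z" if "z \<in> ball p r" for z
        using visc_ge_mono[OF v'[OF that]] by simp
      show "- v (p + h) \<le> Re (poly (- P) h) + r\<^sup>2" if "cmod h = r" for h
        using P[OF that] by simp
    qed
    moreover have "r\<^sup>2 \<ge> 0" by simp
    ultimately show ?thesis by (simp add: abs_le_iff)
  qed
  then show ?thesis by blast
qed

text \<open>Here the approximation error stays at 2 on every scale, so that the normalised error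
  does not decay. It remains below \<open>K\<close>, because 1028 is the fixed point of the map from
  \<open>m\<close> to \<open>m / 2 + 514\<close>. The second-order coefficients then grow at most
  linearly in \<open>k\<close>, which costs the factor \<open>1 + real k\<close>, that is, a
  logarithm.\<close>

lemma visc_gradient_modulus:
  assumes "\<rho> > 0" and cv: "continuous_on (cball p \<rho>) v"
    and v: "\<And>z. z \<in> ball p \<rho> \<Longrightarrow> visc_ge v (- 1) z"
    and v': "\<And>z. z \<in> ball p \<rho> \<Longrightarrow> visc_ge (\<lambda>w. - v w) 0 z"
    and K: "\<And>z. z \<in> cball p \<rho> \<Longrightarrow> \<bar>v z\<bar> \<le> K * \<rho>\<^sup>2" and "K \<ge> 1028"
  shows "\<exists>f. cmod f \<le> 8 * (K + 2) * \<rho> \<and> (\<forall>k h. cmod h \<le> \<rho> / 16 ^ k \<longrightarrow>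
      \<bar>v (p + h) - v p - Re (f * h)\<bar> \<le> 20 * (K + 2) * (1 + real k) * (\<rho> / 16 ^ k)\<^sup>2)"
proof -
  define M where "M = rec_nat K (\<lambda>_ m. m / 2 + 257 * 2)"
  have M0: "M 0 = K" and MS: "M (Suc k) = M k / 2 + 257 * 2" for k by (simp_all add: M_def)
  have MK: "M k \<le> K" for k
    by (induction k) (use \<open>K \<ge> 1028\<close> in \<open>simp_all add: M0 MS\<close>)
  have approx: "\<exists>P. \<forall>h. cmod h \<le> \<rho> / 16 ^ k \<longrightarrow> \<bar>v (p + h) - Re (poly P h)\<bar> \<le> 2 * (\<rho> / 16 ^ k)\<^sup>2" for k
  proof (rule visc_approx_Re_poly)
    have le: "\<rho> / 16 ^ k \<le> \<rho>" using \<open>\<rho> > 0\<close> by (simp add: divide_le_eq)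
    then show "continuous_on (cball p (\<rho> / 16 ^ k)) v"
      by (intro continuous_on_subset[OF cv] subset_cball)
    show "visc_ge v (- 1) z" "visc_ge (\<lambda>w. - v w) 0 z" if "z \<in> ball p (\<rho> / 16 ^ k)" for z
      using subsetD[OF subset_ball[OF le] that] v v' by blast+
  qed (use \<open>\<rho> > 0\<close> in simp)
  have M0': "\<forall>h. cmod h \<le> \<rho> \<longrightarrow> \<bar>v (p + h)\<bar> \<le> M 0 * \<rho>\<^sup>2"
    using K by (simp add: M0 dist_norm)
  from campanato_iteration[of \<rho> "\<lambda>h. v (p + h)" "\<lambda>_. 2" M, OF \<open>\<rho> > 0\<close> approx M0' MS]
  obtain c0 c1 c2 where c: "c1 0 = 0" "c2 0 = 0"
    and qi: "\<forall>k h. cmod h \<le> \<rho> / 16 ^ k \<longrightarrow>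
       \<bar>v (p + h) - harmonic_quadratic (c0 k) (c1 k) (c2 k) h\<bar> \<le> M k * (\<rho> / 16 ^ k)\<^sup>2"
      "\<forall>k. cmod (c1 (Suc k) - c1 k) \<le> 4 * (M k + 2) * (\<rho> / 16 ^ k)"
      "\<forall>k. cmod (c2 (Suc k) - c2 k) \<le> 4 * (M k + 2)"
    by (elim exE conjE)
  note q = qi(1)[rule_format] and i1 = qi(2)[rule_format] and i2 = qi(3)[rule_format]
  define C where "C = 4 * (K + 2) * \<rho>"
  have C0: "C \<ge> 0" using \<open>K \<ge> 1028\<close> \<open>\<rho> > 0\<close> by (simp add: C_def)
  have "cmod (c1 (Suc k) - c1 k) \<le> C / 16 ^ k" for k
  proof -
    have "4 * (M k + 2) * (\<rho> / 16 ^ k) \<le> 4 * (K + 2) * (\<rho> / 16 ^ k)"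
      using MK[of k] \<open>\<rho> > 0\<close> by (intro mult_right_mono) auto
    then show ?thesis using i1[of k] by (simp add: C_def)
  qed
  then obtain f where f: "\<And>k. cmod (c1 k - f) \<le> 2 * C / 16 ^ k"
    using geometric_increments_limit[of C 0 c1, OF C0] by blast
  have c2: "cmod (c2 k) \<le> 4 * (K + 2) * real k" for k
  proof (induction k)
    case (Suc k)
    have "cmod (c2 (Suc k)) \<le> cmod (c2 (Suc k) - c2 k) + cmod (c2 k)"
      using norm_triangle_ineq[of "c2 (Suc k) - c2 k" "c2 k"] by simp
    also have "\<dots> \<le> 4 * (K + 2) + 4 * (K + 2) * real k"
      using i2[of k] MK[of k] Suc by (intro add_mono) simp_all
    finally show ?case by (simp add: algebra_simps)
  qed (use c in simp)
  show ?thesis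
  proof (intro exI[of _ f] conjI allI impI)
    show "cmod f \<le> 8 * (K + 2) * \<rho>" using f[of 0] c by (simp add: C_def algebra_simps)
    fix k h
    assume h: "cmod h \<le> \<rho> / 16 ^ k"
    define r where "r = \<rho> / 16 ^ k"
    have "r > 0" using \<open>\<rho> > 0\<close> by (simp add: r_def)
    have hr: "cmod h \<le> r" using h by (simp add: r_def)
    have Kr: "M k * r\<^sup>2 \<le> K * r\<^sup>2" using MK[of k] by (intro mult_right_mono) auto
    have t1: "\<bar>v (p + h) - harmonic_quadratic (c0 k) (c1 k) (c2 k) h\<bar> \<le> K * r\<^sup>2"
      using q[OF h] Kr by (simp add: r_def)
    have t2: "\<bar>v p - c0 k\<bar> \<le> K * r\<^sup>2"
      by (rule order_trans[OF _ Kr])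
        (use q[of 0 k] \<open>r > 0\<close> in \<open>simp add: r_def[symmetric] harmonic_quadratic_def\<close>)
    have t3: "\<bar>Re ((c1 k - f) * h)\<bar> \<le> 8 * (K + 2) * r\<^sup>2"
    proof -
      have "\<bar>Re ((c1 k - f) * h)\<bar> \<le> cmod (c1 k - f) * cmod h"
        using abs_Re_le_cmod[of "(c1 k - f) * h"] by (simp only: norm_mult)
      also have "\<dots> \<le> (2 * C / 16 ^ k) * r"
        using f[of k] hr C0 by (intro mult_mono) auto
      also have "\<dots> = 8 * (K + 2) * r\<^sup>2" by (simp add: C_def r_def power2_eq_square)
      finally show ?thesis .
    qed
    have t4: "\<bar>Re (c2 k * h\<^sup>2)\<bar> \<le> 4 * (K + 2) * real k * r\<^sup>2"
    proof -
      have "\<bar>Re (c2 k * h\<^sup>2)\<bar> \<le> cmod (c2 k) * (cmod h)\<^sup>2"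
        using abs_Re_le_cmod[of "c2 k * h\<^sup>2"] by (simp only: norm_mult norm_power)
      also have "\<dots> \<le> 4 * (K + 2) * real k * r\<^sup>2"
        using c2[of k] hr \<open>K \<ge> 1028\<close> by (intro mult_mono power_mono) auto
      finally show ?thesis .
    qed
    have "v (p + h) - v p - Re (f * h) = (v (p + h) - harmonic_quadratic (c0 k) (c1 k) (c2 k) h)
       - (v p - c0 k) + Re ((c1 k - f) * h) + Re (c2 k * h\<^sup>2)"
      by (simp add: harmonic_quadratic_def algebra_simps)
    then have "\<bar>v (p + h) - v p - Re (f * h)\<bar> \<le> K * r\<^sup>2 + K * r\<^sup>2 + 8 * (K + 2) * r\<^sup>2 + 4 * (K + 2) * real k * r\<^sup>2"
      using t1 t2 t3 t4 by linarith
    also have "\<dots> = (2 * K + 8 * (K + 2) + 4 * (K + 2) * real k) * r\<^sup>2" by (simp add: algebra_simps)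
    also have "\<dots> \<le> (20 * (K + 2) * (1 + real k)) * r\<^sup>2"
    proof (rule mult_right_mono)
      have "16 * ((K + 2) * real k) \<ge> 0" using \<open>K \<ge> 1028\<close> by simp
      then show "2 * K + 8 * (K + 2) + 4 * (K + 2) * real k \<le> 20 * (K + 2) * (1 + real k)"
        using \<open>K \<ge> 1028\<close> by (simp add: algebra_simps)
    qed simp
    finally show "\<bar>v (p + h) - v p - Re (f * h)\<bar> \<le> 20 * (K + 2) * (1 + real k) * (\<rho> / 16 ^ k)\<^sup>2"
      by (simp add: r_def)
  qed
qed

lemma real_between_powers16:
  fixes t \<rho> :: real
  assumes "0 < t" and "t \<le> \<rho>"
  obtains k where "\<rho> / 16 ^ Suc k < t" and "t \<le> \<rho> / 16 ^ k"
proof -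
  obtain n where "(1 / 16 :: real) ^ n < t / \<rho>"
    using real_arch_pow_inv[of "t / \<rho>" "1 / 16"] assms by auto
  then have n: "\<rho> / 16 ^ n < t" using assms by (simp add: power_divide field_simps)
  define m where "m = (LEAST n. \<rho> / 16 ^ n < t)"
  have m: "\<rho> / 16 ^ m < t" unfolding m_def by (rule LeastI[of _ n]) (rule n)
  then have "m \<noteq> 0" using assms by (metis div_by_1 not_less power_0)
  then obtain k where k: "m = Suc k" using not0_implies_Suc by blast
  have "\<not> \<rho> / 16 ^ k < t" using not_less_Least[of k "\<lambda>n. \<rho> / 16 ^ n < t"] k by (simp add: m_def)
  then show thesis using that[of k] m k by simp
qed

lemma linear_over_powers16_tendsto: "(\<lambda>k. (1 + real k) * (\<rho> / 16 ^ k)) \<longlonglongrightarrow> 0"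
proof -
  have 1: "(\<lambda>k. (1 / 16 :: real) ^ k) \<longlonglongrightarrow> 0" by (rule LIMSEQ_realpow_zero) auto
  have 2: "(\<lambda>k. real k * (1 / 16 :: real) ^ k) \<longlonglongrightarrow> 0"
    using powser_times_n_limit_0[of "1 / 16 :: real"] by simp
  have "(\<lambda>k. \<rho> * ((1 / 16 :: real) ^ k + real k * (1 / 16) ^ k)) \<longlonglongrightarrow> \<rho> * (0 + 0)"
    by (intro tendsto_intros 1 2)
  moreover have "(\<lambda>k. \<rho> * ((1 / 16 :: real) ^ k + real k * (1 / 16) ^ k)) = (\<lambda>k. (1 + real k) * (\<rho> / 16 ^ k))"
    by (simp add: power_divide algebra_simps add_divide_distrib)
  ultimately show ?thesis by simp
qed

lemma has_derivative_of_dyadic_modulus: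
  fixes v :: "complex \<Rightarrow> real"
  assumes "\<rho> > 0" and "C \<ge> 0"
    and v: "\<And>k h. cmod h \<le> \<rho> / 16 ^ k \<Longrightarrow> \<bar>v (p + h) - v p - Re (f * h)\<bar> \<le> C * (1 + real k) * (\<rho> / 16 ^ k)\<^sup>2"
  shows "(v has_derivative (\<lambda>h. Re (f * h))) (at p)"
  unfolding has_derivative_at_alt
proof (intro conjI allI impI)
  show "bounded_linear (\<lambda>h. Re (f * h))"
    by (intro bounded_linear_compose[OF bounded_linear_Re] bounded_linear_mult_right)
  fix e :: real
  assume "e > 0"
  \<comment> \<open>The factor 16 is the loss in passing from \<open>cmod (y - p)\<close> to the
    next radius of the geometric sequence.\<close>
  have "(\<lambda>k. 16 * C * ((1 + real k) * (\<rho> / 16 ^ k))) \<longlonglongrightarrow> 16 * C * 0"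
    by (intro tendsto_intros linear_over_powers16_tendsto)
  then have "\<forall>\<^sub>F k in sequentially. 16 * C * ((1 + real k) * (\<rho> / 16 ^ k)) < e"
    using \<open>e > 0\<close> by (intro order_tendstoD(2)) auto
  then obtain N where N: "\<And>k. k \<ge> N \<Longrightarrow> 16 * C * ((1 + real k) * (\<rho> / 16 ^ k)) < e"
    unfolding eventually_sequentially by blast
  show "\<exists>d>0. \<forall>y. norm (y - p) < d \<longrightarrow> norm (v y - v p - Re (f * (y - p))) \<le> e * norm (y - p)"
  proof (intro exI[of _ "\<rho> / 16 ^ N"] conjI allI impI)
    show "\<rho> / 16 ^ N > 0" using \<open>\<rho> > 0\<close> by simp
    fix y
    assume y: "norm (y - p) < \<rho> / 16 ^ N"
    show "norm (v y - v p - Re (f * (y - p))) \<le> e * norm (y - p)"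
    proof (cases "y = p")
      case False
      then have y0: "0 < cmod (y - p)" by simp
      have "\<rho> / 16 ^ N \<le> \<rho>" using \<open>\<rho> > 0\<close> by (simp add: divide_le_eq)
      then have "cmod (y - p) \<le> \<rho>" using y by linarith
      with y0 obtain k where k: "\<rho> / 16 ^ Suc k < cmod (y - p)" "cmod (y - p) \<le> \<rho> / 16 ^ k"
        by (rule real_between_powers16)
      have "k \<ge> N"
      proof (rule ccontr)
        assume "\<not> N \<le> k"
        then have "(16::real) ^ Suc k \<le> 16 ^ N" by (intro power_increasing) auto
        then have "\<rho> / 16 ^ N \<le> \<rho> / 16 ^ Suc k" using \<open>\<rho> > 0\<close> by (intro divide_left_mono) auto
        then show False using k(1) y by linarith
      qed
      define r where "r = \<rho> / 16 ^ k"
      have "r > 0" using \<open>\<rho> > 0\<close> by (simp add: r_def)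
      have "\<bar>v (p + (y - p)) - v p - Re (f * (y - p))\<bar> \<le> C * (1 + real k) * r\<^sup>2"
        unfolding r_def by (rule v[OF k(2)])
      also have "\<dots> = C * ((1 + real k) * r) * r" by (simp add: power2_eq_square)
      also have "\<dots> \<le> C * ((1 + real k) * r) * (16 * cmod (y - p))"
      proof (rule mult_left_mono)
        show "r \<le> 16 * cmod (y - p)" using k(1) by (simp add: r_def)
        show "0 \<le> C * ((1 + real k) * r)" using \<open>C \<ge> 0\<close> \<open>r > 0\<close> by simp
      qed
      also have "\<dots> = 16 * C * ((1 + real k) * r) * cmod (y - p)" by simp
      also have "\<dots> \<le> e * cmod (y - p)"
        using N[OF \<open>k \<ge> N\<close>] by (intro mult_right_mono) (auto simp: r_def)
      finally show ?thesis by simp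
    qed simp
  qed
qed

lemma gradient_unique:
  assumes "(v has_derivative (\<lambda>h. Re (f * h))) (at p)" and "(v has_derivative (\<lambda>h. Re (g * h))) (at p)"
  shows "f = g"
proof -
  have "(\<lambda>h. Re (f * h)) = (\<lambda>h. Re (g * h))" by (rule has_derivative_unique[OF assms])
  then have "Re (f * 1) = Re (g * 1)" "Re (f * \<i>) = Re (g * \<i>)" by meson+
  then show ?thesis by (simp add: complex_eq_iff)
qed

text \<open>A scale-invariant interior gradient estimate. It is meant for \<open>v\<close> minus a
  harmonic quadratic, on discs whose radius is comparable to the distance from the origin.\<close>

lemma visc_gradient_bound:
  assumes "\<rho> > 0" and "continuous_on (cball p \<rho>) v"
    and "\<And>z. z \<in> ball p \<rho> \<Longrightarrow> visc_ge v (- 1) z"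
    and "\<And>z. z \<in> ball p \<rho> \<Longrightarrow> visc_ge (\<lambda>w. - v w) 0 z"
    and "\<And>z. z \<in> cball p \<rho> \<Longrightarrow> \<bar>v z\<bar> \<le> K * \<rho>\<^sup>2" and "K \<ge> 1028"
    and f: "(v has_derivative (\<lambda>h. Re (f * h))) (at p)"
  shows "cmod f \<le> 8 * (K + 2) * \<rho>"
proof -
  obtain g where g: "cmod g \<le> 8 * (K + 2) * \<rho>" "\<And>k h. cmod h \<le> \<rho> / 16 ^ k \<Longrightarrow>
      \<bar>v (p + h) - v p - Re (g * h)\<bar> \<le> 20 * (K + 2) * (1 + real k) * (\<rho> / 16 ^ k)\<^sup>2"
    using visc_gradient_modulus[OF assms(1-6)] by blast
  have "(v has_derivative (\<lambda>h. Re (g * h))) (at p)"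
  proof (rule has_derivative_of_dyadic_modulus[OF \<open>\<rho> > 0\<close> _ g(2)])
    show "0 \<le> 20 * (K + 2)" using \<open>K \<ge> 1028\<close> by simp
  qed
  then have "f = g" by (rule gradient_unique[OF f])
  then show ?thesis using g(1) by (simp only:)
qed

text \<open>Two affine approximations are compared at a common point \<open>q + h\<close>. Three
  errors enter, and for \<open>h\<close> in the direction of \<open>cnj (g - f)\<close> with length
  \<open>r / 2\<close> the product \<open>(g - f) * h\<close> is
  \<open>r / 2 * cmod (g - f)\<close>.\<close>

lemma gradient_difference_of_modulus:
  fixes v :: "complex \<Rightarrow> real"
  assumes p: "\<And>h. cmod h \<le> r \<Longrightarrow> \<bar>v (p + h) - v p - Re (f * h)\<bar> \<le> E"
    and q: "\<And>h. cmod h \<le> r \<Longrightarrow> \<bar>v (q + h) - v q - Re (g * h)\<bar> \<le> E"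
    and "cmod (q - p) \<le> r / 2" and "r > 0"
  shows "cmod (g - f) \<le> 6 * E / r"
proof (cases "g = f")
  case True
  have "E \<ge> 0" using p[of 0] \<open>r > 0\<close> by simp
  then show ?thesis using True \<open>r > 0\<close> by simp
next
  case False
  define h where "h = of_real (r / 2) * (cnj (g - f) / of_real (cmod (g - f)))"
  have h: "cmod h = r / 2" using False \<open>r > 0\<close> by (simp add: h_def norm_mult norm_divide del: complex_cnj_diff)
  have "cmod (q - p + h) \<le> r" using norm_triangle_ineq[of "q - p" h] h assms(3) by simp
  from p[OF this] have 1: "\<bar>v (q + h) - v p - Re (f * (q - p + h))\<bar> \<le> E" by (simp add: algebra_simps)
  have 2: "\<bar>v q - v p - Re (f * (q - p))\<bar> \<le> E" using p[of "q - p"] assms(3,4) by simp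
  have 3: "\<bar>v (q + h) - v q - Re (g * h)\<bar> \<le> E" using q[of h] h assms(4) by simp
  have "Re ((g - f) * h) = - (v (q + h) - v q - Re (g * h)) + (v (q + h) - v p - Re (f * (q - p + h)))
      - (v q - v p - Re (f * (q - p)))"
    by (simp add: algebra_simps)
  then have "Re ((g - f) * h) \<le> 3 * E" using 1 2 3 by linarith
  moreover have "(g - f) * h = of_real (r / 2 * cmod (g - f))"
  proof -
    have "(g - f) * cnj (g - f) = of_real (cmod (g - f) * cmod (g - f))"
      by (simp only: complex_norm_square[symmetric] power2_eq_square[symmetric] of_real_power)
    moreover have "(g - f) * h = of_real (r / 2) * ((g - f) * cnj (g - f) / of_real (cmod (g - f)))"
      by (simp add: h_def mult_ac del: complex_cnj_diff)
    ultimately have "(g - f) * h = of_real (r / 2) * (of_real (cmod (g - f) * cmod (g - f)) / of_real (cmod (g - f)))"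
      by (simp only:)
    then show ?thesis using False by simp
  qed
  ultimately have "r / 2 * cmod (g - f) \<le> 3 * E" by (simp only: Re_complex_of_real)
  then show ?thesis using \<open>r > 0\<close> by (simp add: field_simps)
qed

lemma visc_continuous_gradient:
  assumes "open S" and cv: "continuous_on S v"
    and v: "\<And>z. z \<in> S \<Longrightarrow> visc_ge v (- 1) z"
    and v': "\<And>z. z \<in> S \<Longrightarrow> visc_ge (\<lambda>w. - v w) 0 z"
  obtains f where "continuous_on S f" and "\<And>z. z \<in> S \<Longrightarrow> (v has_derivative (\<lambda>h. Re (f z * h))) (at z)"
proof -
  define f where "f z = (SOME c. (v has_derivative (\<lambda>h. Re (c * h))) (at z))" for z
  \<comment> \<open>One radius and one constant serve all base points near \<open>p0\<close>; this
    uniformity is what makes the gradient continuous.\<close>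
  have local: "\<exists>\<rho> C. \<rho> > 0 \<and> C \<ge> 0 \<and> (\<forall>p\<in>cball p0 \<rho>. (v has_derivative (\<lambda>h. Re (f p * h))) (at p) \<and>
      (\<forall>k h. cmod h \<le> \<rho> / 16 ^ k \<longrightarrow> \<bar>v (p + h) - v p - Re (f p * h)\<bar> \<le> C * (1 + real k) * (\<rho> / 16 ^ k)\<^sup>2))"
    if "p0 \<in> S" for p0
  proof -
    obtain R where R: "R > 0" "cball p0 R \<subseteq> S" using \<open>open S\<close> \<open>p0 \<in> S\<close> open_contains_cball by blast
    define \<rho> where "\<rho> = R / 2"
    have "\<rho> > 0" using R by (simp add: \<rho>_def)
    have "bounded (v ` cball p0 R)"
      by (intro compact_imp_bounded compact_continuous_image continuous_on_subset[OF cv R(2)] compact_cball)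
    then obtain B where B: "\<And>z. z \<in> cball p0 R \<Longrightarrow> \<bar>v z\<bar> \<le> B"
      unfolding bounded_iff by (auto simp del: mem_cball)
    define K where "K = max 1028 (B / \<rho>\<^sup>2)"
    have BK: "B \<le> K * \<rho>\<^sup>2"
      using \<open>\<rho> > 0\<close> by (simp add: K_def flip: pos_divide_le_eq)
    show ?thesis
    proof (rule exI[of _ \<rho>], rule exI[of _ "20 * (K + 2)"], intro conjI ballI)
      show "\<rho> > 0" by fact
      show "0 \<le> 20 * (K + 2)" by (simp add: K_def)
      fix p
      assume "p \<in> cball p0 \<rho>"
      then have sub: "cball p \<rho> \<subseteq> cball p0 R"
        by (simp add: \<rho>_def cball_subset_cball_iff dist_commute)
      have bsub: "ball p \<rho> \<subseteq> S" using sub R(2) ball_subset_cball by blast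
      have 1: "continuous_on (cball p \<rho>) v"
        by (rule continuous_on_subset[OF cv order_trans[OF sub R(2)]])
      have 2: "visc_ge v (- 1) z" "visc_ge (\<lambda>w. - v w) 0 z" if "z \<in> ball p \<rho>" for z
        using subsetD[OF bsub that] v v' by blast+
      have 3: "\<bar>v z\<bar> \<le> K * \<rho>\<^sup>2" if "z \<in> cball p \<rho>" for z
        using order_trans[OF B[OF subsetD[OF sub that]] BK] .
      have 4: "1028 \<le> K" by (simp add: K_def)
      obtain g where g: "\<And>k h. cmod h \<le> \<rho> / 16 ^ k \<Longrightarrow>
          \<bar>v (p + h) - v p - Re (g * h)\<bar> \<le> 20 * (K + 2) * (1 + real k) * (\<rho> / 16 ^ k)\<^sup>2"
        using visc_gradient_modulus[OF \<open>\<rho> > 0\<close> 1 2 3 4] by blast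
      have D: "(v has_derivative (\<lambda>h. Re (g * h))) (at p)"
        by (rule has_derivative_of_dyadic_modulus[OF \<open>\<rho> > 0\<close> _ g]) (auto simp: K_def)
      then show D': "(v has_derivative (\<lambda>h. Re (f p * h))) (at p)" unfolding f_def by (rule someI)
      have "f p = g" by (rule gradient_unique[OF D' D])
      then show "\<forall>k h. cmod h \<le> \<rho> / 16 ^ k \<longrightarrow>
          \<bar>v (p + h) - v p - Re (f p * h)\<bar> \<le> 20 * (K + 2) * (1 + real k) * (\<rho> / 16 ^ k)\<^sup>2"
        using g by blast
    qed
  qed
  have "isCont f p" if "p \<in> S" for p
  proof -
    obtain \<rho> C where rc: "\<rho> > 0" "C \<ge> 0" and *: "\<And>q k h. q \<in> cball p \<rho> \<Longrightarrow> cmod h \<le> \<rho> / 16 ^ k \<Longrightarrow>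
        \<bar>v (q + h) - v q - Re (f q * h)\<bar> \<le> C * (1 + real k) * (\<rho> / 16 ^ k)\<^sup>2"
      using local[OF \<open>p \<in> S\<close>] by blast
    show ?thesis
      unfolding continuous_at_eps_delta
    proof (intro allI impI)
      fix e :: real
      assume "e > 0"
      have "(\<lambda>k. 6 * C * ((1 + real k) * (\<rho> / 16 ^ k))) \<longlonglongrightarrow> 6 * C * 0"
        by (intro tendsto_intros linear_over_powers16_tendsto)
      then have "\<forall>\<^sub>F k in sequentially. 6 * C * ((1 + real k) * (\<rho> / 16 ^ k)) < e"
        using \<open>e > 0\<close> by (intro order_tendstoD(2)) auto
      then obtain k where k: "6 * C * ((1 + real k) * (\<rho> / 16 ^ k)) < e"
        unfolding eventually_sequentially by blast
      define r where "r = \<rho> / 16 ^ k"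
      have r: "r > 0" "r \<le> \<rho>" using rc by (simp_all add: r_def divide_le_eq)
      have "dist (f q) (f p) < e" if "dist q p < r / 2" for q
      proof -
        have "q \<in> cball p \<rho>" using that r by (simp add: dist_commute)
        have "cmod (f q - f p) \<le> 6 * (C * (1 + real k) * r\<^sup>2) / r"
        proof (rule gradient_difference_of_modulus[where v = v and p = p and q = q])
          show "\<bar>v (p + h) - v p - Re (f p * h)\<bar> \<le> C * (1 + real k) * r\<^sup>2" if "cmod h \<le> r" for h
            using *[of p h k] that rc by (simp add: r_def)
          show "\<bar>v (q + h) - v q - Re (f q * h)\<bar> \<le> C * (1 + real k) * r\<^sup>2" if "cmod h \<le> r" for h
            using *[of q h k] that \<open>q \<in> cball p \<rho>\<close> by (simp add: r_def)
        qed (use that r in \<open>simp_all add: dist_norm\<close>)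
        also have "\<dots> = 6 * C * ((1 + real k) * r)" using r by (simp add: power2_eq_square)
        also have "\<dots> < e" using k by (simp add: r_def)
        finally show ?thesis by (simp add: dist_norm)
      qed
      then show "\<exists>d>0. \<forall>x'. dist x' p < d \<longrightarrow> dist (f x') (f p) < e"
        using r by (intro exI[of _ "r / 2"]) auto
    qed
  qed
  then have "continuous_on S f" by (simp add: continuous_at_imp_continuous_on)
  moreover have "(v has_derivative (\<lambda>h. Re (f z * h))) (at z)" if "z \<in> S" for z
    using local[OF that] by (auto simp: less_imp_le)
  ultimately show thesis by (rule that)
qed

section \<open>Comparison with model solutions\<close>

text \<open>\<open>v \<le> w + Re P\<close> up to \<open>O(\<epsilon> r\<^sup>2)\<close>, where the Laplacians of \<open>v\<close> and \<open>w\<close> compare except on two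
  strips of width \<open>\<epsilon> r\<close>; the strip barriers absorb the bounded error there.\<close>

lemma le_add_Re_poly_off_strips:
  assumes "0 < r" and "0 < \<epsilon>" "\<epsilon> \<le> 1" and e: "cmod e1 = 1" "cmod e2 = 1"
    and cv: "continuous_on (cball 0 r) v" and cw: "continuous_on (cball 0 r) w"
    and bd: "\<And>h. cmod h = r \<Longrightarrow> v h - w h \<le> Re (poly P h) + \<epsilon> * r\<^sup>2"
    and int: "\<And>z. cmod z < r \<Longrightarrow> z \<noteq> 0 \<Longrightarrow>
      \<exists>\<psi> K \<mu>. has_laplacian \<psi> K z \<and> \<psi> z = w z \<and> (\<forall>\<^sub>F y in nhds z. w y \<le> \<psi> y) \<and> visc_ge v \<mu> z \<and>
        (K \<le> \<mu> \<or> K \<le> \<mu> + 5 \<and> (\<bar>Im (e1 * z)\<bar> \<le> \<epsilon> * r \<or> \<bar>Im (e2 * z)\<bar> \<le> \<epsilon> * r))"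
    and h: "cmod h \<le> r"
  shows "v h - w h \<le> Re (poly P h) + 74 * \<epsilon> * r\<^sup>2"
proof -
  define d where "d = \<epsilon> * r"
  have "d > 0" using assms by (simp add: d_def)
  define lb where "lb t = d ^ 3 / sqrt (d\<^sup>2 + t\<^sup>2) ^ 3" for t
  have lb0: "lb t \<ge> 0" for t using \<open>d > 0\<close> by (simp add: lb_def)
  have lb1: "lb t \<ge> 1 / 3" if "\<bar>t\<bar> \<le> d" for t
    unfolding lb_def by (rule strip_barrier_laplacian_ge[OF \<open>d > 0\<close> that])
  \<comment> \<open>On a strip the Laplacian of \<open>b\<close> is at least 18/3 = 6, which
    outweighs the admissible defect 5. Each of the two barriers is at most
    \<open>2 * \<epsilon> * r\<^sup>2\<close>, whence the bound with 72.\<close>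
  define b where "b z = 18 * (strip_barrier d (Im (e1 * z)) + strip_barrier d (Im (e2 * z)))" for z
  have b: "0 \<le> b z" "b z \<le> 72 * \<epsilon> * r\<^sup>2" if "cmod z \<le> r" for z
  proof -
    have i: "\<bar>Im (e1 * z)\<bar> \<le> r" "\<bar>Im (e2 * z)\<bar> \<le> r"
      using abs_Im_le_cmod[of "e1 * z"] abs_Im_le_cmod[of "e2 * z"] that e by (simp_all add: norm_mult)
    note B = strip_barrier_bounds[OF \<open>d > 0\<close> i(1)] strip_barrier_bounds[OF \<open>d > 0\<close> i(2)]
    show "0 \<le> b z" using B by (simp add: b_def)
    have "d \<le> r" using assms by (simp add: d_def)
    then have "d * (d + r) \<le> d * (r + r)" using \<open>d > 0\<close> by (intro mult_left_mono) auto
    also have "\<dots> = 2 * \<epsilon> * r\<^sup>2" by (simp add: d_def power2_eq_square)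
    finally have "d * (d + r) \<le> 2 * \<epsilon> * r\<^sup>2" .
    then show "b z \<le> 72 * \<epsilon> * r\<^sup>2" using B by (simp add: b_def)
  qed
  \<comment> \<open>Besides the 72 for \<open>b\<close>, one unit of
    \<open>\<epsilon> * r\<^sup>2\<close> covers the boundary error and one the last term, whose
    Laplacian makes the inequality strict also off the strips.\<close>
  define g where "g z = Re (poly P (z - 0)) + (74 * \<epsilon> * r\<^sup>2 - b z - \<epsilon> * (cmod (z - 0))\<^sup>2)" for z
  have lap_g: "has_laplacian g (0 + (0 - 18 * (lb (Im (e1 * z)) + lb (Im (e2 * z))) - \<epsilon> * 4)) z" for z
    unfolding g_def b_def lb_def
    by (intro has_laplacian_add has_laplacian_diff has_laplacian_cmult has_laplacian_const
        has_laplacian_cmod_power2 has_laplacian_Re_poly has_laplacian_strip_barrier e \<open>d > 0\<close>)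
  have "v h \<le> w h + g h"
  proof (rule comparison[OF \<open>0 < r\<close> cv])
    show "continuous_on (cball 0 r) (\<lambda>z. w z + g z)"
      unfolding g_def b_def strip_barrier_def by (intro continuous_intros cw)
    show "v z \<le> w z + g z" if "cmod (z - 0) = r" for z
      using bd[of z] b[of z] that by (simp add: g_def)
    show "h \<in> cball 0 r" using h by simp
    fix z
    assume z: "cmod (z - 0) < r" "z \<noteq> 0"
    then obtain \<psi> K \<mu> where \<psi>: "has_laplacian \<psi> K z" "\<psi> z = w z" "\<forall>\<^sub>F y in nhds z. w y \<le> \<psi> y" "visc_ge v \<mu> z"
      and K: "K \<le> \<mu> \<or> K \<le> \<mu> + 5 \<and> (\<bar>Im (e1 * z)\<bar> \<le> d \<or> \<bar>Im (e2 * z)\<bar> \<le> d)"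
      using int[of z] unfolding d_def by auto
    let ?L = "K + (0 + (0 - 18 * (lb (Im (e1 * z)) + lb (Im (e2 * z))) - \<epsilon> * 4))"
    have "has_laplacian (\<lambda>y. \<psi> y + g y) ?L z"
      by (intro has_laplacian_add[OF \<psi>(1) lap_g])
    moreover have "\<forall>\<^sub>F y in nhds z. w y + g y \<le> \<psi> y + g y"
      using \<psi>(3) by eventually_elim simp
    moreover have "?L < \<mu>"
      using K lb0[of "Im (e1 * z)"] lb0[of "Im (e2 * z)"] lb1[of "Im (e1 * z)"] lb1[of "Im (e2 * z)"] \<open>0 < \<epsilon>\<close>
      by auto
    ultimately show "\<exists>\<psi> L \<mu>. has_laplacian \<psi> L z \<and> \<psi> z = w z + g z \<and>
        (\<forall>\<^sub>F y in nhds z. w y + g y \<le> \<psi> y) \<and> visc_ge v \<mu> z \<and> L < \<mu>"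
      using \<psi>(2,4) by (intro exI[of _ "\<lambda>y. \<psi> y + g y"] exI[of _ ?L] exI[of _ \<mu>]) auto
  qed
  moreover have "g h \<le> Re (poly P h) + 74 * \<epsilon> * r\<^sup>2"
  proof -
    have "0 \<le> \<epsilon> * (cmod h)\<^sup>2" using \<open>0 < \<epsilon>\<close> by simp
    then show ?thesis using b(1)[OF h] unfolding g_def diff_0_right by linarith
  qed
  ultimately show ?thesis by linarith
qed

definition on_cross :: "real \<Rightarrow> complex \<Rightarrow> bool" where
  "on_cross \<theta> z \<longleftrightarrow> Im (cis (- \<theta>) * z) = 0 \<or> Im (cis \<theta> * z) = 0"

text \<open>\<open>w\<close> solves \<open>\<Delta>w = - s\<close> off the cross; on the cross it is squeezed between smooth functions.\<close>

definition cross_model :: "real \<Rightarrow> real \<Rightarrow> (complex \<Rightarrow> real) \<Rightarrow> (complex \<Rightarrow> real) \<Rightarrow> bool" where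
  "cross_model \<theta> N w s \<longleftrightarrow> (\<forall>z. z \<noteq> 0 \<longrightarrow>
     (\<exists>\<psi> K. has_laplacian \<psi> K z \<and> \<psi> z = w z \<and> (\<forall>\<^sub>F y in nhds z. w y \<le> \<psi> y) \<and> K \<le> 0 \<and>
        (\<not> on_cross \<theta> z \<longrightarrow> K = - s z)) \<and>
     (\<exists>\<psi> K. has_laplacian \<psi> K z \<and> \<psi> z = w z \<and> (\<forall>\<^sub>F y in nhds z. \<psi> y \<le> w y) \<and> - N \<le> K \<and>
        (\<not> on_cross \<theta> z \<longrightarrow> K = - s z)))"

lemma cross_model_add:
  assumes "cross_model \<theta> N w s" and "cross_model \<theta> N' w' s'"
  shows "cross_model \<theta> (N + N') (\<lambda>z. w z + w' z) (\<lambda>z. s z + s' z)"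
  unfolding cross_model_def
proof (intro allI impI conjI)
  fix z :: complex
  assume "z \<noteq> 0"
  from assms(1)[unfolded cross_model_def, rule_format, OF this]
  obtain \<psi> K \<phi> L where 1: "has_laplacian \<psi> K z" "\<psi> z = w z" "\<forall>\<^sub>F y in nhds z. w y \<le> \<psi> y" "K \<le> 0"
      "\<not> on_cross \<theta> z \<Longrightarrow> K = - s z"
      "has_laplacian \<phi> L z" "\<phi> z = w z" "\<forall>\<^sub>F y in nhds z. \<phi> y \<le> w y" "- N \<le> L"
      "\<not> on_cross \<theta> z \<Longrightarrow> L = - s z"
    by blast
  from assms(2)[unfolded cross_model_def, rule_format, OF \<open>z \<noteq> 0\<close>]
  obtain \<psi>' K' \<phi>' L' where 2: "has_laplacian \<psi>' K' z" "\<psi>' z = w' z" "\<forall>\<^sub>F y in nhds z. w' y \<le> \<psi>' y" "K' \<le> 0"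
      "\<not> on_cross \<theta> z \<Longrightarrow> K' = - s' z"
      "has_laplacian \<phi>' L' z" "\<phi>' z = w' z" "\<forall>\<^sub>F y in nhds z. \<phi>' y \<le> w' y" "- N' \<le> L'"
      "\<not> on_cross \<theta> z \<Longrightarrow> L' = - s' z"
    by blast
  have "\<forall>\<^sub>F y in nhds z. w y + w' y \<le> \<psi> y + \<psi>' y"
    using 1(3) 2(3) by eventually_elim simp
  then show "\<exists>\<psi> K. has_laplacian \<psi> K z \<and> \<psi> z = w z + w' z \<and> (\<forall>\<^sub>F y in nhds z. w y + w' y \<le> \<psi> y) \<and> K \<le> 0 \<and>
        (\<not> on_cross \<theta> z \<longrightarrow> K = - (s z + s' z))"
    using has_laplacian_add[OF 1(1) 2(1)] 1(2,4,5) 2(2,4,5)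
    by (intro exI[of _ "\<lambda>y. \<psi> y + \<psi>' y"] exI[of _ "K + K'"]) auto
  have "\<forall>\<^sub>F y in nhds z. \<phi> y + \<phi>' y \<le> w y + w' y"
    using 1(8) 2(8) by eventually_elim simp
  then show "\<exists>\<psi> K. has_laplacian \<psi> K z \<and> \<psi> z = w z + w' z \<and> (\<forall>\<^sub>F y in nhds z. \<psi> y \<le> w y + w' y) \<and> - (N + N') \<le> K \<and>
        (\<not> on_cross \<theta> z \<longrightarrow> K = - (s z + s' z))"
    using has_laplacian_add[OF 1(6) 2(6)] 1(7,9,10) 2(7,9,10)
    by (intro exI[of _ "\<lambda>y. \<phi> y + \<phi>' y"] exI[of _ "L + L'"]) auto
qed

lemma cross_model_mono:
  assumes "cross_model \<theta> N w s" and "N \<le> N'"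
  shows "cross_model \<theta> N' w s"
  using assms unfolding cross_model_def by (meson neg_le_iff_le order_trans)

text \<open>Off the strips the Laplacians of \<open>v\<close> and \<open>w\<close> agree. On them
  only the bounds between - 1 and 0 for \<open>v\<close> and between - 4 and 0 for the test
  functions of \<open>w\<close> are available, so that a defect of 5 suffices in both one-sided
  comparisons.\<close>

lemma cross_model_approx:
  assumes r: "0 < r" and \<epsilon>: "0 < \<epsilon>" "\<epsilon> \<le> 1"
    and cv: "continuous_on (cball 0 r) v" and cw: "continuous_on (cball 0 r) w"
    and w: "cross_model \<theta> 4 w s"
    and v: "\<And>z. cmod z < r \<Longrightarrow> visc_ge v (- 1) z" "\<And>z. cmod z < r \<Longrightarrow> visc_ge (\<lambda>w. - v w) 0 z"
    and off: "\<And>z. cmod z < r \<Longrightarrow> \<epsilon> * r < \<bar>Im (cis (- \<theta>) * z)\<bar> \<Longrightarrow> \<epsilon> * r < \<bar>Im (cis \<theta> * z)\<bar> \<Longrightarrow>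
      visc_ge v (- s z) z \<and> visc_ge (\<lambda>w. - v w) (s z) z"
  shows "\<exists>P. \<forall>h. cmod h \<le> r \<longrightarrow> \<bar>(v h - w h) - Re (poly P h)\<bar> \<le> 74 * \<epsilon> * r\<^sup>2"
proof -
  have "continuous_on (sphere 0 r) (\<lambda>h. v h - w h)"
    by (intro continuous_on_diff continuous_on_subset[OF cv] continuous_on_subset[OF cw]) auto
  moreover have "0 < \<epsilon> * r\<^sup>2" using r \<epsilon> by simp
  ultimately obtain P where "\<forall>h. cmod h = r \<longrightarrow> \<bar>(v (0 + h) - w (0 + h)) - Re (poly P h)\<bar> < \<epsilon> * r\<^sup>2"
    using circle_approx[OF _ r] by blast
  then have P: "\<bar>v h - w h - Re (poly P h)\<bar> < \<epsilon> * r\<^sup>2" if "cmod h = r" for h using that by simp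
  have strips: "\<bar>Im (cis (- \<theta>) * z)\<bar> \<le> \<epsilon> * r \<or> \<bar>Im (cis \<theta> * z)\<bar> \<le> \<epsilon> * r \<or>
      (\<not> on_cross \<theta> z \<and> \<epsilon> * r < \<bar>Im (cis (- \<theta>) * z)\<bar> \<and> \<epsilon> * r < \<bar>Im (cis \<theta> * z)\<bar>)" for z
    using mult_pos_pos[OF \<epsilon>(1) r] by (auto simp: on_cross_def not_le simp del: times_complex.sel)
  have "\<bar>(v h - w h) - Re (poly P h)\<bar> \<le> 74 * \<epsilon> * r\<^sup>2" if h: "cmod h \<le> r" for h
  proof -
    have "v h - w h \<le> Re (poly P h) + 74 * \<epsilon> * r\<^sup>2"
    proof (rule le_add_Re_poly_off_strips[OF r \<epsilon> _ _ cv cw _ _ h, where ?e1.0 = "cis (- \<theta>)" and ?e2.0 = "cis \<theta>"])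
      show "v h - w h \<le> Re (poly P h) + \<epsilon> * r\<^sup>2" if "cmod h = r" for h
        using P[OF that] by linarith
      fix z :: complex
      assume z: "cmod z < r" "z \<noteq> 0"
      from w[unfolded cross_model_def, rule_format, OF z(2)]
      obtain \<psi> K where \<psi>: "has_laplacian \<psi> K z" "\<psi> z = w z" "\<forall>\<^sub>F y in nhds z. w y \<le> \<psi> y" "K \<le> 0"
        and K: "\<not> on_cross \<theta> z \<Longrightarrow> K = - s z" by blast
      show "\<exists>\<psi> K \<mu>. has_laplacian \<psi> K z \<and> \<psi> z = w z \<and> (\<forall>\<^sub>F y in nhds z. w y \<le> \<psi> y) \<and> visc_ge v \<mu> z \<and>
        (K \<le> \<mu> \<or> K \<le> \<mu> + 5 \<and> (\<bar>Im (cis (- \<theta>) * z)\<bar> \<le> \<epsilon> * r \<or> \<bar>Im (cis \<theta> * z)\<bar> \<le> \<epsilon> * r))"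
      proof (cases "\<bar>Im (cis (- \<theta>) * z)\<bar> \<le> \<epsilon> * r \<or> \<bar>Im (cis \<theta> * z)\<bar> \<le> \<epsilon> * r")
        case True
        moreover have "K \<le> - 1 + 5" using \<psi>(4) by simp
        ultimately show ?thesis using \<psi>(1-3) v(1)[OF z(1)] by blast
      next
        case False
        then show ?thesis using strips[of z] \<psi>(1-3) off[of z] z(1) K by (metis order_refl)
      qed
    qed simp_all
    moreover have "- v h - - w h \<le> Re (poly (- P) h) + 74 * \<epsilon> * r\<^sup>2"
    proof (rule le_add_Re_poly_off_strips[OF r \<epsilon> _ _ _ _ _ _ h, where ?e1.0 = "cis (- \<theta>)" and ?e2.0 = "cis \<theta>"])
      show "- v h - - w h \<le> Re (poly (- P) h) + \<epsilon> * r\<^sup>2" if "cmod h = r" for h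
        using P[OF that] by simp
      show "continuous_on (cball 0 r) (\<lambda>h. - v h)" "continuous_on (cball 0 r) (\<lambda>h. - w h)"
        by (intro continuous_intros cv cw)+
      fix z :: complex
      assume z: "cmod z < r" "z \<noteq> 0"
      from w[unfolded cross_model_def, rule_format, OF z(2)]
      obtain \<psi> K where \<psi>: "has_laplacian \<psi> K z" "\<psi> z = w z" "\<forall>\<^sub>F y in nhds z. \<psi> y \<le> w y" "- 4 \<le> K"
        and K: "\<not> on_cross \<theta> z \<Longrightarrow> K = - s z" by blast
      have n: "has_laplacian (\<lambda>y. - \<psi> y) (- K) z" "- \<psi> z = - w z" "\<forall>\<^sub>F y in nhds z. - w y \<le> - \<psi> y"
        using has_laplacian_uminus[OF \<psi>(1)] \<psi>(2,3) by simp_all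
      show "\<exists>\<psi> K \<mu>. has_laplacian \<psi> K z \<and> \<psi> z = - w z \<and> (\<forall>\<^sub>F y in nhds z. - w y \<le> \<psi> y) \<and> visc_ge (\<lambda>y. - v y) \<mu> z \<and>
        (K \<le> \<mu> \<or> K \<le> \<mu> + 5 \<and> (\<bar>Im (cis (- \<theta>) * z)\<bar> \<le> \<epsilon> * r \<or> \<bar>Im (cis \<theta> * z)\<bar> \<le> \<epsilon> * r))"
      proof (cases "\<bar>Im (cis (- \<theta>) * z)\<bar> \<le> \<epsilon> * r \<or> \<bar>Im (cis \<theta> * z)\<bar> \<le> \<epsilon> * r")
        case True
        moreover have "- K \<le> 0 + 5" using \<psi>(4) by simp
        ultimately show ?thesis using n v(2)[OF z(1)]
          by (intro exI[of _ "\<lambda>y. - \<psi> y"] exI[of _ "- K"] exI[of _ 0]) blast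
      next
        case False
        then have "visc_ge (\<lambda>w. - v w) (s z) z" "- K = s z"
          using strips[of z] off[of z] z(1) K by auto
        then show ?thesis using n
          by (intro exI[of _ "\<lambda>y. - \<psi> y"] exI[of _ "- K"] exI[of _ "s z"]) simp
      qed
    qed simp_all
    ultimately show ?thesis by (simp add: abs_le_iff)
  qed
  then show ?thesis by blast
qed

section \<open>Vanishing errors and the expansion at the origin\<close>

lemma halving_recursion_tendsto_0:
  fixes x y :: "nat \<Rightarrow> real"
  assumes rec: "\<And>k. x (Suc k) = x k / 2 + y k" and y: "y \<longlonglongrightarrow> 0"
  shows "x \<longlonglongrightarrow> 0"
proof (rule LIMSEQ_I)
  fix e :: real
  assume "e > 0"
  then obtain N where N: "\<And>k. k \<ge> N \<Longrightarrow> \<bar>y k\<bar> < e / 4"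
    using LIMSEQ_D[OF y, of "e / 4"] by auto
  have bound: "\<bar>x (N + j)\<bar> \<le> \<bar>x N\<bar> * (1 / 2) ^ j + e / 2" for j
  proof (induction j)
    case 0
    then show ?case using \<open>e > 0\<close> by simp
  next
    case (Suc j)
    have "\<bar>x (N + Suc j)\<bar> \<le> \<bar>x (N + j)\<bar> / 2 + \<bar>y (N + j)\<bar>" using rec[of "N + j"] by simp
    also have "\<dots> \<le> (\<bar>x N\<bar> * (1 / 2) ^ j + e / 2) / 2 + e / 4"
      using Suc N[of "N + j"] by (intro add_mono divide_right_mono) auto
    also have "\<dots> = \<bar>x N\<bar> * (1 / 2) ^ Suc j + e / 2" by (simp add: field_simps)
    finally show ?case .
  qed
  have "(\<lambda>j. \<bar>x N\<bar> * (1 / 2) ^ j) \<longlonglongrightarrow> \<bar>x N\<bar> * 0"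
    by (intro tendsto_intros LIMSEQ_realpow_zero) auto
  then obtain J where J: "\<And>j. j \<ge> J \<Longrightarrow> \<bar>x N\<bar> * (1 / 2) ^ j < e / 2"
    using LIMSEQ_D[of _ "\<bar>x N\<bar> * 0" "e / 2"] \<open>e > 0\<close> by fastforce
  have "norm (x n - 0) < e" if "n \<ge> N + J" for n
  proof -
    have "J \<le> n - N" "N + (n - N) = n" using that by simp_all
    then show ?thesis using bound[of "n - N"] J[of "n - N"] by simp
  qed
  then show "\<exists>no. \<forall>n\<ge>no. norm (x n - 0) < e" by blast
qed

text \<open>A diagonal choice: each fixed error is admissible from some stage on, so the infimum of
  the admissible errors tends to zero. The summand \<open>1 / (k + 1)\<close> is added because the
  infimum need not be admissible.\<close>

lemma vanishing_errors_choice: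
  fixes Q :: "nat \<Rightarrow> real \<Rightarrow> bool"
  assumes Q1: "\<And>k. Q k 1" and mono: "\<And>k e e'. Q k e \<Longrightarrow> e \<le> e' \<Longrightarrow> Q k e'"
    and ev: "\<And>e. 0 < e \<Longrightarrow> e \<le> 1 \<Longrightarrow> \<forall>\<^sub>F k in sequentially. Q k e"
  shows "\<exists>\<delta>. \<delta> \<longlonglongrightarrow> 0 \<and> (\<forall>k. 0 \<le> \<delta> k \<and> Q k (\<delta> k))"
proof -
  define X where "X k = {e. 0 < e \<and> Q k e}" for k
  define \<delta> where "\<delta> k = Inf (X k) + inverse (real (Suc k))" for k
  have ne: "X k \<noteq> {}" for k using Q1[of k] by (auto simp: X_def intro!: exI[of _ 1])
  have bb: "bdd_below (X k)" for k by (rule bdd_belowI[of _ 0]) (simp add: X_def)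
  have ge: "Inf (X k) \<ge> 0" for k by (rule cInf_greatest[OF ne]) (simp add: X_def)
  have "Q k (\<delta> k)" for k
  proof -
    have "Inf (X k) < \<delta> k" by (simp add: \<delta>_def)
    then obtain e where "e \<in> X k" "e < \<delta> k" using cInf_lessD[OF ne] by blast
    then show ?thesis using mono[of k e "\<delta> k"] by (simp add: X_def)
  qed
  moreover have "\<delta> \<longlonglongrightarrow> 0"
  proof (rule LIMSEQ_I)
    fix r :: real
    assume "r > 0"
    define e where "e = min (r / 2) 1"
    have "0 < e" "e \<le> 1" "e \<le> r / 2" using \<open>r > 0\<close> by (auto simp: e_def)
    have "\<forall>\<^sub>F k in sequentially. inverse (real (Suc k)) < r / 2"
      using LIMSEQ_inverse_real_of_nat \<open>r > 0\<close> by (intro order_tendstoD(2)) auto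
    with ev[OF \<open>0 < e\<close> \<open>e \<le> 1\<close>] have "\<forall>\<^sub>F k in sequentially. norm (\<delta> k - 0) < r"
    proof eventually_elim
      case (elim k)
      have "Inf (X k) \<le> e" using elim \<open>0 < e\<close> by (intro cInf_lower bb) (simp add: X_def)
      then show ?case using elim ge[of k] \<open>e \<le> r / 2\<close> by (simp add: \<delta>_def)
    qed
    then show "\<exists>no. \<forall>n\<ge>no. norm (\<delta> n - 0) < r" by (simp add: eventually_sequentially)
  qed
  moreover have "0 \<le> \<delta> k" for k using ge[of k] by (simp add: \<delta>_def)
  ultimately show ?thesis by blast
qed

lemma bounded_increments_linear_growth:
  fixes x :: "nat \<Rightarrow> complex"
  assumes "x 0 = 0" and "\<And>k. cmod (x (Suc k) - x k) \<le> B"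
  shows "cmod (x k) \<le> B * (1 + real k)"
proof (induction k)
  case 0
  then show ?case using assms(1) order_trans[OF norm_ge_zero assms(2)[of 0]] by simp
next
  case (Suc k)
  have "cmod (x (Suc k)) \<le> cmod (x (Suc k) - x k) + cmod (x k)"
    using norm_triangle_ineq[of "x (Suc k) - x k" "x k"] by simp
  also have "\<dots> \<le> B + B * (1 + real k)" by (intro add_mono assms Suc)
  finally show ?case by (simp add: algebra_simps)
qed

text \<open>With vanishing approximation errors the normalised errors \<open>M k\<close> and the
  increments of the quadratic coefficients vanish too. Value and gradient of \<open>g\<close> at 0
  are zero, which makes the constant and linear terms negligible on each scale; only the quadratic
  remains.\<close>

lemma harmonic_expansion_at_0:
  fixes g :: "complex \<Rightarrow> real"
  assumes "\<rho> > 0" and cg: "continuous_on (cball 0 \<rho>) g" and g0: "g 0 = 0"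
    and dg: "(g has_derivative (\<lambda>_. 0)) (at 0)"
    and \<delta>: "\<delta> \<longlonglongrightarrow> 0"
    and P: "\<And>k. \<exists>P. \<forall>h. cmod h \<le> \<rho> / 16 ^ k \<longrightarrow> \<bar>g h - Re (poly P h)\<bar> \<le> \<delta> k * (\<rho> / 16 ^ k)\<^sup>2"
  shows "\<exists>e m. m \<longlonglongrightarrow> 0 \<and> (\<lambda>k. e (Suc k) - e k) \<longlonglongrightarrow> 0 \<and>
    (\<forall>k h. cmod h \<le> \<rho> / 16 ^ k \<longrightarrow> \<bar>g h - Re (e k * h\<^sup>2)\<bar> \<le> m k * (\<rho> / 16 ^ k)\<^sup>2)"
proof -
  define r where "r k = \<rho> / 16 ^ k" for k :: nat
  have r0: "r k > 0" for k using \<open>\<rho> > 0\<close> by (simp add: r_def)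
  have r_lim: "r \<longlonglongrightarrow> 0"
    using tendsto_mult[OF tendsto_const[of \<rho>] LIMSEQ_realpow_zero[of "1 / 16"]]
    by (simp add: r_def[abs_def] power_divide)
  have "bounded (g ` cball 0 \<rho>)"
    by (intro compact_imp_bounded compact_continuous_image cg compact_cball)
  then obtain B where B: "\<And>h. h \<in> cball 0 \<rho> \<Longrightarrow> \<bar>g h\<bar> \<le> B"
    unfolding bounded_iff by (auto simp del: mem_cball mem_cball_0)
  define M where "M = rec_nat (B / \<rho>\<^sup>2) (\<lambda>k m. m / 2 + 257 * \<delta> k)"
  have M0: "M 0 = B / \<rho>\<^sup>2" and MS: "M (Suc k) = M k / 2 + 257 * \<delta> k" for k by (simp_all add: M_def)
  have "(\<lambda>k. 257 * \<delta> k) \<longlonglongrightarrow> 0" using tendsto_mult[OF tendsto_const \<delta>, of 257] by simp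
  then have M_lim: "M \<longlonglongrightarrow> 0" by (rule halving_recursion_tendsto_0[of M, OF MS])
  have Mb: "\<forall>h. cmod h \<le> \<rho> \<longrightarrow> \<bar>g h\<bar> \<le> M 0 * \<rho>\<^sup>2"
    using B \<open>\<rho> > 0\<close> by (simp add: M0)
  from campanato_iteration[of \<rho> g \<delta> M, OF \<open>\<rho> > 0\<close> P Mb MS]
  obtain c0 c1 c2 where c: "c1 0 = 0" "c2 0 = 0"
    and qi: "\<forall>k h. cmod h \<le> \<rho> / 16 ^ k \<longrightarrow>
       \<bar>g h - harmonic_quadratic (c0 k) (c1 k) (c2 k) h\<bar> \<le> M k * (\<rho> / 16 ^ k)\<^sup>2"
      "\<forall>k. cmod (c1 (Suc k) - c1 k) \<le> 4 * (M k + \<delta> k) * (\<rho> / 16 ^ k)"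
      "\<forall>k. cmod (c2 (Suc k) - c2 k) \<le> 4 * (M k + \<delta> k)"
    by (elim exE conjE)
  have q: "\<bar>g h - harmonic_quadratic (c0 k) (c1 k) (c2 k) h\<bar> \<le> M k * (r k)\<^sup>2" if "cmod h \<le> r k" for k h
    using qi(1) that by (simp add: r_def)
  have i1: "cmod (c1 (Suc k) - c1 k) \<le> 4 * (M k + \<delta> k) * r k" for k using qi(2) by (simp add: r_def)
  have i2: "cmod (c2 (Suc k) - c2 k) \<le> 4 * (M k + \<delta> k)" for k using qi(3) by blast
  have inc_lim: "(\<lambda>k. 4 * (M k + \<delta> k)) \<longlonglongrightarrow> 0"
    using tendsto_mult[OF tendsto_const tendsto_add[OF M_lim \<delta>], of 4] by simp
  obtain D where D: "\<And>k. 4 * (M k + \<delta> k) \<le> D"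
    using convergent_imp_Bseq[OF convergentI[OF inc_lim]] unfolding Bseq_def by (auto simp: abs_le_iff)
  have c2: "cmod (c2 k) \<le> D * (1 + real k)" for k
    by (rule bounded_increments_linear_growth[of c2, OF c(2)]) (rule order_trans[OF i2 D])
  have c0: "\<bar>c0 k\<bar> \<le> M k * (r k)\<^sup>2" for k
    using q[of 0 k] r0[of k] by (simp add: harmonic_quadratic_def g0)
  \<comment> \<open>The polynomial is tested in the direction where \<open>c1 k * h\<close> is real
    and positive. The quadratic term is harmless there, since \<open>c2 k\<close> is O(k) and
    \<open>k * r k\<close> tends to zero.\<close>
  have c1_lim: "c1 \<longlonglongrightarrow> 0"
  proof (rule LIMSEQ_I)
    fix e :: real
    assume "e > 0"
    then have "e / 2 > 0" by simp
    then obtain d where d: "d > 0" "\<And>y. cmod y < d \<Longrightarrow> \<bar>g y\<bar> \<le> e / 2 * cmod y"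
      using dg unfolding has_derivative_at_alt by (fastforce simp: g0)
    have "(\<lambda>k. 2 * M k * r k + D * ((1 + real k) * r k)) \<longlonglongrightarrow> 2 * 0 * 0 + D * 0"
      unfolding r_def by (intro tendsto_intros M_lim r_lim[unfolded r_def] linear_over_powers16_tendsto)
    then have "\<forall>\<^sub>F k in sequentially. 2 * M k * r k + D * ((1 + real k) * r k) < e / 2"
      using \<open>e > 0\<close> by (intro order_tendstoD(2)) auto
    moreover have "\<forall>\<^sub>F k in sequentially. r k < d"
      using r_lim d(1) by (rule order_tendstoD(2))
    ultimately have "\<forall>\<^sub>F k in sequentially. norm (c1 k - 0) < e"
    proof eventually_elim
      case (elim k)
      show ?case
      proof (cases "c1 k = 0")
        case False
        define h where "h = of_real (r k) * (cnj (c1 k) / of_real (cmod (c1 k)))"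
        have h: "cmod h = r k" using False r0[of k] by (simp add: h_def norm_mult norm_divide)
        have "c1 k * cnj (c1 k) = of_real (cmod (c1 k) * cmod (c1 k))"
          by (simp only: complex_norm_square[symmetric] power2_eq_square[symmetric] of_real_power)
        moreover have "c1 k * h = of_real (r k) * (c1 k * cnj (c1 k) / of_real (cmod (c1 k)))"
          by (simp add: h_def mult_ac)
        ultimately have "c1 k * h = of_real (r k * cmod (c1 k))" using False by simp
        then have ch: "Re (c1 k * h) = r k * cmod (c1 k)" by (simp only: Re_complex_of_real)
        have "\<bar>Re (c2 k * h\<^sup>2)\<bar> \<le> cmod (c2 k) * (r k)\<^sup>2"
          using abs_Re_le_cmod[of "c2 k * h\<^sup>2"] by (simp only: norm_mult norm_power h)
        also have "\<dots> \<le> D * (1 + real k) * (r k)\<^sup>2" using c2[of k] by (intro mult_right_mono) auto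
        finally have t: "\<bar>Re (c2 k * h\<^sup>2)\<bar> \<le> D * (1 + real k) * (r k)\<^sup>2" .
        have "\<bar>g h\<bar> \<le> e / 2 * r k" using d(2)[of h] elim(2) h by simp
        moreover have "\<bar>g h - (c0 k + (Re (c1 k * h) + Re (c2 k * h\<^sup>2)))\<bar> \<le> M k * (r k)\<^sup>2"
          using q[of h k] h by (simp only: harmonic_quadratic_def plus_complex.sel order_refl)
        ultimately have "r k * cmod (c1 k) \<le> e / 2 * r k + 2 * (M k * (r k)\<^sup>2) + D * (1 + real k) * (r k)\<^sup>2"
          using t c0[of k] unfolding ch by linarith
        also have "\<dots> = r k * (e / 2 + (2 * M k * r k + D * ((1 + real k) * r k)))"
          by (simp add: power2_eq_square algebra_simps)
        also have "\<dots> < r k * e" using elim(1) r0[of k] by (intro mult_strict_left_mono) auto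
        finally show ?thesis using r0[of k] by simp
      qed (use \<open>e > 0\<close> in simp)
    qed
    then show "\<exists>no. \<forall>n\<ge>no. norm (c1 n - 0) < e" by (simp add: eventually_sequentially)
  qed
  \<comment> \<open>Convergence to zero is not enough, as \<open>c1 k\<close> must be small compared
    with \<open>r k\<close>. Summing the increments from \<open>k\<close> to infinity gives this,
    their factor in front of \<open>r k\<close> being as small as desired.\<close>
  have c1_small: "(\<lambda>k. cmod (c1 k) / r k) \<longlonglongrightarrow> 0"
  proof (rule LIMSEQ_I)
    fix e :: real
    assume "e > 0"
    have "\<forall>\<^sub>F k in sequentially. 4 * (M k + \<delta> k) < e / 4"
      using inc_lim \<open>e > 0\<close> by (intro order_tendstoD(2)) auto
    then obtain N where N: "\<And>k. k \<ge> N \<Longrightarrow> 4 * (M k + \<delta> k) < e / 4"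
      unfolding eventually_sequentially by blast
    have "cmod (c1 (Suc k) - c1 k) \<le> (e / 4 * \<rho>) / 16 ^ k" if "k \<ge> N" for k
    proof -
      have "4 * (M k + \<delta> k) * r k \<le> e / 4 * r k" using N[OF that] r0[of k] by (intro mult_right_mono) auto
      then show ?thesis using i1[of k] by (simp add: r_def)
    qed
    moreover have "0 \<le> e / 4 * \<rho>" using \<open>e > 0\<close> \<open>\<rho> > 0\<close> by simp
    ultimately obtain l where l: "c1 \<longlonglongrightarrow> l" "\<And>k. k \<ge> N \<Longrightarrow> cmod (c1 k - l) \<le> 2 * (e / 4 * \<rho>) / 16 ^ k"
      using geometric_increments_limit[of "e / 4 * \<rho>" N c1] by blast
    have "l = 0" by (rule LIMSEQ_unique[OF l(1) c1_lim])
    have "norm (cmod (c1 k) / r k - 0) < e" if "k \<ge> N" for k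
    proof -
      have "cmod (c1 k) \<le> e / 2 * r k" using l(2)[OF that] by (simp add: \<open>l = 0\<close> r_def mult.commute)
      then have "cmod (c1 k) / r k \<le> e / 2" using r0[of k] by (simp add: divide_le_eq)
      moreover have "0 \<le> cmod (c1 k) / r k" using r0[of k] by simp
      ultimately show ?thesis using \<open>e > 0\<close> unfolding real_norm_def by linarith
    qed
    then show "\<exists>no. \<forall>n\<ge>no. norm (cmod (c1 n) / r n - 0) < e" by blast
  qed
  define m where "m k = 2 * M k + cmod (c1 k) / r k" for k
  have "m \<longlonglongrightarrow> 2 * 0 + 0" unfolding m_def by (intro tendsto_intros M_lim c1_small)
  moreover have "(\<lambda>k. c2 (Suc k) - c2 k) \<longlonglongrightarrow> 0"
    by (rule Lim_null_comparison[OF always_eventually[OF allI[OF i2]] inc_lim])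
  moreover have "\<bar>g h - Re (c2 k * h\<^sup>2)\<bar> \<le> m k * (\<rho> / 16 ^ k)\<^sup>2" if "cmod h \<le> \<rho> / 16 ^ k" for k h
  proof -
    have h: "cmod h \<le> r k" using that by (simp add: r_def)
    have "\<bar>Re (c1 k * h)\<bar> \<le> cmod (c1 k) * cmod h"
      using abs_Re_le_cmod[of "c1 k * h"] by (simp only: norm_mult)
    also have "\<dots> \<le> cmod (c1 k) * r k" using h by (intro mult_left_mono) auto
    also have "\<dots> = cmod (c1 k) / r k * (r k)\<^sup>2" using r0[of k] by (simp add: power2_eq_square)
    finally have "\<bar>Re (c1 k * h)\<bar> \<le> cmod (c1 k) / r k * (r k)\<^sup>2" .
    moreover have "\<bar>g h - (c0 k + (Re (c1 k * h) + Re (c2 k * h\<^sup>2)))\<bar> \<le> M k * (r k)\<^sup>2"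
      using q[OF h] by (simp only: harmonic_quadratic_def plus_complex.sel)
    ultimately have "\<bar>g h - Re (c2 k * h\<^sup>2)\<bar> \<le> 2 * (M k * (r k)\<^sup>2) + cmod (c1 k) / r k * (r k)\<^sup>2"
      using c0[of k] by linarith
    also have "\<dots> = m k * (\<rho> / 16 ^ k)\<^sup>2" by (simp add: m_def r_def[symmetric] algebra_simps)
    finally show ?thesis .
  qed
  ultimately show ?thesis by (intro exI[of _ c2] exI[of _ m]) simp
qed

section \<open>Explicit solutions in sectors\<close>

lemma has_laplacian_rotate:
  assumes "has_laplacian f L (\<omega> * z)" and "cmod \<omega> = 1"
  shows "has_laplacian (\<lambda>w. f (\<omega> * w)) L z"
proof -
  obtain b c where f: "\<And>\<epsilon>. \<epsilon> > 0 \<Longrightarrow> \<forall>\<^sub>F h in nhds 0.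
     \<bar>f (\<omega> * z + h) - (f (\<omega> * z) + Re (b * h) + Re (c * h\<^sup>2) + L / 4 * (cmod h)\<^sup>2)\<bar> \<le> \<epsilon> * (cmod h)\<^sup>2"
    using assms unfolding has_laplacian_def by blast
  have lim: "filterlim (\<lambda>h. \<omega> * h) (nhds (\<omega> * 0)) (nhds 0)"
    by (intro tendsto_intros filterlim_ident)
  show ?thesis
  proof (rule has_laplacianI[where b = "b * \<omega>" and c = "c * \<omega>\<^sup>2"])
    fix \<epsilon> :: real
    assume "\<epsilon> > 0"
    have "\<forall>\<^sub>F h in nhds 0. \<bar>f (\<omega> * z + \<omega> * h) - (f (\<omega> * z) + Re (b * (\<omega> * h))
       + Re (c * (\<omega> * h)\<^sup>2) + L / 4 * (cmod (\<omega> * h))\<^sup>2)\<bar> \<le> \<epsilon> * (cmod (\<omega> * h))\<^sup>2"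
      using eventually_compose_filterlim[OF f[OF \<open>\<epsilon> > 0\<close>] lim[unfolded mult_zero_right]] .
    then show "\<forall>\<^sub>F h in nhds 0. \<bar>f (\<omega> * (z + h)) - (f (\<omega> * z) + Re (b * \<omega> * h) + Re (c * \<omega>\<^sup>2 * h\<^sup>2)
       + L / 4 * (cmod h)\<^sup>2)\<bar> \<le> \<epsilon> * (cmod h)\<^sup>2"
      by (simp only: norm_mult assms(2) mult_1 distrib_left power_mult_distrib mult.assoc)
  qed
qed

lemma has_laplacian_imp_isCont:
  assumes "has_laplacian f L z"
  shows "isCont f z"
proof -
  obtain b c where f: "\<And>\<epsilon>. \<epsilon> > 0 \<Longrightarrow> \<forall>\<^sub>F h in nhds 0.
     \<bar>f (z + h) - (f z + Re (b * h) + Re (c * h\<^sup>2) + L / 4 * (cmod h)\<^sup>2)\<bar> \<le> \<epsilon> * (cmod h)\<^sup>2"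
    using assms unfolding has_laplacian_def by blast
  define g where "g h = Re (b * h) + Re (c * h\<^sup>2) + L / 4 * (cmod h)\<^sup>2" for h
  have ev: "\<forall>\<^sub>F h in nhds 0. norm (f (z + h) - f z - g h) \<le> (cmod h)\<^sup>2"
    using f[of 1] by (simp add: g_def algebra_simps)
  have "((\<lambda>h. (cmod h)\<^sup>2) \<longlongrightarrow> (cmod 0)\<^sup>2) (nhds (0::complex))"
    by (intro tendsto_intros filterlim_ident)
  then have "((\<lambda>h. (cmod h)\<^sup>2) \<longlongrightarrow> 0) (nhds (0::complex))"
    by simp
  with ev have 1: "((\<lambda>h. f (z + h) - f z - g h) \<longlongrightarrow> 0) (nhds 0)"
    by (rule Lim_null_comparison)
  have "(g \<longlongrightarrow> Re (b * 0) + Re (c * 0\<^sup>2) + L / 4 * (cmod 0)\<^sup>2) (nhds 0)"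
    unfolding g_def by (intro tendsto_intros filterlim_ident)
  from tendsto_add[OF tendsto_add[OF 1 this] tendsto_const[of "f z"]]
  have "((\<lambda>h. f (z + h)) \<longlongrightarrow> f z) (nhds 0)" by simp
  then have "((\<lambda>h. f (z + h)) \<longlongrightarrow> f z) (at 0)"
    by (rule tendsto_mono[rotated]) (simp add: at_within_def)
  then show ?thesis by (simp add: isCont_iff)
qed

lemma cross_model_imp_isCont:
  assumes "cross_model \<theta> N w s" and "z \<noteq> 0"
  shows "isCont w z"
proof -
  from assms(1)[unfolded cross_model_def, rule_format, OF \<open>z \<noteq> 0\<close>]
  obtain \<psi> K \<phi> L where 1: "has_laplacian \<psi> K z" "\<psi> z = w z" "\<forall>\<^sub>F y in nhds z. w y \<le> \<psi> y"
      "has_laplacian \<phi> L z" "\<phi> z = w z" "\<forall>\<^sub>F y in nhds z. \<phi> y \<le> w y"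
    by blast
  have l: "(\<psi> \<longlongrightarrow> w z) (at z)" "(\<phi> \<longlongrightarrow> w z) (at z)"
    using has_laplacian_imp_isCont[OF 1(1)] has_laplacian_imp_isCont[OF 1(4)] 1(2,5)
    by (simp_all add: isCont_def)
  have "\<forall>\<^sub>F y in at z. \<phi> y \<le> w y" "\<forall>\<^sub>F y in at z. w y \<le> \<psi> y"
    using 1(3,6) by (simp_all add: eventually_nhds_conv_at)
  from tendsto_sandwich[OF this l(2) l(1)] show ?thesis unfolding isCont_def .
qed

lemma cross_model_rotate:
  assumes w: "cross_model \<theta> N w s" and \<omega>: "cmod \<omega> = 1"
    and cr: "\<And>z. on_cross \<theta>' z \<longleftrightarrow> on_cross \<theta> (\<omega> * z)"
  shows "cross_model \<theta>' N (\<lambda>z. w (\<omega> * z)) (\<lambda>z. s (\<omega> * z))"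
  unfolding cross_model_def
proof (intro allI impI)
  fix z :: complex
  assume "z \<noteq> 0"
  then have "\<omega> * z \<noteq> 0" using \<omega> by auto
  from w[unfolded cross_model_def, rule_format, OF this]
  obtain \<psi> K \<phi> L where 1: "has_laplacian \<psi> K (\<omega> * z)" "\<psi> (\<omega> * z) = w (\<omega> * z)" "\<forall>\<^sub>F y in nhds (\<omega> * z). w y \<le> \<psi> y" "K \<le> 0"
      "\<not> on_cross \<theta> (\<omega> * z) \<longrightarrow> K = - s (\<omega> * z)"
      "has_laplacian \<phi> L (\<omega> * z)" "\<phi> (\<omega> * z) = w (\<omega> * z)" "\<forall>\<^sub>F y in nhds (\<omega> * z). \<phi> y \<le> w y" "- N \<le> L"
      "\<not> on_cross \<theta> (\<omega> * z) \<longrightarrow> L = - s (\<omega> * z)"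
    by blast
  have lim: "filterlim (\<lambda>h. \<omega> * h) (nhds (\<omega> * z)) (nhds z)"
    by (intro tendsto_intros filterlim_ident)
  have "\<forall>\<^sub>F y in nhds z. w (\<omega> * y) \<le> \<psi> (\<omega> * y)" "\<forall>\<^sub>F y in nhds z. \<phi> (\<omega> * y) \<le> w (\<omega> * y)"
    using eventually_compose_filterlim[OF 1(3) lim] eventually_compose_filterlim[OF 1(8) lim] .
  then show "(\<exists>\<psi> K. has_laplacian \<psi> K z \<and> \<psi> z = w (\<omega> * z) \<and> (\<forall>\<^sub>F y in nhds z. w (\<omega> * y) \<le> \<psi> y) \<and> K \<le> 0 \<and>
        (\<not> on_cross \<theta>' z \<longrightarrow> K = - s (\<omega> * z))) \<and>
     (\<exists>\<psi> K. has_laplacian \<psi> K z \<and> \<psi> z = w (\<omega> * z) \<and> (\<forall>\<^sub>F y in nhds z. \<psi> y \<le> w (\<omega> * y)) \<and> - N \<le> K \<and>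
        (\<not> on_cross \<theta>' z \<longrightarrow> K = - s (\<omega> * z)))"
    using 1 has_laplacian_rotate[OF 1(1) \<omega>] has_laplacian_rotate[OF 1(6) \<omega>] unfolding cr by blast
qed

lemma cross_modelI_smooth:
  assumes "\<And>z. has_laplacian w (- s z) z" and "\<And>z. 0 \<le> s z" "\<And>z. s z \<le> N"
  shows "cross_model \<theta> N w s"
  unfolding cross_model_def using assms by fastforce

lemma Im_power2_eq: "(Im k)\<^sup>2 = ((cmod k)\<^sup>2 - Re (k\<^sup>2)) / 2"
  unfolding cmod_power2 by (simp add: power2_eq_square)

lemma has_laplacian_Im_power2:
  assumes "cmod e = 1"
  shows "has_laplacian (\<lambda>w. (Im (e * w))\<^sup>2) 2 z"
proof -
  have "has_laplacian (\<lambda>w. (1 / 2) * ((cmod (w - 0))\<^sup>2 - Re ((e * w)\<^sup>2))) ((1 / 2) * (4 - 0)) z"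
    by (intro has_laplacian_cmult has_laplacian_diff has_laplacian_cmod_power2
        has_laplacian_Re_holomorphic[where S = UNIV]) (auto intro!: holomorphic_intros)
  moreover have "(1 / 2) * ((cmod (w - 0))\<^sup>2 - Re ((e * w)\<^sup>2)) = (Im (e * w))\<^sup>2" for w
    unfolding Im_power2_eq[of "e * w"] by (simp add: norm_mult assms)
  ultimately show ?thesis by simp
qed

lemma cross_model_half_plane:
  assumes e: "cmod e = 1" and cr: "\<And>z. Im (e * z) = 0 \<Longrightarrow> on_cross \<theta> z"
  shows "cross_model \<theta> 1 (\<lambda>z. - (1 / 2) * (max 0 (Im (e * z)))\<^sup>2) (\<lambda>z. of_bool (0 < Im (e * z)))"
  unfolding cross_model_def
proof (intro allI impI)
  fix z :: complex
  define f where "f y = - (1 / 2) * (Im (e * y))\<^sup>2" for y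
  define w where "w y = - (1 / 2) * (max 0 (Im (e * y)))\<^sup>2" for y
  have "has_laplacian f (- (1 / 2) * 2) z"
    unfolding f_def by (intro has_laplacian_cmult has_laplacian_Im_power2 e)
  then have f: "has_laplacian f (- 1) z" by simp
  have g: "has_laplacian (\<lambda>_. 0) 0 z" by (rule has_laplacian_const)
  have w: "f y \<le> w y" "w y \<le> 0" for y
    by (auto simp: f_def w_def max_def)
  have cont: "continuous_on UNIV (\<lambda>y. Im (e * y))" by (intro continuous_intros)
  consider "Im (e * z) > 0" | "Im (e * z) < 0" | "Im (e * z) = 0" by linarith
  then show "(\<exists>\<psi> K. has_laplacian \<psi> K z \<and> \<psi> z = - (1 / 2) * (max 0 (Im (e * z)))\<^sup>2 \<and>
        (\<forall>\<^sub>F y in nhds z. - (1 / 2) * (max 0 (Im (e * y)))\<^sup>2 \<le> \<psi> y) \<and> K \<le> 0 \<and>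
        (\<not> on_cross \<theta> z \<longrightarrow> K = - of_bool (0 < Im (e * z)))) \<and>
     (\<exists>\<psi> K. has_laplacian \<psi> K z \<and> \<psi> z = - (1 / 2) * (max 0 (Im (e * z)))\<^sup>2 \<and>
        (\<forall>\<^sub>F y in nhds z. \<psi> y \<le> - (1 / 2) * (max 0 (Im (e * y)))\<^sup>2) \<and> - 1 \<le> K \<and>
        (\<not> on_cross \<theta> z \<longrightarrow> K = - of_bool (0 < Im (e * z))))"
    unfolding w_def[symmetric]
  proof cases
    case 1
    have "open {y. 0 < Im (e * y)}" by (intro open_Collect_less continuous_intros)
    then have "\<forall>\<^sub>F y in nhds z. 0 < Im (e * y)" using 1 eventually_nhds_in_open by fastforce
    then have "\<forall>\<^sub>F y in nhds z. w y \<le> f y" by eventually_elim (simp add: f_def w_def max_def)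
    moreover have "f z = w z" using 1 by (simp add: f_def w_def max_def)
    ultimately show "(\<exists>\<psi> K. has_laplacian \<psi> K z \<and> \<psi> z = w z \<and> (\<forall>\<^sub>F y in nhds z. w y \<le> \<psi> y) \<and> K \<le> 0 \<and>
        (\<not> on_cross \<theta> z \<longrightarrow> K = - of_bool (0 < Im (e * z)))) \<and>
     (\<exists>\<psi> K. has_laplacian \<psi> K z \<and> \<psi> z = w z \<and> (\<forall>\<^sub>F y in nhds z. \<psi> y \<le> w y) \<and> - 1 \<le> K \<and>
        (\<not> on_cross \<theta> z \<longrightarrow> K = - of_bool (0 < Im (e * z))))"
      using f w 1 by (intro conjI exI[of _ f] exI[of _ "- 1"]) auto
  next
    case 2
    have "open {y. Im (e * y) < 0}" by (intro open_Collect_less continuous_intros)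
    then have "\<forall>\<^sub>F y in nhds z. Im (e * y) < 0" using 2 eventually_nhds_in_open by fastforce
    then have "\<forall>\<^sub>F y in nhds z. 0 \<le> w y" by eventually_elim (simp add: w_def max_def)
    moreover have "w z = 0" using 2 by (simp add: w_def max_def)
    ultimately show "(\<exists>\<psi> K. has_laplacian \<psi> K z \<and> \<psi> z = w z \<and> (\<forall>\<^sub>F y in nhds z. w y \<le> \<psi> y) \<and> K \<le> 0 \<and>
        (\<not> on_cross \<theta> z \<longrightarrow> K = - of_bool (0 < Im (e * z)))) \<and>
     (\<exists>\<psi> K. has_laplacian \<psi> K z \<and> \<psi> z = w z \<and> (\<forall>\<^sub>F y in nhds z. \<psi> y \<le> w y) \<and> - 1 \<le> K \<and>
        (\<not> on_cross \<theta> z \<longrightarrow> K = - of_bool (0 < Im (e * z))))"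
      using g w 2 by (intro conjI exI[of _ "\<lambda>_. 0"] exI[of _ 0]) auto
  next
    case 3
    then have "w z = 0" "f z = 0" by (auto simp: w_def f_def)
    then show "(\<exists>\<psi> K. has_laplacian \<psi> K z \<and> \<psi> z = w z \<and> (\<forall>\<^sub>F y in nhds z. w y \<le> \<psi> y) \<and> K \<le> 0 \<and>
        (\<not> on_cross \<theta> z \<longrightarrow> K = - of_bool (0 < Im (e * z)))) \<and>
     (\<exists>\<psi> K. has_laplacian \<psi> K z \<and> \<psi> z = w z \<and> (\<forall>\<^sub>F y in nhds z. \<psi> y \<le> w y) \<and> - 1 \<le> K \<and>
        (\<not> on_cross \<theta> z \<longrightarrow> K = - of_bool (0 < Im (e * z))))"
      using f g w cr[OF 3]
      by (intro conjI) (rule exI[of _ "\<lambda>_. 0"], rule exI[of _ 0], simp,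
          rule exI[of _ f], rule exI[of _ "- 1"], simp)
  qed
qed

text \<open>The coefficient of the logarithm is the one for which the two branches match to first order along both rays:
  there they differ by half the squared distance to the ray.\<close>

definition sector_inner :: "real \<Rightarrow> complex \<Rightarrow> real" where
  "sector_inner \<theta> z = - sin (2 * \<theta>) / (4 * pi) * Re (z\<^sup>2 * Ln z) + (- (1 / 4) * (cmod z)\<^sup>2 + cos (2 * \<theta>) / 4 * Re (z\<^sup>2))"

text \<open>The argument \<open>- z\<close> puts the branch cut on the positive real axis, inside
  the sector where the other branch is used.\<close>

definition sector_outer :: "real \<Rightarrow> complex \<Rightarrow> real" where
  "sector_outer \<theta> z = - sin (2 * \<theta>) / (4 * pi) * Re (z\<^sup>2 * Ln (- z))"

definition sector_solution :: "real \<Rightarrow> complex \<Rightarrow> real" where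
  "sector_solution \<theta> z =
     (if Im (cis (- \<theta>) * z) < 0 \<and> 0 < Im (cis \<theta> * z) then sector_inner \<theta> z else sector_outer \<theta> z)"

text \<open>In the upper half plane the logarithms of \<open>z\<close> and \<open>- z\<close> differ
  by a constant, so the difference of the branches is a quadratic form.\<close>

lemma sector_inner_eq_upper:
  assumes "Im z > 0"
  shows "sector_inner \<theta> z = sector_outer \<theta> z - (1 / 2) * (Im (cis (- \<theta>) * z))\<^sup>2"
proof -
  have Ln: "Ln (- z) = Ln z - \<i> * pi" using assms by (subst Ln_minus) auto
  have 1: "Re (z\<^sup>2 * Ln z) - Re (z\<^sup>2 * Ln (- z)) = - pi * Im (z\<^sup>2)"
    unfolding Ln by (simp add: algebra_simps)
  have 2: "(Im (cis (- \<theta>) * z))\<^sup>2 = ((cmod z)\<^sup>2 - (cos (2 * \<theta>) * Re (z\<^sup>2) + sin (2 * \<theta>) * Im (z\<^sup>2))) / 2"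
    unfolding Im_power2_eq by (simp add: norm_mult power_mult_distrib Complex.DeMoivre)
  have "sector_inner \<theta> z - sector_outer \<theta> z = - sin (2 * \<theta>) / (4 * pi) * (Re (z\<^sup>2 * Ln z) - Re (z\<^sup>2 * Ln (- z)))
      + (- (1 / 4) * (cmod z)\<^sup>2 + cos (2 * \<theta>) / 4 * Re (z\<^sup>2))"
    unfolding sector_inner_def sector_outer_def by (simp only: right_diff_distrib)
  also have "\<dots> = - (1 / 2) * (Im (cis (- \<theta>) * z))\<^sup>2"
    unfolding 1 2 by (simp add: field_simps)
  finally show ?thesis by simp
qed

lemma sector_inner_eq_lower:
  assumes "Im z < 0"
  shows "sector_inner \<theta> z = sector_outer \<theta> z - (1 / 2) * (Im (cis \<theta> * z))\<^sup>2"
proof -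
  have Ln: "Ln (- z) = Ln z + \<i> * pi" using assms by (subst Ln_minus) auto
  have 1: "Re (z\<^sup>2 * Ln z) - Re (z\<^sup>2 * Ln (- z)) = pi * Im (z\<^sup>2)"
    unfolding Ln by (simp add: algebra_simps)
  have 2: "(Im (cis \<theta> * z))\<^sup>2 = ((cmod z)\<^sup>2 - (cos (2 * \<theta>) * Re (z\<^sup>2) - sin (2 * \<theta>) * Im (z\<^sup>2))) / 2"
    unfolding Im_power2_eq by (simp add: norm_mult power_mult_distrib Complex.DeMoivre)
  have "sector_inner \<theta> z - sector_outer \<theta> z = - sin (2 * \<theta>) / (4 * pi) * (Re (z\<^sup>2 * Ln z) - Re (z\<^sup>2 * Ln (- z)))
      + (- (1 / 4) * (cmod z)\<^sup>2 + cos (2 * \<theta>) / 4 * Re (z\<^sup>2))"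
    unfolding sector_inner_def sector_outer_def by (simp only: right_diff_distrib)
  also have "\<dots> = - (1 / 2) * (Im (cis \<theta> * z))\<^sup>2"
    unfolding 1 2 by (simp add: field_simps)
  finally show ?thesis by simp
qed

lemma has_laplacian_sector_inner:
  assumes "0 < Re z"
  shows "has_laplacian (sector_inner \<theta>) (- 1) z"
proof -
  have "open {w. 0 < Re w}" by (intro open_Collect_less continuous_intros)
  have "has_laplacian (\<lambda>w. Re (w\<^sup>2 * Ln w)) 0 z"
    by (rule has_laplacian_Re_holomorphic[OF _ \<open>open {w. 0 < Re w}\<close>])
      (use assms in \<open>auto intro!: holomorphic_intros simp: complex_nonpos_Reals_iff\<close>)
  moreover have "has_laplacian (\<lambda>w. Re (w\<^sup>2)) 0 z"
    by (rule has_laplacian_Re_holomorphic[where S = UNIV]) (auto intro!: holomorphic_intros)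
  moreover have "has_laplacian (\<lambda>w. (cmod w)\<^sup>2) 4 z"
    using has_laplacian_cmod_power2[of 0 z] by simp
  ultimately have "has_laplacian (sector_inner \<theta>)
      (- sin (2 * \<theta>) / (4 * pi) * 0 + (- (1 / 4) * 4 + cos (2 * \<theta>) / 4 * 0)) z"
    unfolding sector_inner_def[abs_def] by (intro has_laplacian_add has_laplacian_cmult)
  then show ?thesis by simp
qed

lemma has_laplacian_sector_outer:
  assumes "\<not> (Im z = 0 \<and> 0 \<le> Re z)"
  shows "has_laplacian (sector_outer \<theta>) 0 z"
proof -
  have "open (- \<real>\<^sub>\<ge>\<^sub>0 :: complex set)" by (simp add: open_Compl closed_nonneg_Reals_complex)
  have "has_laplacian (\<lambda>w. Re (w\<^sup>2 * Ln (- w))) 0 z"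
    by (rule has_laplacian_Re_holomorphic[OF _ \<open>open (- \<real>\<^sub>\<ge>\<^sub>0)\<close>])
      (use assms in \<open>auto intro!: holomorphic_intros simp: complex_nonpos_Reals_iff complex_nonneg_Reals_iff\<close>)
  then have "has_laplacian (sector_outer \<theta>) (- sin (2 * \<theta>) / (4 * pi) * 0) z"
    unfolding sector_outer_def[abs_def] by (intro has_laplacian_cmult)
  then show ?thesis by simp
qed

lemma cross_model_sector_solution:
  assumes \<theta>: "0 < \<theta>" "\<theta> < pi / 2"
  shows "cross_model \<theta> 1 (sector_solution \<theta>)
    (\<lambda>z. of_bool (Im (cis (- \<theta>) * z) < 0 \<and> 0 < Im (cis \<theta> * z)))"
  unfolding cross_model_def
proof (intro allI impI)
  fix z :: complex
  assume "z \<noteq> 0"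
  have sc: "0 < sin \<theta>" "0 < cos \<theta>" using \<theta> by (auto intro: sin_gt_zero cos_gt_zero)
  define x1 x2 where "x1 y = Im (cis (- \<theta>) * y)" and "x2 y = Im (cis \<theta> * y)" for y
  have x: "x1 y = Im y * cos \<theta> - Re y * sin \<theta>" "x2 y = Im y * cos \<theta> + Re y * sin \<theta>" for y
    by (simp_all add: x1_def x2_def algebra_simps)
  have c: "continuous_on UNIV x1" "continuous_on UNIV x2"
    unfolding x1_def x2_def by (intro continuous_intros)+
  let ?s = "\<lambda>z. of_bool (x1 z < 0 \<and> 0 < x2 z) :: real"
  let ?goal = "(\<exists>\<psi> K. has_laplacian \<psi> K z \<and> \<psi> z = sector_solution \<theta> z \<and>
        (\<forall>\<^sub>F y in nhds z. sector_solution \<theta> y \<le> \<psi> y) \<and> K \<le> 0 \<and> (\<not> on_cross \<theta> z \<longrightarrow> K = - ?s z)) \<and>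
     (\<exists>\<psi> K. has_laplacian \<psi> K z \<and> \<psi> z = sector_solution \<theta> z \<and>
        (\<forall>\<^sub>F y in nhds z. \<psi> y \<le> sector_solution \<theta> y) \<and> - 1 \<le> K \<and> (\<not> on_cross \<theta> z \<longrightarrow> K = - ?s z))"
  have sol: "sector_solution \<theta> y = (if x1 y < 0 \<and> 0 < x2 y then sector_inner \<theta> y else sector_outer \<theta> y)" for y
    by (simp add: sector_solution_def x1_def x2_def)
  have onc: "on_cross \<theta> y \<longleftrightarrow> x1 y = 0 \<or> x2 y = 0" for y by (simp add: on_cross_def x1_def x2_def)
  \<comment> \<open>Near a ray the inner branch lies below the outer one, and the glued function
    lies between them. They serve as test functions from below, with Laplacian - 1, and from above,
    with Laplacian 0.\<close>
  have on_ray: ?goal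
    if Re: "0 < Re z" and Im: "Im z \<noteq> 0" and ev: "\<forall>\<^sub>F y in nhds z. sector_inner \<theta> y \<le> sector_outer \<theta> y"
      and eq: "sector_inner \<theta> z = sector_outer \<theta> z" and cr: "on_cross \<theta> z"
  proof (intro conjI)
    have "\<forall>\<^sub>F y in nhds z. sector_solution \<theta> y \<le> sector_outer \<theta> y"
      using ev by eventually_elim (simp add: sol)
    then show "\<exists>\<psi> K. has_laplacian \<psi> K z \<and> \<psi> z = sector_solution \<theta> z \<and>
        (\<forall>\<^sub>F y in nhds z. sector_solution \<theta> y \<le> \<psi> y) \<and> K \<le> 0 \<and> (\<not> on_cross \<theta> z \<longrightarrow> K = - ?s z)"
      using has_laplacian_sector_outer[of z \<theta>] Im eq cr by (intro exI[of _ "sector_outer \<theta>"] exI[of _ 0]) (simp add: sol)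
    have "\<forall>\<^sub>F y in nhds z. sector_inner \<theta> y \<le> sector_solution \<theta> y"
      using ev by eventually_elim (simp add: sol)
    then show "\<exists>\<psi> K. has_laplacian \<psi> K z \<and> \<psi> z = sector_solution \<theta> z \<and>
        (\<forall>\<^sub>F y in nhds z. \<psi> y \<le> sector_solution \<theta> y) \<and> - 1 \<le> K \<and> (\<not> on_cross \<theta> z \<longrightarrow> K = - ?s z)"
      using has_laplacian_sector_inner[OF Re, of \<theta>] eq cr by (intro exI[of _ "sector_inner \<theta>"] exI[of _ "- 1"]) (simp add: sol)
  qed
  \<comment> \<open>Only two of the four half lines of the cross bound the sector; they are the last
    two cases. The other two half lines lie in the second case, where the outer branch is harmonic,
    so no gluing occurs there.\<close>
  consider "x1 z < 0" "0 < x2 z" | "0 < x1 z \<or> x2 z < 0" | "x1 z = 0" "0 \<le> x2 z" | "x2 z = 0" "x1 z \<le> 0"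
    by linarith
  then have ?goal
  proof cases
    case 1
    then have "0 < Re z * sin \<theta>" unfolding x by linarith
    then have Re: "0 < Re z" using sc by (simp add: zero_less_mult_iff)
    have "open {y. x1 y < 0 \<and> 0 < x2 y}"
      by (intro open_Collect_conj open_Collect_less c continuous_intros)
    then have "\<forall>\<^sub>F y in nhds z. x1 y < 0 \<and> 0 < x2 y" using 1 eventually_nhds_in_open by fastforce
    then have "\<forall>\<^sub>F y in nhds z. sector_solution \<theta> y = sector_inner \<theta> y" by eventually_elim (simp add: sol)
    then have "\<forall>\<^sub>F y in nhds z. sector_solution \<theta> y \<le> sector_inner \<theta> y" "\<forall>\<^sub>F y in nhds z. sector_inner \<theta> y \<le> sector_solution \<theta> y"
      by (auto elim: eventually_mono)
    then show ?thesis
      using 1 has_laplacian_sector_inner[OF Re, of \<theta>] by (intro conjI exI[of _ "sector_inner \<theta>"] exI[of _ "- 1"]) (simp_all add: sol)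
  next
    case 2
    have "\<not> (Im z = 0 \<and> 0 \<le> Re z)" using 2 sc by (auto simp: x mult_less_0_iff not_less)
    note lap = has_laplacian_sector_outer[OF this, of \<theta>]
    have "open {y. 0 < x1 y \<or> x2 y < 0}"
      by (intro open_Collect_disj open_Collect_less c continuous_intros)
    then have "\<forall>\<^sub>F y in nhds z. 0 < x1 y \<or> x2 y < 0" using 2 eventually_nhds_in_open by fastforce
    then have "\<forall>\<^sub>F y in nhds z. sector_solution \<theta> y = sector_outer \<theta> y" by eventually_elim (auto simp: sol)
    then have "\<forall>\<^sub>F y in nhds z. sector_solution \<theta> y \<le> sector_outer \<theta> y" "\<forall>\<^sub>F y in nhds z. sector_outer \<theta> y \<le> sector_solution \<theta> y"
      by (auto elim: eventually_mono)
    then show ?thesis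
      using 2 lap by (intro conjI exI[of _ "sector_outer \<theta>"] exI[of _ 0]) (auto simp: sol)
  next
    case 3
    have eq: "Im z * cos \<theta> = Re z * sin \<theta>" using 3(1) by (simp add: x)
    have "0 \<le> Im z * cos \<theta>" using 3(2) eq unfolding x by linarith
    moreover have "Im z \<noteq> 0"
    proof
      assume "Im z = 0"
      then have "Re z = 0" using eq sc by simp
      then show False using \<open>Im z = 0\<close> \<open>z \<noteq> 0\<close> by (simp add: complex_eq_iff)
    qed
    ultimately have Im: "0 < Im z" using sc by (simp add: zero_le_mult_iff)
    then have "0 < Re z * sin \<theta>" using eq sc by (metis mult_pos_pos)
    then have Re: "0 < Re z" using sc by (simp add: zero_less_mult_iff)
    have "open {y. 0 < Im y}" by (intro open_Collect_less continuous_intros)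
    then have "\<forall>\<^sub>F y in nhds z. 0 < Im y" using Im eventually_nhds_in_open by fastforce
    then have ev: "\<forall>\<^sub>F y in nhds z. sector_inner \<theta> y \<le> sector_outer \<theta> y"
      by eventually_elim (simp only: sector_inner_eq_upper, simp)
    have "sector_inner \<theta> z = sector_outer \<theta> z"
      using sector_inner_eq_upper[OF Im, of \<theta>] 3(1) by (simp add: x1_def)
    then show ?thesis using on_ray[OF Re _ ev] Im 3 by (simp add: onc)
  next
    case 4
    have eq: "- Im z * cos \<theta> = Re z * sin \<theta>" using 4(1) by (simp add: x)
    have "0 \<le> - Im z * cos \<theta>" using 4(2) eq unfolding x by linarith
    moreover have "Im z \<noteq> 0"
    proof
      assume "Im z = 0"
      then have "Re z = 0" using eq sc by simp
      then show False using \<open>Im z = 0\<close> \<open>z \<noteq> 0\<close> by (simp add: complex_eq_iff)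
    qed
    ultimately have Im: "Im z < 0" using sc by (simp add: zero_le_mult_iff mult_le_0_iff)
    then have "0 < - Im z" by simp
    then have "0 < Re z * sin \<theta>" using eq sc by (metis mult_pos_pos)
    then have Re: "0 < Re z" using sc by (simp add: zero_less_mult_iff)
    have "open {y. Im y < 0}" by (intro open_Collect_less continuous_intros)
    then have "\<forall>\<^sub>F y in nhds z. Im y < 0" using Im eventually_nhds_in_open by fastforce
    then have ev: "\<forall>\<^sub>F y in nhds z. sector_inner \<theta> y \<le> sector_outer \<theta> y"
      by eventually_elim (simp only: sector_inner_eq_lower, simp)
    have "sector_inner \<theta> z = sector_outer \<theta> z"
      using sector_inner_eq_lower[OF Im, of \<theta>] 4(1) by (simp add: x2_def)
    then show ?thesis using on_ray[OF Re _ ev] Im 4 by (simp add: onc)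
  qed
  then show "(\<exists>\<psi> K. has_laplacian \<psi> K z \<and> \<psi> z = sector_solution \<theta> z \<and>
        (\<forall>\<^sub>F y in nhds z. sector_solution \<theta> y \<le> \<psi> y) \<and> K \<le> 0 \<and>
        (\<not> on_cross \<theta> z \<longrightarrow> K = - of_bool (Im (cis (- \<theta>) * z) < 0 \<and> 0 < Im (cis \<theta> * z)))) \<and>
     (\<exists>\<psi> K. has_laplacian \<psi> K z \<and> \<psi> z = sector_solution \<theta> z \<and>
        (\<forall>\<^sub>F y in nhds z. \<psi> y \<le> sector_solution \<theta> y) \<and> - 1 \<le> K \<and>
        (\<not> on_cross \<theta> z \<longrightarrow> K = - of_bool (Im (cis (- \<theta>) * z) < 0 \<and> 0 < Im (cis \<theta> * z))))"
    unfolding x1_def x2_def .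
qed

text \<open>The junk value \<open>ln 0\<close> is harmless because of the factor \<open>z\<^sup>2\<close>.\<close>

definition log_quadratic :: "real \<Rightarrow> (complex \<Rightarrow> real) \<Rightarrow> bool" where
  "log_quadratic c w \<longleftrightarrow> (\<exists>C. \<forall>z. \<bar>w z - c * (Re (z\<^sup>2) * ln (cmod z))\<bar> \<le> C * (cmod z)\<^sup>2)"

lemma log_quadratic_add:
  assumes "log_quadratic c w" and "log_quadratic c' w'"
  shows "log_quadratic (c + c') (\<lambda>z. w z + w' z)"
proof -
  obtain C C' where "\<And>z. \<bar>w z - c * (Re (z\<^sup>2) * ln (cmod z))\<bar> \<le> C * (cmod z)\<^sup>2"
    "\<And>z. \<bar>w' z - c' * (Re (z\<^sup>2) * ln (cmod z))\<bar> \<le> C' * (cmod z)\<^sup>2"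
    using assms unfolding log_quadratic_def by blast
  then have "\<bar>w z + w' z - (c + c') * (Re (z\<^sup>2) * ln (cmod z))\<bar> \<le> (C + C') * (cmod z)\<^sup>2" for z
    unfolding distrib_right by (smt (verit))
  then show ?thesis unfolding log_quadratic_def by blast
qed

lemma log_quadratic_bounded:
  assumes "\<And>z. \<bar>w z\<bar> \<le> C * (cmod z)\<^sup>2"
  shows "log_quadratic 0 w"
  unfolding log_quadratic_def using assms by auto

text \<open>Meant for \<open>\<sigma> = 1\<close>, the half turn, and \<open>\<sigma> = - 1\<close>,
  the quarter turns, which reverse the sign of the logarithmic coefficient.\<close>

lemma log_quadratic_rotate:
  assumes "log_quadratic c w" and "cmod \<omega> = 1" and "\<And>z. Re ((\<omega> * z)\<^sup>2) = \<sigma> * Re (z\<^sup>2)"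
  shows "log_quadratic (\<sigma> * c) (\<lambda>z. w (\<omega> * z))"
proof -
  obtain C where C: "\<And>z. \<bar>w z - c * (Re (z\<^sup>2) * ln (cmod z))\<bar> \<le> C * (cmod z)\<^sup>2"
    using assms unfolding log_quadratic_def by blast
  have "\<bar>w (\<omega> * z) - \<sigma> * c * (Re (z\<^sup>2) * ln (cmod z))\<bar> \<le> C * (cmod z)\<^sup>2" for z
    using C[of "\<omega> * z"] unfolding assms(3) norm_mult assms(2) by (simp add: mult_ac)
  then show ?thesis unfolding log_quadratic_def by blast
qed

text \<open>The deviation from the logarithm of the modulus comes from the argument, which is
  bounded by \<open>pi\<close>, and from the quadratic terms.\<close>

lemma log_quadratic_sector_solution: "log_quadratic (- sin (2 * \<theta>) / (4 * pi)) (sector_solution \<theta>)"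
proof -
  define A where "A = - sin (2 * \<theta>) / (4 * pi)"
  have "\<bar>A\<bar> * pi = \<bar>sin (2 * \<theta>)\<bar> / 4" by (simp add: A_def abs_mult)
  then have A: "\<bar>A\<bar> * pi \<le> 1" using abs_sin_le_one[of "2 * \<theta>"] by linarith
  have R: "\<bar>Re (z\<^sup>2)\<bar> \<le> (cmod z)\<^sup>2" "\<bar>Im (z\<^sup>2)\<bar> \<le> (cmod z)\<^sup>2" for z
    using abs_Re_le_cmod[of "z\<^sup>2"] abs_Im_le_cmod[of "z\<^sup>2"] by (simp_all only: norm_power)
  have L: "\<bar>A * Re (z\<^sup>2 * Ln u) - A * (Re (z\<^sup>2) * ln (cmod z))\<bar> \<le> (cmod z)\<^sup>2" if "cmod u = cmod z" "z \<noteq> 0" for z u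
  proof -
    have "u \<noteq> 0" using that by auto
    then have "Re (Ln u) = ln (cmod z)" using that by simp
    then have "A * Re (z\<^sup>2 * Ln u) - A * (Re (z\<^sup>2) * ln (cmod z)) = - A * Im (z\<^sup>2) * Im (Ln u)"
      by (simp only: times_complex.sel) (simp add: algebra_simps)
    then have "\<bar>A * Re (z\<^sup>2 * Ln u) - A * (Re (z\<^sup>2) * ln (cmod z))\<bar> = \<bar>A\<bar> * \<bar>Im (z\<^sup>2)\<bar> * \<bar>Im (Ln u)\<bar>"
      by (simp only: abs_mult abs_minus_cancel)
    also have "\<dots> \<le> \<bar>A\<bar> * (cmod z)\<^sup>2 * pi"
      using R[of z] mpi_less_Im_Ln[OF \<open>u \<noteq> 0\<close>] Im_Ln_le_pi[OF \<open>u \<noteq> 0\<close>]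
      by (intro mult_mono mult_left_mono) (auto simp: abs_le_iff)
    also have "\<dots> = (\<bar>A\<bar> * pi) * (cmod z)\<^sup>2" by simp
    also have "\<dots> \<le> 1 * (cmod z)\<^sup>2" using A by (intro mult_right_mono) auto
    finally show ?thesis by simp
  qed
  have "\<bar>sector_solution \<theta> z - A * (Re (z\<^sup>2) * ln (cmod z))\<bar> \<le> 2 * (cmod z)\<^sup>2" for z
  proof (cases "z = 0")
    case True
    then show ?thesis by (simp add: sector_solution_def sector_outer_def)
  next
    case False
    have "\<bar>cos (2 * \<theta>) * Re (z\<^sup>2)\<bar> \<le> 1 * (cmod z)\<^sup>2"
      unfolding abs_mult using R[of z] by (intro mult_mono) auto
    then have "\<bar>- (1 / 4) * (cmod z)\<^sup>2 + cos (2 * \<theta>) / 4 * Re (z\<^sup>2)\<bar> \<le> (cmod z)\<^sup>2"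
      by (simp add: abs_le_iff)
    then show ?thesis
      using L[of z z] L[of "- z" z] False R[of z]
      unfolding sector_solution_def sector_inner_def sector_outer_def A_def[symmetric]
      by (auto simp: abs_le_iff simp del: times_complex.sel)
  qed
  then show ?thesis unfolding log_quadratic_def A_def by blast
qed

lemma x_squared_ln_bound:
  fixes x :: real
  assumes "0 < x" and "x \<le> 1"
  shows "x\<^sup>2 * \<bar>ln x\<bar> \<le> x"
proof -
  have "ln (1 / x) \<le> 1 / x - 1" using assms by (intro ln_le_minus_one) auto
  then have "- ln x \<le> 1 / x" using assms by (simp add: ln_div)
  then have "\<bar>ln x\<bar> \<le> 1 / x" using assms by (simp add: abs_if ln_less_zero_iff)
  then have "x\<^sup>2 * \<bar>ln x\<bar> \<le> x\<^sup>2 * (1 / x)" by (intro mult_left_mono) auto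
  then show ?thesis using assms by (simp add: power2_eq_square)
qed

text \<open>Freezing the logarithm at the radius costs only a term of order
  \<open>r\<^sup>2\<close>, since \<open>t\<^sup>2 * |ln t|\<close> is bounded for
  \<open>t = cmod z / r\<close>. On each scale the model thus looks like a real multiple of
  \<open>Re (z\<^sup>2)\<close>.\<close>

lemma log_quadratic_rescale:
  assumes "log_quadratic c w"
  shows "\<exists>C. \<forall>r z. 0 < r \<longrightarrow> cmod z \<le> r \<longrightarrow> \<bar>w z - c * ln r * Re (z\<^sup>2)\<bar> \<le> C * r\<^sup>2"
proof -
  obtain C where C: "\<And>z. \<bar>w z - c * (Re (z\<^sup>2) * ln (cmod z))\<bar> \<le> C * (cmod z)\<^sup>2"
    using assms unfolding log_quadratic_def by blast
  have "C \<ge> 0" using order_trans[OF abs_ge_zero C[of 1]] by simp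
  have "\<bar>w z - c * ln r * Re (z\<^sup>2)\<bar> \<le> (C + \<bar>c\<bar>) * r\<^sup>2" if "0 < r" "cmod z \<le> r" for r z
  proof (cases "z = 0")
    case True
    then show ?thesis using C[of 0] \<open>C \<ge> 0\<close> by simp
  next
    case False
    define t where "t = cmod z / r"
    have t: "0 < t" "t \<le> 1" using False that by (auto simp: t_def)
    have lt: "ln (cmod z) - ln r = ln t" using False that by (simp add: t_def ln_div)
    have "\<bar>Re (z\<^sup>2)\<bar> \<le> (cmod z)\<^sup>2" using abs_Re_le_cmod[of "z\<^sup>2"] by (simp only: norm_power)
    then have "\<bar>c * (Re (z\<^sup>2) * ln t)\<bar> \<le> \<bar>c\<bar> * ((cmod z)\<^sup>2 * \<bar>ln t\<bar>)"
      unfolding abs_mult by (intro mult_left_mono mult_right_mono) auto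
    also have "(cmod z)\<^sup>2 * \<bar>ln t\<bar> = r\<^sup>2 * (t\<^sup>2 * \<bar>ln t\<bar>)" using that by (simp add: t_def power_divide)
    also have "\<dots> \<le> r\<^sup>2 * 1"
      using x_squared_ln_bound[OF t] t by (intro mult_left_mono) auto
    finally have 1: "\<bar>c * (Re (z\<^sup>2) * ln t)\<bar> \<le> \<bar>c\<bar> * r\<^sup>2" by (simp add: mult_left_mono)
    have "C * (cmod z)\<^sup>2 \<le> C * r\<^sup>2" using that \<open>C \<ge> 0\<close> by (intro mult_left_mono power_mono) auto
    then have 2: "\<bar>w z - c * (Re (z\<^sup>2) * ln (cmod z))\<bar> \<le> C * r\<^sup>2" using C[of z] by linarith
    have "w z - c * ln r * Re (z\<^sup>2) = (w z - c * (Re (z\<^sup>2) * ln (cmod z))) + c * (Re (z\<^sup>2) * ln t)"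
      unfolding lt[symmetric] by (simp add: algebra_simps)
    then show ?thesis using 1 2 unfolding distrib_right by linarith
  qed
  then show ?thesis by blast
qed

lemma log_quadratic_at_0:
  assumes "log_quadratic c w"
  shows "w 0 = 0" and "(w has_derivative (\<lambda>_. 0)) (at 0)"
proof -
  obtain C where C: "\<And>z. \<bar>w z - c * (Re (z\<^sup>2) * ln (cmod z))\<bar> \<le> C * (cmod z)\<^sup>2"
    using assms unfolding log_quadratic_def by blast
  show w0: "w 0 = 0" using C[of 0] by simp
  have "C \<ge> 0" using order_trans[OF abs_ge_zero C[of 1]] by simp
  have lnb: "x * \<bar>ln x\<bar> \<le> 2 * sqrt x" if "0 < x" "x \<le> 1" for x :: real
    using x_squared_ln_bound[of "sqrt x"] that by (simp add: ln_sqrt)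
  have "((\<lambda>x::real. C * x + \<bar>c\<bar> * (2 * sqrt x)) \<longlongrightarrow> C * 0 + \<bar>c\<bar> * (2 * sqrt 0)) (at_right 0)"
    by (intro tendsto_intros)
  then have lim: "((\<lambda>x::real. C * x + \<bar>c\<bar> * (2 * sqrt x)) \<longlongrightarrow> 0) (at_right 0)"
    by simp
  show "(w has_derivative (\<lambda>_. 0)) (at 0)"
    unfolding has_derivative_at_alt
  proof (intro conjI allI impI)
    fix e :: real
    assume "e > 0"
    then have "\<forall>\<^sub>F x in at_right 0. C * x + \<bar>c\<bar> * (2 * sqrt x) < e"
      using lim by (intro order_tendstoD(2)) auto
    then obtain d' where d': "d' > 0" "\<And>x. 0 < x \<Longrightarrow> x < d' \<Longrightarrow> C * x + \<bar>c\<bar> * (2 * sqrt x) < e"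
      unfolding eventually_at_right_field by auto
    define d where "d = min d' 1"
    have d: "d > 0" "C * x + \<bar>c\<bar> * (x * \<bar>ln x\<bar>) < e" if "0 < x" "x < d" for x
    proof -
      show "d > 0" using d' by (simp add: d_def)
      have "\<bar>c\<bar> * (x * \<bar>ln x\<bar>) \<le> \<bar>c\<bar> * (2 * sqrt x)"
        using that by (intro mult_left_mono lnb) (auto simp: d_def)
      moreover have "C * x + \<bar>c\<bar> * (2 * sqrt x) < e" using that by (intro d') (auto simp: d_def)
      ultimately show "C * x + \<bar>c\<bar> * (x * \<bar>ln x\<bar>) < e" by linarith
    qed
    have "d > 0" using d' by (simp add: d_def)
    show "\<exists>d>0. \<forall>y. norm (y - 0) < d \<longrightarrow> norm (w y - w 0 - 0) \<le> e * norm (y - 0)"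
    proof (intro exI[of _ d] conjI allI impI)
      fix y :: complex
      assume y: "norm (y - 0) < d"
      show "norm (w y - w 0 - 0) \<le> e * norm (y - 0)"
      proof (cases "y = 0")
        case False
        define x where "x = cmod y"
        have x: "0 < x" "x < d" using False y by (simp_all add: x_def)
        have "\<bar>Re (y\<^sup>2)\<bar> \<le> x\<^sup>2" using abs_Re_le_cmod[of "y\<^sup>2"] by (simp only: norm_power x_def)
        then have "\<bar>c * (Re (y\<^sup>2) * ln x)\<bar> \<le> \<bar>c\<bar> * (x\<^sup>2 * \<bar>ln x\<bar>)"
          unfolding abs_mult by (intro mult_left_mono mult_right_mono) auto
        then have "\<bar>w y\<bar> \<le> C * x\<^sup>2 + \<bar>c\<bar> * (x\<^sup>2 * \<bar>ln x\<bar>)"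
          using C[of y] unfolding x_def by linarith
        also have "\<dots> = (C * x + \<bar>c\<bar> * (x * \<bar>ln x\<bar>)) * x" by (simp add: power2_eq_square algebra_simps)
        also have "\<dots> \<le> e * x" using d(2)[OF x] x by (intro mult_right_mono) auto
        finally show ?thesis by (simp add: x_def w0)
      qed simp
    qed fact
  qed simp
qed

section \<open>Growth at a crossing point\<close>

lemma cross_model_zero: "cross_model \<theta> 1 (\<lambda>_. 0) (\<lambda>_. 0)"
  by (rule cross_modelI_smooth) (auto intro: has_laplacian_const)

lemma cross_model_of_bool:
  assumes "cross_model \<theta> 1 w s"
  shows "cross_model \<theta> 1 (\<lambda>z. of_bool b * w z) (\<lambda>z. of_bool b * s z)"
  using assms cross_model_zero by (cases b) auto

lemma log_quadratic_of_bool: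
  assumes "log_quadratic c w"
  shows "log_quadratic (of_bool b * c) (\<lambda>z. of_bool b * w z)"
  using assms log_quadratic_bounded[of "\<lambda>_. 0" 0] by (cases b) auto

lemma abs_sin_diff_le:
  assumes "\<bar>sin a\<bar> \<le> d" and "\<bar>sin b\<bar> \<le> d"
  shows "\<bar>sin (b - a)\<bar> \<le> 2 * (d::real)"
proof -
  have "\<bar>sin b * cos a\<bar> \<le> d * 1" "\<bar>cos b * sin a\<bar> \<le> 1 * d"
    unfolding abs_mult using assms order_trans[OF abs_ge_zero assms(1)] by (intro mult_mono; simp)+
  then show ?thesis unfolding sin_diff by linarith
qed

text \<open>Among three directions \<open>\<pi>/6\<close> apart, each line of the cross is close to at most one.\<close>

lemma direction_off_cross:
  obtains \<zeta> where "cmod \<zeta> = 1" and "1 / 5 < \<bar>Im (cis (- \<theta>) * \<zeta>)\<bar>" and "1 / 5 < \<bar>Im (cis \<theta> * \<zeta>)\<bar>"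
    and "cmod c / 2 \<le> Re (c * \<zeta>\<^sup>2)"
proof -
  \<comment> \<open>For \<open>j = 0\<close> the number \<open>c * \<zeta>\<^sup>2\<close> is real
    and nonnegative; for the neighbours it is turned by \<open>pi / 3\<close>, which halves its real
    part. If two directions were within 1/5 of the same line, the sine of their difference would be
    at most 2/5, but it is at least 1/2.\<close>
  define \<phi> where "\<phi> j = - Arg c / 2 + real_of_int j * (pi / 6)" for j
  define bad where "bad t j \<longleftrightarrow> \<bar>sin (\<phi> j + t)\<bar> \<le> 1 / 5" for t j
  have s60: "1 / 2 \<le> sin (pi / 3)"
    by (simp add: sin_60)
  have one: "\<not> (bad t i \<and> bad t j)" if "i \<in> {-1, 0, 1}" "j \<in> {-1, 0, 1}" "i < j" for t i j
  proof
    assume "bad t i \<and> bad t j"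
    then have bnd: "\<bar>sin ((\<phi> j + t) - (\<phi> i + t))\<bar> \<le> 2 * (1 / 5)"
      unfolding bad_def by (intro abs_sin_diff_le) auto
    define n where "n = j - i"
    have eq: "(\<phi> j + t) - (\<phi> i + t) = real_of_int n * (pi / 6)" by (simp add: \<phi>_def n_def algebra_simps)
    have "n = 1 \<or> n = 2" using that by (auto simp: n_def)
    then have "1 / 2 \<le> sin (real_of_int n * (pi / 6))" using s60 by (auto simp: sin_30)
    then show False using bnd[unfolded eq] by linarith
  qed
  have "\<exists>j\<in>{-1, 0, 1}. \<not> bad (- \<theta>) j \<and> \<not> bad \<theta> j"
    using one[of "-1" 0 "-\<theta>"] one[of "-1" 1 "-\<theta>"] one[of 0 1 "-\<theta>"]
      one[of "-1" 0 \<theta>] one[of "-1" 1 \<theta>] one[of 0 1 \<theta>] by auto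
  then obtain j where j: "j \<in> {-1, 0, 1}" "\<not> bad (- \<theta>) j" "\<not> bad \<theta> j" by blast
  show thesis
  proof (rule that[of "cis (\<phi> j)"])
    have "\<And>t. cis t * cis (\<phi> j) = cis (\<phi> j + t)" by (simp add: cis_mult add.commute)
    then show "1 / 5 < \<bar>Im (cis (- \<theta>) * cis (\<phi> j))\<bar>" "1 / 5 < \<bar>Im (cis \<theta> * cis (\<phi> j))\<bar>"
      using j(2,3) unfolding bad_def by (simp_all del: times_complex.sel)
    have "c * (cis (\<phi> j))\<^sup>2 = of_real (cmod c) * cis (Arg c) * (cis (\<phi> j))\<^sup>2"
      using rcis_cmod_Arg[of c] by (simp add: rcis_def)
    also have "\<dots> = of_real (cmod c) * cis (real_of_int j * (pi / 3))"
      unfolding Complex.DeMoivre mult.assoc cis_mult by (simp add: \<phi>_def algebra_simps)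
    finally have "Re (c * (cis (\<phi> j))\<^sup>2) = cmod c * cos (real_of_int j * (pi / 3))" by simp
    moreover have "1 / 2 \<le> cos (real_of_int j * (pi / 3))" using j(1) by (auto simp: cos_60)
    ultimately show "cmod c / 2 \<le> Re (c * (cis (\<phi> j))\<^sup>2)"
      using mult_left_mono[of "1 / 2" "cos (real_of_int j * (pi / 3))" "cmod c"] by simp
  qed simp
qed

text \<open>The sequence may diverge, but averaging the increments makes it o(k), slower than the
  logarithm along a geometric sequence of radii.\<close>

lemma increments_tendsto_0_imp_sublinear:
  fixes x :: "nat \<Rightarrow> complex"
  assumes "(\<lambda>k. x (Suc k) - x k) \<longlonglongrightarrow> 0"
  shows "(\<lambda>k. x k / of_nat (Suc k)) \<longlonglongrightarrow> 0"
proof (rule LIMSEQ_I)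
  fix e :: real
  assume "e > 0"
  then obtain N where N: "\<And>k. k \<ge> N \<Longrightarrow> cmod (x (Suc k) - x k) < e / 2"
    using LIMSEQ_D[OF assms, of "e / 2"] by auto
  have bound: "cmod (x (N + j)) \<le> cmod (x N) + e / 2 * real j" for j
  proof (induction j)
    case (Suc j)
    have "cmod (x (N + Suc j)) \<le> cmod (x (Suc (N + j)) - x (N + j)) + cmod (x (N + j))"
      using norm_triangle_ineq[of "x (Suc (N + j)) - x (N + j)" "x (N + j)"] by simp
    also have "\<dots> \<le> e / 2 + (cmod (x N) + e / 2 * real j)" using Suc N[of "N + j"] by (intro add_mono) auto
    finally show ?case by (simp add: algebra_simps add_divide_distrib)
  qed simp
  have "(\<lambda>k. cmod (x N) * inverse (real (Suc k))) \<longlonglongrightarrow> cmod (x N) * 0"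
    by (intro tendsto_intros LIMSEQ_inverse_real_of_nat)
  then have "\<forall>\<^sub>F k in sequentially. cmod (x N) * inverse (real (Suc k)) < e / 2"
    using \<open>e > 0\<close> by (intro order_tendstoD(2)) auto
  moreover have "\<forall>\<^sub>F k in sequentially. k \<ge> N" by (rule eventually_ge_at_top)
  ultimately have "\<forall>\<^sub>F k in sequentially. norm (x k / of_nat (Suc k) - 0) < e"
  proof eventually_elim
    case (elim k)
    have "N + (k - N) = k" using elim(2) by simp
    then have "cmod (x k) \<le> cmod (x N) + e / 2 * real (k - N)" using bound[of "k - N"] by simp
    also have "\<dots> \<le> cmod (x N) + e / 2 * real (Suc k)" using \<open>e > 0\<close> by (intro add_left_mono mult_left_mono) auto
    also have "\<dots> < e / 2 * real (Suc k) + e / 2 * real (Suc k)"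
    proof -
      have "cmod (x N) < e / 2 * real (Suc k)" using elim(1) by (simp add: field_simps del: of_nat_Suc)
      then show ?thesis by simp
    qed
    finally have "cmod (x k) < e * real (Suc k)" by simp
    then show ?case by (simp add: norm_divide divide_less_eq del: of_nat_Suc)
  qed
  then show "\<exists>no. \<forall>n\<ge>no. norm (x n / of_nat (Suc n) - 0) < e" by (simp add: eventually_sequentially)
qed

text \<open>The situation after the linear change of variables. Free boundary points are those with
  \<open>v z \<le> 0\<close> that are limits of points of positivity. The assumption
  \<open>flat\<close> is the half of the Hausdorff closeness that confines them to thin cones about
  the cross; the other half enters in \<open>free_boundary_curves\<close>.\<close>

locale cross_point =
  fixes v :: "complex \<Rightarrow> real" and \<theta> R :: real
  assumes theta: "0 < \<theta>" "\<theta> < pi / 2" and R: "0 < R"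
    and cont: "continuous_on (ball 0 R) v"
    and visc: "\<And>z. cmod z < R \<Longrightarrow> visc_ge v (- of_bool (0 < v z)) z"
    and visc': "\<And>z. cmod z < R \<Longrightarrow> visc_ge (\<lambda>w. - v w) (of_bool (0 < v z)) z"
    and v0: "v 0 = 0" and dv: "(v has_derivative (\<lambda>_. 0)) (at 0)"
    and flat: "\<And>\<epsilon>. 0 < \<epsilon> \<Longrightarrow> \<exists>r>0. \<forall>z. 0 < cmod z \<longrightarrow> cmod z < r \<longrightarrow> v z \<le> 0 \<longrightarrow>
      (\<exists>\<^sub>F y in nhds z. 0 < v y) \<longrightarrow>
      \<bar>Im (cis (- \<theta>) * z)\<bar> \<le> \<epsilon> * cmod z \<or> \<bar>Im (cis \<theta> * z)\<bar> \<le> \<epsilon> * cmod z"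
    and nondeg: "\<exists>c>0. \<exists>r0>0. \<forall>r. 0 < r \<longrightarrow> r < r0 \<longrightarrow> (\<exists>z. cmod z < r \<and> v z \<le> - c * r\<^sup>2)"
begin

text \<open>The signed distance to the line through \<open>cis \<theta>\<close>; its companion
  \<open>x2\<close> belongs to the line through \<open>cis (- \<theta>)\<close>.\<close>

definition x1 :: "complex \<Rightarrow> real" where "x1 z = Im (cis (- \<theta>) * z)"

definition x2 :: "complex \<Rightarrow> real" where "x2 z = Im (cis \<theta> * z)"

lemma x_eq: "x1 z = Im z * cos \<theta> - Re z * sin \<theta>" "x2 z = Im z * cos \<theta> + Re z * sin \<theta>"
  by (simp_all add: x1_def x2_def algebra_simps)

lemma sin_cos_pos: "0 < sin \<theta>" "0 < cos \<theta>"
  using theta by (auto intro: sin_gt_zero cos_gt_zero)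

lemma x_scale: "x1 (of_real t * z) = t * x1 z" "x2 (of_real t * z) = t * x2 z"
  by (simp_all add: x_eq algebra_simps)

lemma x_minus: "x1 (- z) = - x1 z" "x2 (- z) = - x2 z"
  by (simp_all add: x_eq)

lemma on_cross_iff: "on_cross \<theta> z \<longleftrightarrow> x1 z = 0 \<or> x2 z = 0"
  by (simp add: on_cross_def x1_def x2_def)

lemma visc_weak:
  assumes "cmod z < R"
  shows "visc_ge v (- 1) z" and "visc_ge (\<lambda>w. - v w) 0 z"
  using visc_ge_mono[OF visc[OF assms], of "- 1"] visc_ge_mono[OF visc'[OF assms], of 0] by auto

text \<open>In the absence of free boundary points the set where \<open>v \<le> 0\<close> is open as
  well, so a connected set cannot meet both signs.\<close>

lemma sign_constant:
  assumes "open D" and "convex D" and "D \<subseteq> ball 0 R"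
    and no_fb: "\<And>z. z \<in> D \<Longrightarrow> v z \<le> 0 \<Longrightarrow> \<not> (\<exists>\<^sub>F y in nhds z. 0 < v y)"
    and "p \<in> D" "q \<in> D" "0 < v p"
  shows "0 < v q"
proof (rule ccontr)
  assume "\<not> 0 < v q"
  define A B where "A = D \<inter> v -` {0<..}" and "B = {z \<in> D. v z \<le> 0}"
  have "open A"
    unfolding A_def
    by (rule continuous_open_preimage[OF continuous_on_subset[OF cont \<open>D \<subseteq> ball 0 R\<close>] \<open>open D\<close>]) simp
  moreover have "open B"
    unfolding open_subopen[of B]
  proof
    fix z
    assume "z \<in> B"
    then have "\<forall>\<^sub>F y in nhds z. \<not> 0 < v y" using no_fb unfolding B_def frequently_def by auto
    moreover have "\<forall>\<^sub>F y in nhds z. y \<in> D" using \<open>open D\<close> \<open>z \<in> B\<close> eventually_nhds_in_open unfolding B_def by blast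
    ultimately have "\<forall>\<^sub>F y in nhds z. y \<in> B" by eventually_elim (simp add: B_def not_less)
    then show "\<exists>T. open T \<and> z \<in> T \<and> T \<subseteq> B" unfolding eventually_nhds by blast
  qed
  moreover have "D \<subseteq> A \<union> B" by (auto simp: A_def B_def)
  moreover have "A \<inter> B \<inter> D = {}" by (auto simp: A_def B_def)
  moreover have "p \<in> A \<inter> D" "q \<in> B \<inter> D" using assms(5-7) \<open>\<not> 0 < v q\<close> by (auto simp: A_def B_def)
  ultimately show False using connectedD[OF convex_connected[OF \<open>convex D\<close>], of A B] by blast
qed

section \<open>Signs of the solution in the four sectors\<close>

definition pm :: "bool \<Rightarrow> real" where "pm \<alpha> = (if \<alpha> then 1 else - 1)"

definition quadrant_cone :: "bool \<Rightarrow> bool \<Rightarrow> real \<Rightarrow> complex set" where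
  "quadrant_cone \<alpha> \<beta> \<epsilon> = {z. \<epsilon> * cmod z < pm \<alpha> * x1 z \<and> \<epsilon> * cmod z < pm \<beta> * x2 z}"

text \<open>The coordinate half axis inside the sector where \<open>x1\<close> has the sign
  \<open>\<alpha>\<close> and \<open>x2\<close> the sign \<open>\<beta>\<close>: for instance, the
  two signs differ on the real axis.\<close>

definition bisector :: "bool \<Rightarrow> bool \<Rightarrow> complex" where
  "bisector \<alpha> \<beta> = (if \<alpha> then (if \<beta> then \<i> else - 1) else (if \<beta> then 1 else - \<i>))"

lemma convex_norm_less_linear:
  assumes "0 \<le> \<epsilon>"
  shows "convex {z. \<epsilon> * cmod z < s * Im (c * z)}"
proof (rule convexI)
  fix y z :: complex and u w :: real
  assume yz: "y \<in> {z. \<epsilon> * cmod z < s * Im (c * z)}" "z \<in> {z. \<epsilon> * cmod z < s * Im (c * z)}"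
    and uw: "0 \<le> u" "0 \<le> w" "u + w = 1"
  have "u * (\<epsilon> * cmod y - s * Im (c * y)) + w * (\<epsilon> * cmod z - s * Im (c * z)) < 0"
    using yz uw by (intro convex_bound_lt) auto
  moreover have "\<epsilon> * cmod (u *\<^sub>R y + w *\<^sub>R z) \<le> \<epsilon> * (u * cmod y + w * cmod z)"
    using norm_triangle_ineq[of "u *\<^sub>R y" "w *\<^sub>R z"] uw assms by (intro mult_left_mono) auto
  ultimately show "u *\<^sub>R y + w *\<^sub>R z \<in> {z. \<epsilon> * cmod z < s * Im (c * z)}"
    by (simp add: algebra_simps)
qed

lemma quadrant_cone_convex_open:
  assumes "0 \<le> \<epsilon>"
  shows "convex (quadrant_cone \<alpha> \<beta> \<epsilon>)" "open (quadrant_cone \<alpha> \<beta> \<epsilon>)"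
proof -
  have eq: "quadrant_cone \<alpha> \<beta> \<epsilon> = {z. \<epsilon> * cmod z < pm \<alpha> * Im (cis (- \<theta>) * z)} \<inter> {z. \<epsilon> * cmod z < pm \<beta> * Im (cis \<theta> * z)}"
    by (auto simp: quadrant_cone_def x1_def x2_def)
  show "convex (quadrant_cone \<alpha> \<beta> \<epsilon>)"
    unfolding eq by (intro convex_Int convex_norm_less_linear assms)
  show "open (quadrant_cone \<alpha> \<beta> \<epsilon>)"
    unfolding eq by (intro open_Int open_Collect_less continuous_intros)
qed

lemma bisector_in_quadrant_cone:
  assumes "\<epsilon> < sin \<theta>" "\<epsilon> < cos \<theta>" and "0 < t"
  shows "of_real t * bisector \<alpha> \<beta> \<in> quadrant_cone \<alpha> \<beta> \<epsilon>"
proof -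
  have "\<epsilon> * t < sin \<theta> * t" "\<epsilon> * t < cos \<theta> * t" using assms by auto
  then show ?thesis
    using assms(3) by (auto simp: quadrant_cone_def bisector_def pm_def x_eq norm_mult mult.commute)
qed

text \<open>The sign of a sector is read off along its bisector, so that the notion does not depend
  on a cone; \<open>quadrant_sign\<close> carries it over to every cone.\<close>

definition positive_near :: "bool \<Rightarrow> bool \<Rightarrow> bool" where
  "positive_near \<alpha> \<beta> \<longleftrightarrow> (\<exists>\<rho>>0. \<forall>t. 0 < t \<longrightarrow> t < \<rho> \<longrightarrow> 0 < v (of_real t * bisector \<alpha> \<beta>))"

lemma quadrant_sign:
  assumes "0 < \<epsilon>"
  shows "\<exists>r>0. \<forall>z. cmod z < r \<longrightarrow> \<epsilon> * cmod z < \<bar>x1 z\<bar> \<longrightarrow> \<epsilon> * cmod z < \<bar>x2 z\<bar> \<longrightarrow>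
    (0 < v z \<longleftrightarrow> positive_near (0 < x1 z) (0 < x2 z))"
proof -
  \<comment> \<open>The cones are widened until they contain their bisectors, on which the distances
    to the two lines are \<open>sin \<theta>\<close> or \<open>cos \<theta>\<close> times the
    modulus.\<close>
  define \<epsilon>' where "\<epsilon>' = min \<epsilon> (min (sin \<theta>) (cos \<theta>) / 2)"
  have e': "0 < \<epsilon>'" "\<epsilon>' \<le> \<epsilon>" "\<epsilon>' < sin \<theta>" "\<epsilon>' < cos \<theta>"
    using assms sin_cos_pos by (auto simp: \<epsilon>'_def min_def)
  obtain r' where r': "r' > 0" and fl: "\<And>z. 0 < cmod z \<Longrightarrow> cmod z < r' \<Longrightarrow> v z \<le> 0 \<Longrightarrow>
      (\<exists>\<^sub>F y in nhds z. 0 < v y) \<Longrightarrow> \<bar>x1 z\<bar> \<le> \<epsilon>' * cmod z \<or> \<bar>x2 z\<bar> \<le> \<epsilon>' * cmod z"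
    using flat[OF e'(1)] unfolding x1_def x2_def by blast
  define r where "r = min r' R"
  have r: "r > 0" "r \<le> r'" "r \<le> R" using r' R by (auto simp: r_def)
  have same: "0 < v q" if "p \<in> quadrant_cone \<alpha> \<beta> \<epsilon>'" "q \<in> quadrant_cone \<alpha> \<beta> \<epsilon>'" "cmod p < r" "cmod q < r" "0 < v p"
    for \<alpha> \<beta> p q
  proof (rule sign_constant[of "quadrant_cone \<alpha> \<beta> \<epsilon>' \<inter> ball 0 r" p q])
    show "open (quadrant_cone \<alpha> \<beta> \<epsilon>' \<inter> ball 0 r)" "convex (quadrant_cone \<alpha> \<beta> \<epsilon>' \<inter> ball 0 r)"
      using quadrant_cone_convex_open[of \<epsilon>' \<alpha> \<beta>] e' by (auto intro: convex_Int open_Int)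
    show "quadrant_cone \<alpha> \<beta> \<epsilon>' \<inter> ball 0 r \<subseteq> ball 0 R" using r by auto
    show "\<not> (\<exists>\<^sub>F y in nhds z. 0 < v y)" if "z \<in> quadrant_cone \<alpha> \<beta> \<epsilon>' \<inter> ball 0 r" "v z \<le> 0" for z
    proof
      assume fr: "\<exists>\<^sub>F y in nhds z. 0 < v y"
      have z: "\<epsilon>' * cmod z < \<bar>x1 z\<bar>" "\<epsilon>' * cmod z < \<bar>x2 z\<bar>"
        using that(1) by (auto simp: quadrant_cone_def pm_def split: if_splits)
      have "z \<noteq> 0" using z by (auto simp: x_eq)
      then show False using fl[of z] that r z fr by auto
    qed
  qed (use that in auto)
  show ?thesis
  proof (intro exI[of _ r] conjI allI impI)
    fix z
    assume z: "cmod z < r" "\<epsilon> * cmod z < \<bar>x1 z\<bar>" "\<epsilon> * cmod z < \<bar>x2 z\<bar>"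
    define \<alpha> \<beta> where "\<alpha> = (0 < x1 z)" and "\<beta> = (0 < x2 z)"
    have "\<epsilon>' * cmod z \<le> \<epsilon> * cmod z" using e' by (intro mult_right_mono) auto
    then have zq: "z \<in> quadrant_cone \<alpha> \<beta> \<epsilon>'"
      using z by (auto simp: quadrant_cone_def \<alpha>_def \<beta>_def pm_def)
    have tq: "of_real t * bisector \<alpha> \<beta> \<in> quadrant_cone \<alpha> \<beta> \<epsilon>'" "cmod (of_real t * bisector \<alpha> \<beta>) = t" if "0 < t" for t
      using bisector_in_quadrant_cone[OF e'(3,4) that] that by (auto simp: norm_mult bisector_def)
    show "0 < v z \<longleftrightarrow> positive_near (0 < x1 z) (0 < x2 z)"
      unfolding \<alpha>_def[symmetric] \<beta>_def[symmetric]
    proof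
      assume "0 < v z"
      then show "positive_near \<alpha> \<beta>"
        unfolding positive_near_def using r(1) same[OF zq tq(1)] tq(2) z(1) by (intro exI[of _ r]) auto
    next
      assume "positive_near \<alpha> \<beta>"
      then obtain \<rho> where \<rho>: "\<rho> > 0" "\<And>t. 0 < t \<Longrightarrow> t < \<rho> \<Longrightarrow> 0 < v (of_real t * bisector \<alpha> \<beta>)"
        unfolding positive_near_def by blast
      define t where "t = min \<rho> r / 2"
      have t: "0 < t" "t < \<rho>" "t < r" using \<rho>(1) r(1) by (auto simp: t_def)
      show "0 < v z" by (rule same[OF tq(1)[OF t(1)] zq]) (use t tq(2)[OF t(1)] z(1) \<rho>(2) in auto)
    qed
  qed (rule r)
qed

text \<open>One statement serves all sign patterns, as only the Laplacian and the growth of the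
  model enter. For each fixed \<open>\<epsilon>\<close> the harmonic approximation has error
  \<open>74 * \<epsilon>\<close> on small discs; the errors are then chosen to vanish along the
  radii.\<close>

lemma expansion:
  assumes w: "cross_model \<theta> 4 w s" and lw: "log_quadratic c w"
    and s: "\<And>z. \<not> on_cross \<theta> z \<Longrightarrow> s z = of_bool (positive_near (0 < x1 z) (0 < x2 z))"
  obtains \<rho> e m where "0 < \<rho>" "\<rho> < R" "m \<longlonglongrightarrow> (0::real)" "(\<lambda>k. e (Suc k) - e k) \<longlonglongrightarrow> (0::complex)"
    "\<And>k h. cmod h \<le> \<rho> / 16 ^ k \<Longrightarrow> \<bar>v h - w h - Re (e k * h\<^sup>2)\<bar> \<le> m k * (\<rho> / 16 ^ k)\<^sup>2"
proof -
  have "isCont w z" for z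
  proof (cases "z = 0")
    case True
    then show ?thesis using has_derivative_continuous[OF log_quadratic_at_0(2)[OF lw]] by simp
  qed (rule cross_model_imp_isCont[OF w])
  then have cw: "continuous_on S w" for S by (simp add: continuous_at_imp_continuous_on)
  have approx: "\<exists>r0>0. \<forall>r. 0 < r \<longrightarrow> r < r0 \<longrightarrow>
      (\<exists>P. \<forall>h. cmod h \<le> r \<longrightarrow> \<bar>(v h - w h) - Re (poly P h)\<bar> \<le> 74 * \<epsilon> * r\<^sup>2)"
    if \<epsilon>: "0 < \<epsilon>" "\<epsilon> \<le> 1" for \<epsilon>
  proof -
    obtain r1 where r1: "r1 > 0" and sg: "\<And>z. cmod z < r1 \<Longrightarrow> \<epsilon> * cmod z < \<bar>x1 z\<bar> \<Longrightarrow> \<epsilon> * cmod z < \<bar>x2 z\<bar> \<Longrightarrow>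
        (0 < v z \<longleftrightarrow> positive_near (0 < x1 z) (0 < x2 z))"
      using quadrant_sign[OF \<epsilon>(1)] by blast
    show ?thesis
    proof (intro exI[of _ "min r1 R"] conjI allI impI)
      show "0 < min r1 R" using r1 R by simp
      fix r
      assume r: "0 < r" "r < min r1 R"
      show "\<exists>P. \<forall>h. cmod h \<le> r \<longrightarrow> \<bar>(v h - w h) - Re (poly P h)\<bar> \<le> 74 * \<epsilon> * r\<^sup>2"
      proof (rule cross_model_approx[OF r(1) \<epsilon> _ cw w])
        show "continuous_on (cball 0 r) v" by (rule continuous_on_subset[OF cont]) (use r in auto)
        show "visc_ge v (- 1) z" "visc_ge (\<lambda>w. - v w) 0 z" if "cmod z < r" for z
          using visc_weak[of z] that r by auto
        show "visc_ge v (- s z) z \<and> visc_ge (\<lambda>w. - v w) (s z) z"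
          if z: "cmod z < r" "\<epsilon> * r < \<bar>Im (cis (- \<theta>) * z)\<bar>" "\<epsilon> * r < \<bar>Im (cis \<theta> * z)\<bar>" for z
        proof -
          have "\<epsilon> * cmod z \<le> \<epsilon> * r" using z(1) \<epsilon> by (intro mult_left_mono) auto
          then have "0 < v z \<longleftrightarrow> positive_near (0 < x1 z) (0 < x2 z)"
            using sg[of z] z r by (simp add: x1_def x2_def)
          moreover have "\<not> on_cross \<theta> z"
            using z(2,3) mult_pos_pos[OF \<epsilon>(1) r(1)] by (auto simp: on_cross_def)
          ultimately have "s z = of_bool (0 < v z)" using s by simp
          then show ?thesis using visc[of z] visc'[of z] z(1) r by simp
        qed
      qed
    qed
  qed
  \<comment> \<open>The case \<open>\<epsilon> = 1\<close> fixes a starting radius, so that some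
    approximation exists at every scale and not merely eventually.\<close>
  obtain r1 where r1: "r1 > 0" and ap1: "\<And>r. 0 < r \<Longrightarrow> r < r1 \<Longrightarrow>
      \<exists>P. \<forall>h. cmod h \<le> r \<longrightarrow> \<bar>(v h - w h) - Re (poly P h)\<bar> \<le> 74 * 1 * r\<^sup>2"
    using approx[of 1] by auto
  define \<rho> where "\<rho> = min r1 R / 2"
  have \<rho>: "0 < \<rho>" "\<rho> < r1" "\<rho> < R" using r1 R by (auto simp: \<rho>_def)
  have rk: "0 < \<rho> / 16 ^ k" "\<rho> / 16 ^ k \<le> \<rho>" for k using \<rho> by (simp_all add: divide_le_eq)
  have r_lim: "(\<lambda>k. \<rho> / 16 ^ k) \<longlonglongrightarrow> 0"
    using tendsto_mult[OF tendsto_const[of \<rho>] LIMSEQ_realpow_zero[of "1 / 16"]] by (simp add: power_divide)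
  define Q where "Q k \<epsilon> \<longleftrightarrow> (\<exists>P. \<forall>h. cmod h \<le> \<rho> / 16 ^ k \<longrightarrow> \<bar>(v h - w h) - Re (poly P h)\<bar> \<le> 74 * \<epsilon> * (\<rho> / 16 ^ k)\<^sup>2)" for k \<epsilon>
  have "\<exists>\<delta>. \<delta> \<longlonglongrightarrow> 0 \<and> (\<forall>k. 0 \<le> \<delta> k \<and> Q k (\<delta> k))"
  proof (rule vanishing_errors_choice)
    show "Q k 1" for k unfolding Q_def by (intro ap1 rk(1) le_less_trans[OF rk(2) \<rho>(2)])
    show "Q k e'" if "Q k e" "e \<le> e'" for k e e'
    proof -
      have "74 * e * (\<rho> / 16 ^ k)\<^sup>2 \<le> 74 * e' * (\<rho> / 16 ^ k)\<^sup>2" using that(2) by (intro mult_right_mono) auto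
      then show ?thesis using that(1) unfolding Q_def by (meson order_trans)
    qed
    show "\<forall>\<^sub>F k in sequentially. Q k e" if e: "0 < e" "e \<le> 1" for e
    proof -
      obtain r0 where r0: "r0 > 0" and ap: "\<And>r. 0 < r \<Longrightarrow> r < r0 \<Longrightarrow>
          \<exists>P. \<forall>h. cmod h \<le> r \<longrightarrow> \<bar>(v h - w h) - Re (poly P h)\<bar> \<le> 74 * e * r\<^sup>2"
        using approx[OF e] by blast
      have "\<forall>\<^sub>F k in sequentially. \<rho> / 16 ^ k < r0" using r_lim r0 by (rule order_tendstoD(2))
      then show ?thesis by eventually_elim (use ap rk in \<open>simp add: Q_def\<close>)
    qed
  qed
  then obtain \<delta> where \<delta>: "\<delta> \<longlonglongrightarrow> 0" "\<And>k. Q k (\<delta> k)" by blast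
  have "(\<lambda>k. 74 * \<delta> k) \<longlonglongrightarrow> 0" using tendsto_mult[OF tendsto_const \<delta>(1), of 74] by simp
  moreover have "continuous_on (cball 0 \<rho>) (\<lambda>h. v h - w h)"
    by (intro continuous_on_diff cw continuous_on_subset[OF cont]) (use \<rho> in auto)
  moreover have "v 0 - w 0 = 0" using v0 log_quadratic_at_0(1)[OF lw] by simp
  moreover have "((\<lambda>h. v h - w h) has_derivative (\<lambda>_. 0)) (at 0)"
    using has_derivative_diff[OF dv log_quadratic_at_0(2)[OF lw]] by simp
  ultimately obtain e m where "m \<longlonglongrightarrow> 0" "(\<lambda>k. e (Suc k) - e k) \<longlonglongrightarrow> 0"
    "\<And>k h. cmod h \<le> \<rho> / 16 ^ k \<Longrightarrow> \<bar>v h - w h - Re (e k * h\<^sup>2)\<bar> \<le> m k * (\<rho> / 16 ^ k)\<^sup>2"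
    using harmonic_expansion_at_0[OF \<rho>(1), of "\<lambda>h. v h - w h" "\<lambda>k. 74 * \<delta> k"] \<delta>(2) unfolding Q_def by blast
  then show thesis using that \<rho>(1,3) by blast
qed

section \<open>Exclusion of the sign patterns whose model has no logarithm\<close>

lemma direction_sign:
  assumes "0 < \<rho>"
  shows "\<forall>\<^sub>F k in sequentially. \<forall>\<zeta>. cmod \<zeta> = 1 \<longrightarrow> 1 / 5 < \<bar>x1 \<zeta>\<bar> \<longrightarrow> 1 / 5 < \<bar>x2 \<zeta>\<bar> \<longrightarrow>
    (0 < v (of_real (\<rho> / 16 ^ k) * \<zeta>) \<longleftrightarrow> positive_near (0 < x1 \<zeta>) (0 < x2 \<zeta>))"
proof -
  obtain r where r: "r > 0" and sg: "\<And>z. cmod z < r \<Longrightarrow> 1 / 5 * cmod z < \<bar>x1 z\<bar> \<Longrightarrow> 1 / 5 * cmod z < \<bar>x2 z\<bar> \<Longrightarrow>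
        (0 < v z \<longleftrightarrow> positive_near (0 < x1 z) (0 < x2 z))"
    using quadrant_sign[of "1 / 5"] by auto
  have "(\<lambda>k. \<rho> / 16 ^ k) \<longlonglongrightarrow> 0"
    using tendsto_mult[OF tendsto_const[of \<rho>] LIMSEQ_realpow_zero[of "1 / 16"]] by (simp add: power_divide)
  then have "\<forall>\<^sub>F k in sequentially. \<rho> / 16 ^ k < r" using r by (rule order_tendstoD(2))
  then show ?thesis
  proof eventually_elim
    case (elim k)
    define t where "t = \<rho> / 16 ^ k"
    have t: "0 < t" "t < r" using assms elim by (auto simp: t_def)
    show ?case
      unfolding t_def[symmetric]
    proof (intro allI impI)
      fix \<zeta>
      assume \<zeta>: "cmod \<zeta> = 1" "1 / 5 < \<bar>x1 \<zeta>\<bar>" "1 / 5 < \<bar>x2 \<zeta>\<bar>"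
      have "cmod (of_real t * \<zeta>) = t" using t \<zeta> by (simp add: norm_mult)
      moreover have "t * (1 / 5) < t * \<bar>x1 \<zeta>\<bar>" "t * (1 / 5) < t * \<bar>x2 \<zeta>\<bar>"
        using t \<zeta> by (auto intro!: mult_strict_left_mono)
      moreover have "\<bar>t * x1 \<zeta>\<bar> = t * \<bar>x1 \<zeta>\<bar>" "\<bar>t * x2 \<zeta>\<bar> = t * \<bar>x2 \<zeta>\<bar>" using t by (auto simp: abs_mult)
      moreover have "0 < t * x1 \<zeta> \<longleftrightarrow> 0 < x1 \<zeta>" "0 < t * x2 \<zeta> \<longleftrightarrow> 0 < x2 \<zeta>"
        using t by (auto simp: zero_less_mult_iff)
      ultimately show "0 < v (of_real t * \<zeta>) \<longleftrightarrow> positive_near (0 < x1 \<zeta>) (0 < x2 \<zeta>)"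
        using sg[of "of_real t * \<zeta>"] t(2) unfolding x_scale by (simp add: mult.commute)
    qed
  qed
qed

text \<open>In a direction off the cross where \<open>Re (e k * \<zeta>\<^sup>2)\<close> is at least
  half of \<open>cmod (e k)\<close>, the sign of \<open>v\<close> forces
  \<open>cmod (e k) \<le> 2 * m k\<close>. Hence \<open>v\<close> is of smaller order than
  \<open>r\<^sup>2\<close>, against non-degeneracy.\<close>

lemma not_all_nonpositive:
  assumes "\<And>\<alpha> \<beta>. \<not> positive_near \<alpha> \<beta>"
  shows False
proof -
  have m: "cross_model \<theta> 4 (\<lambda>_. 0) (\<lambda>_. 0)" using cross_model_mono[OF cross_model_zero] by simp
  have l: "log_quadratic 0 (\<lambda>_. 0)" by (rule log_quadratic_bounded[of _ 0]) simp
  obtain \<rho> e m where em: "0 < \<rho>" "m \<longlonglongrightarrow> (0::real)"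
    "\<And>k h. cmod h \<le> \<rho> / 16 ^ k \<Longrightarrow> \<bar>v h - 0 - Re (e k * h\<^sup>2)\<bar> \<le> m k * (\<rho> / 16 ^ k)\<^sup>2"
    by (rule expansion[OF m l]) (use assms in auto)
  obtain c r0 where c: "c > 0" "r0 > 0" "\<And>r. 0 < r \<Longrightarrow> r < r0 \<Longrightarrow> \<exists>z. cmod z < r \<and> v z \<le> - c * r\<^sup>2"
    using nondeg by blast
  have "(\<lambda>k. \<rho> / 16 ^ k) \<longlonglongrightarrow> 0"
    using tendsto_mult[OF tendsto_const[of \<rho>] LIMSEQ_realpow_zero[of "1 / 16"]] by (simp add: power_divide)
  then have "\<forall>\<^sub>F k in sequentially. \<rho> / 16 ^ k < r0" using c(2) by (rule order_tendstoD(2))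
  moreover have "\<forall>\<^sub>F k in sequentially. m k < c / 4" using em(2) c(1) by (intro order_tendstoD(2)) auto
  ultimately have "\<forall>\<^sub>F k in sequentially. False" using direction_sign[OF em(1)]
  proof eventually_elim
    case (elim k)
    define t where "t = \<rho> / 16 ^ k"
    have t: "0 < t" "t < r0" using em(1) elim by (auto simp: t_def)
    have exp: "\<bar>v h - Re (e k * h\<^sup>2)\<bar> \<le> m k * t\<^sup>2" if "cmod h \<le> t" for h
      using em(3)[of h k] that by (simp add: t_def)
    obtain \<zeta> where \<zeta>: "cmod \<zeta> = 1" "1 / 5 < \<bar>x1 \<zeta>\<bar>" "1 / 5 < \<bar>x2 \<zeta>\<bar>" "cmod (e k) / 2 \<le> Re (e k * \<zeta>\<^sup>2)"
      unfolding x1_def x2_def by (rule direction_off_cross)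
    have "v (of_real t * \<zeta>) \<le> 0"
      using elim(3) \<zeta>(1-3) assms unfolding t_def[symmetric] by (meson not_less)
    moreover have "\<bar>v (of_real t * \<zeta>) - Re (e k * (of_real t * \<zeta>)\<^sup>2)\<bar> \<le> m k * t\<^sup>2"
      using \<zeta>(1) t by (intro exp) (simp add: norm_mult)
    moreover have "e k * (of_real t * \<zeta>)\<^sup>2 = of_real (t\<^sup>2) * (e k * \<zeta>\<^sup>2)" by (simp add: power_mult_distrib)
    then have "Re (e k * (of_real t * \<zeta>)\<^sup>2) = t\<^sup>2 * Re (e k * \<zeta>\<^sup>2)"
      by (simp only: times_complex.sel Re_complex_of_real Im_complex_of_real mult_zero_left diff_zero)
    ultimately have "t\<^sup>2 * Re (e k * \<zeta>\<^sup>2) \<le> t\<^sup>2 * m k" by (simp add: mult.commute)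
    then have ek: "cmod (e k) / 2 \<le> m k" using \<zeta>(4) t(1) by simp
    obtain h where h: "cmod h < t" "v h \<le> - c * t\<^sup>2" using c(3)[OF t] by blast
    have "\<bar>Re (e k * h\<^sup>2)\<bar> \<le> cmod (e k) * (cmod h)\<^sup>2"
      using abs_Re_le_cmod[of "e k * h\<^sup>2"] by (simp only: norm_mult norm_power)
    also have "\<dots> \<le> cmod (e k) * t\<^sup>2" using h(1) by (intro mult_left_mono power_mono) auto
    finally have "\<bar>Re (e k * h\<^sup>2)\<bar> \<le> cmod (e k) * t\<^sup>2" .
    then have "c * t\<^sup>2 \<le> (cmod (e k) + m k) * t\<^sup>2"
      using exp[of h] h by (simp add: algebra_simps)
    then have "c \<le> cmod (e k) + m k" using t(1) by simp
    then show False using ek elim(2) c(1) by linarith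
  qed
  then show False by simp
qed

text \<open>The model \<open>- (cmod z)\<^sup>2 / 4\<close> is negative, and in some direction off
  the cross the harmonic quadratic is nonpositive. There \<open>v\<close> would be negative at small
  scales.\<close>

lemma not_all_positive:
  assumes "\<And>\<alpha> \<beta>. positive_near \<alpha> \<beta>"
  shows False
proof -
  have "has_laplacian (\<lambda>z. - (1 / 4) * (cmod (z - 0))\<^sup>2) (- (1 / 4) * 4) z" for z
    by (intro has_laplacian_cmult has_laplacian_cmod_power2)
  then have "cross_model \<theta> 4 (\<lambda>z. - (1 / 4) * (cmod z)\<^sup>2) (\<lambda>_. 1)"
    by (intro cross_modelI_smooth) auto
  moreover have "log_quadratic 0 (\<lambda>z. - (1 / 4) * (cmod z)\<^sup>2)"
    by (rule log_quadratic_bounded[of _ "1 / 4"]) (simp add: abs_mult)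
  ultimately obtain \<rho> e m where em: "0 < \<rho>" "m \<longlonglongrightarrow> (0::real)"
    "\<And>k h. cmod h \<le> \<rho> / 16 ^ k \<Longrightarrow> \<bar>v h - - (1 / 4) * (cmod h)\<^sup>2 - Re (e k * h\<^sup>2)\<bar> \<le> m k * (\<rho> / 16 ^ k)\<^sup>2"
    by (rule expansion) (use assms in auto)
  have "\<forall>\<^sub>F k in sequentially. m k < 1 / 4" using em(2) by (intro order_tendstoD(2)) auto
  then have "\<forall>\<^sub>F k in sequentially. False" using direction_sign[OF em(1)]
  proof eventually_elim
    case (elim k)
    define t where "t = \<rho> / 16 ^ k"
    have t: "0 < t" using em(1) by (auto simp: t_def)
    obtain \<zeta> where \<zeta>: "cmod \<zeta> = 1" "1 / 5 < \<bar>x1 \<zeta>\<bar>" "1 / 5 < \<bar>x2 \<zeta>\<bar>" "cmod (- e k) / 2 \<le> Re (- e k * \<zeta>\<^sup>2)"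
      unfolding x1_def x2_def by (rule direction_off_cross)
    have nt: "cmod (of_real t * \<zeta>) = t" using \<zeta>(1) t by (simp add: norm_mult)
    have "0 < v (of_real t * \<zeta>)"
      using elim(2) \<zeta>(1-3) assms unfolding t_def[symmetric] by blast
    moreover have "\<bar>v (of_real t * \<zeta>) - - (1 / 4) * t\<^sup>2 - Re (e k * (of_real t * \<zeta>)\<^sup>2)\<bar> \<le> m k * t\<^sup>2"
      using em(3)[of "of_real t * \<zeta>" k] nt by (simp add: t_def)
    moreover have "e k * (of_real t * \<zeta>)\<^sup>2 = of_real (t\<^sup>2) * (e k * \<zeta>\<^sup>2)" by (simp add: power_mult_distrib)
    then have "Re (e k * (of_real t * \<zeta>)\<^sup>2) = t\<^sup>2 * Re (e k * \<zeta>\<^sup>2)"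
      by (simp only: times_complex.sel Re_complex_of_real Im_complex_of_real mult_zero_left diff_zero)
    moreover have "t\<^sup>2 * Re (e k * \<zeta>\<^sup>2) \<le> 0"
    proof -
      have "0 \<le> cmod (- e k) / 2" by simp
      then have "0 \<le> Re (- e k * \<zeta>\<^sup>2)" using \<zeta>(4) by linarith
      then have "Re (e k * \<zeta>\<^sup>2) \<le> 0" by simp
      then show ?thesis by (intro mult_nonneg_nonpos) auto
    qed
    ultimately have "(1 / 4) * t\<^sup>2 < m k * t\<^sup>2" by linarith
    then show False using elim(1) t by simp
  qed
  then show False by simp
qed

text \<open>A quadratic form takes the same value at opposite points. On the nonpositive side the
  favourable direction yields \<open>cmod (e k) \<le> 2 * m k\<close>; at the opposite point the
  model is at most \<open>- t\<^sup>2 / 50\<close>, so positivity of \<open>v\<close> would require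
  \<open>1 / 50 < 3 * m k\<close>. This is the origin of the bound 1/150.\<close>

lemma not_half_plane:
  assumes e0: "cmod e0 = 1" and cr: "\<And>z. Im (e0 * z) = 0 \<Longrightarrow> on_cross \<theta> z"
    and pos: "\<And>z. \<not> on_cross \<theta> z \<Longrightarrow> positive_near (0 < x1 z) (0 < x2 z) \<longleftrightarrow> 0 < Im (e0 * z)"
    and big: "\<And>z. \<bar>Im (e0 * z)\<bar> = \<bar>x1 z\<bar> \<or> \<bar>Im (e0 * z)\<bar> = \<bar>x2 z\<bar>"
  shows False
proof -
  let ?w = "\<lambda>z. - (1 / 2) * (max 0 (Im (e0 * z)))\<^sup>2"
  have "cross_model \<theta> 4 ?w (\<lambda>z. of_bool (0 < Im (e0 * z)))"
    by (rule cross_model_mono[OF cross_model_half_plane[OF e0 cr]]) auto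
  moreover have "log_quadratic 0 ?w"
  proof (rule log_quadratic_bounded[of _ "1 / 2"])
    fix z
    have "\<bar>max 0 (Im (e0 * z))\<bar> \<le> cmod z"
      using abs_Im_le_cmod[of "e0 * z"] by (simp add: norm_mult e0)
    then have "(max 0 (Im (e0 * z)))\<^sup>2 \<le> (cmod z)\<^sup>2" using power_mono by fastforce
    then show "\<bar>?w z\<bar> \<le> 1 / 2 * (cmod z)\<^sup>2" by (simp add: abs_mult)
  qed
  ultimately obtain \<rho> e m where em: "0 < \<rho>" "m \<longlonglongrightarrow> (0::real)"
    "\<And>k h. cmod h \<le> \<rho> / 16 ^ k \<Longrightarrow> \<bar>v h - ?w h - Re (e k * h\<^sup>2)\<bar> \<le> m k * (\<rho> / 16 ^ k)\<^sup>2"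
    by (rule expansion) (use pos in auto)
  have "\<forall>\<^sub>F k in sequentially. m k < 1 / 150" using em(2) by (intro order_tendstoD(2)) auto
  then have "\<forall>\<^sub>F k in sequentially. False" using direction_sign[OF em(1)]
  proof eventually_elim
    case (elim k)
    define t where "t = \<rho> / 16 ^ k"
    have t: "0 < t" using em(1) by (auto simp: t_def)
    obtain \<zeta>' where \<zeta>': "cmod \<zeta>' = 1" "1 / 5 < \<bar>x1 \<zeta>'\<bar>" "1 / 5 < \<bar>x2 \<zeta>'\<bar>" "cmod (e k) / 2 \<le> Re (e k * \<zeta>'\<^sup>2)"
      unfolding x1_def x2_def by (rule direction_off_cross)
    define \<zeta> where "\<zeta> = (if Im (e0 * \<zeta>') < 0 then \<zeta>' else - \<zeta>')"
    have \<zeta>: "cmod \<zeta> = 1" "1 / 5 < \<bar>x1 \<zeta>\<bar>" "1 / 5 < \<bar>x2 \<zeta>\<bar>" "cmod (e k) / 2 \<le> Re (e k * \<zeta>\<^sup>2)"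
      using \<zeta>' by (auto simp: \<zeta>_def x_minus)
    have "1 / 5 < \<bar>Im (e0 * \<zeta>)\<bar>" using big[of \<zeta>] \<zeta>(2,3) by auto
    then have neg: "Im (e0 * \<zeta>) < - (1 / 5)" by (auto simp: \<zeta>_def split: if_splits)
    have off: "\<not> on_cross \<theta> \<zeta>" "\<not> on_cross \<theta> (- \<zeta>)" using \<zeta>(2,3) by (auto simp: on_cross_iff x_minus)
    have scale: "e k * (of_real t * y)\<^sup>2 = of_real (t\<^sup>2) * (e k * y\<^sup>2)" for y by (simp add: power_mult_distrib)
    have scale': "Re (e k * (of_real t * y)\<^sup>2) = t\<^sup>2 * Re (e k * y\<^sup>2)" for y
      unfolding scale by (simp only: times_complex.sel Re_complex_of_real Im_complex_of_real mult_zero_left diff_zero)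
    have ims: "Im (e0 * (of_real t * y)) = t * Im (e0 * y)" for y by (simp add: algebra_simps)
    have exp: "\<bar>v (of_real t * y) - - (1 / 2) * (max 0 (t * Im (e0 * y)))\<^sup>2 - t\<^sup>2 * Re (e k * y\<^sup>2)\<bar> \<le> m k * t\<^sup>2"
      if "cmod y = 1" for y
    proof -
      have "cmod (of_real t * y) = t" using that t by (simp add: norm_mult)
      then have "cmod (of_real t * y) \<le> \<rho> / 16 ^ k" by (simp add: t_def)
      from em(3)[OF this] show ?thesis unfolding scale' ims t_def[symmetric] .
    qed
    have "\<not> 0 < v (of_real t * \<zeta>)"
      using elim(2)[rule_format, OF \<zeta>(1-3)] pos[OF off(1)] neg unfolding t_def[symmetric] by linarith
    moreover have "t * Im (e0 * \<zeta>) \<le> 0" using neg t by (intro mult_nonneg_nonpos) linarith+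
    then have "max 0 (t * Im (e0 * \<zeta>)) = 0" by (rule max_absorb1)
    ultimately have "t\<^sup>2 * Re (e k * \<zeta>\<^sup>2) \<le> t\<^sup>2 * m k" using exp[OF \<zeta>(1)] by (simp add: mult.commute)
    then have small: "cmod (e k) / 2 \<le> m k" using \<zeta>(4) t by simp
    have m\<zeta>: "cmod (- \<zeta>) = 1" "1 / 5 < \<bar>x1 (- \<zeta>)\<bar>" "1 / 5 < \<bar>x2 (- \<zeta>)\<bar>"
      using \<zeta>(1-3) by (auto simp: x_minus)
    have "0 < v (of_real t * - \<zeta>)"
      using elim(2)[rule_format, OF m\<zeta>] pos[OF off(2)] neg unfolding t_def[symmetric] by simp
    moreover have "t\<^sup>2 * Re (e k * (- \<zeta>)\<^sup>2) \<le> t\<^sup>2 * cmod (e k)"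
    proof (rule mult_left_mono)
      have "Re (e k * (- \<zeta>)\<^sup>2) \<le> cmod (e k * (- \<zeta>)\<^sup>2)" by (rule complex_Re_le_cmod)
      also have "\<dots> = cmod (e k)" using \<zeta>(1) by (simp add: norm_mult norm_power)
      finally show "Re (e k * (- \<zeta>)\<^sup>2) \<le> cmod (e k)" .
    qed simp
    moreover have "t\<^sup>2 * (1 / 25) \<le> (max 0 (t * Im (e0 * - \<zeta>)))\<^sup>2"
    proof -
      have "t * (1 / 5) \<le> t * Im (e0 * - \<zeta>)" using neg t by (intro mult_left_mono) auto
      then have "t * (1 / 5) \<le> max 0 (t * Im (e0 * - \<zeta>))" by linarith
      then have "(t * (1 / 5))\<^sup>2 \<le> (max 0 (t * Im (e0 * - \<zeta>)))\<^sup>2"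
        by (rule power_mono) (use t in simp)
      then show ?thesis by (simp add: power_mult_distrib power2_eq_square)
    qed
    ultimately have "t\<^sup>2 * (1 / 50) < t\<^sup>2 * cmod (e k) + t\<^sup>2 * m k"
      using exp[OF m\<zeta>(1)] by (simp only: mult.commute[of "m k"] abs_le_iff) linarith
    then have "1 / 50 < cmod (e k) + m k" using t by (simp flip: distrib_left)
    then show False using small elim(1) by linarith
  qed
  then show False by simp
qed

text \<open>Equality leaves six patterns: all sectors, none, and the four pairs of adjacent sectors.
  Each contradicts one of the three preceding exclusions, the adjacent pairs because they fill a
  half plane up to the cross.\<close>

lemma unbalanced:
  "of_bool (positive_near False True) + of_bool (positive_near True False)
     \<noteq> (of_bool (positive_near True True) + of_bool (positive_near False False) :: real)"
proof
  assume bal: "of_bool (positive_near False True) + of_bool (positive_near True False)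
     = (of_bool (positive_near True True) + of_bool (positive_near False False) :: real)"
  note defs = x1_def[symmetric] x2_def[symmetric]
  have hp: "False" if "e0 \<in> {cis (- \<theta>), - cis (- \<theta>), cis \<theta>, - cis \<theta>}"
      "\<And>z. \<not> on_cross \<theta> z \<Longrightarrow> positive_near (0 < x1 z) (0 < x2 z) \<longleftrightarrow> 0 < Im (e0 * z)" for e0
  proof (rule not_half_plane[of e0])
    have i: "Im (e0 * z) \<in> {x1 z, - x1 z, x2 z, - x2 z}" for z
      using that(1) by (auto simp: x_eq algebra_simps)
    show "cmod e0 = 1" using that(1) by auto
    show "on_cross \<theta> z" if "Im (e0 * z) = 0" for z using i[of z] that by (auto simp: on_cross_iff)
    show "\<bar>Im (e0 * z)\<bar> = \<bar>x1 z\<bar> \<or> \<bar>Im (e0 * z)\<bar> = \<bar>x2 z\<bar>" for z using i[of z] by auto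
  qed (rule that(2))
  have im: "Im (cis (- \<theta>) * z) = x1 z" "Im (- cis (- \<theta>) * z) = - x1 z"
    "Im (cis \<theta> * z) = x2 z" "Im (- cis \<theta> * z) = - x2 z" for z
    by (simp_all add: x_eq algebra_simps)
  show False
  proof (cases "positive_near False True"; cases "positive_near True False";
      cases "positive_near True True"; cases "positive_near False False")
    assume "positive_near False True" "positive_near True False" "positive_near True True" "positive_near False False"
    then have "positive_near \<alpha> \<beta>" for \<alpha> \<beta> by (cases \<alpha>; cases \<beta>) auto
    then show False by (rule not_all_positive)
  next
    assume "\<not> positive_near False True" "\<not> positive_near True False" "\<not> positive_near True True" "\<not> positive_near False False"
    then have "\<not> positive_near \<alpha> \<beta>" for \<alpha> \<beta> by (cases \<alpha>; cases \<beta>) auto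
    then show False by (rule not_all_nonpositive)
  next
    assume *: "positive_near False True" "\<not> positive_near True False" "positive_near True True" "\<not> positive_near False False"
    show False
    proof (rule hp[of "cis \<theta>"])
      show "positive_near (0 < x1 z) (0 < x2 z) \<longleftrightarrow> 0 < Im (cis \<theta> * z)" for z
        unfolding im using * by (cases "0 < x1 z"; cases "0 < x2 z") auto
    qed simp
  next
    assume *: "positive_near False True" "\<not> positive_near True False" "\<not> positive_near True True" "positive_near False False"
    show False
    proof (rule hp[of "- cis (- \<theta>)"])
      show "positive_near (0 < x1 z) (0 < x2 z) \<longleftrightarrow> 0 < Im (- cis (- \<theta>) * z)" if "\<not> on_cross \<theta> z" for z
        unfolding im using * that by (cases "0 < x1 z"; cases "0 < x2 z") (auto simp: on_cross_iff)
    qed simp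
  next
    assume *: "\<not> positive_near False True" "positive_near True False" "positive_near True True" "\<not> positive_near False False"
    show False
    proof (rule hp[of "cis (- \<theta>)"])
      show "positive_near (0 < x1 z) (0 < x2 z) \<longleftrightarrow> 0 < Im (cis (- \<theta>) * z)" for z
        unfolding im using * by (cases "0 < x1 z"; cases "0 < x2 z") auto
    qed simp
  next
    assume *: "\<not> positive_near False True" "positive_near True False" "\<not> positive_near True True" "positive_near False False"
    show False
    proof (rule hp[of "- cis \<theta>"])
      show "positive_near (0 < x1 z) (0 < x2 z) \<longleftrightarrow> 0 < Im (- cis \<theta> * z)" if "\<not> on_cross \<theta> z" for z
        unfolding im using * that by (cases "0 < x1 z"; cases "0 < x2 z") (auto simp: on_cross_iff)
    qed simp
  qed (use bal in simp_all)
qed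

text \<open>The upper and lower sectors have half-opening \<open>pi / 2 - \<theta>\<close> and are
  carried to the right one by quarter turns. Since \<open>sin (2 * \<theta>)\<close> is the same for
  both angles and a quarter turn changes the sign of \<open>Re (z\<^sup>2)\<close>, their logarithms
  enter with the opposite sign.\<close>

lemma model_solution:
  defines "A \<equiv> - sin (2 * \<theta>) / (4 * pi)"
  obtains w s where "cross_model \<theta> 4 w s"
    and "log_quadratic (A * (of_bool (positive_near False True) + of_bool (positive_near True False)
      - of_bool (positive_near True True) - of_bool (positive_near False False))) w"
    and "\<And>z. \<not> on_cross \<theta> z \<Longrightarrow> s z = of_bool (positive_near (0 < x1 z) (0 < x2 z))"
proof -
  define \<theta>' where "\<theta>' = pi / 2 - \<theta>"
  have t': "0 < \<theta>'" "\<theta>' < pi / 2" using theta by (auto simp: \<theta>'_def)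
  have cs: "cos \<theta>' = sin \<theta>" "sin \<theta>' = cos \<theta>" by (simp_all add: \<theta>'_def cos_diff sin_diff)
  define f where "f \<theta> z = (of_bool (Im (cis (- \<theta>) * z) < 0 \<and> 0 < Im (cis \<theta> * z)) :: real)" for \<theta> z
  have W: "cross_model \<theta> 1 (sector_solution \<theta>) (f \<theta>)" "cross_model \<theta>' 1 (sector_solution \<theta>') (f \<theta>')"
    unfolding f_def by (intro cross_model_sector_solution theta t')+
  have r1: "Im (cis (- \<theta>) * (- 1 * z)) = - x1 z" "Im (cis \<theta> * (- 1 * z)) = - x2 z" for z
    by (simp_all add: x_eq)
  have r2: "Im (cis (- \<theta>') * (- \<i> * z)) = - x2 z" "Im (cis \<theta>' * (- \<i> * z)) = x1 z" for z
    by (simp_all add: x_eq cs)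
  have r3: "Im (cis (- \<theta>') * (\<i> * z)) = x2 z" "Im (cis \<theta>' * (\<i> * z)) = - x1 z" for z
    by (simp_all add: x_eq cs)
  have modR: "cross_model \<theta> 1 (sector_solution \<theta>) (f \<theta>)" by (rule W)
  have modL: "cross_model \<theta> 1 (\<lambda>z. sector_solution \<theta> (- 1 * z)) (\<lambda>z. f \<theta> (- 1 * z))"
    by (rule cross_model_rotate[OF W(1)]) (simp_all add: on_cross_iff x_minus)
  have modT: "cross_model \<theta> 1 (\<lambda>z. sector_solution \<theta>' (- \<i> * z)) (\<lambda>z. f \<theta>' (- \<i> * z))"
    by (rule cross_model_rotate[OF W(2)]) (auto simp only: on_cross_def r2 x1_def[symmetric] x2_def[symmetric] neg_equal_0_iff_equal norm_minus_cancel norm_ii)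
  have modB: "cross_model \<theta> 1 (\<lambda>z. sector_solution \<theta>' (\<i> * z)) (\<lambda>z. f \<theta>' (\<i> * z))"
    by (rule cross_model_rotate[OF W(2)]) (auto simp only: on_cross_def r3 x1_def[symmetric] x2_def[symmetric] neg_equal_0_iff_equal norm_ii)
  have s2: "sin (2 * \<theta>') = sin (2 * \<theta>)" by (simp add: sin_double cs)
  have LR: "log_quadratic A (sector_solution \<theta>)" unfolding A_def by (rule log_quadratic_sector_solution)
  have L': "log_quadratic A (sector_solution \<theta>')" unfolding A_def s2[symmetric] by (rule log_quadratic_sector_solution)
  have LL: "log_quadratic (1 * A) (\<lambda>z. sector_solution \<theta> (- 1 * z))"
    by (rule log_quadratic_rotate[OF LR]) auto
  have LT: "log_quadratic (- 1 * A) (\<lambda>z. sector_solution \<theta>' (- \<i> * z))"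
    by (rule log_quadratic_rotate[OF L']) (auto simp: power_mult_distrib)
  have LB: "log_quadratic (- 1 * A) (\<lambda>z. sector_solution \<theta>' (\<i> * z))"
    by (rule log_quadratic_rotate[OF L']) (auto simp: power_mult_distrib)
  define bR bL bT bB where "bR = positive_near False True" and "bL = positive_near True False"
    and "bT = positive_near True True" and "bB = positive_near False False"
  note b_defs = bR_def bL_def bT_def bB_def
  show thesis
  proof (rule that)
    show "cross_model \<theta> 4
      (\<lambda>z. (of_bool bR * sector_solution \<theta> z + of_bool bL * sector_solution \<theta> (- 1 * z))
         + (of_bool bT * sector_solution \<theta>' (- \<i> * z) + of_bool bB * sector_solution \<theta>' (\<i> * z)))
      (\<lambda>z. (of_bool bR * f \<theta> z + of_bool bL * f \<theta> (- 1 * z))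
         + (of_bool bT * f \<theta>' (- \<i> * z) + of_bool bB * f \<theta>' (\<i> * z)))"
      by (rule cross_model_mono[OF cross_model_add[OF cross_model_add[OF cross_model_of_bool[OF modR] cross_model_of_bool[OF modL]]
          cross_model_add[OF cross_model_of_bool[OF modT] cross_model_of_bool[OF modB]]]]) simp
    show "log_quadratic (A * (of_bool (positive_near False True) + of_bool (positive_near True False)
        - of_bool (positive_near True True) - of_bool (positive_near False False)))
      (\<lambda>z. (of_bool bR * sector_solution \<theta> z + of_bool bL * sector_solution \<theta> (- 1 * z))
         + (of_bool bT * sector_solution \<theta>' (- \<i> * z) + of_bool bB * sector_solution \<theta>' (\<i> * z)))"
      using log_quadratic_add[OF log_quadratic_add[OF log_quadratic_of_bool[OF LR, of bR] log_quadratic_of_bool[OF LL, of bL]]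
          log_quadratic_add[OF log_quadratic_of_bool[OF LT, of bT] log_quadratic_of_bool[OF LB, of bB]]]
      unfolding b_defs[symmetric] by (simp add: algebra_simps)
    show "(of_bool bR * f \<theta> z + of_bool bL * f \<theta> (- 1 * z))
         + (of_bool bT * f \<theta>' (- \<i> * z) + of_bool bB * f \<theta>' (\<i> * z)) = of_bool (positive_near (0 < x1 z) (0 < x2 z))"
      if "\<not> on_cross \<theta> z" for z
    proof -
      have "x1 z \<noteq> 0" "x2 z \<noteq> 0" using that by (auto simp: on_cross_iff)
      then consider "0 < x1 z" "0 < x2 z" | "0 < x1 z" "x2 z < 0" | "x1 z < 0" "0 < x2 z" | "x1 z < 0" "x2 z < 0"
        by linarith
      then show ?thesis
        unfolding f_def r1 r2 r3 x1_def[symmetric] x2_def[symmetric] b_defs by cases (auto simp: x_minus)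
    qed
  qed
qed

lemma quadratic_growth:
  obtains \<rho> a C \<sigma> where "0 < \<rho>" "\<rho> < R" "\<sigma> \<in> {-1, 1::real}"
    and "\<And>k h. cmod h \<le> \<rho> / 16 ^ k \<Longrightarrow> \<bar>v h - Re (a k * h\<^sup>2)\<bar> \<le> C * (\<rho> / 16 ^ k)\<^sup>2"
    and "filterlim (\<lambda>k. cmod (a k)) at_top sequentially"
    and "(\<lambda>k. a k / of_real (cmod (a k))) \<longlonglongrightarrow> of_real \<sigma>"
proof -
  define A where "A = - sin (2 * \<theta>) / (4 * pi)"
  define c where "c = A * (of_bool (positive_near False True) + of_bool (positive_near True False)
      - of_bool (positive_near True True) - of_bool (positive_near False False))"
  have "0 < sin (2 * \<theta>)" using theta by (intro sin_gt_zero) auto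
  then have "A \<noteq> 0" by (simp add: A_def)
  then have c0: "c \<noteq> 0" using unbalanced by (simp add: c_def)
  obtain w s where w: "cross_model \<theta> 4 w s" "log_quadratic c w"
    "\<And>z. \<not> on_cross \<theta> z \<Longrightarrow> s z = of_bool (positive_near (0 < x1 z) (0 < x2 z))"
    using model_solution unfolding c_def A_def by blast
  obtain \<rho> e m where em: "0 < \<rho>" "\<rho> < R" "m \<longlonglongrightarrow> (0::real)" "(\<lambda>k. e (Suc k) - e k) \<longlonglongrightarrow> (0::complex)"
    "\<And>k h. cmod h \<le> \<rho> / 16 ^ k \<Longrightarrow> \<bar>v h - w h - Re (e k * h\<^sup>2)\<bar> \<le> m k * (\<rho> / 16 ^ k)\<^sup>2"
    by (rule expansion[OF w]) blast+
  obtain C where C: "\<And>r z. 0 < r \<Longrightarrow> cmod z \<le> r \<Longrightarrow> \<bar>w z - c * ln r * Re (z\<^sup>2)\<bar> \<le> C * r\<^sup>2"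
    using log_quadratic_rescale[OF w(2)] by blast
  obtain D where D: "\<And>k. m k \<le> D"
    using convergent_imp_Bseq[OF convergentI[OF em(3)]] unfolding Bseq_def by (auto simp: abs_le_iff)
  define a where "a k = e k + of_real (c * ln (\<rho> / 16 ^ k))" for k
  have est: "\<bar>v h - Re (a k * h\<^sup>2)\<bar> \<le> (D + C) * (\<rho> / 16 ^ k)\<^sup>2" if "cmod h \<le> \<rho> / 16 ^ k" for k h
  proof -
    have "0 < \<rho> / 16 ^ k" using em(1) by simp
    from C[OF this that] have 1: "\<bar>w h - c * ln (\<rho> / 16 ^ k) * Re (h\<^sup>2)\<bar> \<le> C * (\<rho> / 16 ^ k)\<^sup>2" .
    have "m k * (\<rho> / 16 ^ k)\<^sup>2 \<le> D * (\<rho> / 16 ^ k)\<^sup>2" using D[of k] by (intro mult_right_mono) auto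
    then have 2: "\<bar>v h - w h - Re (e k * h\<^sup>2)\<bar> \<le> D * (\<rho> / 16 ^ k)\<^sup>2" using em(5)[OF that] by linarith
    have "Re (of_real (c * ln (\<rho> / 16 ^ k)) * h\<^sup>2) = c * ln (\<rho> / 16 ^ k) * Re (h\<^sup>2)"
      by (simp only: times_complex.sel Re_complex_of_real Im_complex_of_real mult_zero_left diff_zero)
    then have "Re (a k * h\<^sup>2) = Re (e k * h\<^sup>2) + c * ln (\<rho> / 16 ^ k) * Re (h\<^sup>2)"
      unfolding a_def distrib_right plus_complex.sel by simp
    then show ?thesis using 1 2 unfolding distrib_right by linarith
  qed
  define L where "L = - c * ln 16"
  have "L \<noteq> 0" using c0 by (simp add: L_def)
  \<comment> \<open>Division by \<open>k + 1\<close> removes the drift of \<open>e\<close> and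
    leaves the slope of the logarithm, \<open>- c * ln 16\<close> per step.\<close>
  have lim1: "(\<lambda>k. a k / of_nat (Suc k)) \<longlonglongrightarrow> of_real L"
  proof -
    have 1: "(\<lambda>k. e k / of_nat (Suc k)) \<longlonglongrightarrow> 0" by (rule increments_tendsto_0_imp_sublinear[OF em(4)])
    have eq: "c * ln (\<rho> / 16 ^ k) / real (Suc k) = L + c * (ln \<rho> + ln 16) * inverse (real (Suc k))" for k
      using em(1) by (simp add: L_def ln_div ln_realpow field_simps)
    have "(\<lambda>k. L + c * (ln \<rho> + ln 16) * inverse (real (Suc k))) \<longlonglongrightarrow> L + c * (ln \<rho> + ln 16) * 0"
      by (intro tendsto_intros LIMSEQ_inverse_real_of_nat)
    then have "(\<lambda>k. c * ln (\<rho> / 16 ^ k) / real (Suc k)) \<longlonglongrightarrow> L" unfolding eq by simp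
    then have "(\<lambda>k. complex_of_real (c * ln (\<rho> / 16 ^ k) / real (Suc k))) \<longlonglongrightarrow> of_real L"
      by (rule tendsto_of_real)
    from tendsto_add[OF 1 this] show ?thesis
      by (simp add: a_def add_divide_distrib del: of_nat_Suc)
  qed
  have lim2: "(\<lambda>k. cmod (a k) / real (Suc k)) \<longlonglongrightarrow> \<bar>L\<bar>"
    using tendsto_norm[OF lim1] by (simp add: norm_divide del: of_nat_Suc)
  have "filterlim (\<lambda>k. cmod (a k) / real (Suc k) * real (Suc k)) at_top sequentially"
  proof (rule filterlim_tendsto_pos_mult_at_top[OF lim2])
    show "0 < \<bar>L\<bar>" using \<open>L \<noteq> 0\<close> by simp
    show "filterlim (\<lambda>k. real (Suc k)) at_top sequentially"
      using filterlim_compose[OF filterlim_real_sequentially filterlim_Suc] .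
  qed
  then have top: "filterlim (\<lambda>k. cmod (a k)) at_top sequentially" by (simp del: of_nat_Suc)
  have "(\<lambda>k. (a k / of_nat (Suc k)) / of_real (cmod (a k) / real (Suc k))) \<longlonglongrightarrow> of_real L / of_real \<bar>L\<bar>"
    using \<open>L \<noteq> 0\<close> by (intro tendsto_divide lim1 tendsto_of_real lim2) auto
  then have dir: "(\<lambda>k. a k / of_real (cmod (a k))) \<longlonglongrightarrow> of_real (sgn L)"
    by (simp add: real_sgn_eq del: of_nat_Suc)
  have "sgn L \<in> {-1, 1}" using \<open>L \<noteq> 0\<close> by (auto simp: sgn_if)
  then show thesis using that[OF em(1,2) _ est top dir] by blast
qed

end

text \<open>On the disc about \<open>z\<close> of radius \<open>cmod z\<close>, subtracting the
  harmonic quadratic of the same scale preserves the differential inequalities and leaves a function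
  of order \<open>(cmod z)\<^sup>2\<close>. The interior estimate bounds the gradient error by a
  multiple of \<open>cmod z\<close>, negligible because the coefficients \<open>a k\<close> tend to
  infinity.\<close>

lemma (in cross_point) gradient_asymptotics:
  obtains \<sigma> f where "\<sigma> \<in> {-1, 1::real}" and "continuous_on (ball 0 R) f"
    and "\<And>z. cmod z < R \<Longrightarrow> (v has_derivative (\<lambda>h. Re (f z * h))) (at z)"
    and "\<And>\<delta>. 0 < \<delta> \<Longrightarrow> \<exists>r>0. \<forall>z. 0 < cmod z \<longrightarrow> cmod z < r \<longrightarrow>
      (\<exists>b>0. \<bar>v z - b * \<sigma> * Re (z\<^sup>2)\<bar> \<le> \<delta> * b * (cmod z)\<^sup>2 \<and>
        cmod (f z - of_real (2 * b * \<sigma>) * z) \<le> \<delta> * b * cmod z)"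
proof -
  obtain \<rho> a C \<sigma> where \<rho>: "0 < \<rho>" "\<rho> < R" and \<sigma>: "\<sigma> \<in> {-1, 1::real}"
    and est: "\<And>k h. cmod h \<le> \<rho> / 16 ^ k \<Longrightarrow> \<bar>v h - Re (a k * h\<^sup>2)\<bar> \<le> C * (\<rho> / 16 ^ k)\<^sup>2"
    and top: "filterlim (\<lambda>k. cmod (a k)) at_top sequentially"
    and dir: "(\<lambda>k. a k / of_real (cmod (a k))) \<longlonglongrightarrow> of_real \<sigma>"
    by (rule quadratic_growth) (rule that)
  obtain f where cf: "continuous_on (ball 0 R) f"
    and f: "\<And>z. z \<in> ball 0 R \<Longrightarrow> (v has_derivative (\<lambda>h. Re (f z * h))) (at z)"
    by (rule visc_continuous_gradient[of "ball 0 R" v]) (use visc_weak cont in auto)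
  have "C \<ge> 0"
  proof -
    have "0 \<le> C * \<rho>\<^sup>2" using est[of 0 0] \<rho> by (simp add: v0)
    then show ?thesis using \<rho> by (simp add: zero_le_mult_iff)
  qed
  \<comment> \<open>The scale \<open>k\<close> below satisfies
    \<open>\<rho> / 16 ^ k \<le> 32 * cmod z\<close>, and 1024 is the square of 32; 1028 is the
    threshold of the gradient estimate.\<close>
  define K where "K = max 1028 (1024 * C)"
  have K: "1028 \<le> K" "1024 * C \<le> K" by (auto simp: K_def)
  have grad: "cmod (f z - 2 * a k * z) \<le> 8 * (K + 2) * cmod z" and val: "\<bar>v z - Re (a k * z\<^sup>2)\<bar> \<le> 1024 * C * (cmod z)\<^sup>2"
    if z: "0 < cmod z" "\<rho> / 16 ^ Suc k < 2 * cmod z" "2 * cmod z \<le> \<rho> / 16 ^ k" for z k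
  proof -
    define s where "s = cmod z"
    have s: "0 < s" "2 * s \<le> \<rho> / 16 ^ k" using z by (simp_all add: s_def)
    have rk: "\<rho> / 16 ^ k \<le> \<rho>" using \<rho> by (simp add: divide_le_eq)
    have "\<rho> / 16 ^ k \<le> 32 * s" using z(2) by (simp add: s_def)
    then have "(\<rho> / 16 ^ k)\<^sup>2 \<le> (32 * s)\<^sup>2" using \<rho> by (intro power_mono) auto
    then have "C * (\<rho> / 16 ^ k)\<^sup>2 \<le> C * (32 * s)\<^sup>2" using \<open>C \<ge> 0\<close> by (rule mult_left_mono)
    then have bd: "\<bar>v h - Re (a k * h\<^sup>2)\<bar> \<le> 1024 * C * s\<^sup>2" if "cmod h \<le> 2 * s" for h
      using est[of h k] that s(2) by (simp add: power_mult_distrib)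
    show "\<bar>v z - Re (a k * z\<^sup>2)\<bar> \<le> 1024 * C * (cmod z)\<^sup>2"
      using bd[of z] s by (simp add: s_def)
    define g where "g h = v h + - Re (a k * h\<^sup>2)" for h
    have near: "cmod h \<le> 2 * s" if "cmod (h - z) \<le> s" for h
      using norm_triangle_ineq[of "h - z" z] that by (simp add: s_def)
    have inR: "cmod h < R" if "cmod (h - z) \<le> s" for h
      using near[OF that] s(2) rk \<rho> by linarith
    have lap: "has_laplacian (\<lambda>h. Re (a k * h\<^sup>2)) 0 y" for y
      by (rule has_laplacian_Re_holomorphic[where S = UNIV]) (auto intro!: holomorphic_intros)
    have lap': "has_laplacian (\<lambda>h. - Re (a k * h\<^sup>2)) (- 0) y" for y
      by (rule has_laplacian_uminus[OF lap])
    have "cmod (f z - 2 * a k * z) \<le> 8 * (K + 2) * s"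
    proof (rule visc_gradient_bound[of s z g])
      show "continuous_on (cball z s) g"
        unfolding g_def
        by (intro continuous_intros continuous_on_subset[OF cont])
          (use inR in \<open>auto simp: dist_norm norm_minus_commute\<close>)
      show "visc_ge g (- 1) y" if "y \<in> ball z s" for y
        using visc_ge_add[OF visc_weak(1)[of y] lap'[of y]] inR[of y] that
        by (simp add: g_def[abs_def] dist_norm norm_minus_commute)
      show "visc_ge (\<lambda>w. - g w) 0 y" if "y \<in> ball z s" for y
        using visc_ge_add[OF visc_weak(2)[of y] lap[of y]] inR[of y] that
        by (simp add: g_def[abs_def] dist_norm norm_minus_commute)
      show "\<bar>g y\<bar> \<le> K * s\<^sup>2" if "y \<in> cball z s" for y
      proof -
        have "\<bar>g y\<bar> \<le> 1024 * C * s\<^sup>2"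
          using bd[OF near, of y] that by (simp add: g_def dist_norm norm_minus_commute)
        also have "\<dots> \<le> K * s\<^sup>2" using K by (intro mult_right_mono) auto
        finally show ?thesis .
      qed
      have "(v has_derivative (\<lambda>h. Re (f z * h))) (at z)"
        using f[of z] inR[of z] s by simp
      moreover have "((\<lambda>h. Re (a k * h\<^sup>2)) has_derivative (\<lambda>h. Re (2 * a k * z * h))) (at z)"
        by (auto intro!: derivative_eq_intros simp: algebra_simps)
      ultimately have "(g has_derivative (\<lambda>h. Re (f z * h) + - Re (2 * a k * z * h))) (at z)"
        unfolding g_def[abs_def] by (intro has_derivative_add has_derivative_minus)
      then show "(g has_derivative (\<lambda>h. Re ((f z - 2 * a k * z) * h))) (at z)"
        by (simp add: algebra_simps)
    qed (use s K in auto)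
    then show "cmod (f z - 2 * a k * z) \<le> 8 * (K + 2) * cmod z" by (simp add: s_def)
  qed
  have asym: "\<exists>r>0. \<forall>z. 0 < cmod z \<longrightarrow> cmod z < r \<longrightarrow>
      (\<exists>b>0. \<bar>v z - b * \<sigma> * Re (z\<^sup>2)\<bar> \<le> \<delta> * b * (cmod z)\<^sup>2 \<and>
        cmod (f z - of_real (2 * b * \<sigma>) * z) \<le> \<delta> * b * cmod z)" if \<delta>: "0 < \<delta>" for \<delta>
  proof -
    have "\<forall>\<^sub>F k in sequentially. max 1 (max (1024 * C) (8 * (K + 2)) * (2 / \<delta>)) \<le> cmod (a k)"
      using top unfolding filterlim_at_top by blast
    moreover have "\<forall>\<^sub>F k in sequentially. dist (a k / of_real (cmod (a k))) (of_real \<sigma>) < \<delta> / 4"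
      using dir \<delta> by (intro tendstoD) auto
    ultimately have "\<forall>\<^sub>F k in sequentially. max 1 (max (1024 * C) (8 * (K + 2)) * (2 / \<delta>)) \<le> cmod (a k) \<and>
        dist (a k / of_real (cmod (a k))) (of_real \<sigma>) < \<delta> / 4" by eventually_elim simp
    \<comment> \<open>The bounded errors take up \<open>\<delta> / 2\<close> and the direction of
      \<open>a k\<close> takes up \<open>\<delta> / 4\<close>. The latter counts twice in the
      gradient, where the two contributions add up to exactly \<open>\<delta>\<close>.\<close>
    then obtain N where N: "\<And>k. k \<ge> N \<Longrightarrow> max 1 (max (1024 * C) (8 * (K + 2)) * (2 / \<delta>)) \<le> cmod (a k)"
        "\<And>k. k \<ge> N \<Longrightarrow> dist (a k / of_real (cmod (a k))) (of_real \<sigma>) < \<delta> / 4"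
      unfolding eventually_sequentially by blast
    show ?thesis
    proof (rule exI[of _ "\<rho> / 16 ^ N / 2"], intro conjI allI impI)
      show "0 < \<rho> / 16 ^ N / 2" using \<rho> by simp
      fix z
      assume z: "0 < cmod z" "cmod z < \<rho> / 16 ^ N / 2"
      have "\<rho> / 16 ^ N \<le> \<rho>" using \<rho> by (simp add: divide_le_eq)
      define s where "s = \<rho> / 16 ^ N"
      have "2 * cmod z \<le> \<rho>"
        using z \<open>\<rho> / 16 ^ N \<le> \<rho>\<close> unfolding s_def[symmetric] by linarith
      moreover have "0 < 2 * cmod z" using z by simp
      ultimately obtain k where k: "\<rho> / 16 ^ Suc k < 2 * cmod z" "2 * cmod z \<le> \<rho> / 16 ^ k"
        using real_between_powers16[of "2 * cmod z" \<rho>] by blast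
      have "k \<ge> N"
      proof (rule ccontr)
        assume "\<not> N \<le> k"
        then have "(16::real) ^ Suc k \<le> 16 ^ N" by (intro power_increasing) auto
        then have "\<rho> / 16 ^ N \<le> \<rho> / 16 ^ Suc k" using \<rho> by (intro divide_left_mono) auto
        moreover define A where "A = \<rho> / 16 ^ Suc k"
        ultimately show False using k(1) z(2) unfolding s_def[symmetric] A_def[symmetric] by linarith
      qed
      define b where "b = cmod (a k)"
      have b: "0 < b" "max (1024 * C) (8 * (K + 2)) * (2 / \<delta>) \<le> b" using N(1)[OF \<open>k \<ge> N\<close>] by (auto simp: b_def)
      have "max (1024 * C) (8 * (K + 2)) \<le> \<delta> / 2 * b" using b(2) \<delta> by (simp add: field_simps)
      then have b2: "1024 * C \<le> \<delta> / 2 * b" "8 * (K + 2) \<le> \<delta> / 2 * b"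
        unfolding max.bounded_iff by blast+
      have "a k / of_real b - of_real \<sigma> = (a k - of_real (b * \<sigma>)) / of_real b"
        using b(1) by (simp add: field_simps)
      then have "cmod (a k - of_real (b * \<sigma>)) / b < \<delta> / 4"
        using N(2)[OF \<open>k \<ge> N\<close>] b(1) by (simp add: b_def[symmetric] dist_norm norm_divide)
      then have d: "cmod (a k - of_real (b * \<sigma>)) \<le> \<delta> / 4 * b" using b(1) by (simp add: divide_less_eq)
      show "\<exists>b>0. \<bar>v z - b * \<sigma> * Re (z\<^sup>2)\<bar> \<le> \<delta> * b * (cmod z)\<^sup>2 \<and>
        cmod (f z - of_real (2 * b * \<sigma>) * z) \<le> \<delta> * b * cmod z"
      proof (intro exI[of _ b] conjI)
        show "b > 0" by fact
        have "\<bar>Re ((a k - of_real (b * \<sigma>)) * z\<^sup>2)\<bar> \<le> cmod (a k - of_real (b * \<sigma>)) * (cmod z)\<^sup>2"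
          using abs_Re_le_cmod[of "(a k - of_real (b * \<sigma>)) * z\<^sup>2"] by (simp only: norm_mult norm_power)
        also have "\<dots> \<le> \<delta> / 4 * b * (cmod z)\<^sup>2" by (intro mult_right_mono d) auto
        finally have 1: "\<bar>Re ((a k - of_real (b * \<sigma>)) * z\<^sup>2)\<bar> \<le> \<delta> / 4 * b * (cmod z)\<^sup>2" .
        have "1024 * C * (cmod z)\<^sup>2 \<le> \<delta> / 2 * b * (cmod z)\<^sup>2" by (intro mult_right_mono b2) auto
        then have 2: "\<bar>v z - Re (a k * z\<^sup>2)\<bar> \<le> \<delta> / 2 * b * (cmod z)\<^sup>2"
          using val[OF z(1) k] by linarith
        have "Re ((a k - of_real (b * \<sigma>)) * z\<^sup>2) = Re (a k * z\<^sup>2) - b * \<sigma> * Re (z\<^sup>2)"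
          by (simp add: algebra_simps)
        then have "\<bar>v z - b * \<sigma> * Re (z\<^sup>2)\<bar> \<le> \<delta> / 2 * b * (cmod z)\<^sup>2 + \<delta> / 4 * b * (cmod z)\<^sup>2"
          using 1 2 by linarith
        moreover have "0 \<le> \<delta> / 4 * b * (cmod z)\<^sup>2" using \<delta> b by simp
        ultimately show "\<bar>v z - b * \<sigma> * Re (z\<^sup>2)\<bar> \<le> \<delta> * b * (cmod z)\<^sup>2" by (simp add: field_simps)
        have eq: "f z - of_real (2 * b * \<sigma>) * z = (f z - 2 * a k * z) + 2 * ((a k - of_real (b * \<sigma>)) * z)"
          by (simp add: algebra_simps)
        have "cmod (f z - of_real (2 * b * \<sigma>) * z) \<le> cmod (f z - 2 * a k * z) + 2 * (cmod (a k - of_real (b * \<sigma>)) * cmod z)"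
          unfolding eq
          using norm_triangle_ineq[of "f z - 2 * a k * z" "2 * ((a k - of_real (b * \<sigma>)) * z)"]
          by (simp only: norm_mult norm_numeral)
        also have "\<dots> \<le> \<delta> / 2 * b * cmod z + 2 * (\<delta> / 4 * b * cmod z)"
        proof (rule add_mono)
          show "cmod (f z - 2 * a k * z) \<le> \<delta> / 2 * b * cmod z"
            using grad[OF z(1) k] mult_right_mono[OF b2(2), of "cmod z"] by simp
          show "2 * (cmod (a k - of_real (b * \<sigma>)) * cmod z) \<le> 2 * (\<delta> / 4 * b * cmod z)"
            using mult_right_mono[OF d, of "cmod z"] by simp
        qed
        also have "\<dots> = \<delta> * b * cmod z" by simp
        finally show "cmod (f z - of_real (2 * b * \<sigma>) * z) \<le> \<delta> * b * cmod z" .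
      qed
    qed
  qed
  show thesis by (rule that[OF \<sigma> cf _ asym]) (use f in auto)
qed

section \<open>Zero sets near a saddle\<close>

text \<open>\<open>V\<close> behaves to first order like \<open>b Im(z\<^sup>2)\<close>, the positive factor \<open>b\<close> depending on the scale, so
  that its zero set is close to the coordinate axes.\<close>

definition saddle_like :: "(complex \<Rightarrow> real) \<Rightarrow> (complex \<Rightarrow> complex) \<Rightarrow> real \<Rightarrow> bool" where
  "saddle_like V F R \<longleftrightarrow> 0 < R \<and> continuous_on (ball 0 R) F \<and>
    (\<forall>z. cmod z < R \<longrightarrow> (V has_derivative (\<lambda>h. Re (F z * h))) (at z)) \<and>
    (\<forall>\<delta>>0. \<exists>r>0. \<forall>z. 0 < cmod z \<longrightarrow> cmod z < r \<longrightarrow> (\<exists>b>0. \<bar>V z - b * Im (z\<^sup>2)\<bar> \<le> \<delta> * b * (cmod z)\<^sup>2 \<and>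
        cmod (F z + 2 * \<i> * of_real b * z) \<le> \<delta> * b * cmod z))"

text \<open>A quarter turn reverses the sign of \<open>Im (z\<^sup>2)\<close>, and the minus sign
  restores it. Every half axis can thus be moved to the positive real one.\<close>

lemma saddle_like_rotate:
  assumes "saddle_like V F R"
  shows "saddle_like (\<lambda>z. - V (\<i> * z)) (\<lambda>z. - \<i> * F (\<i> * z)) R"
proof -
  have R: "0 < R" and cF: "continuous_on (ball 0 R) F"
    and D: "\<And>z. cmod z < R \<Longrightarrow> (V has_derivative (\<lambda>h. Re (F z * h))) (at z)"
    and asym: "\<And>\<delta>. \<delta> > 0 \<Longrightarrow> \<exists>r>0. \<forall>z. 0 < cmod z \<longrightarrow> cmod z < r \<longrightarrow> (\<exists>b>0. \<bar>V z - b * Im (z\<^sup>2)\<bar> \<le> \<delta> * b * (cmod z)\<^sup>2 \<and>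
        cmod (F z + 2 * \<i> * of_real b * z) \<le> \<delta> * b * cmod z)"
    using assms unfolding saddle_like_def by blast+
  show ?thesis
    unfolding saddle_like_def
  proof (intro conjI allI impI)
    show "continuous_on (ball 0 R) (\<lambda>z. - \<i> * F (\<i> * z))"
      by (intro continuous_intros continuous_on_compose2[OF cF]) (auto simp: norm_mult)
    show "((\<lambda>z. - V (\<i> * z)) has_derivative (\<lambda>h. Re (- \<i> * F (\<i> * z) * h))) (at z)" if "cmod z < R" for z
    proof -
      have "((\<lambda>z. \<i> * z) has_derivative (\<lambda>h. \<i> * h)) (at z)"
        by (auto intro!: derivative_eq_intros)
      from has_derivative_compose[OF this D[of "\<i> * z"]] that
      have "((\<lambda>z. V (\<i> * z)) has_derivative (\<lambda>h. Re (F (\<i> * z) * (\<i> * h)))) (at z)"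
        by (simp add: norm_mult)
      from has_derivative_minus[OF this] show ?thesis by (simp add: algebra_simps)
    qed
    fix \<delta> :: real
    assume "\<delta> > 0"
    then obtain r where r: "r > 0" and *: "\<And>z. 0 < cmod z \<Longrightarrow> cmod z < r \<Longrightarrow> \<exists>b>0. \<bar>V z - b * Im (z\<^sup>2)\<bar> \<le> \<delta> * b * (cmod z)\<^sup>2 \<and>
        cmod (F z + 2 * \<i> * of_real b * z) \<le> \<delta> * b * cmod z" using asym by blast
    show "\<exists>r>0. \<forall>z. 0 < cmod z \<longrightarrow> cmod z < r \<longrightarrow> (\<exists>b>0. \<bar>- V (\<i> * z) - b * Im (z\<^sup>2)\<bar> \<le> \<delta> * b * (cmod z)\<^sup>2 \<and>
        cmod (- \<i> * F (\<i> * z) + 2 * \<i> * of_real b * z) \<le> \<delta> * b * cmod z)"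
    proof (rule exI[of _ r], intro conjI allI impI)
      fix z
      assume z: "0 < cmod z" "cmod z < r"
      then obtain b where b: "b > 0" "\<bar>V (\<i> * z) - b * Im ((\<i> * z)\<^sup>2)\<bar> \<le> \<delta> * b * (cmod (\<i> * z))\<^sup>2"
        "cmod (F (\<i> * z) + 2 * \<i> * of_real b * (\<i> * z)) \<le> \<delta> * b * cmod (\<i> * z)"
        using *[of "\<i> * z"] by (auto simp: norm_mult)
      have "- \<i> * F (\<i> * z) + 2 * \<i> * of_real b * z = - \<i> * (F (\<i> * z) + 2 * \<i> * of_real b * (\<i> * z))"
        by (simp add: algebra_simps)
      then have "cmod (- \<i> * F (\<i> * z) + 2 * \<i> * of_real b * z) = cmod (F (\<i> * z) + 2 * \<i> * of_real b * (\<i> * z))"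
        by (simp only: norm_mult norm_minus_cancel norm_ii mult_1)
      moreover have "\<bar>- V (\<i> * z) - b * Im (z\<^sup>2)\<bar> = \<bar>V (\<i> * z) - b * Im ((\<i> * z)\<^sup>2)\<bar>"
        by (simp add: power_mult_distrib abs_minus_commute)
      ultimately show "\<exists>b>0. \<bar>- V (\<i> * z) - b * Im (z\<^sup>2)\<bar> \<le> \<delta> * b * (cmod z)\<^sup>2 \<and>
          cmod (- \<i> * F (\<i> * z) + 2 * \<i> * of_real b * z) \<le> \<delta> * b * cmod z"
        using b by (intro exI[of _ b]) (simp add: norm_mult)
    qed (rule r)
  qed (rule R)
qed

text \<open>Since the differential of \<open>V\<close> is \<open>Re (c * h)\<close>, tangent vectors
  satisfy \<open>Re c * X = Im c * Y\<close>; hence the slope has no minus sign.\<close>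

lemma implicit_function_derivative:
  fixes V :: "complex \<Rightarrow> real" and y :: "real \<Rightarrow> real"
  assumes D: "(V has_derivative (\<lambda>h. Re (c * h))) (at (Complex x (y x)))"
    and zero: "\<forall>\<^sub>F t in nhds x. V (Complex t (y t)) = 0"
    and cont: "isCont y x" and c: "Im c \<noteq> 0"
  shows "(y has_real_derivative Re c / Im c) (at x)"
proof -
  define p where "p = \<bar>Im c\<bar>"
  define q where "q = Re c / Im c"
  have "p > 0" using c by (simp add: p_def)
  have V0: "V (Complex x (y x)) = 0" using zero eventually_nhds_x_imp_x by blast
  have "(y has_derivative (\<lambda>h. q * h)) (at x)"
    unfolding has_derivative_at_alt
  proof (intro conjI allI impI)
    show "bounded_linear (\<lambda>h. q * h)" by (rule bounded_linear_mult_right)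
    fix e :: real
    assume "e > 0"
    \<comment> \<open>The first bound allows the increment of \<open>y\<close> to be absorbed, so
      that it is O(|X|); the second then makes the error at most \<open>e * |X|\<close>.\<close>
    define e' where "e' = min (p / 2) (e * p / (2 * \<bar>q\<bar> + 2))"
    have "0 < e * p / (2 * \<bar>q\<bar> + 2)" using \<open>e > 0\<close> \<open>p > 0\<close> by simp
    then have e': "e' > 0" "e' \<le> p / 2" "e' \<le> e * p / (2 * \<bar>q\<bar> + 2)"
      using \<open>p > 0\<close> by (simp_all only: e'_def min_less_iff_conj min.cobounded1 min.cobounded2) simp
    obtain d where d: "d > 0" "\<And>z. cmod (z - Complex x (y x)) < d \<Longrightarrow>
        \<bar>V z - V (Complex x (y x)) - Re (c * (z - Complex x (y x)))\<bar> \<le> e' * cmod (z - Complex x (y x))"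
      using D e'(1) unfolding has_derivative_at_alt real_norm_def by blast
    have "isCont (\<lambda>t. Complex t (y t)) x"
      unfolding Complex_eq by (intro continuous_intros cont)
    then have "\<forall>\<^sub>F t in nhds x. dist (Complex t (y t)) (Complex x (y x)) < d"
      using d(1) by (simp add: continuous_at_eps_delta eventually_nhds_metric)
    with zero have "\<forall>\<^sub>F t in nhds x. norm (y t - y x - q * (t - x)) \<le> e * norm (t - x)"
    proof eventually_elim
      case (elim t)
      define X Y where "X = t - x" and "Y = y t - y x"
      have diff: "Complex t (y t) - Complex x (y x) = Complex X Y" by (simp add: X_def Y_def complex_eq_iff)
      have "\<bar>Re (c * Complex X Y)\<bar> \<le> e' * cmod (Complex X Y)"
        using d(2)[of "Complex t (y t)"] elim V0 unfolding dist_norm diff by simp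
      also have "\<dots> \<le> e' * (\<bar>X\<bar> + \<bar>Y\<bar>)"
        using cmod_le[of "Complex X Y"] e'(1) by (intro mult_left_mono) auto
      also have "Re (c * Complex X Y) = - Im c * (Y - q * X)"
        using c by (simp add: q_def algebra_simps)
      finally have "p * \<bar>Y - q * X\<bar> \<le> e' * (\<bar>X\<bar> + \<bar>Y\<bar>)" by (simp add: abs_mult p_def)
      then have 1: "\<bar>Y - q * X\<bar> \<le> e' / p * (\<bar>X\<bar> + \<bar>Y\<bar>)" using \<open>p > 0\<close> by (simp add: field_simps)
      have "e' / p \<le> 1 / 2" using e'(2) \<open>p > 0\<close> by (simp add: field_simps)
      then have "e' / p * (\<bar>X\<bar> + \<bar>Y\<bar>) \<le> 1 / 2 * (\<bar>X\<bar> + \<bar>Y\<bar>)" by (intro mult_right_mono) auto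
      with 1 have half: "\<bar>Y - q * X\<bar> \<le> 1 / 2 * (\<bar>X\<bar> + \<bar>Y\<bar>)" by (rule order_trans)
      have triangle: "\<bar>Y\<bar> \<le> \<bar>Y - q * X\<bar> + \<bar>q\<bar> * \<bar>X\<bar>" by (simp flip: abs_mult)
      have "a \<le> 1 / 2 * (x + y) \<Longrightarrow> y \<le> a + c \<Longrightarrow> x + y \<le> 2 * c + 2 * x" for a c x y :: real by simp
      from this[OF half triangle] have "\<bar>X\<bar> + \<bar>Y\<bar> \<le> (2 * \<bar>q\<bar> + 2) * \<bar>X\<bar>"
        by (simp add: algebra_simps)
      then have "e' / p * (\<bar>X\<bar> + \<bar>Y\<bar>) \<le> e' / p * ((2 * \<bar>q\<bar> + 2) * \<bar>X\<bar>)"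
        using e'(1) \<open>p > 0\<close> by (intro mult_left_mono) auto
      also have "\<dots> = (e' * (2 * \<bar>q\<bar> + 2) / p) * \<bar>X\<bar>" by simp
      also have "\<dots> \<le> e * \<bar>X\<bar>"
      proof (rule mult_right_mono)
        have "e' * (2 * \<bar>q\<bar> + 2) \<le> e * p" using e'(3) by (simp add: pos_le_divide_eq)
        then show "e' * (2 * \<bar>q\<bar> + 2) / p \<le> e" using \<open>p > 0\<close> by (simp add: divide_le_eq)
      qed simp
      finally show ?case using 1 by (simp add: X_def Y_def)
    qed
    then show "\<exists>d>0. \<forall>t. norm (t - x) < d \<longrightarrow> norm (y t - y x - q * (t - x)) \<le> e * norm (t - x)"
      by (simp add: eventually_nhds_metric dist_norm)
  qed
  then show ?thesis unfolding has_field_derivative_def q_def .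
qed

text \<open>The factor \<open>b\<close> changes from point to point, but it stays positive. On the
  segment \<open>|t| \<le> x / 2\<close> the derivative of \<open>V\<close> in \<open>t\<close> is
  therefore positive, close to \<open>2 * b * x\<close>, and \<open>V\<close> has opposite signs at
  the two ends. This gives exactly one zero on each segment.\<close>

lemma saddle_like_graph:
  assumes "saddle_like V F R"
  shows "\<exists>X y y'. 0 < X \<and>
    (\<forall>x t. 0 < x \<longrightarrow> x < X \<longrightarrow> \<bar>t\<bar> \<le> x / 2 \<longrightarrow> (V (Complex x t) = 0 \<longleftrightarrow> t = y x)
        \<and> (0 < V (Complex x t) \<longleftrightarrow> y x < t)) \<and>
    (\<forall>x. 0 < x \<longrightarrow> x < X \<longrightarrow> \<bar>y x\<bar> < x / 2 \<and> (y has_real_derivative y' x) (at x)) \<and>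
    continuous_on {0<..<X} y' \<and>
    (\<forall>\<delta>>0. \<exists>r>0. \<forall>x. 0 < x \<longrightarrow> x < r \<longrightarrow> \<bar>y x\<bar> \<le> \<delta> * x \<and> \<bar>y' x\<bar> \<le> \<delta>)"
proof -
  have R: "0 < R" and cF: "continuous_on (ball 0 R) F"
    and D: "\<And>z. cmod z < R \<Longrightarrow> (V has_derivative (\<lambda>h. Re (F z * h))) (at z)"
    and asym: "\<And>\<delta>. \<delta> > 0 \<Longrightarrow> \<exists>r>0. \<forall>z. 0 < cmod z \<longrightarrow> cmod z < r \<longrightarrow> (\<exists>b>0. \<bar>V z - b * Im (z\<^sup>2)\<bar> \<le> \<delta> * b * (cmod z)\<^sup>2 \<and>
        cmod (F z + 2 * \<i> * of_real b * z) \<le> \<delta> * b * cmod z)"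
    using assms unfolding saddle_like_def by blast+
  have asymC: "\<exists>r>0. \<forall>x t. 0 < x \<longrightarrow> x < r \<longrightarrow> \<bar>t\<bar> \<le> x / 2 \<longrightarrow> (\<exists>b>0. \<bar>V (Complex x t) - 2 * b * (x * t)\<bar> \<le> \<delta> * b * (2 * x\<^sup>2) \<and>
      \<bar>Re (F (Complex x t)) - 2 * b * t\<bar> \<le> \<delta> * b * (2 * x) \<and> \<bar>Im (F (Complex x t)) + 2 * b * x\<bar> \<le> \<delta> * b * (2 * x))"
    if \<delta>: "\<delta> > 0" for \<delta>
  proof -
    obtain r where r: "r > 0" and *: "\<And>z. 0 < cmod z \<Longrightarrow> cmod z < r \<Longrightarrow> \<exists>b>0. \<bar>V z - b * Im (z\<^sup>2)\<bar> \<le> \<delta> * b * (cmod z)\<^sup>2 \<and>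
        cmod (F z + 2 * \<i> * of_real b * z) \<le> \<delta> * b * cmod z" using asym[OF \<delta>] by blast
    show ?thesis
    proof (rule exI[of _ "r / 2"], intro conjI allI impI)
      show "0 < r / 2" using r by simp
      fix x t :: real
      assume x: "0 < x" "x < r / 2" "\<bar>t\<bar> \<le> x / 2"
      define z where "z = Complex x t"
      have "cmod z \<le> \<bar>x\<bar> + \<bar>t\<bar>" unfolding z_def using cmod_le[of "Complex x t"] by simp
      then have "cmod z < r" using x by linarith
      have "0 < cmod z" using x by (simp add: z_def complex_eq_iff)
      then obtain b where b: "b > 0" "\<bar>V z - b * Im (z\<^sup>2)\<bar> \<le> \<delta> * b * (cmod z)\<^sup>2"
        "cmod (F z + 2 * \<i> * of_real b * z) \<le> \<delta> * b * cmod z" using *[OF _ \<open>cmod z < r\<close>] by blast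
      have "\<bar>t\<bar>\<^sup>2 \<le> (x / 2)\<^sup>2" using x by (intro power_mono) auto
      then have t2: "t\<^sup>2 \<le> x\<^sup>2 / 4" by (simp add: power_divide)
      have "(cmod z)\<^sup>2 \<le> 2 * x\<^sup>2" using t2 zero_le_power2[of x] unfolding z_def cmod_power2 complex.sel by linarith
      then have z2: "\<delta> * b * (cmod z)\<^sup>2 \<le> \<delta> * b * (2 * x\<^sup>2)" using \<delta> b(1) by (intro mult_left_mono) auto
      have "cmod z \<le> 2 * x" using \<open>cmod z \<le> \<bar>x\<bar> + \<bar>t\<bar>\<close> x by linarith
      then have z1: "\<delta> * b * cmod z \<le> \<delta> * b * (2 * x)" using \<delta> b(1) by (intro mult_left_mono) auto
      have im: "Im (z\<^sup>2) = 2 * (x * t)" by (simp add: z_def power2_eq_square)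
      have re: "Re (F z + 2 * \<i> * of_real b * z) = Re (F z) - 2 * b * t"
        "Im (F z + 2 * \<i> * of_real b * z) = Im (F z) + 2 * b * x" by (simp_all add: z_def)
      show "\<exists>b>0. \<bar>V (Complex x t) - 2 * b * (x * t)\<bar> \<le> \<delta> * b * (2 * x\<^sup>2) \<and>
        \<bar>Re (F (Complex x t)) - 2 * b * t\<bar> \<le> \<delta> * b * (2 * x) \<and> \<bar>Im (F (Complex x t)) + 2 * b * x\<bar> \<le> \<delta> * b * (2 * x)"
        unfolding z_def[symmetric]
      proof (intro exI[of _ b] conjI)
        show "\<bar>V z - 2 * b * (x * t)\<bar> \<le> \<delta> * b * (2 * x\<^sup>2)" using b(2) z2 unfolding im by (simp add: mult_ac)
        show "\<bar>Re (F z) - 2 * b * t\<bar> \<le> \<delta> * b * (2 * x)"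
          using abs_Re_le_cmod[of "F z + 2 * \<i> * of_real b * z"] b(3) z1 unfolding re by linarith
        show "\<bar>Im (F z) + 2 * b * x\<bar> \<le> \<delta> * b * (2 * x)"
          using abs_Im_le_cmod[of "F z + 2 * \<i> * of_real b * z"] b(3) z1 unfolding re by linarith
      qed (rule b)
    qed
  qed
  \<comment> \<open>An error of 1/8 preserves the signs: it costs at most \<open>b * x / 4\<close>
    in the derivative and \<open>b * x\<^sup>2 / 4\<close> at the ends, against leading terms of
    modulus \<open>2 * b * x\<close> and \<open>b * x\<^sup>2\<close>.\<close>
  obtain r where r: "r > 0" and A: "\<And>x t. 0 < x \<Longrightarrow> x < r \<Longrightarrow> \<bar>t\<bar> \<le> x / 2 \<Longrightarrow> \<exists>b>0. \<bar>V (Complex x t) - 2 * b * (x * t)\<bar> \<le> 1 / 8 * b * (2 * x\<^sup>2) \<and>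
      \<bar>Re (F (Complex x t)) - 2 * b * t\<bar> \<le> 1 / 8 * b * (2 * x) \<and> \<bar>Im (F (Complex x t)) + 2 * b * x\<bar> \<le> 1 / 8 * b * (2 * x)"
    using asymC[of "1 / 8"] by auto
  define X where "X = min r (R / 2)"
  have X: "0 < X" "X \<le> r" "X \<le> R / 2" using r R by (auto simp: X_def)
  have inR: "cmod (Complex x t) < R" if "0 < x" "x < X" "\<bar>t\<bar> \<le> x / 2" for x t
    using cmod_le[of "Complex x t"] that X by simp
  have ImF: "Im (F (Complex x t)) < 0" if x: "0 < x" "x < X" "\<bar>t\<bar> \<le> x / 2" for x t
  proof -
    obtain b where b: "b > 0" "\<bar>Im (F (Complex x t)) + 2 * b * x\<bar> \<le> 1 / 8 * b * (2 * x)"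
      using A[of x t] x X by auto
    moreover have "0 < b * x" using b(1) x by simp
    moreover have "2 * b * x = 2 * (b * x)" "1 / 8 * b * (2 * x) = (b * x) / 4" by simp_all
    ultimately show ?thesis using abs_le_D1[OF b(2)] by linarith
  qed
  have dV: "((\<lambda>t. V (Complex x t)) has_real_derivative - Im (F (Complex x t))) (at t)"
    if x: "0 < x" "x < X" "\<bar>t\<bar> \<le> x / 2" for x t
  proof -
    have "((\<lambda>t. Complex x t) has_derivative (\<lambda>h. \<i> * of_real h)) (at t)"
      unfolding Complex_eq by (auto intro!: derivative_eq_intros)
    from has_derivative_compose[OF this D[OF inR[OF x]]]
    have "((\<lambda>t. V (Complex x t)) has_derivative (\<lambda>h. Re (F (Complex x t) * (\<i> * of_real h)))) (at t)" .
    moreover have "(\<lambda>h. Re (F (Complex x t) * (\<i> * of_real h))) = (*) (- Im (F (Complex x t)))" by auto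
    ultimately show ?thesis by (simp only: has_field_derivative_def)
  qed
  have incr: "V (Complex x s) < V (Complex x t)" if x: "0 < x" "x < X" and st: "- (x / 2) \<le> s" "s < t" "t \<le> x / 2" for x s t
  proof (rule DERIV_pos_imp_increasing[OF st(2)])
    fix u assume "s \<le> u" "u \<le> t"
    then have u: "\<bar>u\<bar> \<le> x / 2" using st by auto
    show "\<exists>d. ((\<lambda>t. V (Complex x t)) has_real_derivative d) (at u) \<and> 0 < d"
      using dV[OF x u] ImF[OF x u] by (intro exI[of _ "- Im (F (Complex x u))"]) simp
  qed
  have ends: "V (Complex x (- (x / 2))) < 0" "0 < V (Complex x (x / 2))" if x: "0 < x" "x < X" for x
  proof -
    have e: "\<bar>- (x / 2)\<bar> \<le> x / 2" "\<bar>x / 2\<bar> \<le> x / 2" "x < r" using x X by auto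
    obtain b where b: "b > 0" "\<bar>V (Complex x (- (x / 2))) - 2 * b * (x * - (x / 2))\<bar> \<le> 1 / 8 * b * (2 * x\<^sup>2)"
      using A[OF x(1) e(3,1)] by blast
    have "0 < b * x\<^sup>2" using b(1) x by simp
    have eq: "2 * b * (x * - (x / 2)) = - (b * x\<^sup>2)" "1 / 8 * b * (2 * x\<^sup>2) = b * x\<^sup>2 / 4"
      by (simp_all add: power2_eq_square)
    show "V (Complex x (- (x / 2))) < 0"
      using abs_le_D1[OF b(2)[unfolded eq]] \<open>0 < b * x\<^sup>2\<close> by linarith
    obtain b' where b': "b' > 0" "\<bar>V (Complex x (x / 2)) - 2 * b' * (x * (x / 2))\<bar> \<le> 1 / 8 * b' * (2 * x\<^sup>2)"
      using A[OF x(1) e(3,2)] by blast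
    have "0 < b' * x\<^sup>2" using b'(1) x by simp
    have eq': "2 * b' * (x * (x / 2)) = b' * x\<^sup>2" "1 / 8 * b' * (2 * x\<^sup>2) = b' * x\<^sup>2 / 4"
      by (simp_all add: power2_eq_square)
    show "0 < V (Complex x (x / 2))"
      using abs_le_D2[OF b'(2)[unfolded eq']] \<open>0 < b' * x\<^sup>2\<close> by linarith
  qed
  have ex: "\<exists>t. \<bar>t\<bar> < x / 2 \<and> V (Complex x t) = 0" if x: "0 < x" "x < X" for x
  proof -
    have "continuous_on {- (x / 2)..x / 2} (\<lambda>t. V (Complex x t))"
      using dV[OF x] by (intro DERIV_continuous_on[of _ _ "\<lambda>t. - Im (F (Complex x t))"])
        (auto intro: has_field_derivative_at_within)
    then obtain t where t: "- (x / 2) \<le> t" "t \<le> x / 2" "V (Complex x t) = 0"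
      using IVT'[of "\<lambda>t. V (Complex x t)" "- (x / 2)" 0 "x / 2"] ends[OF x] x by auto
    have "t \<noteq> - (x / 2)" "t \<noteq> x / 2" using t(3) ends[OF x] by auto
    then show ?thesis using t by (intro exI[of _ t]) auto
  qed
  define y where "y x = (SOME t. \<bar>t\<bar> < x / 2 \<and> V (Complex x t) = 0)" for x
  have y: "\<bar>y x\<bar> < x / 2" "V (Complex x (y x)) = 0" if "0 < x" "x < X" for x
    using someI_ex[OF ex[OF that]] unfolding y_def by blast+
  have char: "(V (Complex x t) = 0 \<longleftrightarrow> t = y x) \<and> (0 < V (Complex x t) \<longleftrightarrow> y x < t)"
    if x: "0 < x" "x < X" "\<bar>t\<bar> \<le> x / 2" for x t
  proof -
    have "- (x / 2) \<le> t" "t \<le> x / 2" "- (x / 2) \<le> y x" "y x \<le> x / 2"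
      using x(3) y(1)[OF x(1,2)] by linarith+
    then show ?thesis
      using incr[OF x(1,2), of t "y x"] incr[OF x(1,2), of "y x" t] y(2)[OF x(1,2)]
      by (cases t "y x" rule: linorder_cases) auto
  qed
  have cV: "continuous_on (ball 0 R) V"
    by (rule continuous_at_imp_continuous_on) (simp add: has_derivative_continuous[OF D])
  \<comment> \<open>The strict signs of \<open>V\<close> slightly below and slightly above the zero
    persist on nearby segments, and monotonicity traps their zeros in between.\<close>
  have cont: "isCont y x" if x: "0 < x" "x < X" for x
    unfolding continuous_at_eps_delta
  proof (intro allI impI)
    fix e :: real
    assume "e > 0"
    define d where "d = min (e / 2) ((x / 2 - \<bar>y x\<bar>) / 2)"
    have d: "0 < d" "d < e" "\<bar>y x\<bar> + d < x / 2" using y(1)[OF x] \<open>e > 0\<close> by (auto simp: d_def min_def field_simps)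
    have cVs: "isCont (\<lambda>s. V (Complex s t)) x" if "\<bar>t\<bar> \<le> x / 2" for t
    proof -
      have "isCont V (Complex x t)"
        using cV inR[OF x that] by (simp add: continuous_on_eq_continuous_at)
      moreover have "isCont (\<lambda>s. Complex s t) x" unfolding Complex_eq by (intro continuous_intros)
      ultimately show ?thesis using isCont_o2[of x "\<lambda>s. Complex s t" V] by blast
    qed
    have b: "\<bar>y x - d\<bar> \<le> x / 2" "\<bar>y x + d\<bar> \<le> x / 2"
      using abs_triangle_ineq4[of "y x" d] abs_triangle_ineq[of "y x" d] d by simp_all
    have "V (Complex x (y x - d)) < 0" using char[OF x b(1)] d(1) by auto
    then have ev1: "\<forall>\<^sub>F s in at x. V (Complex s (y x - d)) < 0"
      using cVs[OF b(1)] unfolding isCont_def by (intro order_tendstoD(2))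
    have "0 < V (Complex x (y x + d))" using char[OF x b(2)] d(1) by auto
    then have ev2: "\<forall>\<^sub>F s in at x. 0 < V (Complex s (y x + d))"
      using cVs[OF b(2)] unfolding isCont_def by (intro order_tendstoD(1))
    have ev3: "\<forall>\<^sub>F s in at x. 2 * (\<bar>y x\<bar> + d) < s" "\<forall>\<^sub>F s in at x. s < X"
      using d(3) x by (auto intro!: order_tendstoD[of "\<lambda>s. s" x])
    have "\<forall>\<^sub>F s in at x. dist (y s) (y x) < e"
      using ev1 ev2 ev3
    proof eventually_elim
      case (elim s)
      have s: "0 < s" "s < X" using elim d(1) by auto
      have bs: "\<bar>y x - d\<bar> \<le> s / 2" "\<bar>y x + d\<bar> \<le> s / 2"
        using abs_triangle_ineq4[of "y x" d] abs_triangle_ineq[of "y x" d] elim(3) d(1) by simp_all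
      have "y x - d < y s" using char[OF s bs(1)] elim(1) by (smt (verit))
      moreover have "y s < y x + d" using char[OF s bs(2)] elim(2) by blast
      ultimately show ?case using d(2) by (auto simp: dist_real_def)
    qed
    then obtain d' where d': "d' > 0" "\<And>s. s \<noteq> x \<Longrightarrow> dist s x < d' \<Longrightarrow> dist (y s) (y x) < e"
      unfolding eventually_at by blast
    have "dist (y s) (y x) < e" if "dist s x < d'" for s
      using d'(2)[of s] that \<open>e > 0\<close> by (cases "s = x") auto
    then show "\<exists>d>0. \<forall>x'. dist x' x < d \<longrightarrow> dist (y x') (y x) < e"
      using d'(1) by blast
  qed
  define y' where "y' x = Re (F (Complex x (y x))) / Im (F (Complex x (y x)))" for x
  have dy: "(y has_real_derivative y' x) (at x)" if x: "0 < x" "x < X" for x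
    unfolding y'_def
  proof (rule implicit_function_derivative)
    have yx: "\<bar>y x\<bar> \<le> x / 2" using y(1)[OF x] by simp
    show "(V has_derivative (\<lambda>h. Re (F (Complex x (y x)) * h))) (at (Complex x (y x)))"
      by (rule D[OF inR[OF x yx]])
    show "Im (F (Complex x (y x))) \<noteq> 0" using ImF[OF x yx] by simp
    have "\<forall>\<^sub>F t in nhds x. t \<in> {0<..<X}" using x by (intro eventually_nhds_in_open) auto
    then show "\<forall>\<^sub>F t in nhds x. V (Complex t (y t)) = 0" by eventually_elim (simp add: y)
  qed (rule cont[OF x])
  have cy: "continuous_on {0<..<X} y" using cont by (intro continuous_at_imp_continuous_on) auto
  have cFy: "continuous_on {0<..<X} (\<lambda>x. F (Complex x (y x)))"
  proof (rule continuous_on_compose2[OF cF])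
    show "continuous_on {0<..<X} (\<lambda>x. Complex x (y x))" unfolding Complex_eq by (intro continuous_intros cy)
    show "(\<lambda>x. Complex x (y x)) ` {0<..<X} \<subseteq> ball 0 R"
      using inR y(1) by (auto simp: less_imp_le)
  qed
  have "Im (F (Complex x (y x))) \<noteq> 0" if "x \<in> {0<..<X}" for x
    using ImF[of x "y x"] y(1)[of x] that by simp
  then have cy': "continuous_on {0<..<X} y'"
    unfolding y'_def by (intro continuous_intros cFy) blast
  have small: "\<exists>r>0. \<forall>x. 0 < x \<longrightarrow> x < r \<longrightarrow> \<bar>y x\<bar> \<le> \<delta> * x \<and> \<bar>y' x\<bar> \<le> \<delta>" if "\<delta> > 0" for \<delta>
  proof -
    \<comment> \<open>With this error \<open>|y x| \<le> \<epsilon> * x\<close>, so the real part of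
      \<open>F\<close> on the graph is at most \<open>4 * \<epsilon> * (b * x)\<close>. The bound
      1/2 keeps its imaginary part at least \<open>b * x\<close> in modulus; hence the slope is at
      most \<open>4 * \<epsilon>\<close>.\<close>
    define \<epsilon> where "\<epsilon> = min (\<delta> / 4) (1 / 2)"
    have \<epsilon>: "\<epsilon> > 0" "4 * \<epsilon> \<le> \<delta>" "\<epsilon> \<le> 1 / 2" using that by (auto simp: \<epsilon>_def)
    obtain r1 where r1: "r1 > 0" and A1: "\<And>x t. 0 < x \<Longrightarrow> x < r1 \<Longrightarrow> \<bar>t\<bar> \<le> x / 2 \<Longrightarrow> \<exists>b>0. \<bar>V (Complex x t) - 2 * b * (x * t)\<bar> \<le> \<epsilon> * b * (2 * x\<^sup>2) \<and>
      \<bar>Re (F (Complex x t)) - 2 * b * t\<bar> \<le> \<epsilon> * b * (2 * x) \<and> \<bar>Im (F (Complex x t)) + 2 * b * x\<bar> \<le> \<epsilon> * b * (2 * x)"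
      using asymC[OF \<epsilon>(1)] by blast
    show ?thesis
    proof (rule exI[of _ "min r1 X"], intro conjI allI impI)
      show "0 < min r1 X" using r1 X by simp
      fix x
      assume x: "0 < x" "x < min r1 X"
      then have x': "x < r1" "x < X" by auto
      have yx: "\<bar>y x\<bar> \<le> x / 2" using y(1)[OF x(1) x'(2)] by simp
      obtain b where b: "b > 0" "\<bar>V (Complex x (y x)) - 2 * b * (x * y x)\<bar> \<le> \<epsilon> * b * (2 * x\<^sup>2)"
        "\<bar>Re (F (Complex x (y x))) - 2 * b * y x\<bar> \<le> \<epsilon> * b * (2 * x)"
        "\<bar>Im (F (Complex x (y x))) + 2 * b * x\<bar> \<le> \<epsilon> * b * (2 * x)"
        using A1[OF x(1) x'(1) yx] by blast
      have "(2 * b * x) * \<bar>y x\<bar> \<le> (2 * b * x) * (\<epsilon> * x)"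
        using b(1,2) x(1) y(2)[OF x(1) x'(2)] by (simp add: abs_mult power2_eq_square mult_ac)
      then have yb: "\<bar>y x\<bar> \<le> \<epsilon> * x" using b(1) x(1) by (subst (asm) mult_le_cancel_left_pos) auto
      have "\<epsilon> * x \<le> \<delta> * x" using \<epsilon> x by (intro mult_right_mono) auto
      with yb show "\<bar>y x\<bar> \<le> \<delta> * x" by linarith
      have bx: "0 < b * x" using b(1) x by simp
      have "2 * b * \<bar>y x\<bar> \<le> 2 * b * (\<epsilon> * x)" using yb b(1) by (intro mult_left_mono) auto
      moreover have "\<bar>2 * b * y x\<bar> = 2 * b * \<bar>y x\<bar>" using b(1) by (simp add: abs_mult)
      ultimately have "\<bar>Re (F (Complex x (y x)))\<bar> \<le> 2 * b * (\<epsilon> * x) + \<epsilon> * b * (2 * x)"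
        using b(3) by linarith
      then have re: "\<bar>Re (F (Complex x (y x)))\<bar> \<le> 4 * \<epsilon> * (b * x)" by (simp add: mult_ac)
      have "\<epsilon> * (b * x) \<le> 1 / 2 * (b * x)" using \<epsilon> bx by (intro mult_right_mono) auto
      then have "\<epsilon> * b * (2 * x) \<le> b * x" by (simp add: mult_ac)
      then have im: "b * x \<le> \<bar>Im (F (Complex x (y x)))\<bar>" using b(4) by linarith
      have "\<bar>y' x\<bar> \<le> 4 * \<epsilon> * (b * x) / (b * x)"
        unfolding y'_def abs_divide using re im bx \<epsilon> by (intro frac_le) auto
      also have "\<dots> = 4 * \<epsilon>"
        by (rule nonzero_mult_div_cancel_right[OF less_imp_neq[OF bx, symmetric]])
      finally show "\<bar>y' x\<bar> \<le> \<delta>" using \<epsilon> by linarith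
    qed
  qed
  show ?thesis
    using X(1) char y(1) dy cy' small by (intro exI[of _ X] exI[of _ y] exI[of _ y']) simp
qed

definition axis_graph :: "(real \<Rightarrow> real) \<Rightarrow> real \<Rightarrow> real \<Rightarrow> complex" where
  "axis_graph y c t = Complex (c * t) (if t \<le> 0 then 0 else y (c * t))"

text \<open>The graph is continued by the axis for \<open>t \<le> 0\<close>, so that the one-sided derivative at \<open>0\<close> becomes
  a two-sided one.\<close>

lemma C1_arc_axis_graph:
  fixes y y' :: "real \<Rightarrow> real"
  assumes dy: "\<And>x. 0 < x \<Longrightarrow> x < X \<Longrightarrow> (y has_real_derivative y' x) (at x)"
    and cy': "continuous_on {0<..<X} y'"
    and small: "\<And>\<delta>. \<delta> > 0 \<Longrightarrow> \<exists>r>0. \<forall>x. 0 < x \<longrightarrow> x < r \<longrightarrow> \<bar>y x\<bar> \<le> \<delta> * x \<and> \<bar>y' x\<bar> \<le> \<delta>"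
    and c: "0 < c" "c < X"
  shows "C1_arc (axis_graph y c)" and "(axis_graph y c has_vector_derivative of_real c) (at 0)"
proof -
  define u where "u s = (if s \<le> 0 then 0 else y s)" for s
  define d where "d s = (if s \<le> 0 then 0 else y' s)" for s
  have du: "(u has_real_derivative d s) (at s)" if "s < X" for s
  proof -
    consider "s < 0" | "s = 0" | "0 < s" by linarith
    then show ?thesis
    proof cases
      case 1
      have "\<forall>\<^sub>F t in nhds s. t \<in> {..<0}" using 1 by (intro eventually_nhds_in_open) auto
      then have "\<forall>\<^sub>F t in nhds s. u t = 0" by eventually_elim (simp add: u_def)
      then have "(u has_real_derivative 0) (at s) \<longleftrightarrow> ((\<lambda>_. 0) has_real_derivative 0) (at s)"
        by (intro DERIV_cong_ev) auto
      then show ?thesis using 1 by (simp add: d_def)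
    next
      case 3
      have "\<forall>\<^sub>F t in nhds s. t \<in> {0<..}" using 3 by (intro eventually_nhds_in_open) auto
      then have "\<forall>\<^sub>F t in nhds s. u t = y t" by eventually_elim (simp add: u_def)
      then have "(u has_real_derivative y' s) (at s) \<longleftrightarrow> (y has_real_derivative y' s) (at s)"
        by (intro DERIV_cong_ev) auto
      then show ?thesis using 3 dy[OF 3 that] by (simp add: d_def)
    next
      case 2
      have "(u has_derivative (\<lambda>h. 0)) (at 0)"
        unfolding has_derivative_at_alt
      proof (intro conjI allI impI)
        fix e :: real
        assume "e > 0"
        then obtain r where r: "r > 0" "\<And>x. 0 < x \<Longrightarrow> x < r \<Longrightarrow> \<bar>y x\<bar> \<le> e * x" using small by blast
        have "norm (u t - u 0 - 0) \<le> e * norm (t - 0)" if "norm (t - 0) < r" for t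
          using r(2)[of t] that \<open>e > 0\<close> by (auto simp: u_def mult_le_0_iff)
        then show "\<exists>d>0. \<forall>t. norm (t - 0) < d \<longrightarrow> norm (u t - u 0 - 0) \<le> e * norm (t - 0)"
          using r(1) by blast
      qed simp
      moreover have "(*) (0::real) = (\<lambda>h. 0)" by auto
      ultimately show ?thesis using 2 by (simp add: d_def has_field_derivative_def)
    qed
  qed
  have cd: "isCont d s" if "s < X" for s
  proof -
    consider "s < 0" | "s = 0" | "0 < s" by linarith
    then show ?thesis
    proof cases
      case 1
      have "\<forall>\<^sub>F t in nhds s. t \<in> {..<0}" using 1 by (intro eventually_nhds_in_open) auto
      then have "\<forall>\<^sub>F t in nhds s. d t = 0" by eventually_elim (simp add: d_def)
      then have "isCont d s \<longleftrightarrow> isCont (\<lambda>_. 0 :: real) s" by (rule isCont_cong)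
      then show ?thesis by simp
    next
      case 3
      have "\<forall>\<^sub>F t in nhds s. t \<in> {0<..}" using 3 by (intro eventually_nhds_in_open) auto
      then have "\<forall>\<^sub>F t in nhds s. d t = y' t" by eventually_elim (simp add: d_def)
      then have "isCont d s \<longleftrightarrow> isCont y' s" by (rule isCont_cong)
      then show ?thesis using cy' 3 that by (simp add: continuous_on_eq_continuous_at)
    next
      case 2
      show ?thesis
        unfolding continuous_at_eps_delta
      proof (intro allI impI)
        fix e :: real
        assume "e > 0"
        then have "e / 2 > 0" by simp
        then obtain r where r: "r > 0" "\<And>x. 0 < x \<Longrightarrow> x < r \<Longrightarrow> \<bar>y' x\<bar> \<le> e / 2" using small by blast
        have "dist (d t) (d s) < e" if "dist t s < r" for t
          using r(2)[of t] that \<open>e > 0\<close> 2 by (fastforce simp: d_def dist_real_def)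
        then show "\<exists>b>0. \<forall>t. dist t s < b \<longrightarrow> dist (d t) (d s) < e" using r(1) by blast
      qed
    qed
  qed
  have graph: "axis_graph y c t = of_real (c * t) + \<i> * of_real (u (c * t))" for t
    using c(1) by (simp add: axis_graph_def u_def Complex_eq mult_le_0_iff)
  define D where "D t = of_real c + \<i> * of_real (c * d (c * t))" for t
  have ct: "c * t < X" if "t \<le> 1" for t
  proof -
    have "c * t \<le> c * 1" using that c by (intro mult_left_mono) auto
    then show ?thesis using c by linarith
  qed
  have deriv: "(axis_graph y c has_vector_derivative D t) (at t)" if "t \<le> 1" for t
  proof -
    have "((\<lambda>t. c * t) has_real_derivative c) (at t)" by (auto intro!: derivative_eq_intros)
    from DERIV_chain2[OF du[OF ct[OF that]] this]
    have "((\<lambda>t. u (c * t)) has_real_derivative d (c * t) * c) (at t)" .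
    then have "((\<lambda>t. u (c * t)) has_vector_derivative c * d (c * t)) (at t)"
      by (simp add: has_real_derivative_iff_has_vector_derivative mult.commute)
    then show ?thesis
      unfolding graph[abs_def] D_def
      by (intro has_vector_derivative_add has_vector_derivative_mult_right has_vector_derivative_of_real)
        (auto intro!: derivative_eq_intros simp flip: has_real_derivative_iff_has_vector_derivative)
  qed
  have cD: "continuous_on {0..1} D"
    unfolding D_def
  proof (intro continuous_intros continuous_at_imp_continuous_on ballI)
    fix t :: real
    assume "t \<in> {0..1}"
    then have "isCont d (c * t)" using cd ct by simp
    moreover have "isCont (\<lambda>t. c * t) t" by (intro continuous_intros)
    ultimately show "isCont (\<lambda>t. d (c * t)) t" using isCont_o2[of t "\<lambda>t. c * t" d] by blast
  qed
  have D0: "D t \<noteq> 0" for t using c by (simp add: D_def complex_eq_iff)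
  show "C1_arc (axis_graph y c)"
    unfolding C1_arc_def
  proof (intro conjI ballI)
    have "continuous_on {0..1} (axis_graph y c)"
      by (intro continuous_at_imp_continuous_on ballI has_vector_derivative_continuous[OF deriv]) simp
    moreover have "inj_on (axis_graph y c) {0..1}"
      using c by (auto simp: inj_on_def axis_graph_def)
    ultimately show "arc (axis_graph y c)" by (simp add: arc_def path_def)
    show "axis_graph y c C1_differentiable_on {0..1}"
      unfolding C1_differentiable_on_def using deriv cD by (intro exI[of _ D]) simp
    fix t :: real
    assume "t \<in> {0..1}"
    then have "vector_derivative (axis_graph y c) (at t) = D t" by (intro vector_derivative_at deriv) simp
    then show "vector_derivative (axis_graph y c) (at t) \<noteq> 0" using D0 by simp
  qed
  show "(axis_graph y c has_vector_derivative of_real c) (at 0)"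
    using deriv[of 0] by (simp add: D_def d_def)
qed

section \<open>The zero set as four rotated graphs\<close>

lemma frequently_nhds_metric:
  "(\<exists>\<^sub>F y in nhds x. P y) \<longleftrightarrow> (\<forall>e>0. \<exists>y. dist y x < e \<and> P y)"
  unfolding frequently_def eventually_nhds_metric by blast

text \<open>Outside the cones of slope 1/2 about the axes \<open>(cmod z)\<^sup>2\<close> is at most
  twice \<open>|Im (z\<^sup>2)|\<close>, which the assumption excludes.\<close>

lemma small_Im_square_near_axis:
  fixes z :: complex
  assumes "\<bar>Im (z\<^sup>2)\<bar> \<le> 1 / 8 * (cmod z)\<^sup>2"
  shows "\<bar>Im z\<bar> \<le> \<bar>Re z\<bar> / 2 \<or> \<bar>Re z\<bar> \<le> \<bar>Im z\<bar> / 2"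
proof (rule ccontr)
  assume "\<not> ?thesis"
  then have *: "\<bar>Re z\<bar> < 2 * \<bar>Im z\<bar>" "\<bar>Im z\<bar> < 2 * \<bar>Re z\<bar>" by auto
  have "\<bar>Re z\<bar> * \<bar>Re z\<bar> \<le> (2 * \<bar>Im z\<bar>) * \<bar>Re z\<bar>" "\<bar>Im z\<bar> * \<bar>Im z\<bar> \<le> (2 * \<bar>Re z\<bar>) * \<bar>Im z\<bar>"
    using * by (intro mult_right_mono; simp)+
  then have "\<bar>Re z\<bar> * \<bar>Re z\<bar> + \<bar>Im z\<bar> * \<bar>Im z\<bar> \<le> (2 * \<bar>Im z\<bar>) * \<bar>Re z\<bar> + (2 * \<bar>Re z\<bar>) * \<bar>Im z\<bar>"
    by (rule add_mono)
  also have "\<dots> = 4 * (\<bar>Re z\<bar> * \<bar>Im z\<bar>)" by simp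
  also have "\<bar>Re z\<bar> * \<bar>Re z\<bar> + \<bar>Im z\<bar> * \<bar>Im z\<bar> = (cmod z)\<^sup>2"
    by (simp add: cmod_power2) (simp add: power2_eq_square)
  finally have "(cmod z)\<^sup>2 \<le> 4 * (\<bar>Re z\<bar> * \<bar>Im z\<bar>)" .
  moreover have "\<bar>Im (z\<^sup>2)\<bar> = 2 * (\<bar>Re z\<bar> * \<bar>Im z\<bar>)" by (simp add: power2_eq_square abs_mult)
  moreover have "0 < \<bar>Re z\<bar> * \<bar>Im z\<bar>" using * by auto
  ultimately show False using assms by linarith
qed

lemma saddle_like_rotate_power:
  assumes "saddle_like V F R"
  shows "\<exists>F'. saddle_like (\<lambda>z. (- 1) ^ k * V (\<i> ^ k * z)) F' R"
proof (induction k)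
  case 0
  then show ?case using assms by auto
next
  case (Suc k)
  then obtain F' where "saddle_like (\<lambda>z. (- 1) ^ k * V (\<i> ^ k * z)) F' R" by blast
  from saddle_like_rotate[OF this] show ?case by (auto simp: mult_ac)
qed

text \<open>The zeros near 0 lie in four cones about the half axes, and in each of them they form a
  graph. That both signs occur near every zero off the origin is recorded because the function is
  later \<open>v\<close> up to an undetermined sign, and the zeros must be recognised as free
  boundary points in either case.\<close>

lemma saddle_like_zero_set:
  assumes sad: "saddle_like V F R" and V0: "V 0 = 0" and "0 < \<rho>"
  obtains N \<gamma> where "open N" and "0 \<in> N" and "N \<subseteq> ball 0 \<rho>"
    and "{z \<in> N. V z = 0} = (\<Union>k<4. (\<lambda>t. \<i> ^ k * \<gamma> k t) ` {0..<1})"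
    and "\<And>k::nat. C1_arc (\<gamma> k)" and "\<And>k. \<gamma> k 0 = 0"
    and "\<And>k. \<exists>c>0. (\<gamma> k has_vector_derivative of_real c) (at 0)"
    and "\<And>k t. 0 < t \<Longrightarrow> t \<le> 1 \<Longrightarrow> \<bar>Im (\<gamma> k t)\<bar> < Re (\<gamma> k t)"
    and "\<And>z. z \<in> N \<Longrightarrow> V z = 0 \<Longrightarrow> z \<noteq> 0 \<Longrightarrow> (\<exists>\<^sub>F y in nhds z. 0 < V y) \<and> (\<exists>\<^sub>F y in nhds z. V y < 0)"
proof -
  define W where "W k z = (- 1) ^ k * V (\<i> ^ k * z)" for k :: nat and z
  define G where "G k X y y' \<longleftrightarrow> 0 < X \<and>
    (\<forall>x t. 0 < x \<longrightarrow> x < X \<longrightarrow> \<bar>t\<bar> \<le> x / 2 \<longrightarrow> (W k (Complex x t) = 0 \<longleftrightarrow> t = y x)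
        \<and> (0 < W k (Complex x t) \<longleftrightarrow> y x < t)) \<and>
    (\<forall>x. 0 < x \<longrightarrow> x < X \<longrightarrow> \<bar>y x\<bar> < x / 2 \<and> (y has_real_derivative y' x) (at x)) \<and>
    continuous_on {0<..<X} y' \<and>
    (\<forall>\<delta>>0. \<exists>r>0. \<forall>x. 0 < x \<longrightarrow> x < r \<longrightarrow> \<bar>y x\<bar> \<le> \<delta> * x \<and> \<bar>y' x\<bar> \<le> \<delta>)" for k X y y'
  have "\<exists>p. G k (fst p) (fst (snd p)) (snd (snd p))" for k
  proof -
    obtain F' where "saddle_like (\<lambda>z. (- 1) ^ k * V (\<i> ^ k * z)) F' R"
      using saddle_like_rotate_power[OF sad] by blast
    from saddle_like_graph[OF this] obtain X y y' where "G k X y y'" unfolding G_def W_def by (elim exE)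
    then show ?thesis by (intro exI[of _ "(X, y, y')"]) simp
  qed
  then obtain p where p: "\<And>k. G k (fst (p k)) (fst (snd (p k))) (snd (snd (p k)))" by metis
  define X y y' where "X k = fst (p k)" and "y k = fst (snd (p k))" and "y' k = snd (snd (p k))" for k
  have "G k (X k) (y k) (y' k)" for k using p by (simp add: X_def y_def y'_def)
  then have X: "\<And>k. 0 < X k"
    and char: "\<And>k x t. 0 < x \<Longrightarrow> x < X k \<Longrightarrow> \<bar>t\<bar> \<le> x / 2 \<Longrightarrow> (W k (Complex x t) = 0 \<longleftrightarrow> t = y k x)
        \<and> (0 < W k (Complex x t) \<longleftrightarrow> y k x < t)"
    and y: "\<And>k x. 0 < x \<Longrightarrow> x < X k \<Longrightarrow> \<bar>y k x\<bar> < x / 2"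
    and dy: "\<And>k x. 0 < x \<Longrightarrow> x < X k \<Longrightarrow> (y k has_real_derivative y' k x) (at x)"
    and cy': "\<And>k. continuous_on {0<..<X k} (y' k)"
    and small: "\<And>k \<delta>. \<delta> > 0 \<Longrightarrow> \<exists>r>0. \<forall>x. 0 < x \<longrightarrow> x < r \<longrightarrow> \<bar>y k x\<bar> \<le> \<delta> * x \<and> \<bar>y' k x\<bar> \<le> \<delta>"
    unfolding G_def by blast+
  have asym_all: "\<forall>\<delta>>0. \<exists>r>0. \<forall>z. 0 < cmod z \<longrightarrow> cmod z < r \<longrightarrow> (\<exists>b>0. \<bar>V z - b * Im (z\<^sup>2)\<bar> \<le> \<delta> * b * (cmod z)\<^sup>2 \<and>
        cmod (F z + 2 * \<i> * of_real b * z) \<le> \<delta> * b * cmod z)"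
    using sad unfolding saddle_like_def by (elim conjE)
  have "(0::real) < 1 / 8" by simp
  from mp[OF spec[OF asym_all] this] obtain r where r: "r > 0"
    and asym8: "\<forall>z. 0 < cmod z \<longrightarrow> cmod z < r \<longrightarrow> (\<exists>b>0. \<bar>V z - b * Im (z\<^sup>2)\<bar> \<le> 1 / 8 * b * (cmod z)\<^sup>2 \<and>
        cmod (F z + 2 * \<i> * of_real b * z) \<le> 1 / 8 * b * cmod z)"
    by (elim exE conjE)
  have asym: "\<exists>b>0. \<bar>V z - b * Im (z\<^sup>2)\<bar> \<le> 1 / 8 * b * (cmod z)\<^sup>2" if "0 < cmod z" "cmod z < r" for z
    using asym8[rule_format, OF that] by blast
  \<comment> \<open>Half of the minimum: points of the square \<open>N\<close> have modulus below
    \<open>2 * c\<close>, where the expansion is valid, and each graph extends beyond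
    \<open>c\<close>, as an arc with its endpoint requires.\<close>
  define c where "c = Min {X 0, X 1, X 2, X 3, r, \<rho>} / 2"
  have c: "0 < c" "\<And>k. k < 4 \<Longrightarrow> c < X k" "2 * c \<le> r" "2 * c \<le> \<rho>"
  proof -
    have "0 < Min {X 0, X 1, X 2, X 3, r, \<rho>}" using X r \<open>0 < \<rho>\<close> by simp
    then show "0 < c" by (simp add: c_def)
    show "2 * c \<le> r" "2 * c \<le> \<rho>" by (simp_all add: c_def)
    fix k :: nat
    assume "k < 4"
    then have "k = 0 \<or> k = 1 \<or> k = 2 \<or> k = 3" by auto
    then have "2 * c \<le> X k" by (auto simp: c_def)
    then show "c < X k" using \<open>0 < c\<close> by linarith
  qed
  define N where "N = {z. \<bar>Re z\<bar> < c \<and> \<bar>Im z\<bar> < c}"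
  \<comment> \<open>From index 4 on the first graph is repeated, so that the conclusions about
    \<open>\<gamma> k\<close> hold for every \<open>k\<close>.\<close>
  define \<gamma> where "\<gamma> k = axis_graph (y (if k < 4 then k else 0)) c" for k :: nat
  have k4: "c < X (if k < 4 then k else 0)" for k using c(2)[of k] c(2)[of 0] by auto
  have rot_N: "\<i> ^ k * w \<in> N \<longleftrightarrow> w \<in> N" for k w
  proof (induction k arbitrary: w)
    case (Suc k)
    have "\<i> ^ Suc k * w = \<i> ^ k * (\<i> * w)" by simp
    then have "\<i> ^ Suc k * w \<in> N \<longleftrightarrow> \<i> * w \<in> N" using Suc[of "\<i> * w"] by (simp only:)
    then show ?case by (auto simp: N_def)
  qed simp
  have NB: "cmod z < 2 * c" if "z \<in> N" for z
    using cmod_le[of z] that by (simp add: N_def)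
  have ii: "\<i> ^ k * ((- \<i>) ^ k * z) = z" for k z
    by (simp flip: mult.assoc power_mult_distrib)
  have WV: "V (\<i> ^ k * w) = (- 1) ^ k * W k w" for k w
    by (simp add: W_def flip: mult.assoc power_mult_distrib)
  have curve: "\<gamma> k t = Complex (c * t) (y k (c * t))" "0 < c * t" "c * t < X k" if "k < 4" "0 < t" "t \<le> 1" for k t
  proof -
    show "\<gamma> k t = Complex (c * t) (y k (c * t))" using that by (simp add: \<gamma>_def axis_graph_def)
    show "0 < c * t" using that c by simp
    have "c * t \<le> c * 1" using that c by (intro mult_left_mono) auto
    then show "c * t < X k" using c(2)[OF that(1)] by linarith
  qed
  have branch: "\<exists>k<4. \<exists>x t. z = \<i> ^ k * Complex x t \<and> 0 < x \<and> x < c \<and> \<bar>t\<bar> \<le> x / 2" if z: "z \<in> N" "V z = 0" "z \<noteq> 0" for z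
  proof -
    obtain b where b: "b > 0" "\<bar>V z - b * Im (z\<^sup>2)\<bar> \<le> 1 / 8 * b * (cmod z)\<^sup>2"
      using asym[of z] NB[OF z(1)] c(3) z(3) by auto
    then have "b * \<bar>Im (z\<^sup>2)\<bar> \<le> b * (1 / 8 * (cmod z)\<^sup>2)" using z(2) by (simp add: abs_mult mult_ac)
    then have "\<bar>Im (z\<^sup>2)\<bar> \<le> 1 / 8 * (cmod z)\<^sup>2" using b(1) mult_le_cancel_left_pos by blast
    then have "\<bar>Im z\<bar> \<le> \<bar>Re z\<bar> / 2 \<or> \<bar>Re z\<bar> \<le> \<bar>Im z\<bar> / 2" by (rule small_Im_square_near_axis)
    then consider "0 < Re z" "\<bar>Im z\<bar> \<le> \<bar>Re z\<bar> / 2" | "Re z < 0" "\<bar>Im z\<bar> \<le> \<bar>Re z\<bar> / 2"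
      | "0 < Im z" "\<bar>Re z\<bar> \<le> \<bar>Im z\<bar> / 2" | "Im z < 0" "\<bar>Re z\<bar> \<le> \<bar>Im z\<bar> / 2"
      using z(3) by (cases "Re z" "0::real" rule: linorder_cases; cases "Im z" "0::real" rule: linorder_cases)
        (auto simp: complex_eq_iff)
    then show ?thesis
    proof cases
      case 1
      then show ?thesis using z(1)
        by (intro exI[of _ 0] conjI exI[of _ "Re z"] exI[of _ "Im z"]) (auto simp: N_def complex_eq_iff)
    next
      case 2
      then show ?thesis using z(1)
        by (intro exI[of _ 2] conjI exI[of _ "- Re z"] exI[of _ "- Im z"]) (auto simp: N_def complex_eq_iff)
    next
      case 3
      then show ?thesis using z(1)
        by (intro exI[of _ 1] conjI exI[of _ "Im z"] exI[of _ "- Re z"]) (auto simp: N_def complex_eq_iff)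
    next
      case 4
      then show ?thesis using z(1)
        by (intro exI[of _ 3] conjI exI[of _ "- Im z"] exI[of _ "Re z"]) (auto simp: N_def complex_eq_iff power3_eq_cube)
    qed
  qed
  have zero: "\<exists>k<4. \<exists>x. z = \<i> ^ k * Complex x (y k x) \<and> 0 < x \<and> x < c" if z: "z \<in> N" "V z = 0" "z \<noteq> 0" for z
  proof -
    obtain k x t where k: "k < 4" "z = \<i> ^ k * Complex x t" "0 < x" "x < c" "\<bar>t\<bar> \<le> x / 2" using branch[OF z] by blast
    then have "x < X k" using c(2)[OF k(1)] by linarith
    have "W k (Complex x t) = 0" using WV[of k "Complex x t"] z(2) unfolding k(2)[symmetric] by simp
    then have "t = y k x" using char[OF k(3) \<open>x < X k\<close> k(5)] by blast
    then show ?thesis using k by blast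
  qed
  show thesis
  proof (rule that[of N \<gamma>])
    show "open N" unfolding N_def by (intro open_Collect_conj open_Collect_less continuous_intros)
    show "0 \<in> N" using c by (simp add: N_def)
    show "N \<subseteq> ball 0 \<rho>" using NB c(4) by force
    show "C1_arc (\<gamma> k)" for k
      unfolding \<gamma>_def by (rule C1_arc_axis_graph(1)[OF dy cy' small c(1) k4]) auto
    show "\<gamma> k 0 = 0" for k by (simp add: \<gamma>_def axis_graph_def Complex_eq)
    show "\<exists>c>0. (\<gamma> k has_vector_derivative of_real c) (at 0)" for k
    proof (intro exI[of _ c] conjI c(1))
      show "(\<gamma> k has_vector_derivative of_real c) (at 0)"
        unfolding \<gamma>_def by (rule C1_arc_axis_graph(2)[OF dy cy' small c(1) k4]) auto
    qed
    show "\<bar>Im (\<gamma> k t)\<bar> < Re (\<gamma> k t)" if t: "0 < t" "t \<le> 1" for k t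
    proof -
      define j where "j = (if k < 4 then k else 0)"
      have "j < 4" by (simp add: j_def)
      have "\<gamma> k = \<gamma> j" by (simp add: \<gamma>_def j_def)
      moreover have "\<bar>Im (\<gamma> j t)\<bar> < Re (\<gamma> j t)"
        using curve[OF \<open>j < 4\<close> t] y[OF curve(2,3)[OF \<open>j < 4\<close> t]] by simp
      ultimately show ?thesis by simp
    qed
    show "{z \<in> N. V z = 0} = (\<Union>k<4. (\<lambda>t. \<i> ^ k * \<gamma> k t) ` {0..<1})"
    proof (intro equalityI subsetI)
      fix z
      assume "z \<in> {z \<in> N. V z = 0}"
      then have z: "z \<in> N" "V z = 0" by auto
      show "z \<in> (\<Union>k<4. (\<lambda>t. \<i> ^ k * \<gamma> k t) ` {0..<1})"
      proof (cases "z = 0")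
        case True
        then have "z = \<i> ^ 0 * \<gamma> 0 0" by (simp add: \<gamma>_def axis_graph_def Complex_eq)
        then show ?thesis by (intro UN_I[of 0] image_eqI[of _ _ 0]) auto
      next
        case False
        obtain k x where k: "k < 4" "z = \<i> ^ k * Complex x (y k x)" "0 < x" "x < c" using zero[OF z False] by blast
        have t: "0 < x / c" "x / c < 1" using k c by auto
        then have "\<gamma> k (x / c) = Complex x (y k x)" using curve(1)[OF k(1), of "x / c"] c by simp
        then show ?thesis using k t by (intro UN_I[of k] image_eqI[of _ _ "x / c"]) auto
      qed
    next
      fix z
      assume "z \<in> (\<Union>k<4. (\<lambda>t. \<i> ^ k * \<gamma> k t) ` {0..<1})"
      then obtain k t where k: "k < 4" "z = \<i> ^ k * \<gamma> k t" "0 \<le> t" "t < 1" by auto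
      show "z \<in> {z \<in> N. V z = 0}"
      proof (cases "t = 0")
        case True
        then have "z = 0" using k(2) by (simp add: \<gamma>_def axis_graph_def Complex_eq)
        then show ?thesis using V0 c by (simp add: N_def)
      next
        case False
        then have t: "0 < t" "t \<le> 1" using k by auto
        note cv = curve[OF k(1) t]
        have yy: "\<bar>y k (c * t)\<bar> < c * t / 2" by (rule y[OF cv(2,3)])
        have "c * t < c" using k(4) c by simp
        then have "\<gamma> k t \<in> N" using yy cv by (simp add: N_def)
        then have "z \<in> N" using rot_N k(2) by simp
        moreover have "W k (\<gamma> k t) = 0" using char[OF cv(2,3) less_imp_le[OF yy]] cv(1) by simp
        then have "V z = 0" using WV[of k "\<gamma> k t"] k(2) by simp
        ultimately show ?thesis by simp
      qed
    qed
    fix z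
    assume z: "z \<in> N" "V z = 0" "z \<noteq> 0"
    obtain k x where k: "k < 4" "z = \<i> ^ k * Complex x (y k x)" "0 < x" "x < c" using zero[OF z] by blast
    have "x < X k" using c(2)[OF k(1)] k by linarith
    have yx: "\<bar>y k x\<bar> < x / 2" by (rule y[OF k(3) \<open>x < X k\<close>])
    \<comment> \<open>Leaving the graph vertically in the k-th rotated frame produces either sign;
      \<open>s'\<close> accounts for the alternating sign of \<open>W k\<close>.\<close>
    have both: "\<exists>u. dist u z < e \<and> 0 < s * V u" if e: "0 < e" and s: "s \<in> {1, - 1}" for e s :: real
    proof -
      define h where "h = min (e / 2) (x / 2 - \<bar>y k x\<bar>)"
      have h: "0 < h" "h < e" "\<bar>y k x\<bar> + h \<le> x / 2" using e yx by (auto simp: h_def min_def)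
      define s' where "s' = s * (- 1) ^ k"
      have s': "s' = 1 \<or> s' = - 1" using s by (cases "even k") (auto simp: s'_def)
      define t where "t = y k x + s' * h"
      have t: "\<bar>t\<bar> \<le> x / 2"
        using s' h abs_triangle_ineq[of "y k x" h] abs_triangle_ineq4[of "y k x" h] by (auto simp: t_def)
      have "W k (Complex x t) = 0 \<longleftrightarrow> t = y k x" "0 < W k (Complex x t) \<longleftrightarrow> y k x < t"
        using char[OF k(3) \<open>x < X k\<close> t] by auto
      then have "0 < s' * W k (Complex x t)" using s' h(1) by (auto simp: t_def)
      then have "0 < s * V (\<i> ^ k * Complex x t)" unfolding WV by (simp add: s'_def mult_ac)
      moreover have "dist (\<i> ^ k * Complex x t) z < e"
      proof -
        have "\<i> ^ k * Complex x t - z = \<i> ^ k * (\<i> * of_real (s' * h))"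
          unfolding k(2) by (simp add: t_def Complex_eq algebra_simps)
        then have "dist (\<i> ^ k * Complex x t) z = cmod (\<i> ^ k * (\<i> * of_real (s' * h)))"
          by (simp only: dist_norm)
        also have "\<dots> = \<bar>s' * h\<bar>" by (simp only: norm_mult norm_power norm_ii power_one mult_1 norm_of_real)
        also have "\<dots> = h" using s' h by auto
        finally show ?thesis using h by simp
      qed
      ultimately show ?thesis by blast
    qed
    show "(\<exists>\<^sub>F y in nhds z. 0 < V y) \<and> (\<exists>\<^sub>F y in nhds z. V y < 0)"
      unfolding frequently_nhds_metric using both[of _ 1] both[of _ "- 1"] by simp
  qed
qed

text \<open>The rotation by \<open>pi / 4\<close> turns \<open>Re (z\<^sup>2)\<close> into
  \<open>- Im (z\<^sup>2)\<close>, and the factor \<open>- \<sigma>\<close> makes the result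
  saddle-like for either sign of the leading coefficient. Free boundary points are zeros by
  continuity; conversely, zeros off the origin are limits of points of positivity.\<close>

lemma (in cross_point) free_boundary_curves:
  assumes flat2: "\<And>\<epsilon>. 0 < \<epsilon> \<Longrightarrow> \<exists>r>0. \<forall>z. on_cross \<theta> z \<longrightarrow> 0 < cmod z \<longrightarrow> cmod z < r \<longrightarrow>
      (\<exists>z'. cmod (z' - z) \<le> \<epsilon> * cmod z \<and> v z' \<le> 0 \<and> (\<exists>\<^sub>F y in nhds z'. 0 < v y))"
    and fb0: "\<exists>\<^sub>F y in nhds 0. 0 < v y"
  obtains N \<gamma> where "\<theta> = pi / 4" and "open N" and "0 \<in> N" and "N \<subseteq> ball 0 R"
    and "{z \<in> N. v z \<le> 0 \<and> (\<exists>\<^sub>F y in nhds z. 0 < v y)} = (\<Union>k<4. (\<lambda>t. cis (pi / 4) * (\<i> ^ k * \<gamma> k t)) ` {0..<1})"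
    and "\<And>k::nat. C1_arc (\<gamma> k)" and "\<And>k. \<gamma> k 0 = 0"
    and "\<And>k. \<exists>c>0. (\<gamma> k has_vector_derivative of_real c) (at 0)"
    and "\<And>k t. 0 < t \<Longrightarrow> t \<le> 1 \<Longrightarrow> \<bar>Im (\<gamma> k t)\<bar> < Re (\<gamma> k t)"
proof -
  obtain \<sigma> f where \<sigma>: "\<sigma> \<in> {-1, 1::real}" and cf: "continuous_on (ball 0 R) f"
    and D: "\<And>z. cmod z < R \<Longrightarrow> (v has_derivative (\<lambda>h. Re (f z * h))) (at z)"
    and asym: "\<And>\<delta>. 0 < \<delta> \<Longrightarrow> \<exists>r>0. \<forall>z. 0 < cmod z \<longrightarrow> cmod z < r \<longrightarrow>
      (\<exists>b>0. \<bar>v z - b * \<sigma> * Re (z\<^sup>2)\<bar> \<le> \<delta> * b * (cmod z)\<^sup>2 \<and>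
        cmod (f z - of_real (2 * b * \<sigma>) * z) \<le> \<delta> * b * cmod z)"
    by (rule gradient_asymptotics) (rule that)
  have fb_zero: "v z = 0" if z: "cmod z < R" "v z \<le> 0" "\<exists>\<^sub>F y in nhds z. 0 < v y" for z
  proof (rule ccontr)
    assume "v z \<noteq> 0"
    then have "v z < 0" using z(2) by simp
    moreover have "(v \<longlongrightarrow> v z) (nhds z)"
      using has_derivative_continuous[OF D[OF z(1)]] by (simp add: isCont_def tendsto_at_iff_tendsto_nhds)
    ultimately have "\<forall>\<^sub>F y in nhds z. v y < 0" by (intro order_tendstoD(2))
    then have "\<forall>\<^sub>F y in nhds z. \<not> 0 < v y" by eventually_elim simp
    then show False using z(3) by (simp add: frequently_def)
  qed
  define q where "q = cis (pi / 4)"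
  have q: "cmod q = 1" "q\<^sup>2 = \<i>" by (simp_all add: q_def Complex.DeMoivre)
  then have "q \<noteq> 0" by auto
  have cq: "cnj q * q = 1" "q * cnj q = 1"
    using complex_norm_square[of q] q(1) by (simp_all add: mult.commute)
  define V where "V z = - \<sigma> * v (q * z)" for z
  define F where "F z = of_real (- \<sigma>) * q * f (q * z)" for z
  have sad: "saddle_like V F R"
    unfolding saddle_like_def
  proof (intro conjI allI impI)
    show "0 < R" by (rule R)
    show "continuous_on (ball 0 R) F"
      unfolding F_def by (intro continuous_intros continuous_on_compose2[OF cf]) (auto simp: norm_mult q)
    show "(V has_derivative (\<lambda>h. Re (F z * h))) (at z)" if "cmod z < R" for z
    proof -
      have "((\<lambda>z. q * z) has_derivative (\<lambda>h. q * h)) (at z)" by (auto intro!: derivative_eq_intros)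
      from has_derivative_compose[OF this D[of "q * z"]] that q
      have "((\<lambda>z. v (q * z)) has_derivative (\<lambda>h. Re (f (q * z) * (q * h)))) (at z)" by (simp add: norm_mult)
      from has_derivative_mult_right[OF this, of "- \<sigma>"]
      show ?thesis unfolding V_def[abs_def] F_def by (simp add: algebra_simps)
    qed
    fix \<delta> :: real
    assume "\<delta> > 0"
    then obtain r where r: "r > 0" and *: "\<And>z. 0 < cmod z \<Longrightarrow> cmod z < r \<Longrightarrow>
      (\<exists>b>0. \<bar>v z - b * \<sigma> * Re (z\<^sup>2)\<bar> \<le> \<delta> * b * (cmod z)\<^sup>2 \<and>
        cmod (f z - of_real (2 * b * \<sigma>) * z) \<le> \<delta> * b * cmod z)" using asym by blast
    show "\<exists>r>0. \<forall>z. 0 < cmod z \<longrightarrow> cmod z < r \<longrightarrow> (\<exists>b>0. \<bar>V z - b * Im (z\<^sup>2)\<bar> \<le> \<delta> * b * (cmod z)\<^sup>2 \<and>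
        cmod (F z + 2 * \<i> * of_real b * z) \<le> \<delta> * b * cmod z)"
    proof (rule exI[of _ r], intro conjI allI impI)
      fix z
      assume z: "0 < cmod z" "cmod z < r"
      have nq: "cmod (q * z) = cmod z" by (simp add: norm_mult q)
      obtain b where b: "b > 0" "\<bar>v (q * z) - b * \<sigma> * Re ((q * z)\<^sup>2)\<bar> \<le> \<delta> * b * (cmod z)\<^sup>2"
        "cmod (f (q * z) - of_real (2 * b * \<sigma>) * (q * z)) \<le> \<delta> * b * cmod z"
        using *[of "q * z"] z unfolding nq by blast
      have s2: "\<sigma> * \<sigma> = 1" "\<bar>\<sigma>\<bar> = 1" using \<sigma> by auto
      have re: "Re ((q * z)\<^sup>2) = - Im (z\<^sup>2)" by (simp add: power_mult_distrib q)
      have "V z - b * Im (z\<^sup>2) = - \<sigma> * (v (q * z) - b * \<sigma> * Re ((q * z)\<^sup>2))"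
        unfolding re V_def using s2(1) by (simp add: algebra_simps)
      then have 1: "\<bar>V z - b * Im (z\<^sup>2)\<bar> \<le> \<delta> * b * (cmod z)\<^sup>2"
        using b(2) by (simp only: abs_mult abs_minus_cancel s2 mult_1)
      have "of_real (- \<sigma>) * q * (of_real (2 * b * \<sigma>) * (q * z)) = - (of_real (\<sigma> * \<sigma>) * (2 * of_real b) * (q\<^sup>2 * z))"
        by (simp add: power2_eq_square mult_ac)
      also have "\<dots> = - (2 * \<i> * of_real b * z)" unfolding s2 q by simp
      finally have e: "of_real (- \<sigma>) * q * (of_real (2 * b * \<sigma>) * (q * z)) = - (2 * \<i> * of_real b * z)" .
      have "F z + 2 * \<i> * of_real b * z = of_real (- \<sigma>) * q * (f (q * z) - of_real (2 * b * \<sigma>) * (q * z))"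
        unfolding F_def right_diff_distrib e by simp
      then have 2: "cmod (F z + 2 * \<i> * of_real b * z) \<le> \<delta> * b * cmod z"
        using b(3) by (simp only: norm_mult norm_of_real abs_minus_cancel s2 q mult_1)
      show "\<exists>b>0. \<bar>V z - b * Im (z\<^sup>2)\<bar> \<le> \<delta> * b * (cmod z)\<^sup>2 \<and>
        cmod (F z + 2 * \<i> * of_real b * z) \<le> \<delta> * b * cmod z" using b(1) 1 2 by blast
    qed (rule r)
  qed
  \<comment> \<open>A point \<open>z\<close> of the cross has a zero \<open>z'\<close> of
    \<open>v\<close> nearby, where \<open>|Re (z'\<^sup>2)|\<close> is at most
    \<open>4 * \<delta> * t\<^sup>2\<close>; returning to \<open>z\<close> changes the square by at
    most \<open>3 * \<delta> * t\<^sup>2\<close>. On the ray through \<open>cis \<theta>\<close>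
    this bounds \<open>|cos (2 * \<theta>)|\<close> by \<open>7 * \<delta>\<close>.\<close>
  have theta4: "\<theta> = pi / 4"
  proof -
    have "\<bar>cos (2 * \<theta>)\<bar> \<le> 0"
    proof (rule field_le_epsilon)
      fix e :: real
      assume "e > 0"
      define \<delta> where "\<delta> = min 1 (e / 7)"
      have \<delta>: "0 < \<delta>" "\<delta> \<le> 1" "7 * \<delta> \<le> e" using \<open>e > 0\<close> by (auto simp: \<delta>_def)
      obtain r1 where r1: "r1 > 0" and a1: "\<And>z. 0 < cmod z \<Longrightarrow> cmod z < r1 \<Longrightarrow>
          \<exists>b>0. \<bar>v z - b * \<sigma> * Re (z\<^sup>2)\<bar> \<le> \<delta> * b * (cmod z)\<^sup>2"
        using asym[OF \<delta>(1)] by blast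
      obtain r2 where r2: "r2 > 0" and a2: "\<And>z. on_cross \<theta> z \<Longrightarrow> 0 < cmod z \<Longrightarrow> cmod z < r2 \<Longrightarrow>
          \<exists>z'. cmod (z' - z) \<le> \<delta> * cmod z \<and> v z' \<le> 0 \<and> (\<exists>\<^sub>F y in nhds z'. 0 < v y)"
        using flat2[OF \<delta>(1)] by blast
      define t where "t = min (min r1 R / 2) r2 / 2"
      have t: "0 < t" "2 * t < r1" "2 * t < R" "t < r2" using r1 r2 R by (auto simp: t_def)
      define z where "z = of_real t * cis \<theta>"
      have cz: "cmod z = t" using t by (simp add: z_def norm_mult)
      have "on_cross \<theta> z" by (simp add: on_cross_def z_def)
      then obtain z' where z': "cmod (z' - z) \<le> \<delta> * t" "v z' \<le> 0" "\<exists>\<^sub>F y in nhds z'. 0 < v y"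
        using a2[of z] t unfolding cz by blast
      have dt: "\<delta> * t \<le> t" using \<delta> t by simp
      have cz': "cmod z' \<le> 2 * t" using norm_triangle_ineq[of "z' - z" z] z'(1) dt cz by simp
      have "v z' = 0" by (rule fb_zero) (use cz' t z' in auto)
      have "\<bar>Re (z'\<^sup>2)\<bar> \<le> \<delta> * (cmod z')\<^sup>2"
      proof (cases "z' = 0")
        case False
        then obtain b where b: "b > 0" "\<bar>v z' - b * \<sigma> * Re (z'\<^sup>2)\<bar> \<le> \<delta> * b * (cmod z')\<^sup>2"
          using a1[of z'] cz' t by auto
        have "\<bar>\<sigma>\<bar> = 1" using \<sigma> by auto
        then have "b * \<bar>Re (z'\<^sup>2)\<bar> \<le> b * (\<delta> * (cmod z')\<^sup>2)"
          using b \<open>v z' = 0\<close> by (simp add: abs_mult mult_ac)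
        then show ?thesis using b(1) mult_le_cancel_left_pos by blast
      qed simp
      also have "\<dots> \<le> \<delta> * (2 * t)\<^sup>2" using cz' \<delta> by (intro mult_left_mono power_mono) auto
      finally have 1: "\<bar>Re (z'\<^sup>2)\<bar> \<le> 4 * \<delta> * t\<^sup>2" by (simp add: power_mult_distrib)
      have "z\<^sup>2 - z'\<^sup>2 = (z - z') * (z + z')" by (simp add: power2_eq_square algebra_simps)
      then have "cmod (z\<^sup>2 - z'\<^sup>2) = cmod (z' - z) * cmod (z + z')" by (simp add: norm_mult norm_minus_commute)
      also have "\<dots> \<le> (\<delta> * t) * (3 * t)"
        using z'(1) norm_triangle_ineq[of z z'] cz cz' \<delta> t by (intro mult_mono) auto
      finally have 2: "\<bar>Re (z\<^sup>2 - z'\<^sup>2)\<bar> \<le> 3 * \<delta> * t\<^sup>2"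
        using abs_Re_le_cmod[of "z\<^sup>2 - z'\<^sup>2"] by (simp add: power2_eq_square)
      have "\<bar>Re (z\<^sup>2)\<bar> \<le> \<bar>Re (z\<^sup>2 - z'\<^sup>2)\<bar> + \<bar>Re (z'\<^sup>2)\<bar>" by simp
      also have "\<dots> \<le> 7 * \<delta> * t\<^sup>2" using 1 2 by simp
      also have "z\<^sup>2 = of_real (t\<^sup>2) * cis (2 * \<theta>)" by (simp add: z_def power_mult_distrib Complex.DeMoivre)
      also have "\<bar>Re (of_real (t\<^sup>2) * cis (2 * \<theta>))\<bar> = t\<^sup>2 * \<bar>cos (2 * \<theta>)\<bar>" by (simp add: abs_mult)
      finally have "t\<^sup>2 * \<bar>cos (2 * \<theta>)\<bar> \<le> t\<^sup>2 * (7 * \<delta>)" by (simp add: mult_ac)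
      then have "\<bar>cos (2 * \<theta>)\<bar> \<le> 7 * \<delta>" using t(1) by simp
      then show "\<bar>cos (2 * \<theta>)\<bar> \<le> 0 + e" using \<delta> by simp
    qed
    then have "cos (2 * \<theta>) = cos (pi / 2)" by simp
    then have "2 * \<theta> = pi / 2" using cos_inj_pi[of "2 * \<theta>" "pi / 2"] theta by simp
    then show ?thesis by simp
  qed
  have "V 0 = 0" by (simp add: V_def v0)
  then obtain N \<gamma> where N: "open N" "0 \<in> N" "N \<subseteq> ball 0 R"
    and set: "{z \<in> N. V z = 0} = (\<Union>k<4. (\<lambda>t. \<i> ^ k * \<gamma> k t) ` {0..<1})"
    and \<gamma>: "\<And>k::nat. C1_arc (\<gamma> k)" "\<And>k. \<gamma> k 0 = 0"
      "\<And>k. \<exists>c>0. (\<gamma> k has_vector_derivative of_real c) (at 0)"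
      "\<And>k t. 0 < t \<Longrightarrow> t \<le> 1 \<Longrightarrow> \<bar>Im (\<gamma> k t)\<bar> < Re (\<gamma> k t)"
    and freq: "\<And>z. z \<in> N \<Longrightarrow> V z = 0 \<Longrightarrow> z \<noteq> 0 \<Longrightarrow> (\<exists>\<^sub>F y in nhds z. 0 < V y) \<and> (\<exists>\<^sub>F y in nhds z. V y < 0)"
    by (rule saddle_like_zero_set[OF sad _ R]) (rule that)
  define N' where "N' = (\<lambda>z. cnj q * z) -` N"
  show thesis
  proof (rule that[of N' \<gamma>])
    show "open N'" unfolding N'_def by (intro open_vimage N continuous_intros)
    show "0 \<in> N'" using N by (simp add: N'_def)
    show "N' \<subseteq> ball 0 R" using N(3) by (force simp: N'_def norm_mult q)
    have iff: "v z \<le> 0 \<and> (\<exists>\<^sub>F y in nhds z. 0 < v y) \<longleftrightarrow> V (cnj q * z) = 0" if "z \<in> N'" for z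
    proof
      have zR: "cmod z < R" using that N(3) by (force simp: N'_def norm_mult q)
      have qz: "q * (cnj q * z) = z" using cq by (simp flip: mult.assoc)
      assume "v z \<le> 0 \<and> (\<exists>\<^sub>F y in nhds z. 0 < v y)"
      then show "V (cnj q * z) = 0" using fb_zero[OF zR] by (simp add: V_def qz)
    next
      assume V: "V (cnj q * z) = 0"
      have qz: "q * (cnj q * z) = z" using cq by (simp flip: mult.assoc)
      have "v z = 0" using V \<sigma> by (auto simp: V_def qz)
      moreover have "\<exists>\<^sub>F y in nhds z. 0 < v y"
      proof (cases "z = 0")
        case False
        then have "cnj q * z \<noteq> 0" using \<open>q \<noteq> 0\<close> by simp
        moreover have "cnj q * z \<in> N" using that by (simp add: N'_def)
        ultimately have fr: "\<exists>\<^sub>F y in nhds (cnj q * z). 0 < V y" "\<exists>\<^sub>F y in nhds (cnj q * z). V y < 0"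
          using freq V by blast+
        have "\<exists>\<^sub>F y in nhds (cnj q * z). 0 < v (q * y)"
          using \<sigma> fr by (auto simp: V_def)
        then show ?thesis
          unfolding frequently_nhds_metric
        proof (intro allI impI, elim allE impE)
          fix e :: real
          assume "\<exists>y. dist y (cnj q * z) < e \<and> 0 < v (q * y)"
          then obtain y where y: "dist y (cnj q * z) < e" "0 < v (q * y)" by blast
          have "q * y - z = q * (y - cnj q * z)" using qz by (simp add: algebra_simps)
          then have "dist (q * y) z = dist y (cnj q * z)" by (simp add: dist_norm norm_mult q)
          with y(1) have "dist (q * y) z < e" by (simp only:)
          then show "\<exists>y. dist y z < e \<and> 0 < v y" using y(2) by (intro exI[of _ "q * y"] conjI)
        qed
      qed (use fb0 in simp)
      ultimately show "v z \<le> 0 \<and> (\<exists>\<^sub>F y in nhds z. 0 < v y)" by simp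
    qed
    have "{z \<in> N'. v z \<le> 0 \<and> (\<exists>\<^sub>F y in nhds z. 0 < v y)} = {z \<in> N'. V (cnj q * z) = 0}"
      using iff by blast
    also have "\<dots> = (\<lambda>z. q * z) ` {z \<in> N. V z = 0}"
    proof (intro equalityI subsetI)
      fix z
      assume "z \<in> {z \<in> N'. V (cnj q * z) = 0}"
      then show "z \<in> (\<lambda>z. q * z) ` {z \<in> N. V z = 0}"
        using cq by (intro image_eqI[of _ _ "cnj q * z"]) (auto simp: N'_def simp flip: mult.assoc)
    next
      fix z
      assume "z \<in> (\<lambda>z. q * z) ` {z \<in> N. V z = 0}"
      then show "z \<in> {z \<in> N'. V (cnj q * z) = 0}"
        using cq by (auto simp: N'_def simp flip: mult.assoc)
    qed
    also have "\<dots> = (\<Union>k<4. (\<lambda>t. cis (pi / 4) * (\<i> ^ k * \<gamma> k t)) ` {0..<1})"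
      unfolding set q_def[symmetric] by (simp add: image_UN image_image)
    finally show "{z \<in> N'. v z \<le> 0 \<and> (\<exists>\<^sub>F y in nhds z. 0 < v y)} = (\<Union>k<4. (\<lambda>t. cis (pi / 4) * (\<i> ^ k * \<gamma> k t)) ` {0..<1})" .
  qed (use theta4 \<gamma> in blast)+
qed

section \<open>Reduction of \<open>F\<close> to the Laplacian\<close>

definition outer_prod :: "real ^ 'n \<Rightarrow> real ^ 'n \<Rightarrow> real ^ 'n ^ 'n" where
  "outer_prod s t = (\<chi> i j. s $ i * t $ j)"

lemma outer_prod_mult_vec: "outer_prod s t *v x = (t \<bullet> x) *\<^sub>R s"
  by (simp add: vec_eq_iff outer_prod_def matrix_vector_mult_def inner_vec_def sum_distrib_left sum_distrib_right mult_ac)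

lemma inner_outer_prod: "x \<bullet> (outer_prod s t *v x) = (s \<bullet> x) * (t \<bullet> x)"
  by (simp add: outer_prod_mult_vec inner_commute)

lemma sym_mats_outer_prod: "outer_prod s t + outer_prod t s \<in> sym_mats" "outer_prod s s \<in> sym_mats"
  by (simp_all add: sym_mats_def vec_eq_iff transpose_def outer_prod_def mult.commute add.commute)

lemma psd_mats_outer_prod: "outer_prod s s \<in> psd_mats"
  by (simp add: psd_mats_def sym_mats_outer_prod inner_outer_prod)

lemma sym_mats_add: "A \<in> sym_mats \<Longrightarrow> B \<in> sym_mats \<Longrightarrow> A + B \<in> sym_mats"
  by (simp add: sym_mats_def vec_eq_iff transpose_def)

lemma sym_mats_scaleR: "A \<in> sym_mats \<Longrightarrow> t *\<^sub>R A \<in> sym_mats"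
  by (simp add: sym_mats_def vec_eq_iff transpose_def)

text \<open>Convexity and homogeneity give subadditivity. Applied to \<open>- A\<close> and
  \<open>- B\<close>, where \<open>F\<close> changes sign, the same inequality is reversed.\<close>

lemma convex_homogeneous_additive:
  assumes cvx: "convex_on sym_mats F" and hom: "homogeneous_deg1 F"
    and "A \<in> sym_mats" "B \<in> sym_mats"
  shows "F (A + B) = F A + F B"
proof -
  have H: "F (t *\<^sub>R A) = t * F A" if "A \<in> sym_mats" for A t
    using hom that by (simp add: homogeneous_deg1_def)
  have le: "F (A + B) \<le> F A + F B" if AB: "A \<in> sym_mats" "B \<in> sym_mats" for A B
  proof -
    have "F ((1 - 1 / 2) *\<^sub>R A + (1 / 2) *\<^sub>R B) \<le> (1 - 1 / 2) * F A + 1 / 2 * F B"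
      by (rule convex_onD[OF cvx]) (use AB in auto)
    moreover have "(1 - 1 / 2) *\<^sub>R A + (1 / 2) *\<^sub>R B = (1 / 2) *\<^sub>R (A + B)" by (simp add: scaleR_right_distrib)
    ultimately show ?thesis using H[OF sym_mats_add[OF AB], of "1 / 2"] by simp
  qed
  have neg: "F (- A) = - F A" "- A \<in> sym_mats" if "A \<in> sym_mats" for A
    using H[OF that, of "- 1"] sym_mats_scaleR[OF that, of "- 1"] by simp_all
  have "F (- A + - B) \<le> F (- A) + F (- B)" using assms neg by (intro le) auto
  moreover have "- A + - B = - (A + B)" by simp
  ultimately have "F A + F B \<le> F (A + B)" using assms neg sym_mats_add by fastforce
  then show ?thesis using le[OF assms(3,4)] by simp
qed

locale linear_elliptic =
  fixes F :: "real ^ 2 ^ 2 \<Rightarrow> real" and M :: real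
  assumes additive: "\<And>A B. A \<in> sym_mats \<Longrightarrow> B \<in> sym_mats \<Longrightarrow> F (A + B) = F A + F B"
    and homogeneous: "\<And>A t. A \<in> sym_mats \<Longrightarrow> F (t *\<^sub>R A) = t * F A"
    and positive: "\<And>s. s \<noteq> 0 \<Longrightarrow> 0 < F (outer_prod s s)"
    and M: "0 < M"
begin

text \<open>A linear \<open>F\<close> is a contraction with a fixed symmetric matrix; this is the
  associated bilinear form on covectors, the polarised principal symbol. Ellipticity makes it an
  inner product.\<close>

definition ip :: "real ^ 2 \<Rightarrow> real ^ 2 \<Rightarrow> real" where
  "ip s t = F (outer_prod s t + outer_prod t s) / 2"

lemma ip_commute: "ip s t = ip t s"
  by (simp add: ip_def add.commute)

lemma ip_add: "ip (s + s') t = ip s t + ip s' t"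
proof -
  have "outer_prod (s + s') t + outer_prod t (s + s')
      = (outer_prod s t + outer_prod t s) + (outer_prod s' t + outer_prod t s')"
    by (simp add: vec_eq_iff outer_prod_def algebra_simps)
  then show ?thesis by (simp add: ip_def additive sym_mats_outer_prod add_divide_distrib)
qed

lemma ip_scaleR: "ip (r *\<^sub>R s) t = r * ip s t"
proof -
  have "outer_prod (r *\<^sub>R s) t + outer_prod t (r *\<^sub>R s) = r *\<^sub>R (outer_prod s t + outer_prod t s)"
    by (simp add: vec_eq_iff outer_prod_def algebra_simps)
  then show ?thesis by (simp add: ip_def homogeneous sym_mats_outer_prod)
qed

lemma ip_add_right: "ip t (s + s') = ip t s + ip t s'"
  using ip_add[of s s' t] by (simp add: ip_commute)

lemma ip_scaleR_right: "ip t (r *\<^sub>R s) = r * ip t s"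
  using ip_scaleR[of r s t] by (simp add: ip_commute)

lemma ip_diff: "ip (s - s') t = ip s t - ip s' t" "ip t (s - s') = ip t s - ip t s'"
  using ip_add[of s "(- 1) *\<^sub>R s'" t] ip_add_right[of t s "(- 1) *\<^sub>R s'"] ip_scaleR[of "- 1" s' t] ip_scaleR_right[of t "- 1" s']
  by simp_all

lemma F_outer_prod: "F (outer_prod s s) = ip s s"
proof -
  have "outer_prod s s + outer_prod s s = 2 *\<^sub>R outer_prod s s" by (simp add: scaleR_2)
  then show ?thesis by (simp add: ip_def homogeneous sym_mats_outer_prod)
qed

lemma ip_pos: "s \<noteq> 0 \<Longrightarrow> 0 < ip s s"
  using positive by (simp add: F_outer_prod)

text \<open>Coordinates in which \<open>F\<close> becomes the Laplacian and the coordinate axes bisect the cross.\<close>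

lemma adapted_coordinates:
  obtains T :: "complex \<Rightarrow> real ^ 2" and S :: "real ^ 2 \<Rightarrow> complex" and \<theta> :: real where "0 < \<theta>" "\<theta> < pi / 2" "bounded_linear T" "bounded_linear S"
    and "\<And>z. S (T z) = z" and "\<And>x. T (S x) = x"
    and "\<And>x :: real ^ 2. M * x $ 1 - x $ 2 = 0 \<longleftrightarrow> Im (cis (- \<theta>) * S x) = 0"
    and "\<And>x :: real ^ 2. M * x $ 1 + x $ 2 = 0 \<longleftrightarrow> Im (cis \<theta> * S x) = 0"
    and "\<exists>k>0. T (cis \<theta>) = k *\<^sub>R vector [1, M]" and "\<exists>k>0. T (cis (- \<theta>)) = k *\<^sub>R vector [1, - M]"
    and "\<And>k b c (\<kappa> :: real) z0. \<exists>a' b' A. A \<in> sym_mats \<and> F A = 4 * \<kappa> \<and>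
      (\<forall>x. paraboloid a' b' A x = k + Re (b * (S x - z0)) + Re (c * (S x - z0)\<^sup>2) + \<kappa> * (cmod (S x - z0))\<^sup>2)"
proof -
  \<comment> \<open>Covectors vanishing on the two lines of the cross. Once they are normalised for
    \<open>ip\<close>, only their product \<open>g\<close> matters, and it determines the opening of
    the cross in the new coordinates.\<close>
  define l1 l2 :: "real ^ 2" where "l1 = vector [M, - 1]" and "l2 = vector [M, 1]"
  have l0: "l1 \<noteq> 0" "l2 \<noteq> 0" using M by (auto simp: l1_def l2_def vec_eq_iff forall_2)
  define n1 n2 where "n1 = sqrt (ip l1 l1)" and "n2 = sqrt (ip l2 l2)"
  have n: "0 < n1" "0 < n2" "n1\<^sup>2 = ip l1 l1" "n2\<^sup>2 = ip l2 l2"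
    using ip_pos[OF l0(1)] ip_pos[OF l0(2)] by (simp_all add: n1_def n2_def)
  define m1 m2 where "m1 = (1 / n1) *\<^sub>R l1" and "m2 = (1 / n2) *\<^sub>R l2"
  have m: "ip m1 m1 = 1" "ip m2 m2 = 1"
    using n by (simp_all add: m1_def m2_def ip_scaleR ip_scaleR_right flip: n(3,4)) (simp_all add: power2_eq_square)
  define g where "g = ip m1 m2"
  have ne: "m1 + m2 \<noteq> 0" "m1 - m2 \<noteq> 0"
  proof -
    have c: "m1 $ 1 = M / n1" "m1 $ 2 = - 1 / n1" "m2 $ 1 = M / n2" "m2 $ 2 = 1 / n2"
      by (simp_all add: m1_def m2_def l1_def l2_def)
    have "0 < m1 $ 1 + m2 $ 1" unfolding c using M n by (intro add_pos_pos) auto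
    then show "m1 + m2 \<noteq> 0" by (metis vector_add_component zero_index less_irrefl)
    have "m1 $ 2 - m2 $ 2 < 0" unfolding c using n by (simp add: field_simps)
    then show "m1 - m2 \<noteq> 0" by (metis vector_minus_component zero_index less_irrefl)
  qed
  have "0 < ip (m1 + m2) (m1 + m2)" by (rule ip_pos[OF ne(1)])
  then have g1: "- 1 < g" by (simp add: ip_add ip_add_right m g_def ip_commute[of m2 m1])
  have "0 < ip (m1 - m2) (m1 - m2)" by (rule ip_pos[OF ne(2)])
  then have g2: "g < 1" by (simp add: ip_diff m g_def ip_commute[of m2 m1])
  \<comment> \<open>In the new coordinates \<open>m1\<close> and \<open>m2\<close> are to become
    \<open>X sin \<theta> - Y cos \<theta>\<close> and
    \<open>X sin \<theta> + Y cos \<theta>\<close>, whose product is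
    \<open>- cos (2 * \<theta>)\<close>. Equating this with \<open>g\<close> gives the
    angle.\<close>
  define \<theta> where "\<theta> = arcsin (sqrt ((1 + g) / 2))"
  have sq: "0 < sqrt ((1 + g) / 2)" "sqrt ((1 + g) / 2) < 1" using g1 g2 by (auto simp: real_sqrt_lt_1_iff)
  have sin: "sin \<theta> = sqrt ((1 + g) / 2)" unfolding \<theta>_def by (rule sin_arcsin) (use sq in linarith)+
  have th: "0 < \<theta>" "\<theta> < pi / 2"
  proof -
    have "arcsin 0 < \<theta>" "\<theta> < arcsin 1"
      unfolding \<theta>_def by (rule arcsin_less_arcsin; use sq in linarith)+
    then show "0 < \<theta>" "\<theta> < pi / 2" by (simp_all only: arcsin_0 arcsin_1)
  qed
  have sc: "0 < sin \<theta>" "0 < cos \<theta>" using th by (auto intro: sin_gt_zero cos_gt_zero)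
  have sin2: "(sin \<theta>)\<^sup>2 = (1 + g) / 2" using g1 by (simp add: sin)
  have cos2: "(cos \<theta>)\<^sup>2 = (1 - g) / 2" unfolding cos_squared_eq sin2 by (simp add: field_simps)
  \<comment> \<open>Sum and difference of two unit covectors are orthogonal for \<open>ip\<close>;
    the factors normalise them.\<close>
  define s1 s2 where "s1 = (1 / (2 * sin \<theta>)) *\<^sub>R (m1 + m2)" and "s2 = (1 / (2 * cos \<theta>)) *\<^sub>R (m2 - m1)"
  have s11: "ip s1 s1 = 1"
  proof -
    have "ip s1 s1 = (2 + 2 * g) / (4 * (sin \<theta>)\<^sup>2)"
      using sc by (simp add: s1_def ip_scaleR ip_scaleR_right ip_add ip_add_right m g_def ip_commute[of m2 m1] power2_eq_square,
          simp add: field_simps)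
    then show ?thesis unfolding sin2 using g1 by (simp add: field_simps)
  qed
  have s22: "ip s2 s2 = 1"
  proof -
    have "ip s2 s2 = (2 - 2 * g) / (4 * (cos \<theta>)\<^sup>2)"
      using sc by (simp add: s2_def ip_scaleR ip_scaleR_right ip_diff m g_def ip_commute[of m2 m1] power2_eq_square,
          simp add: field_simps)
    then show ?thesis unfolding cos2 using g2 by (simp add: field_simps)
  qed
  have s12: "ip s1 s2 = 0"
    by (simp add: s1_def s2_def ip_scaleR ip_scaleR_right ip_diff ip_add ip_add_right m ip_commute[of m2 m1])
  define p1 p2 where "p1 z = - Im (cis (- \<theta>) * z)" and "p2 z = Im (cis \<theta> * z)" for z
  have p: "p1 z = Re z * sin \<theta> - Im z * cos \<theta>" "p2 z = Re z * sin \<theta> + Im z * cos \<theta>" for z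
    by (simp_all add: p1_def p2_def algebra_simps)
  define T :: "complex \<Rightarrow> real ^ 2" where
    "T z = vector [(n2 * p2 z + n1 * p1 z) / (2 * M), (n2 * p2 z - n1 * p1 z) / 2]" for z
  define S where "S x = Complex (s1 \<bullet> x) (s2 \<bullet> x)" for x
  have inner: "l1 \<bullet> x = M * x $ 1 - x $ 2" "l2 \<bullet> x = M * x $ 1 + x $ 2" for x
    by (simp_all add: l1_def l2_def inner_vec_def sum_2)
  have mi: "m1 \<bullet> x = (M * x $ 1 - x $ 2) / n1" "m2 \<bullet> x = (M * x $ 1 + x $ 2) / n2" for x
    by (simp_all add: m1_def m2_def inner)
  have si: "s1 \<bullet> x = (m1 \<bullet> x + m2 \<bullet> x) / (2 * sin \<theta>)" "s2 \<bullet> x = (m2 \<bullet> x - m1 \<bullet> x) / (2 * cos \<theta>)" for x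
    by (simp_all add: s1_def s2_def inner_add_left inner_diff_left)
  have pS: "p1 (S x) = m1 \<bullet> x" "p2 (S x) = m2 \<bullet> x" for x
    using sc by (simp_all add: p S_def si field_simps)
  have mT: "m1 \<bullet> T z = p1 z" "m2 \<bullet> T z = p2 z" for z
    using n M by (simp_all add: mi T_def field_simps)
  have ST: "S (T z) = z" for z
    using sc by (simp add: S_def si mT p complex_eq_iff field_simps)
  have TS: "T (S x) = x" for x
    using n M by (simp add: T_def pS mi vec_eq_iff forall_2 field_simps)
  have bS: "bounded_linear S"
    unfolding S_def[abs_def] Complex_eq
    by (intro bounded_linear_add bounded_linear_compose[OF bounded_linear_of_real] bounded_linear_inner_right
        bounded_linear_compose[OF bounded_linear_mult_right])
  have bT: "bounded_linear T"
  proof (rule linear_conv_bounded_linear[THEN iffD1], rule linearI)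
    show "T (x + y) = T x + T y" for x y
      using M by (simp add: T_def p vec_eq_iff forall_2 field_simps)
    show "T (r *\<^sub>R x) = r *\<^sub>R T x" for r x
      using M by (simp add: T_def p vec_eq_iff forall_2 field_simps)
  qed
  have z1: "M * x $ 1 - x $ 2 = 0 \<longleftrightarrow> Im (cis (- \<theta>) * S x) = 0" for x
    using pS(1)[of x] n unfolding p1_def mi by auto
  have z2: "M * x $ 1 + x $ 2 = 0 \<longleftrightarrow> Im (cis \<theta> * S x) = 0" for x
    using pS(2)[of x] n unfolding p2_def mi by auto
  have "0 < sin (2 * \<theta>)" using th by (intro sin_gt_zero) auto
  have t1: "T (cis \<theta>) = (n2 * sin (2 * \<theta>) / (2 * M)) *\<^sub>R vector [1, M]"
    unfolding sin_double using M by (simp add: T_def p vec_eq_iff forall_2 field_simps)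
  have t2: "T (cis (- \<theta>)) = (n1 * sin (2 * \<theta>) / (2 * M)) *\<^sub>R vector [1, - M]"
    unfolding sin_double using M by (simp add: T_def p vec_eq_iff forall_2 field_simps)
  have quad: "\<exists>a' b' A. A \<in> sym_mats \<and> F A = 4 * \<kappa> \<and>
      (\<forall>x. paraboloid a' b' A x = k + Re (b * (S x - z0)) + Re (c * (S x - z0)\<^sup>2) + \<kappa> * (cmod (S x - z0))\<^sup>2)"
    for k b c \<kappa> z0
  proof -
    \<comment> \<open>The coefficients of the quadratic form in the coordinates \<open>s1\<close>
      and \<open>s2\<close>. As these are orthonormal for \<open>ip\<close>, \<open>F A\<close> is
      the trace \<open>2 * \<alpha> + 2 * \<gamma>\<close>, in which the part coming from
      \<open>c\<close> cancels.\<close>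
    define \<alpha> \<beta> \<gamma> where "\<alpha> = Re c + \<kappa>" and "\<beta> = - 2 * Im c" and "\<gamma> = - Re c + \<kappa>"
    define P Q where "P = Re z0" and "Q = Im z0"
    define A where "A = (2 * \<alpha>) *\<^sub>R outer_prod s1 s1 + (\<beta> *\<^sub>R (outer_prod s1 s2 + outer_prod s2 s1) + (2 * \<gamma>) *\<^sub>R outer_prod s2 s2)"
    define b' where "b' = (Re b - 2 * \<alpha> * P - \<beta> * Q) *\<^sub>R s1 + (- Im b - \<beta> * P - 2 * \<gamma> * Q) *\<^sub>R s2"
    define a' where "a' = k - Re b * P + Im b * Q + \<alpha> * P\<^sup>2 + \<beta> * P * Q + \<gamma> * Q\<^sup>2"
    have sym: "A \<in> sym_mats"
      unfolding A_def by (intro sym_mats_add sym_mats_scaleR sym_mats_outer_prod)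
    have "F A = 2 * \<alpha> * ip s1 s1 + (\<beta> * (2 * ip s1 s2) + 2 * \<gamma> * ip s2 s2)"
      unfolding A_def
      by (simp add: additive homogeneous sym_mats_add sym_mats_scaleR sym_mats_outer_prod F_outer_prod ip_def[of s1 s2])
    then have "F A = 4 * \<kappa>" by (simp add: s11 s12 s22 \<alpha>_def \<gamma>_def)
    moreover have "paraboloid a' b' A x = k + Re (b * (S x - z0)) + Re (c * (S x - z0)\<^sup>2) + \<kappa> * (cmod (S x - z0))\<^sup>2" for x
    proof -
      define X Y where "X = s1 \<bullet> x" and "Y = s2 \<bullet> x"
      have q: "x \<bullet> (A *v x) = 2 * \<alpha> * X\<^sup>2 + 2 * \<beta> * X * Y + 2 * \<gamma> * Y\<^sup>2"
        unfolding A_def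
        by (simp add: matrix_vector_mult_add_rdistrib scaleR_matrix_vector_assoc[symmetric] inner_add_right
            inner_outer_prod X_def Y_def power2_eq_square algebra_simps)
      have l: "b' \<bullet> x = (Re b - 2 * \<alpha> * P - \<beta> * Q) * X + (- Im b - \<beta> * P - 2 * \<gamma> * Q) * Y"
        by (simp add: b'_def inner_add_left X_def Y_def)
      have h: "Re (S x - z0) = X - P" "Im (S x - z0) = Y - Q" by (simp_all add: S_def X_def Y_def P_def Q_def)
      have "Re (b * (S x - z0)) + Re (c * (S x - z0)\<^sup>2) + \<kappa> * (cmod (S x - z0))\<^sup>2
        = Re b * (X - P) - Im b * (Y - Q) + (Re c * ((X - P)\<^sup>2 - (Y - Q)\<^sup>2) - Im c * (2 * (X - P) * (Y - Q)))
          + \<kappa> * ((X - P)\<^sup>2 + (Y - Q)\<^sup>2)"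
        unfolding cmod_power2 times_complex.sel Re_power2 Im_power2 h by simp
      then show ?thesis
        unfolding paraboloid_def q l a'_def \<alpha>_def \<beta>_def \<gamma>_def by (simp add: power2_eq_square algebra_simps)
    qed
    ultimately show ?thesis using sym by blast
  qed
  show thesis
  proof (rule that[OF th bT bS ST TS z1 z2 _ _ quad])
    show "\<exists>k>0. T (cis \<theta>) = k *\<^sub>R vector [1, M]"
      using t1 M n \<open>0 < sin (2 * \<theta>)\<close> by (intro exI[of _ "n2 * sin (2 * \<theta>) / (2 * M)"]) simp
    show "\<exists>k>0. T (cis (- \<theta>)) = k *\<^sub>R vector [1, - M]"
      using t2 M n \<open>0 < sin (2 * \<theta>)\<close> by (intro exI[of _ "n1 * sin (2 * \<theta>) / (2 * M)"]) simp
  qed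
qed

end

text \<open>Positivity is the lower ellipticity bound at the zero matrix, tested with rank-one
  increments.\<close>

lemma linear_ellipticI:
  assumes "convex_on sym_mats F" and "uniformly_elliptic F" and hom: "homogeneous_deg1 F" and "0 < M"
  shows "linear_elliptic F M"
proof
  show "F (A + B) = F A + F B" if "A \<in> sym_mats" "B \<in> sym_mats" for A B
    using convex_homogeneous_additive[OF assms(1,3) that] .
  show "F (t *\<^sub>R A) = t * F A" if "A \<in> sym_mats" for A t
    using hom that by (simp add: homogeneous_deg1_def)
  obtain l where l: "l > 0" "\<And>A N. A \<in> sym_mats \<Longrightarrow> N \<in> psd_mats \<Longrightarrow> l * onorm ((*v) N) \<le> F (A + N) - F A"
    using assms(2) unfolding uniformly_elliptic_def by blast
  show "0 < F (outer_prod s s)" if "s \<noteq> 0" for s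
  proof -
    have z: "(0 :: real ^ 2 ^ 2) \<in> sym_mats" by (simp add: sym_mats_def vec_eq_iff transpose_def)
    have "F 0 = 0" using hom z unfolding homogeneous_deg1_def by (metis mult_zero_left scaleR_zero_left)
    then have le: "l * onorm ((*v) (outer_prod s s)) \<le> F (outer_prod s s)"
      using l(2)[OF z psd_mats_outer_prod[of s]] by simp
    have pos: "0 < onorm ((*v) (outer_prod s s))"
    proof (subst onorm_pos_lt)
      show "bounded_linear ((*v) (outer_prod s s))" by (rule matrix_vector_mul_bounded_linear)
      have "outer_prod s s *v s \<noteq> 0" using that by (simp add: outer_prod_mult_vec)
      then show "\<not> (\<forall>x. outer_prod s s *v x = 0)" by blast
    qed
    show ?thesis by (rule less_le_trans[OF mult_pos_pos[OF l(1) pos] le])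
  qed
qed fact

section \<open>Return to the original coordinates\<close>

text \<open>Real suprema bound their members only if the set is bounded above; the common point 0
  and the radius \<open>r\<close> supply the bound.\<close>

lemma Hausdorff_dist_upper:
  fixes A B :: "'a::real_normed_vector set"
  assumes "A \<subseteq> ball 0 r" "B \<subseteq> ball 0 r" "0 \<in> A" "0 \<in> B"
  shows "a \<in> A \<Longrightarrow> infdist a B \<le> Hausdorff_dist A B" and "b \<in> B \<Longrightarrow> infdist b A \<le> Hausdorff_dist A B"
proof -
  have "infdist x B \<le> r" if "x \<in> A" for x
    using infdist_le[OF assms(4), of x] assms(1) that by force
  then have "bdd_above ((\<lambda>a. infdist a B) ` A)" by (intro bdd_aboveI2[of _ _ r])
  then show "infdist a B \<le> Hausdorff_dist A B" if "a \<in> A"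
    unfolding Hausdorff_dist_def using cSUP_upper[OF that] by fastforce
  have "infdist x A \<le> r" if "x \<in> B" for x
    using infdist_le[OF assms(3), of x] assms(2) that by force
  then have "bdd_above ((\<lambda>b. infdist b A) ` B)" by (intro bdd_aboveI2[of _ _ r])
  then show "infdist b A \<le> Hausdorff_dist A B" if "b \<in> B"
    unfolding Hausdorff_dist_def using cSUP_upper[OF that] by fastforce
qed

lemma infdist_less_imp_near:
  assumes "A \<noteq> {}" and "infdist x A < e"
  shows "\<exists>a\<in>A. dist x a < e"
proof (rule ccontr)
  assume "\<not> ?thesis"
  then have "e \<le> infdist x A" using assms(1) by (simp add: infdist_def not_less) (rule cINF_greatest, auto)
  then show False using assms(2) by simp
qed

text \<open>Flatness is used at the radius \<open>2 * norm x\<close>, so that \<open>x\<close> lies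
  in the open disc; the doubled radius is the reason for the bound
  \<open>\<epsilon> / 2\<close>.\<close>

lemma rank2_flat_near:
  assumes flat: "rank2_flat_at_0 \<Omega> u p" and zero: "0 \<in> free_boundary \<Omega> u" "p 0 = 0" and "\<epsilon> > 0"
  obtains r where "r > 0"
    and "\<And>x. x \<in> free_boundary \<Omega> u \<Longrightarrow> 0 < norm x \<Longrightarrow> norm x < r \<Longrightarrow> \<exists>y. p y = 0 \<and> dist x y < \<epsilon> * norm x"
    and "\<And>x. p x = 0 \<Longrightarrow> 0 < norm x \<Longrightarrow> norm x < r \<Longrightarrow> \<exists>y\<in>free_boundary \<Omega> u. dist x y < \<epsilon> * norm x"
proof -
  have "\<forall>\<^sub>F r in at_right 0. (1 / r) * Hausdorff_dist (free_boundary \<Omega> u \<inter> ball 0 r) ({x. p x = 0} \<inter> ball 0 r) < \<epsilon> / 2"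
    using flat \<open>\<epsilon> > 0\<close> unfolding rank2_flat_at_0_def by (intro order_tendstoD(2)) auto
  then obtain d where d: "d > 0" and HD: "\<And>r. 0 < r \<Longrightarrow> r < d \<Longrightarrow>
      (1 / r) * Hausdorff_dist (free_boundary \<Omega> u \<inter> ball 0 r) ({x. p x = 0} \<inter> ball 0 r) < \<epsilon> / 2"
    unfolding eventually_at_right_field by auto
  have near: "infdist x ({x. p x = 0} \<inter> ball 0 (2 * norm x)) < \<epsilon> * norm x" if "x \<in> free_boundary \<Omega> u" "0 < norm x" "norm x < d / 2" for x
  proof -
    have "Hausdorff_dist (free_boundary \<Omega> u \<inter> ball 0 (2 * norm x)) ({x. p x = 0} \<inter> ball 0 (2 * norm x)) < \<epsilon> * norm x"
      using HD[of "2 * norm x"] that by (simp add: field_simps)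
    moreover have "infdist x ({x. p x = 0} \<inter> ball 0 (2 * norm x))
        \<le> Hausdorff_dist (free_boundary \<Omega> u \<inter> ball 0 (2 * norm x)) ({x. p x = 0} \<inter> ball 0 (2 * norm x))"
      by (rule Hausdorff_dist_upper[of _ "2 * norm x"]) (use that zero in auto)
    ultimately show ?thesis by linarith
  qed
  have near': "infdist x (free_boundary \<Omega> u \<inter> ball 0 (2 * norm x)) < \<epsilon> * norm x" if "p x = 0" "0 < norm x" "norm x < d / 2" for x
  proof -
    have "Hausdorff_dist (free_boundary \<Omega> u \<inter> ball 0 (2 * norm x)) ({x. p x = 0} \<inter> ball 0 (2 * norm x)) < \<epsilon> * norm x"
      using HD[of "2 * norm x"] that by (simp add: field_simps)
    moreover have "infdist x (free_boundary \<Omega> u \<inter> ball 0 (2 * norm x))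
        \<le> Hausdorff_dist (free_boundary \<Omega> u \<inter> ball 0 (2 * norm x)) ({x. p x = 0} \<inter> ball 0 (2 * norm x))"
      by (rule Hausdorff_dist_upper[of _ "2 * norm x"]) (use that zero in auto)
    ultimately show ?thesis by linarith
  qed
  show thesis
  proof (rule that[of "d / 2"])
    show "0 < d / 2" using d by simp
    show "\<exists>y. p y = 0 \<and> dist x y < \<epsilon> * norm x" if "x \<in> free_boundary \<Omega> u" "0 < norm x" "norm x < d / 2" for x
    proof -
      have "{x. p x = 0} \<inter> ball 0 (2 * norm x) \<noteq> {}" using zero that by auto
      from infdist_less_imp_near[OF this near[OF that]] show ?thesis by blast
    qed
    show "\<exists>y\<in>free_boundary \<Omega> u. dist x y < \<epsilon> * norm x" if "p x = 0" "0 < norm x" "norm x < d / 2" for x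
    proof -
      have "free_boundary \<Omega> u \<inter> ball 0 (2 * norm x) \<noteq> {}" using zero that by auto
      from infdist_less_imp_near[OF this near'[OF that]] show ?thesis by blast
    qed
  qed
qed

lemma free_boundary_iff:
  fixes u :: "'a::metric_space \<Rightarrow> real"
  assumes "open \<Omega>" and cont: "continuous_on \<Omega> u" and "x \<in> \<Omega>"
  shows "x \<in> free_boundary \<Omega> u \<longleftrightarrow> u x \<le> 0 \<and> (\<exists>\<^sub>F y in nhds x. 0 < u y)"
proof -
  have "pos_set \<Omega> u = \<Omega> \<inter> u -` {0<..}" by (auto simp: pos_set_def)
  then have "open (pos_set \<Omega> u)" using continuous_open_preimage[OF cont \<open>open \<Omega>\<close>, of "{0<..}"] by simp
  then have "x \<in> free_boundary \<Omega> u \<longleftrightarrow> x \<in> closure (pos_set \<Omega> u) \<and> x \<notin> pos_set \<Omega> u"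
    using \<open>x \<in> \<Omega>\<close> by (auto simp: free_boundary_def frontier_def interior_open)
  also have "x \<in> closure (pos_set \<Omega> u) \<longleftrightarrow> (\<exists>\<^sub>F y in nhds x. 0 < u y)"
  proof
    assume c: "x \<in> closure (pos_set \<Omega> u)"
    show "\<exists>\<^sub>F y in nhds x. 0 < u y"
      unfolding frequently_def
    proof
      assume "\<forall>\<^sub>F y in nhds x. \<not> 0 < u y"
      then obtain e where "e > 0" "\<And>y. dist y x < e \<Longrightarrow> \<not> 0 < u y" unfolding eventually_nhds_metric by blast
      then show False using c unfolding closure_approachable pos_set_def by blast
    qed
  next
    assume f: "\<exists>\<^sub>F y in nhds x. 0 < u y"
    show "x \<in> closure (pos_set \<Omega> u)"
      unfolding closure_approachable
    proof (intro allI impI)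
      fix e :: real
      assume "e > 0"
      then have "\<forall>\<^sub>F y in nhds x. dist y x < e" by (auto simp: eventually_nhds_metric)
      moreover have "\<forall>\<^sub>F y in nhds x. y \<in> \<Omega>" using assms eventually_nhds_in_open by blast
      ultimately have "\<exists>\<^sub>F y in nhds x. 0 < u y \<and> dist y x < e \<and> y \<in> \<Omega>"
        by (intro frequently_rev_mp[OF f]) (auto elim: eventually_elim2)
      then have "\<exists>y. 0 < u y \<and> dist y x < e \<and> y \<in> \<Omega>" by (rule frequently_ex)
      then show "\<exists>y\<in>pos_set \<Omega> u. dist y x < e" by (auto simp: pos_set_def)
    qed
  qed
  finally show ?thesis using \<open>x \<in> \<Omega>\<close> by (auto simp: pos_set_def)
qed

text \<open>The second-order expansion is not itself above \<open>g\<close>, because of its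
  remainder; an arbitrarily small multiple of the squared distance absorbs it. This passes from
  general test functions to paraboloids.\<close>

lemma has_laplacian_touching_quadratic:
  assumes "has_laplacian \<psi> L z0" and "\<psi> z0 = g z0" and le: "\<forall>\<^sub>F w in nhds z0. g w \<le> \<psi> w" and "e > 0"
  obtains b c where "\<forall>\<^sub>F w in nhds z0.
    g w \<le> g z0 + Re (b * (w - z0)) + Re (c * (w - z0)\<^sup>2) + (L / 4 + e) * (cmod (w - z0))\<^sup>2"
proof -
  from assms(1) obtain b c where "\<forall>\<epsilon>>0. \<forall>\<^sub>F h in nhds 0.
      \<bar>\<psi> (z0 + h) - (\<psi> z0 + Re (b * h) + Re (c * h\<^sup>2) + L / 4 * (cmod h)\<^sup>2)\<bar> \<le> \<epsilon> * (cmod h)\<^sup>2"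
    unfolding has_laplacian_def by (elim exE)
  note H = this[rule_format, OF \<open>e > 0\<close>]
  have "((\<lambda>w. w - z0) \<longlongrightarrow> 0) (nhds z0)"
    using tendsto_diff[OF filterlim_ident[of "nhds z0"] tendsto_const[of z0]] by simp
  from eventually_compose_filterlim[OF H this] le
  have "\<forall>\<^sub>F w in nhds z0.
    g w \<le> g z0 + Re (b * (w - z0)) + Re (c * (w - z0)\<^sup>2) + (L / 4 + e) * (cmod (w - z0))\<^sup>2"
    by eventually_elim (simp add: assms(2) distrib_right)
  then show thesis by (rule that)
qed

lemma eventually_nhds_homeomorphic:
  assumes "continuous (at x) S" and "continuous (at (S x)) T" and "\<And>y. T (S y) = y"
  shows "(\<forall>\<^sub>F w in nhds (S x). P (T w)) \<longleftrightarrow> (\<forall>\<^sub>F y in nhds x. P y)"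
proof
  assume "\<forall>\<^sub>F w in nhds (S x). P (T w)"
  moreover have "(S \<longlongrightarrow> S x) (nhds x)"
    using assms(1) by (simp add: isCont_def tendsto_at_iff_tendsto_nhds)
  ultimately have "\<forall>\<^sub>F y in nhds x. P (T (S y))" by (rule eventually_compose_filterlim)
  then show "\<forall>\<^sub>F y in nhds x. P y" by (simp add: assms(3))
next
  assume "\<forall>\<^sub>F y in nhds x. P y"
  moreover have "(T \<longlongrightarrow> x) (nhds (S x))"
    using assms(2) tendsto_at_iff_tendsto_nhds[of T "S x"] by (simp add: isCont_def assms(3))
  ultimately show "\<forall>\<^sub>F w in nhds (S x). P (T w)" by (rule eventually_compose_filterlim)
qed

text \<open>A test function with Laplacian \<open>L\<close> is replaced by a quadratic with
  Laplacian \<open>L + e\<close>, which is the value of \<open>F\<close> on the Hessian of the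
  corresponding paraboloid; then \<open>e\<close> tends to zero. For \<open>- u\<close> the
  paraboloid is negated and touches from below.\<close>

lemma viscosity_solution_adapted_coordinates:
  fixes T :: "complex \<Rightarrow> real ^ 2" and S :: "real ^ 2 \<Rightarrow> complex"
  assumes visc: "viscosity_solution F \<Omega> u" and "T z0 \<in> \<Omega>"
    and T: "bounded_linear T" and S: "bounded_linear S" and ST: "\<And>z. S (T z) = z" and TS: "\<And>x. T (S x) = x"
    and quad: "\<And>k b c \<kappa> z0. \<exists>a' b' A. A \<in> sym_mats \<and> F A = 4 * \<kappa> \<and>
      (\<forall>x. paraboloid a' b' A x = k + Re (b * (S x - z0)) + Re (c * (S x - z0)\<^sup>2) + \<kappa> * (cmod (S x - z0))\<^sup>2)"
  shows "visc_ge (\<lambda>z. u (T z)) (- of_bool (0 < u (T z0))) z0"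
    and "visc_ge (\<lambda>z. - u (T z)) (of_bool (0 < u (T z0))) z0"
proof -
  have ind: "indicator (pos_set \<Omega> u) (T z0) = (of_bool (0 < u (T z0)) :: real)"
    using \<open>T z0 \<in> \<Omega>\<close> by (auto simp: pos_set_def)
  have pull: "(\<forall>\<^sub>F w in nhds z0. P (T w)) \<longleftrightarrow> (\<forall>\<^sub>F y in nhds (T z0). P y)"
    for P
  proof -
    have "isCont S (T z0)" by (rule linear_continuous_at[OF S])
    moreover have "isCont T (S (T z0))" by (rule linear_continuous_at[OF T])
    ultimately have "(\<forall>\<^sub>F w in nhds (S (T z0)). P (T w)) \<longleftrightarrow> (\<forall>\<^sub>F y in nhds (T z0). P y)"
      by (rule eventually_nhds_homeomorphic) (rule TS)
    then show ?thesis unfolding ST .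
  qed
  show "visc_ge (\<lambda>z. u (T z)) (- of_bool (0 < u (T z0))) z0"
    unfolding visc_ge_def
  proof (intro allI impI, rule field_le_epsilon)
    fix \<psi> L and e :: real
    assume \<psi>: "has_laplacian \<psi> L z0" "\<psi> z0 = u (T z0)" "\<forall>\<^sub>F w in nhds z0. u (T w) \<le> \<psi> w" and "e > 0"
    then have "e / 4 > 0" by simp
    obtain b c where le: "\<forall>\<^sub>F w in nhds z0. u (T w) \<le> u (T z0) + Re (b * (w - z0)) + Re (c * (w - z0)\<^sup>2)
        + (L / 4 + e / 4) * (cmod (w - z0))\<^sup>2"
      by (rule has_laplacian_touching_quadratic[OF \<psi> \<open>e / 4 > 0\<close>])
    obtain a' b' A where A: "A \<in> sym_mats" "F A = 4 * (L / 4 + e / 4)"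
      and par: "\<And>x. paraboloid a' b' A x = u (T z0) + Re (b * (S x - z0)) + Re (c * (S x - z0)\<^sup>2)
        + (L / 4 + e / 4) * (cmod (S x - z0))\<^sup>2"
      using quad[of "L / 4 + e / 4" "u (T z0)" b z0 c] by (elim exE conjE) (rule that, auto)
    have "touches_above (paraboloid a' b' A) u (T z0)"
      unfolding touches_above_def pull[symmetric] using le by (simp add: par ST)
    then have "- indicator (pos_set \<Omega> u) (T z0) \<le> F A"
      using visc \<open>T z0 \<in> \<Omega>\<close> A(1) unfolding viscosity_solution_def by simp
    then show "- of_bool (0 < u (T z0)) \<le> L + e" unfolding ind A(2) by simp
  qed
  show "visc_ge (\<lambda>z. - u (T z)) (of_bool (0 < u (T z0))) z0"
    unfolding visc_ge_def
  proof (intro allI impI, rule field_le_epsilon)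
    fix \<psi> L and e :: real
    assume \<psi>: "has_laplacian \<psi> L z0" "\<psi> z0 = - u (T z0)" "\<forall>\<^sub>F w in nhds z0. - u (T w) \<le> \<psi> w" and "e > 0"
    then have "e / 4 > 0" by simp
    obtain b c where le: "\<forall>\<^sub>F w in nhds z0. - u (T w) \<le> - u (T z0) + Re (b * (w - z0)) + Re (c * (w - z0)\<^sup>2)
        + (L / 4 + e / 4) * (cmod (w - z0))\<^sup>2"
      by (rule has_laplacian_touching_quadratic[OF \<psi> \<open>e / 4 > 0\<close>])
    obtain a' b' A where A: "A \<in> sym_mats" "F A = 4 * (- (L / 4 + e / 4))"
      and par: "\<And>x. paraboloid a' b' A x = u (T z0) + Re (- b * (S x - z0)) + Re (- c * (S x - z0)\<^sup>2)
        + - (L / 4 + e / 4) * (cmod (S x - z0))\<^sup>2"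
      using quad[of "- (L / 4 + e / 4)" "u (T z0)" "- b" z0 "- c"] by (elim exE conjE) (rule that, auto)
    have "\<forall>\<^sub>F w in nhds z0. paraboloid a' b' A (T w) \<le> u (T w)"
      using le by eventually_elim (simp add: par ST algebra_simps)
    then have "touches_below (paraboloid a' b' A) u (T z0)"
      unfolding touches_below_def pull[symmetric] by (simp add: par ST)
    then have "F A \<le> - indicator (pos_set \<Omega> u) (T z0)"
      using visc \<open>T z0 \<in> \<Omega>\<close> A(1) unfolding viscosity_solution_def by simp
    then show "of_bool (0 < u (T z0)) \<le> L + e" unfolding ind A(2) by simp
  qed
qed

section \<open>The arcs in the original coordinates\<close>

lemma C1_arc_bounded_linear_image:
  assumes "C1_arc \<gamma>" and L: "bounded_linear L" and inj: "inj L"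
  shows "C1_arc (\<lambda>t. L (\<gamma> t))"
proof -
  interpret L: bounded_linear L by (rule L)
  obtain D where D: "\<And>t. t \<in> {0..1} \<Longrightarrow> (\<gamma> has_vector_derivative D t) (at t)" "continuous_on {0..1} D"
    using assms(1) unfolding C1_arc_def C1_differentiable_on_def by (elim exE conjE) (rule that, auto)
  have D': "((\<lambda>t. L (\<gamma> t)) has_vector_derivative L (D t)) (at t)" if "t \<in> {0..1}" for t
    by (rule L.has_vector_derivative[OF D(1)[OF that]])
  have "continuous_on {0..1} (\<lambda>t. L (D t))" by (rule L.continuous_on[OF D(2)])
  then have "(\<lambda>t. L (\<gamma> t)) C1_differentiable_on {0..1}"
    unfolding C1_differentiable_on_def using D' by (intro exI[of _ "\<lambda>t. L (D t)"] conjI ballI)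
  moreover have "vector_derivative (\<lambda>t. L (\<gamma> t)) (at t) \<noteq> 0" if t: "t \<in> {0..1}" for t
  proof -
    have "D t \<noteq> 0" using assms(1) t vector_derivative_at[OF D(1)[OF t]] by (auto simp: C1_arc_def)
    then have "L (D t) \<noteq> 0" using inj by (metis L.zero injD)
    then show ?thesis by (simp add: vector_derivative_at[OF D'[OF t]])
  qed
  moreover have "arc (\<lambda>t. L (\<gamma> t))"
  proof -
    have "arc \<gamma>" using assms(1) by (simp add: C1_arc_def)
    then show ?thesis
      unfolding arc_def path_def using inj by (auto intro!: L.continuous_on simp: inj_on_def)
  qed
  ultimately show ?thesis by (simp add: C1_arc_def)
qed

lemma rotated_cones_disjoint:
  assumes "k < 4" "l < 4" "\<i> ^ k * w = \<i> ^ l * z" and "\<bar>Im w\<bar> < Re w" "\<bar>Im z\<bar> < Re z"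
  shows "k = l"
proof -
  have p: "\<i> ^ 2 = - 1" "\<i> ^ 3 = - \<i>" by (simp_all add: power3_eq_cube)
  have "k = 0 \<or> k = 1 \<or> k = 2 \<or> k = 3" "l = 0 \<or> l = 1 \<or> l = 2 \<or> l = 3" using assms(1,2) by auto
  then show ?thesis
    using assms(3-5) by (elim disjE) (auto simp: p complex_eq_iff)
qed

lemma four_C1_curves_of_rotated_arcs:
  fixes T :: "complex \<Rightarrow> real ^ 2" and S :: "real ^ 2 \<Rightarrow> complex" and \<gamma> :: "nat \<Rightarrow> real \<Rightarrow> complex"
  assumes T: "bounded_linear T" and S: "bounded_linear S" and ST: "\<And>z. S (T z) = z"
    and rays: "\<exists>k>0. T (cis (pi / 4)) = k *\<^sub>R vector [1, M]" "\<exists>k>0. T (cis (- (pi / 4))) = k *\<^sub>R vector [1, - M]"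
    and N: "open N" "0 \<in> N"
    and \<Gamma>: "\<Gamma> \<inter> S -` N = T ` (\<Union>k<4. (\<lambda>t. cis (pi / 4) * (\<i> ^ k * \<gamma> k t)) ` {0..<1})"
    and arc: "\<And>k. C1_arc (\<gamma> k)" and zero: "\<And>k. \<gamma> k 0 = 0"
    and deriv: "\<And>k. \<exists>c>0. (\<gamma> k has_vector_derivative of_real c) (at 0)"
    and cone: "\<And>k t. 0 < t \<Longrightarrow> t \<le> 1 \<Longrightarrow> \<bar>Im (\<gamma> k t)\<bar> < Re (\<gamma> k t)"
  shows "four_C1_curves_tangential_to_cross \<Gamma> M"
proof -
  interpret T: bounded_linear T by (rule T)
  interpret S: bounded_linear S by (rule S)
  define q where "q = cis (pi / 4)"
  have q0: "q \<noteq> 0" by (simp add: q_def)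
  define arm where "arm k t = T (q * (\<i> ^ k * \<gamma> k t))" for k t
  \<comment> \<open>The rays are numbered counterclockwise in the complex coordinate, starting from
    the one through \<open>cis (pi / 4)\<close>, so that a step of the index is multiplication by
    the imaginary unit.\<close>
  define idx :: "real \<Rightarrow> real \<Rightarrow> nat" where
    "idx \<sigma> \<tau> = (if \<sigma> = 1 then if \<tau> = 1 then 0 else 3 else if \<tau> = 1 then 1 else 2)" for \<sigma> \<tau>
  have idx4: "idx \<sigma> \<tau> < 4" for \<sigma> \<tau> by (simp add: idx_def)
  have idx_inj: "\<sigma> = \<sigma>' \<and> \<tau> = \<tau>'" if "idx \<sigma> \<tau> = idx \<sigma>' \<tau>'" "\<sigma> \<in> {-1, 1}" "\<tau> \<in> {-1, 1}" "\<sigma>' \<in> {-1, 1}" "\<tau>' \<in> {-1, 1}" for \<sigma> \<tau> \<sigma>' \<tau>'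
    using that by (auto simp: idx_def split: if_splits)
  have rot: "bounded_linear (\<lambda>z. T (q * (\<i> ^ k * z)))" for k
    by (intro bounded_linear_compose[OF T] bounded_linear_compose[OF bounded_linear_mult_right] bounded_linear_mult_right)
  have rot_inj: "inj (\<lambda>z. T (q * (\<i> ^ k * z)))" for k
    by (rule injI) (metis ST q0 mult_cancel_left power_not_zero complex_i_not_zero)
  have arm_C1: "C1_arc (arm k)" for k
    unfolding arm_def[abs_def] by (rule C1_arc_bounded_linear_image[OF arc rot rot_inj])
  have arm_0: "arm k 0 = 0" for k by (simp add: arm_def zero T.zero)
  have q_i: "q * \<i> = - cis (- (pi / 4))" "q * \<i> ^ 3 = cis (- (pi / 4))"
    by (simp_all add: q_def complex_eq_iff cos_45 sin_45 power3_eq_cube)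
  have ray: "\<exists>k>0. T (q * \<i> ^ idx \<sigma> \<tau>) = k *\<^sub>R vector [\<sigma>, \<tau> * M]" if st: "\<sigma> \<in> {-1, 1}" "\<tau> \<in> {-1, 1}" for \<sigma> \<tau>
  proof -
    obtain k where k: "k > 0" "T q = k *\<^sub>R vector [1, M]" using rays(1) unfolding q_def by (elim exE conjE)
    obtain l where l: "l > 0" "T (cis (- (pi / 4))) = l *\<^sub>R vector [1, - M]" using rays(2) by (elim exE conjE)
    consider "\<sigma> = 1" "\<tau> = 1" | "\<sigma> = -1" "\<tau> = 1" | "\<sigma> = -1" "\<tau> = -1" | "\<sigma> = 1" "\<tau> = -1"
      using st by blast
    then show ?thesis
    proof cases
      case 1
      then show ?thesis using k by (intro exI[of _ k]) (simp add: idx_def)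
    next
      case 2
      then show ?thesis using l by (intro exI[of _ l]) (simp add: idx_def q_i T.neg vec_eq_iff forall_2)
    next
      case 3
      then show ?thesis using k by (intro exI[of _ k]) (simp add: idx_def T.neg vec_eq_iff forall_2)
    next
      case 4
      then show ?thesis using l by (intro exI[of _ l]) (simp add: idx_def q_i)
    qed
  qed
  have tangent: "\<exists>k>0. vector_derivative (arm (idx \<sigma> \<tau>)) (at 0) = k *\<^sub>R vector [\<sigma>, \<tau> * M]"
    if st: "\<sigma> \<in> {-1, 1}" "\<tau> \<in> {-1, 1}" for \<sigma> \<tau>
  proof -
    obtain c where c: "c > 0" "(\<gamma> (idx \<sigma> \<tau>) has_vector_derivative of_real c) (at 0)" using deriv[of "idx \<sigma> \<tau>"] by (elim exE conjE)
    obtain k where k: "k > 0" "T (q * \<i> ^ idx \<sigma> \<tau>) = k *\<^sub>R vector [\<sigma>, \<tau> * M]" using ray[OF st] by (elim exE conjE)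
    have "(arm (idx \<sigma> \<tau>) has_vector_derivative T (q * (\<i> ^ idx \<sigma> \<tau> * of_real c))) (at 0)"
      unfolding arm_def[abs_def] by (rule bounded_linear.has_vector_derivative[OF rot c(2)])
    moreover have "q * (\<i> ^ idx \<sigma> \<tau> * of_real c) = c *\<^sub>R (q * \<i> ^ idx \<sigma> \<tau>)" by (simp add: scaleR_conv_of_real mult_ac)
    ultimately have "vector_derivative (arm (idx \<sigma> \<tau>)) (at 0) = (c * k) *\<^sub>R vector [\<sigma>, \<tau> * M]"
      by (simp add: vector_derivative_at T.scaleR k(2))
    then show ?thesis using c(1) k(1) by (intro exI[of _ "c * k"]) simp
  qed
  have disjoint: "path_image (arm k) \<inter> path_image (arm l) = {0}" if kl: "k < 4" "l < 4" "k \<noteq> l" for k l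
  proof
    show "path_image (arm k) \<inter> path_image (arm l) \<subseteq> {0}"
    proof
      fix x
      assume "x \<in> path_image (arm k) \<inter> path_image (arm l)"
      then obtain s t where st: "s \<in> {0..1}" "t \<in> {0..1}" "x = arm k s" "x = arm l t" by (auto simp: path_image_def)
      then have "S (arm k s) = S (arm l t)" by simp
      then have eq: "\<i> ^ k * \<gamma> k s = \<i> ^ l * \<gamma> l t" using q0 by (simp add: arm_def ST)
      show "x \<in> {0}"
      proof (rule ccontr)
        assume "x \<notin> {0}"
        then have "s \<noteq> 0" "t \<noteq> 0" using st(3,4) arm_0 by auto
        then have "0 < s" "s \<le> 1" "0 < t" "t \<le> 1" using st(1,2) by auto
        then show False using rotated_cones_disjoint[OF kl(1,2) eq cone cone] kl(3) by blast
      qed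
    qed
    have "arm k 0 \<in> path_image (arm k)" "arm l 0 \<in> path_image (arm l)" by (simp_all add: path_image_def)
    then show "{0} \<subseteq> path_image (arm k) \<inter> path_image (arm l)" by (simp add: arm_0)
  qed
  have four: "{..<4::nat} = {0, 1, 2, 3}" by auto
  have "\<Gamma> \<inter> S -` N = (\<Union>k<4. arm k ` {0..<1})"
    unfolding \<Gamma> arm_def[abs_def] q_def by (simp add: image_UN image_image)
  also have "\<dots> = (\<Union>\<sigma>\<in>{-1, 1}. \<Union>\<tau>\<in>{-1, 1}. arm (idx \<sigma> \<tau>) ` {0..<1})"
    unfolding four by (simp add: idx_def Un_ac)
  finally have union: "\<Gamma> \<inter> S -` N = (\<Union>\<sigma>\<in>{-1, 1}. \<Union>\<tau>\<in>{-1, 1}. arm (idx \<sigma> \<tau>) ` {0..<1})" .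
  have open_N: "open (S -` N)" by (rule open_vimage[OF N(1) linear_continuous_on[OF S]])
  show ?thesis
    unfolding four_C1_curves_tangential_to_cross_def
  proof (rule exI[of _ "S -` N"], rule exI[of _ "\<lambda>\<sigma> \<tau>. arm (idx \<sigma> \<tau>)"], intro conjI ballI impI)
    show "open (S -` N)" by (rule open_N)
    show "0 \<in> S -` N" using N(2) by (simp add: S.zero)
    show "\<Gamma> \<inter> S -` N = (\<Union>\<sigma>\<in>{-1, 1}. \<Union>\<tau>\<in>{-1, 1}. arm (idx \<sigma> \<tau>) ` {0..<1})" by (rule union)
    fix \<sigma> \<tau> :: real
    assume st: "\<sigma> \<in> {-1, 1}" "\<tau> \<in> {-1, 1}"
    show "C1_arc (arm (idx \<sigma> \<tau>))" by (rule arm_C1)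
    show "pathstart (arm (idx \<sigma> \<tau>)) = 0" by (simp add: pathstart_def arm_0)
    show "\<exists>k>0. vector_derivative (arm (idx \<sigma> \<tau>)) (at 0) = k *\<^sub>R vector [\<sigma>, \<tau> * M]" by (rule tangent[OF st])
    fix \<sigma>' \<tau>' :: real
    assume st': "\<sigma>' \<in> {-1, 1}" "\<tau>' \<in> {-1, 1}" "(\<sigma>, \<tau>) \<noteq> (\<sigma>', \<tau>')"
    then have "idx \<sigma> \<tau> \<noteq> idx \<sigma>' \<tau>'" using idx_inj[OF _ st st'(1,2)] by blast
    then show "path_image (arm (idx \<sigma> \<tau>)) \<inter> path_image (arm (idx \<sigma>' \<tau>')) = {0}" by (rule disjoint[OF idx4 idx4])
  qed
qed

lemma cross_poly_eq_0_iff: "cross_poly M x = 0 \<longleftrightarrow> M * x $ 1 - x $ 2 = 0 \<or> M * x $ 1 + x $ 2 = 0"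
proof -
  have "cross_poly M x = (M * x $ 1 - x $ 2) * (M * x $ 1 + x $ 2)"
    by (simp add: cross_poly_def power2_eq_square algebra_simps)
  then show ?thesis by simp
qed

theorem theorem5p2:
  fixes F :: "real ^ 2 ^ 2 \<Rightarrow> real"
    and \<Omega> :: "(real ^ 2) set"
    and u :: "real ^ 2 \<Rightarrow> real"
    and M :: real
  assumes "convex_on sym_mats F"
    and "uniformly_elliptic F"
    and "smooth_except_origin F"
    and "homogeneous_deg1 F"
    and "F 0 = 0"
    and "open \<Omega>" and "connected \<Omega>" and "bounded \<Omega>" and "0 \<in> \<Omega>"
    and "viscosity_solution F \<Omega> u"
    and "0 \<in> free_boundary \<Omega> u"
    and "GDERIV u 0 :> 0"
    and "M > 0"
    and "rank2_flat_at_0 \<Omega> u (cross_poly M)"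
    and "nondegenerate_at_0 \<Omega> u"
  shows "four_C1_curves_tangential_to_cross (free_boundary \<Omega> u) M"
proof -
  interpret linear_elliptic F M by (rule linear_ellipticI) fact+
  obtain T :: "complex \<Rightarrow> real ^ 2" and S :: "real ^ 2 \<Rightarrow> complex" and \<theta> :: real
    where theta: "0 < \<theta>" "\<theta> < pi / 2" and T: "bounded_linear T" and S: "bounded_linear S"
      and ST: "\<And>z. S (T z) = z" and TS: "\<And>x. T (S x) = x"
      and line: "\<And>x :: real ^ 2. M * x $ 1 - x $ 2 = 0 \<longleftrightarrow> Im (cis (- \<theta>) * S x) = 0"
        "\<And>x :: real ^ 2. M * x $ 1 + x $ 2 = 0 \<longleftrightarrow> Im (cis \<theta> * S x) = 0"
      and rays: "\<exists>k>0. T (cis \<theta>) = k *\<^sub>R vector [1, M]" "\<exists>k>0. T (cis (- \<theta>)) = k *\<^sub>R vector [1, - M]"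
      and quad: "\<And>k b c (\<kappa> :: real) z0. \<exists>a' b' A. A \<in> sym_mats \<and> F A = 4 * \<kappa> \<and>
        (\<forall>x. paraboloid a' b' A x = k + Re (b * (S x - z0)) + Re (c * (S x - z0)\<^sup>2) + \<kappa> * (cmod (S x - z0))\<^sup>2)"
    by (rule adapted_coordinates) (rule that)
  interpret T: bounded_linear T by (rule T)
  interpret S: bounded_linear S by (rule S)
  have cross: "cross_poly M x = 0 \<longleftrightarrow> on_cross \<theta> (S x)" for x
    unfolding cross_poly_eq_0_iff line on_cross_def ..
  obtain K1 where K1: "K1 > 0" "\<And>z. norm (T z) \<le> norm z * K1" using T.pos_bounded by blast
  obtain K2 where K2: "\<And>x. norm (S x) \<le> norm x * K2" using S.pos_bounded by blast
  define K where "K = max K1 K2"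
  have K: "K > 0" "norm (T z) \<le> K * norm z" "norm (S x) \<le> K * norm x" for x z
  proof -
    show "K > 0" using K1(1) by (simp add: K_def)
    have "norm z * K1 \<le> norm z * K" by (intro mult_left_mono) (auto simp: K_def)
    then show "norm (T z) \<le> K * norm z" using K1(2)[of z] by (simp add: mult.commute)
    have "norm x * K2 \<le> norm x * K" by (intro mult_left_mono) (auto simp: K_def)
    then show "norm (S x) \<le> K * norm x" using K2[of x] by (simp add: mult.commute)
  qed
  have cont: "continuous_on \<Omega> u" using assms(10) by (simp add: viscosity_solution_def)
  define v where "v z = u (T z)" for z
  obtain R0 where R0: "R0 > 0" "ball 0 R0 \<subseteq> \<Omega>" using \<open>open \<Omega>\<close> \<open>0 \<in> \<Omega>\<close> open_contains_ball by blast
  define R where "R = R0 / K"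
  have R: "R > 0" using R0 K(1) by (simp add: R_def)
  have T_in: "T z \<in> \<Omega>" if "cmod z < R" for z
  proof -
    have "K * norm z < R0" using that K(1) by (simp add: R_def field_simps)
    then have "norm (T z) < R0" using K(2)[of z] by linarith
    then show ?thesis using R0(2) by (auto simp: subset_iff)
  qed
  have freq: "(\<exists>\<^sub>F w in nhds z. 0 < v w) \<longleftrightarrow> (\<exists>\<^sub>F y in nhds (T z). 0 < u y)" for z
  proof -
    have "isCont S (T z)" by (rule linear_continuous_at[OF S])
    moreover have "isCont T (S (T z))" by (rule linear_continuous_at[OF T])
    ultimately have "(\<forall>\<^sub>F w in nhds (S (T z)). \<not> 0 < u (T w)) \<longleftrightarrow> (\<forall>\<^sub>F y in nhds (T z). \<not> 0 < u y)"
      by (rule eventually_nhds_homeomorphic) (rule TS)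
    then show ?thesis unfolding frequently_def v_def ST by simp
  qed
  have fb: "T z \<in> free_boundary \<Omega> u \<longleftrightarrow> v z \<le> 0 \<and> (\<exists>\<^sub>F w in nhds z. 0 < v w)" if "T z \<in> \<Omega>" for z
    unfolding free_boundary_iff[OF \<open>open \<Omega>\<close> cont that] freq by (simp add: v_def)
  have fb_\<Omega>: "x \<in> \<Omega>" if "x \<in> free_boundary \<Omega> u" for x using that by (simp add: free_boundary_def)
  have at0: "v 0 \<le> 0" "\<exists>\<^sub>F w in nhds 0. 0 < v w"
    using fb[of 0] \<open>0 \<in> free_boundary \<Omega> u\<close> \<open>0 \<in> \<Omega>\<close> by (simp_all add: T.zero)
  have du: "(u has_derivative (\<lambda>h. 0)) (at 0)" using \<open>GDERIV u 0 :> 0\<close> by (simp add: gderiv_def)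
  have flat: "\<exists>r>0. \<forall>z. 0 < cmod z \<longrightarrow> cmod z < r \<longrightarrow> v z \<le> 0 \<longrightarrow> (\<exists>\<^sub>F y in nhds z. 0 < v y) \<longrightarrow>
      \<bar>Im (cis (- \<theta>) * z)\<bar> \<le> \<epsilon> * cmod z \<or> \<bar>Im (cis \<theta> * z)\<bar> \<le> \<epsilon> * cmod z"
    and flat2: "\<exists>r>0. \<forall>z. on_cross \<theta> z \<longrightarrow> 0 < cmod z \<longrightarrow> cmod z < r \<longrightarrow>
      (\<exists>z'. cmod (z' - z) \<le> \<epsilon> * cmod z \<and> v z' \<le> 0 \<and> (\<exists>\<^sub>F y in nhds z'. 0 < v y))" if "\<epsilon> > 0" for \<epsilon>
  proof -
    \<comment> \<open>One factor \<open>K\<close> is lost in measuring \<open>T z\<close> by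
      \<open>z\<close>, the other in mapping the nearby point back by \<open>S\<close>.\<close>
    define \<eta> where "\<eta> = \<epsilon> / K\<^sup>2"
    have \<eta>: "\<eta> > 0" "K * (\<eta> * (K * a)) = \<epsilon> * a" for a using that K(1) by (simp_all add: \<eta>_def power2_eq_square)
    have p0: "cross_poly M 0 = 0" by (simp add: cross_poly_def)
    obtain r where r: "r > 0"
      and near: "\<And>x. x \<in> free_boundary \<Omega> u \<Longrightarrow> 0 < norm x \<Longrightarrow> norm x < r \<Longrightarrow>
        \<exists>y. cross_poly M y = 0 \<and> dist x y < \<eta> * norm x"
      and near': "\<And>x. cross_poly M x = 0 \<Longrightarrow> 0 < norm x \<Longrightarrow> norm x < r \<Longrightarrow>
        \<exists>y\<in>free_boundary \<Omega> u. dist x y < \<eta> * norm x"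
      by (rule rank2_flat_near[OF \<open>rank2_flat_at_0 \<Omega> u (cross_poly M)\<close> \<open>0 \<in> free_boundary \<Omega> u\<close> p0 \<eta>(1)]) (rule that)
    have small: "0 < norm (T z)" "norm (T z) < r" if "0 < cmod z" "cmod z < r / K" for z
    proof -
      have "T z \<noteq> 0" using that(1) ST[of z] by (metis S.zero norm_zero less_irrefl)
      then show "0 < norm (T z)" by simp
      have "K * norm z < r" using that(2) K(1) by (simp add: field_simps)
      then show "norm (T z) < r" using K(2)[of z] by linarith
    qed
    have close: "cmod (z - S y) \<le> \<epsilon> * cmod z" if "dist (T z) y < \<eta> * norm (T z)" for z y
    proof -
      have "cmod (z - S y) = norm (S (T z - y))" by (simp add: S.diff ST)
      also have "\<dots> \<le> K * norm (T z - y)" by (rule K(3))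
      also have "\<dots> \<le> K * (\<eta> * (K * norm z))"
      proof (rule mult_left_mono)
        have "\<eta> * norm (T z) \<le> \<eta> * (K * norm z)" using K(2)[of z] \<eta>(1) by (intro mult_left_mono) auto
        then show "norm (T z - y) \<le> \<eta> * (K * norm z)" using that by (simp add: dist_norm)
      qed (use K(1) in simp)
      finally show ?thesis by (simp only: \<eta>(2))
    qed
    show "\<exists>r>0. \<forall>z. 0 < cmod z \<longrightarrow> cmod z < r \<longrightarrow> v z \<le> 0 \<longrightarrow> (\<exists>\<^sub>F y in nhds z. 0 < v y) \<longrightarrow>
      \<bar>Im (cis (- \<theta>) * z)\<bar> \<le> \<epsilon> * cmod z \<or> \<bar>Im (cis \<theta> * z)\<bar> \<le> \<epsilon> * cmod z"
    proof (rule exI[of _ "min R (r / K)"], intro conjI allI impI)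
      show "0 < min R (r / K)" using R r K(1) by simp
      fix z
      assume z: "0 < cmod z" "cmod z < min R (r / K)" "v z \<le> 0" "\<exists>\<^sub>F y in nhds z. 0 < v y"
      then have "T z \<in> free_boundary \<Omega> u" using fb[OF T_in] by simp
      then obtain y where y: "cross_poly M y = 0" "dist (T z) y < \<eta> * norm (T z)"
        using near[OF _ small] z(1,2) by auto
      have "\<bar>Im (c * z)\<bar> \<le> \<epsilon> * cmod z" if "Im (c * S y) = 0" "cmod c = 1" for c
      proof -
        have "\<bar>Im (c * z)\<bar> = \<bar>Im (c * (z - S y))\<bar>" using that(1) by (simp add: algebra_simps)
        also have "\<dots> \<le> cmod (c * (z - S y))" by (rule abs_Im_le_cmod)
        also have "\<dots> = cmod (z - S y)" by (simp add: norm_mult that(2))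
        finally show ?thesis using close[OF y(2)] by linarith
      qed
      then show "\<bar>Im (cis (- \<theta>) * z)\<bar> \<le> \<epsilon> * cmod z \<or> \<bar>Im (cis \<theta> * z)\<bar> \<le> \<epsilon> * cmod z"
        using y(1) unfolding cross on_cross_def by (metis norm_cis)
    qed
    show "\<exists>r>0. \<forall>z. on_cross \<theta> z \<longrightarrow> 0 < cmod z \<longrightarrow> cmod z < r \<longrightarrow>
      (\<exists>z'. cmod (z' - z) \<le> \<epsilon> * cmod z \<and> v z' \<le> 0 \<and> (\<exists>\<^sub>F y in nhds z'. 0 < v y))"
    proof (rule exI[of _ "r / K"], intro conjI allI impI)
      show "0 < r / K" using r K(1) by simp
      fix z
      assume z: "on_cross \<theta> z" "0 < cmod z" "cmod z < r / K"
      then have "cross_poly M (T z) = 0" by (simp add: cross ST)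
      then obtain y where y: "y \<in> free_boundary \<Omega> u" "dist (T z) y < \<eta> * norm (T z)"
        using near'[OF _ small[OF z(2,3)]] by auto
      have "v (S y) \<le> 0 \<and> (\<exists>\<^sub>F w in nhds (S y). 0 < v w)"
        using fb[of "S y"] y(1) fb_\<Omega>[OF y(1)] by (simp add: TS)
      then show "\<exists>z'. cmod (z' - z) \<le> \<epsilon> * cmod z \<and> v z' \<le> 0 \<and> (\<exists>\<^sub>F y in nhds z'. 0 < v y)"
        using close[OF y(2)] by (intro exI[of _ "S y"]) (simp add: norm_minus_commute)
    qed
  qed
  interpret cross_point v \<theta> R
  proof
    show "0 < \<theta>" "\<theta> < pi / 2" "0 < R" by (rule theta R)+
    show "continuous_on (ball 0 R) v"
      unfolding v_def[abs_def]
      by (rule continuous_on_compose2[OF cont linear_continuous_on[OF T]]) (auto intro: T_in)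
    show "visc_ge v (- of_bool (0 < v z)) z" "visc_ge (\<lambda>w. - v w) (of_bool (0 < v z)) z" if "cmod z < R" for z
      unfolding v_def[abs_def]
      by (rule viscosity_solution_adapted_coordinates[OF assms(10) T_in[OF that] T S ST TS quad])+
    show dv: "(v has_derivative (\<lambda>_. 0)) (at 0)"
    proof -
      have "(T has_derivative T) (at 0)" by (rule bounded_linear_imp_has_derivative[OF T])
      moreover have "(u has_derivative (\<lambda>h. 0)) (at (T 0))" using du by (simp add: T.zero)
      ultimately show ?thesis unfolding v_def[abs_def] by (rule has_derivative_compose)
    qed
    show "v 0 = 0"
    proof (rule antisym[OF at0(1)], rule ccontr)
      assume "\<not> 0 \<le> v 0"
      moreover have "(v \<longlongrightarrow> v 0) (nhds 0)"
        using has_derivative_continuous[OF dv] tendsto_at_iff_tendsto_nhds[of v 0] by (simp add: isCont_def)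
      ultimately have "\<forall>\<^sub>F w in nhds 0. v w < 0" by (intro order_tendstoD(2)) auto
      then have "\<forall>\<^sub>F w in nhds 0. \<not> 0 < v w" by eventually_elim simp
      then show False using at0(2) by (simp add: frequently_def)
    qed
    show "\<exists>c>0. \<exists>r0>0. \<forall>r. 0 < r \<longrightarrow> r < r0 \<longrightarrow> (\<exists>z. cmod z < r \<and> v z \<le> - c * r\<^sup>2)"
    proof -
      obtain c \<rho> where c: "c > 0" "\<rho> > 0"
        and inf: "\<And>r. 0 < r \<Longrightarrow> r < \<rho> \<Longrightarrow> (INF x\<in>ball 0 r. u x) \<le> - c * r\<^sup>2"
        using \<open>nondegenerate_at_0 \<Omega> u\<close> unfolding nondegenerate_at_0_def by blast
      have "0 < c / (2 * K\<^sup>2)" using c(1) K(1) by simp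
      moreover have "\<exists>r0>0. \<forall>r. 0 < r \<longrightarrow> r < r0 \<longrightarrow> (\<exists>z. cmod z < r \<and> v z \<le> - (c / (2 * K\<^sup>2)) * r\<^sup>2)"
      proof (rule exI[of _ "\<rho> * K"], intro conjI allI impI)
        show "0 < \<rho> * K" using c K(1) by simp
        fix r :: real
        assume r: "0 < r" "r < \<rho> * K"
        define s where "s = r / K"
        have s: "0 < s" "s < \<rho>" "r = K * s" using r K(1) by (simp_all add: s_def field_simps)
        \<comment> \<open>The infimum need not be attained, so half of the constant is given up; the
          factor \<open>K\<^sup>2\<close> in the final constant comes from rescaling the
          radius.\<close>
        have "\<exists>x\<in>ball 0 s. u x \<le> - (c / 2) * s\<^sup>2"
        proof (rule ccontr)
          assume "\<not> ?thesis"
          then have "- (c / 2) * s\<^sup>2 \<le> u x" if "x \<in> ball 0 s" for x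
            using that by (meson le_cases)
          then have "- (c / 2) * s\<^sup>2 \<le> (INF x\<in>ball 0 s. u x)"
            using s(1) by (intro cINF_greatest) simp_all
          then have "- (c / 2) * s\<^sup>2 \<le> - c * s\<^sup>2" using inf[OF s(1,2)] by linarith
          moreover have "0 < c * s\<^sup>2" using c(1) s(1) by simp
          ultimately show False by simp
        qed
        then obtain x where x: "norm x < s" "u x \<le> - (c / 2) * s\<^sup>2" by auto
        have "K * norm x < K * s" using x(1) K(1) by simp
        then have "cmod (S x) < r" using K(3)[of x] s(3) by linarith
        moreover have "- (c / 2) * s\<^sup>2 = - (c / (2 * K\<^sup>2)) * r\<^sup>2" using K(1) by (simp add: s(3) power_mult_distrib)
        ultimately show "\<exists>z. cmod z < r \<and> v z \<le> - (c / (2 * K\<^sup>2)) * r\<^sup>2"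
          using x(2) by (intro exI[of _ "S x"]) (simp add: v_def TS)
      qed
      ultimately show ?thesis by blast
    qed
  qed (rule flat)
  obtain N \<gamma> where th: "\<theta> = pi / 4" and N: "open N" "0 \<in> N" "N \<subseteq> ball 0 R"
    and union: "{z \<in> N. v z \<le> 0 \<and> (\<exists>\<^sub>F y in nhds z. 0 < v y)}
      = (\<Union>k<4. (\<lambda>t. cis (pi / 4) * (\<i> ^ k * \<gamma> k t)) ` {0..<1})"
    and arc: "\<And>k::nat. C1_arc (\<gamma> k)" and zero: "\<And>k. \<gamma> k 0 = 0"
    and deriv: "\<And>k. \<exists>c>0. (\<gamma> k has_vector_derivative of_real c) (at 0)"
    and cone: "\<And>k t. 0 < t \<Longrightarrow> t \<le> 1 \<Longrightarrow> \<bar>Im (\<gamma> k t)\<bar> < Re (\<gamma> k t)"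
    by (rule free_boundary_curves[OF flat2 at0(2)]) (assumption, rule that)
  have "free_boundary \<Omega> u \<inter> S -` N = T ` {z \<in> N. v z \<le> 0 \<and> (\<exists>\<^sub>F y in nhds z. 0 < v y)}"
  proof (intro equalityI subsetI)
    fix x
    assume "x \<in> free_boundary \<Omega> u \<inter> S -` N"
    then have x: "x \<in> free_boundary \<Omega> u" "S x \<in> N" by auto
    then have "v (S x) \<le> 0 \<and> (\<exists>\<^sub>F y in nhds (S x). 0 < v y)"
      using fb[of "S x"] fb_\<Omega>[OF x(1)] by (simp add: TS)
    then show "x \<in> T ` {z \<in> N. v z \<le> 0 \<and> (\<exists>\<^sub>F y in nhds z. 0 < v y)}"
      using x(2) by (intro image_eqI[of _ _ "S x"]) (simp_all add: TS)
  next
    fix x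
    assume "x \<in> T ` {z \<in> N. v z \<le> 0 \<and> (\<exists>\<^sub>F y in nhds z. 0 < v y)}"
    then obtain z where z: "x = T z" "z \<in> N" "v z \<le> 0" "\<exists>\<^sub>F y in nhds z. 0 < v y" by auto
    then have "T z \<in> \<Omega>" using N(3) by (intro T_in) auto
    then show "x \<in> free_boundary \<Omega> u \<inter> S -` N" using fb z by (simp add: ST)
  qed
  then show ?thesis
    using rays
    unfolding th union by (intro four_C1_curves_of_rotated_arcs[OF T S ST _ _ N(1,2) _ arc zero deriv cone])
qed

end
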